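(* Let $E$ be the topological ring of a family of local fields $\{E_i\}_{i\in\mathbb N\cup\{\infty\}}$ as in the context, with evaluation maps $\mathrm{ev}_i:E\to E_i$. Every closed prime ideal of $E$ equals $\ker\mathrm{ev}_i$ for some $i\in\mathbb N\cup\{\infty\}$. Thus $|\mathrm{Spa}\,E|$ is naturally homeomorphic to $\mathbb N\cup\{\infty\}$, and $\mathrm{Spa}\,E$ is an adic space.
   Context: Let $\kappa$ be a perfect field of characteristic $p>0$. Let $\{E_i\}_{i\in\mathbb N}$ be complete discretely valued fields of characteristic $0$ with residue field $\kappa$, and $E_\infty=\kappa((t))$. Write $\mathcal O_i$, $\mathfrak p_i$, $v_i$ for the ring of integers, maximal ideal and normalized valuation of $E_i$. For $i\in\mathbb N$ put $e_i=v_i(p)$, and assume $e_i\to\infty$ as $i\to\infty$. Fix isomorphisms $\mathrm{Tr}_{e_i}(E_i)\cong\mathrm{Tr}_{e_i}(E_\infty)$ of Deligne triples, where $\mathrm{Tr}_m(L)=(\mathcal O_L/\mathfrak p_L^m,\ \mathfrak p_L/\mathfrak p_L^{m+1},\ \mathfrak p_L/\mathfrak p_L^{m+1}\to\mathcal O_L/\mathfrak p_L^m)$. In particular these give ring isomorphisms $\mathcal O_i/\mathfrak p_i^{e_i}\cong\mathcal O_\infty/\mathfrak p_\infty^{e_i}$. Put $\pi_\infty=t$ and let $\pi_i$ be a uniformizer of $E_i$ whose image in $\mathcal O_i/\mathfrak p_i^{e_i}\cong\mathcal O_\infty/\mathfrak p_\infty^{e_i}$ equals that of $\pi_\infty$.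 Let $\mathbb N\cup\{\infty\}$ be the one-point compactification of the discrete space $\mathbb N$. For $n\ge1$ let $\mathbb O_n$ be the ring topological space over $\mathbb N\cup\{\infty\}$ with discrete fibers $\mathcal O_i/\mathfrak p_i^n$ that, over a neighborhood of $\infty$ on which $e_i\ge n$, is the constant space with fiber $\mathcal O_\infty/\mathfrak p_\infty^n$ via the fixed isomorphisms. Put $\mathbb O=\varprojlim_n\mathbb O_n$. Let $\pi$ be the continuous section $i\mapsto\pi_i$ of $\mathbb O$, and $\mathbb E=\varinjlim(\mathbb O\xrightarrow{\pi}\mathbb O\xrightarrow{\pi}\cdots)$. $E$ is the topological ring of continuous sections of $\mathbb E\to\mathbb N\cup\{\infty\}$ with the compact-open topology. $\mathcal O$ is the subring of sections of $\mathbb O$. One has $E=\mathcal O[1/\pi]$, $\mathcal O=E^\circ$ is $\pi$-adically complete with the $\pi$-adic topology, and $\mathcal O/\pi^n$ is the ring of continuous sections of $\mathbb O_n$. $\mathrm{ev}_i:E\to E_i$ is evaluation at $i$. $\mathrm{Spa}\,E$ means $\mathrm{Spa}(E,E^\circ)$ with its structure presheaf, and it is an adic space if the presheaf is a sheaf. *)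

theory Defs
  imports
    "HOL-Algebra.Algebra"
    "HOL-Algebra.Algebraic_Closure_Type"
    "HOL-Computational_Algebra.Formal_Laurent_Series"
    "HOL-Library.Extended_Real"
    "HOL-Analysis.Analysis"
begin

section \<open>Complete discretely valued fields and Deligne triples\<close>

text \<open>The value of a valuation at zero (morally plus infinity) is never used.\<close>

definition val_ideal :: "('a, 'm) ring_scheme \<Rightarrow> ('a \<Rightarrow> int) \<Rightarrow> nat \<Rightarrow> 'a set" where
  "val_ideal K v n = {x \<in> carrier K. x = \<zero>\<^bsub>K\<^esub> \<or> int n \<le> v x}"

definition val_ring :: "'a ring \<Rightarrow> ('a \<Rightarrow> int) \<Rightarrow> 'a ring" where
  "val_ring K v = K\<lparr>carrier := val_ideal K v 0\<rparr>"

locale complete_dvf =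
  fixes K :: "'a ring" and v :: "'a \<Rightarrow> int"
  assumes is_field: "Ring.field K"
    and val_mult: "\<And>x y. \<lbrakk>x \<in> carrier K; y \<in> carrier K; x \<noteq> \<zero>\<^bsub>K\<^esub>; y \<noteq> \<zero>\<^bsub>K\<^esub>\<rbrakk>
                     \<Longrightarrow> v (x \<otimes>\<^bsub>K\<^esub> y) = v x + v y"
    and val_add: "\<And>x y. \<lbrakk>x \<in> carrier K; y \<in> carrier K; x \<noteq> \<zero>\<^bsub>K\<^esub>; y \<noteq> \<zero>\<^bsub>K\<^esub>; x \<oplus>\<^bsub>K\<^esub> y \<noteq> \<zero>\<^bsub>K\<^esub>\<rbrakk>
                     \<Longrightarrow> min (v x) (v y) \<le> v (x \<oplus>\<^bsub>K\<^esub> y)"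
    and val_normalized: "\<exists>x\<in>carrier K. x \<noteq> \<zero>\<^bsub>K\<^esub> \<and> v x = 1"
    and val_complete: "\<And>x :: nat \<Rightarrow> 'a. \<lbrakk>\<forall>k. x k \<in> carrier K;
                          \<forall>n. \<exists>N. \<forall>k\<ge>N. \<forall>l\<ge>N. x k \<ominus>\<^bsub>K\<^esub> x l \<in> val_ideal K v n\<rbrakk>
                     \<Longrightarrow> \<exists>y\<in>carrier K. \<forall>n. \<exists>N. \<forall>k\<ge>N. x k \<ominus>\<^bsub>K\<^esub> y \<in> val_ideal K v n"

record ('r, 'm) deligne_triple =
  triple_ring :: "'r ring"
  triple_module :: "('r, 'm) module"
  triple_map :: "'m \<Rightarrow> 'r"

text \<open>
  The maximal ideal modulo its power \<open>m + 1\<close> is the set of those cosets in the corresponding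
  quotient of the valuation ring that lie in the maximal ideal; the action of the valuation
  ring modulo the power \<open>m\<close> is multiplication of representatives.  The fields
  \<^const>\<open>monoid.mult\<close> and \<^const>\<open>monoid.one\<close> that every module record carries are irrelevant.
\<close>

definition Tr :: "'a ring \<Rightarrow> ('a \<Rightarrow> int) \<Rightarrow> nat \<Rightarrow> ('a set, 'a set) deligne_triple" where
  "Tr K v m =
    \<lparr>triple_ring = val_ring K v Quot val_ideal K v m,
     triple_module =
       \<lparr>carrier = {C \<in> carrier (val_ring K v Quot val_ideal K v (Suc m)). C \<subseteq> val_ideal K v 1},
        monoid.mult = undefined, monoid.one = undefined,
        ring.zero = val_ideal K v (Suc m),
        ring.add = set_add (val_ring K v),
        Module.module.smult = rcoset_mult (val_ring K v) (val_ideal K v (Suc m))\<rparr>,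
     triple_map = (\<lambda>C. val_ideal K v m <+>\<^bsub>val_ring K v\<^esub> C)\<rparr>"

definition deligne_iso ::
    "('r, 'm) deligne_triple \<Rightarrow> ('s, 'n) deligne_triple \<Rightarrow> (('r \<Rightarrow> 's) \<times> ('m \<Rightarrow> 'n)) set" where
  "deligne_iso S T = {(f, \<eta>).
     f \<in> ring_iso (triple_ring S) (triple_ring T) \<and>
     bij_betw \<eta> (carrier (triple_module S)) (carrier (triple_module T)) \<and>
     (\<forall>x\<in>carrier (triple_module S). \<forall>y\<in>carrier (triple_module S).
        \<eta> (x \<oplus>\<^bsub>triple_module S\<^esub> y) = \<eta> x \<oplus>\<^bsub>triple_module T\<^esub> \<eta> y) \<and>
     (\<forall>a\<in>carrier (triple_ring S). \<forall>x\<in>carrier (triple_module S).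
        \<eta> (a \<odot>\<^bsub>triple_module S\<^esub> x) = f a \<odot>\<^bsub>triple_module T\<^esub> \<eta> x) \<and>
     (\<forall>x\<in>carrier (triple_module S). triple_map T (\<eta> x) = f (triple_map S x))}"


section \<open>Families of local fields\<close>

text \<open>
  The index space is \<^typ>\<open>enat\<close>, whose order topology is that of the one-point compactification
  of the discrete space of natural numbers.
\<close>

record 'a local_fields =
  fld :: "enat \<Rightarrow> 'a ring"
  vl :: "enat \<Rightarrow> 'a \<Rightarrow> int"
  res_char :: nat
  tr_iso :: "nat \<Rightarrow> ('a set \<Rightarrow> 'a set) \<times> ('a set \<Rightarrow> 'a set)"
  unif :: "enat \<Rightarrow> 'a"

definition ints :: "'a local_fields \<Rightarrow> enat \<Rightarrow> 'a ring" where
  "ints F i = val_ring (fld F i) (vl F i)"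

definition pp :: "'a local_fields \<Rightarrow> enat \<Rightarrow> nat \<Rightarrow> 'a set" where
  "pp F i n = val_ideal (fld F i) (vl F i) n"

definition ramif :: "'a local_fields \<Rightarrow> nat \<Rightarrow> nat" where
  "ramif F i = nat (vl F (enat i) ([res_char F] \<cdot>\<^bsub>fld F (enat i)\<^esub> \<one>\<^bsub>fld F (enat i)\<^esub>))"

text \<open>
  The residue field is the type \<^typ>\<open>'k\<close>; the field at infinity is identified with the field of
  Laurent series over it by the isomorphism \<open>lam\<close>.
\<close>

locale local_field_family =
  fixes F :: "'a local_fields" and lam :: "'a \<Rightarrow> 'k::field fls"
  assumes char_pos: "CHAR('k) > 0"
    and perfect: "\<forall>x::'k. \<exists>y. y ^ CHAR('k) = x"
    and res_char: "res_char F = CHAR('k)"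
    and cdvf: "\<And>i. complete_dvf (fld F i) (vl F i)"
    and char_zero: "\<And>(i::nat) (n::nat). n > 0 \<Longrightarrow>
                      [n] \<cdot>\<^bsub>fld F (enat i)\<^esub> \<one>\<^bsub>fld F (enat i)\<^esub> \<noteq> \<zero>\<^bsub>fld F (enat i)\<^esub>"
    and residue_field: "\<And>i::nat. (ints F (enat i) Quot pp F (enat i) 1)
                          \<simeq> (ring_of_type_algebra :: 'k ring)"
    and laurent: "lam \<in> ring_iso (fld F \<infinity>) ring_of_type_algebra"
    and laurent_val: "\<And>x. \<lbrakk>x \<in> carrier (fld F \<infinity>); x \<noteq> \<zero>\<^bsub>fld F \<infinity>\<^esub>\<rbrakk>
                          \<Longrightarrow> vl F \<infinity> x = fls_subdegree (lam x)"
    and ramif_to_infinity: "filterlim (ramif F) at_top sequentially"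
    and tr_iso: "\<And>i. tr_iso F i \<in> deligne_iso (Tr (fld F (enat i)) (vl F (enat i)) (ramif F i))
                                                (Tr (fld F \<infinity>) (vl F \<infinity>) (ramif F i))"
    and unif_infinity: "unif F \<infinity> \<in> carrier (fld F \<infinity>)" "lam (unif F \<infinity>) = fls_X"
    and unif_val: "\<And>i::nat. unif F (enat i) \<in> carrier (fld F (enat i))"
      "\<And>i::nat. unif F (enat i) \<noteq> \<zero>\<^bsub>fld F (enat i)\<^esub>" "\<And>i::nat. vl F (enat i) (unif F (enat i)) = 1"
    and unif_tr: "\<And>i::nat. fst (tr_iso F i) (pp F (enat i) (ramif F i) +>\<^bsub>ints F (enat i)\<^esub> unif F (enat i))
                          = pp F \<infinity> (ramif F i) +>\<^bsub>ints F \<infinity>\<^esub> unif F \<infinity>"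


subsection \<open>The ring spaces over the index space\<close>

text \<open>
  For \<open>n \<le> ramif F i\<close> the ring isomorphism in \<^const>\<open>tr_iso\<close> induces one modulo the \<open>n\<close>-th powers of
  the maximal ideals: a coset of the \<open>n\<close>-th power is a union of cosets of the power
  \<open>ramif F i\<close>, and is sent to the union of their images.
\<close>

definition trunc_iso :: "'a local_fields \<Rightarrow> nat \<Rightarrow> enat \<Rightarrow> 'a set \<Rightarrow> 'a set" where
  "trunc_iso F n i Z = (case i of
      enat k \<Rightarrow> \<Union> (fst (tr_iso F k) `
                   {Y \<in> carrier (ints F i Quot pp F i (ramif F k)). Y \<subseteq> Z})
    | \<infinity> \<Rightarrow> Z)"

definition trunc_nbhd :: "'a local_fields \<Rightarrow> nat \<Rightarrow> enat set" where
  "trunc_nbhd F n = {i. \<forall>k. i = enat k \<longrightarrow> n \<le> ramif F k}"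

definition trunc_triv :: "'a local_fields \<Rightarrow> nat \<Rightarrow> enat \<times> 'a set \<Rightarrow> enat \<times> 'a set" where
  "trunc_triv F n = (\<lambda>(i, Z). (i, trunc_iso F n i Z))"

text \<open>
  The trivialization \<^const>\<open>trunc_triv\<close> is a bijection onto the constant space over
  \<^const>\<open>trunc_nbhd\<close>.  Outside it (hence over isolated points of the base) every set is open.
\<close>

definition trunc_total :: "'a local_fields \<Rightarrow> nat \<Rightarrow> (enat \<times> 'a set) set" where
  "trunc_total F n = (SIGMA i:UNIV. carrier (ints F i Quot pp F i n))"

definition trunc_open :: "'a local_fields \<Rightarrow> nat \<Rightarrow> (enat \<times> 'a set) set \<Rightarrow> bool" where
  "trunc_open F n W \<longleftrightarrow>
     W \<subseteq> trunc_total F n \<and>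
     openin (pullback_topology {w \<in> trunc_total F n. fst w \<in> trunc_nbhd F n} (trunc_triv F n)
               (prod_topology (top_of_set (trunc_nbhd F n))
                              (discrete_topology (carrier (ints F \<infinity> Quot pp F \<infinity> n)))))
            {w \<in> W. fst w \<in> trunc_nbhd F n}"

lemma istopology_trunc_open: "istopology (trunc_open F n)"
proof -
  have 1: "{w \<in> S \<inter> T. fst w \<in> B} = {w \<in> S. fst w \<in> B} \<inter> {w \<in> T. fst w \<in> B}"
    for S T :: "(enat \<times> 'a set) set" and B by auto
  have 2: "{w \<in> \<Union>\<K>. fst w \<in> B} = \<Union> ((\<lambda>S. {w \<in> S. fst w \<in> B}) ` \<K>)"
    for \<K> :: "(enat \<times> 'a set) set set" and B by auto
  show ?thesis
    unfolding istopology_def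
  proof (intro conjI allI impI ballI)
    fix S T assume "trunc_open F n S" "trunc_open F n T"
    then show "trunc_open F n (S \<inter> T)"
      unfolding trunc_open_def 1 by (meson inf.coboundedI1 openin_Int)
  next
    fix \<K> assume "\<forall>S\<in>\<K>. trunc_open F n S"
    then show "trunc_open F n (\<Union>\<K>)"
      unfolding trunc_open_def 2 by (intro conjI Union_least openin_Union) blast+
  qed
qed

definition trunc_space :: "'a local_fields \<Rightarrow> nat \<Rightarrow> (enat \<times> 'a set) topology" where
  "trunc_space F n = topology (trunc_open F n)"

text \<open>
  The inverse limit of the \<^const>\<open>trunc_space\<close>s: by completeness its fibre at \<open>i\<close> is the valuation
  ring at \<open>i\<close>, and its topology is the coarsest one making all reductions continuous.
\<close>

definition int_space :: "'a local_fields \<Rightarrow> (enat \<times> 'a) topology" where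
  "int_space F = topology_generated_by
     {{(i, x). x \<in> carrier (ints F i) \<and> (i, pp F i n +>\<^bsub>ints F i\<^esub> x) \<in> W} | n W.
        1 \<le> n \<and> openin (trunc_space F n) W}"

text \<open>
  The direct limit of \<^const>\<open>int_space\<close> along multiplication by the uniformizers.  The \<open>m\<close>-th copy
  maps to it by division by the \<open>m\<close>-th powers of the uniformizers.
\<close>

definition fld_open :: "'a local_fields \<Rightarrow> (enat \<times> 'a) set \<Rightarrow> bool" where
  "fld_open F W \<longleftrightarrow>
     W \<subseteq> (SIGMA i:UNIV. carrier (fld F i)) \<and>
     (\<forall>m::nat. openin (int_space F)
        {(i, x). x \<in> carrier (ints F i) \<and>
                 (i, inv\<^bsub>fld F i\<^esub> (unif F i [^]\<^bsub>fld F i\<^esub> m) \<otimes>\<^bsub>fld F i\<^esub> x) \<in> W})"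

lemma istopology_fld_open: "istopology (fld_open F)"
proof -
  define j where "j m = (\<lambda>(i, x). (i, inv\<^bsub>fld F i\<^esub> (unif F i [^]\<^bsub>fld F i\<^esub> m) \<otimes>\<^bsub>fld F i\<^esub> x))" for m :: nat
  define Y where "Y = {(i, x). x \<in> carrier (ints F i)}"
  have *: "{(i, x). x \<in> carrier (ints F i) \<and>
             (i, inv\<^bsub>fld F i\<^esub> (unif F i [^]\<^bsub>fld F i\<^esub> m) \<otimes>\<^bsub>fld F i\<^esub> x) \<in> W} = Y \<inter> j m -` W" for m W
    by (auto simp: j_def Y_def)
  have 1: "Y \<inter> j m -` (S \<inter> T) = (Y \<inter> j m -` S) \<inter> (Y \<inter> j m -` T)" for m S T by auto
  have 2: "Y \<inter> j m -` (\<Union>\<K>) = \<Union> ((\<lambda>S. Y \<inter> j m -` S) ` \<K>)" for m \<K> by auto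
  show ?thesis
    unfolding istopology_def
  proof (intro conjI allI impI ballI)
    fix S T assume "fld_open F S" "fld_open F T"
    then show "fld_open F (S \<inter> T)"
      unfolding fld_open_def * 1 by (simp add: inf.coboundedI1 openin_Int)
  next
    fix \<K> assume "\<forall>S\<in>\<K>. fld_open F S"
    then show "fld_open F (\<Union>\<K>)"
      unfolding fld_open_def * 2 by (intro conjI allI Union_least openin_Union) blast+
  qed
qed

definition fld_space :: "'a local_fields \<Rightarrow> (enat \<times> 'a) topology" where
  "fld_space F = topology (fld_open F)"

definition section_ring :: "'a local_fields \<Rightarrow> (enat \<Rightarrow> 'a) ring" where
  "section_ring F =
    \<lparr>carrier = {s. (\<forall>i. s i \<in> carrier (fld F i)) \<and>
                   continuous_map euclidean (fld_space F) (\<lambda>i. (i, s i))},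
     monoid.mult = (\<lambda>s t i. s i \<otimes>\<^bsub>fld F i\<^esub> t i),
     monoid.one = (\<lambda>i. \<one>\<^bsub>fld F i\<^esub>),
     ring.zero = (\<lambda>i. \<zero>\<^bsub>fld F i\<^esub>),
     ring.add = (\<lambda>s t i. s i \<oplus>\<^bsub>fld F i\<^esub> t i)\<rparr>"

text \<open>The compact-open topology.\<close>

definition section_topology :: "'a local_fields \<Rightarrow> (enat \<Rightarrow> 'a) topology" where
  "section_topology F = topology_generated_by
     {{s \<in> carrier (section_ring F). \<forall>i\<in>C. (i, s i) \<in> W} | C W.
        compact C \<and> openin (fld_space F) W}"

definition ev :: "enat \<Rightarrow> (enat \<Rightarrow> 'a) \<Rightarrow> 'a" where
  "ev i s = s i"


section \<open>Topological rings\<close>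

definition topological_ring :: "('r, 'm) ring_scheme \<Rightarrow> 'r topology \<Rightarrow> bool" where
  "topological_ring R \<tau> \<longleftrightarrow>
     cring R \<and> topspace \<tau> = carrier R \<and>
     continuous_map (prod_topology \<tau> \<tau>) \<tau> (\<lambda>(x, y). x \<oplus>\<^bsub>R\<^esub> y) \<and>
     continuous_map \<tau> \<tau> (\<lambda>x. \<ominus>\<^bsub>R\<^esub> x) \<and>
     continuous_map (prod_topology \<tau> \<tau>) \<tau> (\<lambda>(x, y). x \<otimes>\<^bsub>R\<^esub> y)"

definition bounded_subset :: "('r, 'm) ring_scheme \<Rightarrow> 'r topology \<Rightarrow> 'r set \<Rightarrow> bool" where
  "bounded_subset R \<tau> S \<longleftrightarrow> S \<subseteq> carrier R \<and>
     (\<forall>U. openin \<tau> U \<and> \<zero>\<^bsub>R\<^esub> \<in> U \<longrightarrow>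
        (\<exists>V. openin \<tau> V \<and> \<zero>\<^bsub>R\<^esub> \<in> V \<and> (\<forall>x\<in>V. \<forall>s\<in>S. x \<otimes>\<^bsub>R\<^esub> s \<in> U)))"

definition power_bounded :: "('r, 'm) ring_scheme \<Rightarrow> 'r topology \<Rightarrow> 'r set" where
  "power_bounded R \<tau> = {a \<in> carrier R. bounded_subset R \<tau> (range (\<lambda>n::nat. a [^]\<^bsub>R\<^esub> n))}"

definition open_subgroups :: "('r, 'm) ring_scheme \<Rightarrow> 'r topology \<Rightarrow> 'r set set" where
  "open_subgroups R \<tau> = {U. additive_subgroup U R \<and> openin \<tau> U}"

text \<open>
  The group topology with the filter base \<open>\<B>\<close> of additive subgroups as a base of neighbourhoods
  of zero.
\<close>

definition subgroup_topology :: "('r, 'm) ring_scheme \<Rightarrow> 'r set set \<Rightarrow> 'r topology" where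
  "subgroup_topology R \<B> =
     topology (\<lambda>W. W \<subseteq> carrier R \<and> (\<forall>w\<in>W. \<exists>B\<in>\<B>. B +>\<^bsub>R\<^esub> w \<subseteq> W))"


lemma istopology_subgroup_topology:
  assumes "\<And>B C. \<lbrakk>B \<in> \<B>; C \<in> \<B>\<rbrakk> \<Longrightarrow> \<exists>D\<in>\<B>. D \<subseteq> B \<inter> C"
  shows "istopology (\<lambda>W. W \<subseteq> carrier R \<and> (\<forall>w\<in>W. \<exists>B\<in>\<B>. B +>\<^bsub>R\<^esub> w \<subseteq> W))"
proof -
  have mono: "B +>\<^bsub>R\<^esub> w \<subseteq> C +>\<^bsub>R\<^esub> w" if "B \<subseteq> C" for B C w
    using that by (auto simp: a_r_coset_def r_coset_def)
  have "\<exists>D\<in>\<B>. D +>\<^bsub>R\<^esub> w \<subseteq> S \<inter> T"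
    if B: "B \<in> \<B>" "B +>\<^bsub>R\<^esub> w \<subseteq> S" and C: "C \<in> \<B>" "C +>\<^bsub>R\<^esub> w \<subseteq> T" for B C S T w
  proof -
    obtain D where D: "D \<in> \<B>" "D \<subseteq> B \<inter> C" using assms B(1) C(1) by blast
    then have "D +>\<^bsub>R\<^esub> w \<subseteq> S \<inter> T" using mono[of D B w] mono[of D C w] B(2) C(2) by blast
    with D(1) show ?thesis by blast
  qed
  then show ?thesis
    unfolding istopology_def
  proof (intro conjI allI impI ballI, goal_cases)
    case (1 S T) then show ?case by blast
  next
    case (2 S T w) then show ?case by blast
  next
    case (3 \<K>) then show ?case by blast
  next
    case (4 \<K> w)
    from 4(3) obtain S where S: "S \<in> \<K>" "w \<in> S" by (rule UnionE)
    from 4(2)[rule_format, OF S(1)] S(2) obtain B where "B \<in> \<B>" "B +>\<^bsub>R\<^esub> w \<subseteq> S" by auto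
    with S(1) show ?case by (meson Union_upper order_trans)
  qed
qed


subsection \<open>Completion\<close>

text \<open>
  Completion of a topological ring whose open subgroups form a base of neighbourhoods of
  zero and whose topology is first countable (as for Huber rings and the localizations below),
  so that Cauchy sequences suffice.
\<close>

definition cauchy_ring :: "'r ring \<Rightarrow> 'r topology \<Rightarrow> (nat \<Rightarrow> 'r) ring" where
  "cauchy_ring R \<tau> =
    \<lparr>carrier = {x. (\<forall>n. x n \<in> carrier R) \<and>
                   (\<forall>V\<in>open_subgroups R \<tau>. \<exists>N. \<forall>m\<ge>N. \<forall>n\<ge>N. x m \<ominus>\<^bsub>R\<^esub> x n \<in> V)},
     monoid.mult = (\<lambda>x y n. x n \<otimes>\<^bsub>R\<^esub> y n),
     monoid.one = (\<lambda>n. \<one>\<^bsub>R\<^esub>),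
     ring.zero = (\<lambda>n. \<zero>\<^bsub>R\<^esub>),
     ring.add = (\<lambda>x y n. x n \<oplus>\<^bsub>R\<^esub> y n)\<rparr>"

definition null_seqs :: "'r ring \<Rightarrow> 'r topology \<Rightarrow> (nat \<Rightarrow> 'r) set" where
  "null_seqs R \<tau> = {x \<in> carrier (cauchy_ring R \<tau>).
     \<forall>V\<in>open_subgroups R \<tau>. \<exists>N. \<forall>n\<ge>N. x n \<in> V}"

definition completion :: "'r ring \<Rightarrow> 'r topology \<Rightarrow> (nat \<Rightarrow> 'r) set ring" where
  "completion R \<tau> = cauchy_ring R \<tau> Quot null_seqs R \<tau>"

definition completion_map :: "'r ring \<Rightarrow> 'r topology \<Rightarrow> 'r \<Rightarrow> (nat \<Rightarrow> 'r) set" where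
  "completion_map R \<tau> r = null_seqs R \<tau> +>\<^bsub>cauchy_ring R \<tau>\<^esub> (\<lambda>n. r)"

definition completion_topology :: "'r ring \<Rightarrow> 'r topology \<Rightarrow> (nat \<Rightarrow> 'r) set topology" where
  "completion_topology R \<tau> = subgroup_topology (completion R \<tau>)
     {{Z \<in> carrier (completion R \<tau>). \<exists>x\<in>Z. \<exists>N. \<forall>n\<ge>N. x n \<in> V} | V. V \<in> open_subgroups R \<tau>}"


subsection \<open>Rational localization\<close>

text \<open>The class of the fraction with numerator \<open>a\<close> and denominator the \<open>n\<close>-th power of \<open>s\<close>.\<close>

definition frac_class :: "'r ring \<Rightarrow> 'r \<Rightarrow> 'r \<Rightarrow> nat \<Rightarrow> ('r \<times> nat) set" where
  "frac_class A s a n = {(b, m). b \<in> carrier A \<and>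
     (\<exists>k::nat. s [^]\<^bsub>A\<^esub> k \<otimes>\<^bsub>A\<^esub> (s [^]\<^bsub>A\<^esub> n \<otimes>\<^bsub>A\<^esub> b) = s [^]\<^bsub>A\<^esub> k \<otimes>\<^bsub>A\<^esub> (s [^]\<^bsub>A\<^esub> m \<otimes>\<^bsub>A\<^esub> a))}"

definition localization :: "'r ring \<Rightarrow> 'r \<Rightarrow> ('r \<times> nat) set ring" where
  "localization A s =
    \<lparr>carrier = {frac_class A s a n | a n. a \<in> carrier A},
     monoid.mult = (\<lambda>Z Y. \<Union>(a, n)\<in>Z. \<Union>(b, m)\<in>Y. frac_class A s (a \<otimes>\<^bsub>A\<^esub> b) (n + m)),
     monoid.one = frac_class A s \<one>\<^bsub>A\<^esub> 0,
     ring.zero = frac_class A s \<zero>\<^bsub>A\<^esub> 0,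
     ring.add = (\<lambda>Z Y. \<Union>(a, n)\<in>Z. \<Union>(b, m)\<in>Y.
              frac_class A s (s [^]\<^bsub>A\<^esub> m \<otimes>\<^bsub>A\<^esub> a \<oplus>\<^bsub>A\<^esub> s [^]\<^bsub>A\<^esub> n \<otimes>\<^bsub>A\<^esub> b) (n + m))\<rparr>"

text \<open>
  A pair \<open>(T, s)\<close> as below presents the rational subset \<open>U(T/s)\<close>.  The topology of \<open>A(T/s)\<close> is
  given by the subgroups generated by \<open>D U\<close> where \<open>D\<close> is the subring generated by the
  fractions \<open>t/s\<close> and \<open>U\<close> is an open subgroup of \<open>A\<close>.  If \<open>A\<close> has a ring of definition \<open>B\<close> with
  ideal of definition \<open>I\<close>, this is the topology defined by the powers of \<open>I\<close> times
  the ring generated by \<open>B\<close> and the \<open>t/s\<close>.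
\<close>

definition rational_data :: "'r ring \<Rightarrow> 'r topology \<Rightarrow> ('r set \<times> 'r) set" where
  "rational_data A \<tau> = {(T, s). finite T \<and> T \<subseteq> carrier A \<and> s \<in> carrier A \<and> openin \<tau> (Idl\<^bsub>A\<^esub> T)}"

definition frac_subring :: "'r ring \<Rightarrow> 'r set \<times> 'r \<Rightarrow> ('r \<times> nat) set set" where
  "frac_subring A D =
     generate_ring (localization A (snd D)) ((\<lambda>t. frac_class A (snd D) t 1) ` fst D)"

definition localization_topology ::
    "'r ring \<Rightarrow> 'r topology \<Rightarrow> 'r set \<times> 'r \<Rightarrow> ('r \<times> nat) set topology" where
  "localization_topology A \<tau> D = subgroup_topology (localization A (snd D))
     {generate (add_monoid (localization A (snd D)))
        {d \<otimes>\<^bsub>localization A (snd D)\<^esub> frac_class A (snd D) u 0 | d u. d \<in> frac_subring A D \<and> u \<in> U}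
      | U. U \<in> open_subgroups A \<tau>}"

type_synonym 'r rat_elt = "(nat \<Rightarrow> ('r \<times> nat) set) set"

definition rat_ring :: "'r ring \<Rightarrow> 'r topology \<Rightarrow> 'r set \<times> 'r \<Rightarrow> 'r rat_elt ring" where
  "rat_ring A \<tau> D = completion (localization A (snd D)) (localization_topology A \<tau> D)"

definition rat_topology :: "'r ring \<Rightarrow> 'r topology \<Rightarrow> 'r set \<times> 'r \<Rightarrow> 'r rat_elt topology" where
  "rat_topology A \<tau> D = completion_topology (localization A (snd D)) (localization_topology A \<tau> D)"

definition rat_map :: "'r ring \<Rightarrow> 'r topology \<Rightarrow> 'r set \<times> 'r \<Rightarrow> 'r \<Rightarrow> 'r rat_elt" where
  "rat_map A \<tau> D a = completion_map (localization A (snd D)) (localization_topology A \<tau> D)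
                       (frac_class A (snd D) a 0)"


section \<open>The adic spectrum\<close>

subsection \<open>Valuations\<close>

definition ordered_group :: "('g, 'm) monoid_scheme \<Rightarrow> ('g \<Rightarrow> 'g \<Rightarrow> bool) \<Rightarrow> bool" where
  "ordered_group G leq \<longleftrightarrow> comm_group G \<and>
     (\<forall>x\<in>carrier G. \<forall>y\<in>carrier G. leq x y \<or> leq y x) \<and>
     (\<forall>x\<in>carrier G. \<forall>y\<in>carrier G. leq x y \<and> leq y x \<longrightarrow> x = y) \<and>
     (\<forall>x\<in>carrier G. \<forall>y\<in>carrier G. \<forall>z\<in>carrier G. leq x y \<and> leq y z \<longrightarrow> leq x z) \<and>
     (\<forall>x\<in>carrier G. \<forall>y\<in>carrier G. \<forall>z\<in>carrier G. leq x y \<longrightarrow> leq (x \<otimes>\<^bsub>G\<^esub> z) (y \<otimes>\<^bsub>G\<^esub> z))"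

text \<open>
  Valuations are written multiplicatively; \<^const>\<open>None\<close> is the least element 0 adjoined to the
  value group.
\<close>

fun le0 :: "('g \<Rightarrow> 'g \<Rightarrow> bool) \<Rightarrow> 'g option \<Rightarrow> 'g option \<Rightarrow> bool" where
  "le0 leq None y = True"
| "le0 leq (Some a) None = False"
| "le0 leq (Some a) (Some b) = leq a b"

fun mult0 :: "('g, 'm) monoid_scheme \<Rightarrow> 'g option \<Rightarrow> 'g option \<Rightarrow> 'g option" where
  "mult0 G (Some a) (Some b) = Some (a \<otimes>\<^bsub>G\<^esub> b)"
| "mult0 G _ _ = None"

definition is_valuation ::
    "'r ring \<Rightarrow> ('g, 'm) monoid_scheme \<Rightarrow> ('g \<Rightarrow> 'g \<Rightarrow> bool) \<Rightarrow> ('r \<Rightarrow> 'g option) \<Rightarrow> bool" where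
  "is_valuation A G leq w \<longleftrightarrow> ordered_group G leq \<and>
     (\<forall>a\<in>carrier A. w a \<in> insert None (Some ` carrier G)) \<and>
     w \<zero>\<^bsub>A\<^esub> = None \<and> w \<one>\<^bsub>A\<^esub> = Some \<one>\<^bsub>G\<^esub> \<and>
     (\<forall>a\<in>carrier A. \<forall>b\<in>carrier A. w (a \<otimes>\<^bsub>A\<^esub> b) = mult0 G (w a) (w b)) \<and>
     (\<forall>a\<in>carrier A. \<forall>b\<in>carrier A. le0 leq (w (a \<oplus>\<^bsub>A\<^esub> b)) (w a) \<or> le0 leq (w (a \<oplus>\<^bsub>A\<^esub> b)) (w b))"

text \<open>Continuity only refers to the subgroup generated by the nonzero values.\<close>

definition continuous_valuation ::
    "'r ring \<Rightarrow> 'r topology \<Rightarrow> ('g, 'm) monoid_scheme \<Rightarrow> ('g \<Rightarrow> 'g \<Rightarrow> bool) \<Rightarrow> ('r \<Rightarrow> 'g option) \<Rightarrow> bool" where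
  "continuous_valuation A \<tau> G leq w \<longleftrightarrow> is_valuation A G leq w \<and>
     (\<forall>\<gamma>\<in>generate G {g. \<exists>a\<in>carrier A. w a = Some g}.
        openin \<tau> {a \<in> carrier A. le0 leq (w a) (Some \<gamma>) \<and> w a \<noteq> Some \<gamma>})"

text \<open>
  Two valuations are equivalent iff they induce the same relation \<open>|a| \<le> |b|\<close>, so an equivalence
  class is represented by that relation.
\<close>

definition val_class :: "'r ring \<Rightarrow> ('g \<Rightarrow> 'g \<Rightarrow> bool) \<Rightarrow> ('r \<Rightarrow> 'g option) \<Rightarrow> ('r \<times> 'r) set" where
  "val_class A leq w = {(a, b). a \<in> carrier A \<and> b \<in> carrier A \<and> le0 leq (w a) (w b)}"

text \<open>
  It suffices to take value groups with elements in \<open>('r \<times> 'r) set\<close>: the subgroup generated by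
  the nonzero values of a valuation \<open>w\<close> consists of the quotients of two such values, and the
  quotient of \<open>w a\<close> by \<open>w b\<close> can be replaced by the set of all pairs \<open>(c, d)\<close> with the same quotient.
\<close>

definition Spa :: "'r ring \<Rightarrow> 'r topology \<Rightarrow> 'r set \<Rightarrow> ('r \<times> 'r) set set" where
  "Spa A \<tau> Aplus = {val_class A leq w | (G :: ('r \<times> 'r) set monoid) leq w.
     continuous_valuation A \<tau> G leq w \<and> (\<forall>a\<in>Aplus. le0 leq (w a) (Some \<one>\<^bsub>G\<^esub>))}"

definition Spa_topology :: "'r ring \<Rightarrow> 'r topology \<Rightarrow> 'r set \<Rightarrow> ('r \<times> 'r) set topology" where
  "Spa_topology A \<tau> Aplus = topology_generated_by
     {{x \<in> Spa A \<tau> Aplus. (f, g) \<in> x \<and> (g, \<zero>\<^bsub>A\<^esub>) \<notin> x} | f g. f \<in> carrier A \<and> g \<in> carrier A}"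

definition rational_subset ::
    "'r ring \<Rightarrow> 'r topology \<Rightarrow> 'r set \<Rightarrow> 'r set \<times> 'r \<Rightarrow> ('r \<times> 'r) set set" where
  "rational_subset A \<tau> Aplus D =
     {x \<in> Spa A \<tau> Aplus. (snd D, \<zero>\<^bsub>A\<^esub>) \<notin> x \<and> (\<forall>t\<in>fst D. (t, snd D) \<in> x)}"


subsection \<open>The structure presheaf\<close>

text \<open>
  The unique continuous \<open>A\<close>-algebra homomorphism between the rings of two rational subsets, the
  second contained in the first.
\<close>

definition rat_res ::
    "'r ring \<Rightarrow> 'r topology \<Rightarrow> 'r set \<times> 'r \<Rightarrow> 'r set \<times> 'r \<Rightarrow> 'r rat_elt \<Rightarrow> 'r rat_elt" where
  "rat_res A \<tau> D D' = (THE \<phi>.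
     \<phi> \<in> extensional (carrier (rat_ring A \<tau> D)) \<and>
     \<phi> \<in> ring_hom (rat_ring A \<tau> D) (rat_ring A \<tau> D') \<and>
     continuous_map (rat_topology A \<tau> D) (rat_topology A \<tau> D') \<phi> \<and>
     (\<forall>a\<in>carrier A. \<phi> (rat_map A \<tau> D a) = rat_map A \<tau> D' a))"

definition data_in ::
    "'r ring \<Rightarrow> 'r topology \<Rightarrow> 'r set \<Rightarrow> ('r \<times> 'r) set set \<Rightarrow> ('r set \<times> 'r) set" where
  "data_in A \<tau> Aplus W = {D \<in> rational_data A \<tau>. rational_subset A \<tau> Aplus D \<subseteq> W}"

type_synonym 'r str_elt = "'r set \<times> 'r \<Rightarrow> 'r rat_elt"

text \<open>
  The sections over an open set \<open>W\<close> are the limit of the rings of the rational subsets contained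
  in \<open>W\<close>.  The limit is indexed by the presentations \<open>(T, s)\<close>; the rings belonging to
  presentations of the same rational subset are identified by \<^const>\<open>rat_res\<close>.
\<close>

definition str_ring ::
    "'r ring \<Rightarrow> 'r topology \<Rightarrow> 'r set \<Rightarrow> ('r \<times> 'r) set set \<Rightarrow> 'r str_elt ring" where
  "str_ring A \<tau> Aplus W =
    \<lparr>carrier = {x \<in> \<Pi>\<^sub>E D\<in>data_in A \<tau> Aplus W. carrier (rat_ring A \<tau> D).
        \<forall>D\<in>data_in A \<tau> Aplus W. \<forall>D'\<in>data_in A \<tau> Aplus W.
          rational_subset A \<tau> Aplus D' \<subseteq> rational_subset A \<tau> Aplus D \<longrightarrow>
          rat_res A \<tau> D D' (x D) = x D'},
     monoid.mult = (\<lambda>x y. \<lambda>D\<in>data_in A \<tau> Aplus W. x D \<otimes>\<^bsub>rat_ring A \<tau> D\<^esub> y D),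
     monoid.one = (\<lambda>D\<in>data_in A \<tau> Aplus W. \<one>\<^bsub>rat_ring A \<tau> D\<^esub>),
     ring.zero = (\<lambda>D\<in>data_in A \<tau> Aplus W. \<zero>\<^bsub>rat_ring A \<tau> D\<^esub>),
     ring.add = (\<lambda>x y. \<lambda>D\<in>data_in A \<tau> Aplus W. x D \<oplus>\<^bsub>rat_ring A \<tau> D\<^esub> y D)\<rparr>"

definition str_topology ::
    "'r ring \<Rightarrow> 'r topology \<Rightarrow> 'r set \<Rightarrow> ('r \<times> 'r) set set \<Rightarrow> 'r str_elt topology" where
  "str_topology A \<tau> Aplus W =
     subtopology (product_topology (rat_topology A \<tau>) (data_in A \<tau> Aplus W))
                 (carrier (str_ring A \<tau> Aplus W))"

definition str_res ::
    "'r ring \<Rightarrow> 'r topology \<Rightarrow> 'r set \<Rightarrow> ('r \<times> 'r) set set \<Rightarrow> ('r \<times> 'r) set set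
      \<Rightarrow> 'r str_elt \<Rightarrow> 'r str_elt" where
  "str_res A \<tau> Aplus W V x = restrict x (data_in A \<tau> Aplus V)"


subsection \<open>Sheaves of topological rings\<close>

definition presheaf_of_topological_rings ::
    "'x topology \<Rightarrow> ('x set \<Rightarrow> 's ring) \<Rightarrow> ('x set \<Rightarrow> 's topology) \<Rightarrow> ('x set \<Rightarrow> 'x set \<Rightarrow> 's \<Rightarrow> 's) \<Rightarrow> bool"
  where
  "presheaf_of_topological_rings S \<O> \<T> \<rho> \<longleftrightarrow>
     (\<forall>U. openin S U \<longrightarrow> topological_ring (\<O> U) (\<T> U)) \<and>
     (\<forall>U V. openin S U \<and> openin S V \<and> V \<subseteq> U \<longrightarrow>
        \<rho> U V \<in> ring_hom (\<O> U) (\<O> V) \<and> continuous_map (\<T> U) (\<T> V) (\<rho> U V)) \<and>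
     (\<forall>U. openin S U \<longrightarrow> (\<forall>x\<in>carrier (\<O> U). \<rho> U U x = x)) \<and>
     (\<forall>U V W. openin S U \<and> openin S V \<and> openin S W \<and> W \<subseteq> V \<and> V \<subseteq> U \<longrightarrow>
        (\<forall>x\<in>carrier (\<O> U). \<rho> V W (\<rho> U V x) = \<rho> U W x))"

text \<open>
  For every open cover, the ring of sections over the union is, as a topological ring, the
  equalizer of the products over the members and over their pairwise intersections.
\<close>

definition sheaf_of_topological_rings ::
    "'x topology \<Rightarrow> ('x set \<Rightarrow> 's ring) \<Rightarrow> ('x set \<Rightarrow> 's topology) \<Rightarrow> ('x set \<Rightarrow> 'x set \<Rightarrow> 's \<Rightarrow> 's) \<Rightarrow> bool"
  where
  "sheaf_of_topological_rings S \<O> \<T> \<rho> \<longleftrightarrow>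
     presheaf_of_topological_rings S \<O> \<T> \<rho> \<and>
     (\<forall>\<U>. (\<forall>V\<in>\<U>. openin S V) \<longrightarrow>
        homeomorphic_map (\<T> (\<Union>\<U>))
          (subtopology (product_topology \<T> \<U>)
             {x \<in> \<Pi>\<^sub>E V\<in>\<U>. carrier (\<O> V).
                \<forall>V\<in>\<U>. \<forall>V'\<in>\<U>. \<rho> V (V \<inter> V') (x V) = \<rho> V' (V \<inter> V') (x V')})
          (\<lambda>x. \<lambda>V\<in>\<U>. \<rho> (\<Union>\<U>) V x))"

definition Spa_is_adic_space :: "'r ring \<Rightarrow> 'r topology \<Rightarrow> 'r set \<Rightarrow> bool" where
  "Spa_is_adic_space A \<tau> Aplus \<longleftrightarrow>
     sheaf_of_topological_rings (Spa_topology A \<tau> Aplus)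
       (str_ring A \<tau> Aplus) (str_topology A \<tau> Aplus) (str_res A \<tau> Aplus)"


subsection \<open>Points of the adic spectrum of a family of local fields\<close>

text \<open>
  The pullback along \<^const>\<open>ev\<close> of the valuation of the \<open>i\<close>-th field, written multiplicatively: an
  additive value \<open>n\<close> becomes the element \<open>-n\<close> of the infinite cyclic group.
\<close>

definition ev_val :: "'a local_fields \<Rightarrow> enat \<Rightarrow> (enat \<Rightarrow> 'a) \<Rightarrow> int option" where
  "ev_val F i s = (if ev i s = \<zero>\<^bsub>fld F i\<^esub> then None else Some (- vl F i (ev i s)))"

definition spa_point :: "'a local_fields \<Rightarrow> enat \<Rightarrow> ((enat \<Rightarrow> 'a) \<times> (enat \<Rightarrow> 'a)) set" where
  "spa_point F i = val_class (section_ring F) (\<le>) (ev_val F i)"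

end

theory Submission
  imports Defs
begin

text \<open>
  The fixed isomorphisms identify a continuous section with a family \<open>a\<close> of elements \<open>a i\<close> of \<open>E i\<close>
  such that, after multiplication with a power of the uniformizer, \<open>a k\<close> and \<open>a \<infinity>\<close> agree modulo the
  \<open>n\<close>-th power of the maximal ideal for each \<open>n\<close> and all large \<open>k\<close>.  Hence the valuations of \<open>a k\<close> are
  eventually constant if \<open>a \<infinity>\<close> is nonzero and tend to infinity otherwise, sections over clopen sets
  can be cut off and glued, and a section is invertible over every clopen set on which it has no zero.

  Let \<open>P\<close> be a prime ideal.  It contains one of the idempotents \<open>chi {k}\<close> and \<open>chi (- {k})\<close> for each
  \<open>k\<close>.  If it contains \<open>chi (- {k})\<close>, it is the kernel of the evaluation at \<open>k\<close>.  If it contains all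
  \<open>chi {k}\<close>, it contains the sections with finite support in the natural numbers, which are dense in
  the kernel of the evaluation at \<open>\<infinity>\<close>, so a closed \<open>P\<close> equals that kernel.  The support of a continuous
  valuation is closed, so a point of the adic spectrum comes from a valuation of some \<open>E i\<close>
  that is bounded by 1 on the valuation ring, and only one such class is continuous.

  A rational subset \<open>D\<close> is clopen, and sending \<open>a / s\<^sup>n\<close> to the corresponding section over \<open>D\<close> exhibits
  the ring of sections over \<open>D\<close> as the completion of the localization.  The structure presheaf is
  therefore the presheaf of sections of the family, for which the sheaf axiom holds.
\<close>

section \<open>Topologies given by additive subgroups\<close>

text \<open>The fixed isomorphism at \<open>k\<close> compares \<open>E k\<close> with the Laurent
  series field only on integral elements and only modulo the power \<open>e k\<close>. It is handled
  as a relation between elements with an explicit precision. Dividing by a power of the uniformizer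
  lowers the precision by the exponent, which is harmless because \<open>e k\<close> tends to
  infinity; the exponents \<open>m + n\<close> below arise in this way.

  A rational subset is clopen because its ideal, being open, contains a power of the section
  \<open>u\<close>: the numerators have no common zero, so the complement is the union of the open
  loci \<open>|s| < |t|\<close>. The denominator need not vanish off the subset, so the localization
  may retain fractions that are zero on the subset; these must be shown to lie in every
  neighbourhood of zero before the completion can be recognized.

  Finite indices are isolated, so continuity is a condition at \<open>\<infinity>\<close> alone and
  sections glue easily. That the gluing is also a homeomorphism rests on compactness: closeness on a
  clopen set is controlled by finitely many members of a cover.\<close>

lemma (in ring) mem_a_rcos:
  assumes "additive_subgroup B R" "x \<in> carrier R"
  shows "y \<in> B +> x \<longleftrightarrow> y \<in> carrier R \<and> y \<ominus> x \<in> B"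
proof -
  interpret B: additive_subgroup B R by fact
  have sub: "B \<subseteq> carrier R" by (rule B.a_subset)
  show ?thesis
  proof
    assume "y \<in> B +> x"
    then obtain b where b: "b \<in> B" "y = b \<oplus> x"
      by (auto simp: a_r_coset_def')
    then have "b \<in> carrier R" using sub by auto
    then have "y \<ominus> x = b" using b assms(2) by (simp add: minus_eq a_assoc r_neg)
    then show "y \<in> carrier R \<and> y \<ominus> x \<in> B" using b \<open>b \<in> carrier R\<close> assms(2) by auto
  next
    assume y: "y \<in> carrier R \<and> y \<ominus> x \<in> B"
    then have "y = (y \<ominus> x) \<oplus> x" using assms(2) by (simp add: minus_eq a_assoc l_neg)
    then show "y \<in> B +> x" using y by (auto simp: a_r_coset_def')
  qed
qed

lemma (in ring) additive_subgroup_minus: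
  assumes "additive_subgroup B R" "x \<in> B" "y \<in> B"
  shows "x \<ominus> y \<in> B"
  using additive_subgroup.a_closed[OF assms(1,2)] additive_subgroup.a_inv_closed[OF assms(1) assms(3)]
  by (simp add: minus_eq)

text \<open>Only the additive structure is constrained, so the facts below serve rings of sections,
  localizations and completions alike; multiplication enters in
  \<open>topological_ringI\<close>.\<close>

locale subgroup_base = ring R for R (structure) +
  fixes \<B> :: "'a set set"
  assumes subgroup: "B \<in> \<B> \<Longrightarrow> additive_subgroup B R"
    and nonempty: "\<B> \<noteq> {}"
    and directed: "\<lbrakk>B \<in> \<B>; C \<in> \<B>\<rbrakk> \<Longrightarrow> \<exists>D\<in>\<B>. D \<subseteq> B \<inter> C"
begin

abbreviation "\<tau> \<equiv> subgroup_topology R \<B>"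

lemma openin_iff:
  "openin \<tau> W \<longleftrightarrow> W \<subseteq> carrier R \<and> (\<forall>w\<in>W. \<exists>B\<in>\<B>. \<forall>y\<in>carrier R. y \<ominus> w \<in> B \<longrightarrow> y \<in> W)"
proof -
  have "openin \<tau> W \<longleftrightarrow> W \<subseteq> carrier R \<and> (\<forall>w\<in>W. \<exists>B\<in>\<B>. B +> w \<subseteq> W)"
    unfolding subgroup_topology_def
    by (subst topology_inverse'[OF istopology_subgroup_topology]) (use directed in auto)
  also have "\<dots> \<longleftrightarrow> W \<subseteq> carrier R \<and> (\<forall>w\<in>W. \<exists>B\<in>\<B>. \<forall>y\<in>carrier R. y \<ominus> w \<in> B \<longrightarrow> y \<in> W)"
    using mem_a_rcos[OF subgroup] by (intro conj_cong refl ball_cong bex_cong) blast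
  finally show ?thesis .
qed

lemma topspace [simp]: "topspace \<tau> = carrier R"
proof -
  have "openin \<tau> (carrier R)" using nonempty by (auto simp: openin_iff)
  then show ?thesis by (metis openin_iff openin_subset openin_topspace subset_antisym)
qed

lemma openin_ball:
  assumes "B \<in> \<B>" "x \<in> carrier R"
  shows "openin \<tau> {y \<in> carrier R. y \<ominus> x \<in> B}"
  unfolding openin_iff
proof (intro conjI ballI subsetI)
  fix w assume w: "w \<in> {y \<in> carrier R. y \<ominus> x \<in> B}"
  show "\<exists>B'\<in>\<B>. \<forall>y\<in>carrier R. y \<ominus> w \<in> B' \<longrightarrow> y \<in> {y \<in> carrier R. y \<ominus> x \<in> B}"
  proof (intro bexI[of _ B] ballI impI)
    fix y assume y: "y \<in> carrier R" "y \<ominus> w \<in> B"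
    have "y \<ominus> x = (y \<ominus> w) \<oplus> (w \<ominus> x)"
      using y(1) w assms(2) by (auto simp: minus_eq a_assoc r_neg1)
    then show "y \<in> {y \<in> carrier R. y \<ominus> x \<in> B}"
      using y w additive_subgroup.a_closed[OF subgroup[OF assms(1)]] by auto
  qed (use assms in auto)
qed auto

text \<open>A subgroup that contains a neighbourhood of zero contains the translate of that
  neighbourhood to each of its points.\<close>

lemma openin_subgroup_iff:
  assumes "additive_subgroup V R"
  shows "openin \<tau> V \<longleftrightarrow> (\<exists>B\<in>\<B>. B \<subseteq> V)"
proof
  assume "openin \<tau> V"
  moreover have "\<zero> \<in> V" using assms by (simp add: additive_subgroup.zero_closed)
  ultimately obtain B where B: "B \<in> \<B>" "\<forall>y\<in>carrier R. y \<ominus> \<zero> \<in> B \<longrightarrow> y \<in> V"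
    by (auto simp: openin_iff)
  have "B \<subseteq> carrier R" using subgroup[OF B(1)] by (simp add: additive_subgroup.a_subset)
  then show "\<exists>B\<in>\<B>. B \<subseteq> V" using B by (auto simp: minus_eq)
next
  assume "\<exists>B\<in>\<B>. B \<subseteq> V"
  then obtain B where B: "B \<in> \<B>" "B \<subseteq> V" by auto
  show "openin \<tau> V"
    unfolding openin_iff
  proof (intro conjI ballI bexI[OF _ B(1)] impI)
    show sub: "V \<subseteq> carrier R" using assms by (simp add: additive_subgroup.a_subset)
    fix w y assume "w \<in> V" "y \<in> carrier R" "y \<ominus> w \<in> B"
    then have "(y \<ominus> w) \<oplus> w \<in> V"
      using B additive_subgroup.a_closed[OF assms] by blast
    then show "y \<in> V"
      using \<open>w \<in> V\<close> \<open>y \<in> carrier R\<close> sub by (auto simp: minus_eq a_assoc l_neg subset_iff)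
  qed
qed

lemma open_subgroups_eq: "open_subgroups R \<tau> = {V. additive_subgroup V R \<and> (\<exists>B\<in>\<B>. B \<subseteq> V)}"
  unfolding open_subgroups_def using openin_subgroup_iff by blast

lemma continuous_mapI:
  assumes "f \<in> carrier R \<rightarrow> carrier S" "subgroup_base S \<C>"
    "\<And>x C. \<lbrakk>x \<in> carrier R; C \<in> \<C>\<rbrakk> \<Longrightarrow>
       \<exists>B\<in>\<B>. \<forall>y\<in>carrier R. y \<ominus> x \<in> B \<longrightarrow> f y \<ominus>\<^bsub>S\<^esub> f x \<in> C"
  shows "continuous_map \<tau> (subgroup_topology S \<C>) f"
proof -
  interpret S: subgroup_base S \<C> by fact
  show ?thesis
    unfolding continuous_map_def
  proof (intro conjI allI impI)
    show "f \<in> topspace \<tau> \<rightarrow> topspace (subgroup_topology S \<C>)" using assms(1) by simp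
    fix U assume U: "openin (subgroup_topology S \<C>) U"
    show "openin \<tau> {x \<in> topspace \<tau>. f x \<in> U}"
      unfolding openin_iff
    proof (intro conjI ballI)
      fix w assume w: "w \<in> {x \<in> topspace \<tau>. f x \<in> U}"
      then obtain C where C: "C \<in> \<C>" "\<forall>y\<in>carrier S. y \<ominus>\<^bsub>S\<^esub> f w \<in> C \<longrightarrow> y \<in> U"
        using U by (auto simp: S.openin_iff)
      obtain B where B: "B \<in> \<B>" "\<forall>y\<in>carrier R. y \<ominus> w \<in> B \<longrightarrow> f y \<ominus>\<^bsub>S\<^esub> f w \<in> C"
        using assms(3)[of w C] w C by auto
      show "\<exists>B\<in>\<B>. \<forall>y\<in>carrier R. y \<ominus> w \<in> B \<longrightarrow> y \<in> {x \<in> topspace \<tau>. f x \<in> U}"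
        using B C assms(1) by (intro bexI[OF _ B(1)]) auto
    qed auto
  qed
qed

lemma continuous_map_prodI:
  assumes "\<And>x y. \<lbrakk>x \<in> carrier R; y \<in> carrier R\<rbrakk> \<Longrightarrow> f (x, y) \<in> carrier R"
    "\<And>x y C. \<lbrakk>x \<in> carrier R; y \<in> carrier R; C \<in> \<B>\<rbrakk> \<Longrightarrow>
       \<exists>B\<in>\<B>. \<forall>x'\<in>carrier R. \<forall>y'\<in>carrier R. x' \<ominus> x \<in> B \<longrightarrow> y' \<ominus> y \<in> B \<longrightarrow> f (x', y') \<ominus> f (x, y) \<in> C"
  shows "continuous_map (prod_topology \<tau> \<tau>) \<tau> f"
  unfolding continuous_map_def
proof (intro conjI allI impI)
  show "f \<in> topspace (prod_topology \<tau> \<tau>) \<rightarrow> topspace \<tau>" using assms(1) by auto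
  fix U assume U: "openin \<tau> U"
  show "openin (prod_topology \<tau> \<tau>) {p \<in> topspace (prod_topology \<tau> \<tau>). f p \<in> U}"
    unfolding openin_prod_topology_alt
  proof (intro allI impI)
    fix x y assume xy: "(x, y) \<in> {p \<in> topspace (prod_topology \<tau> \<tau>). f p \<in> U}"
    then have c: "x \<in> carrier R" "y \<in> carrier R" by auto
    obtain C where C: "C \<in> \<B>" "\<forall>z\<in>carrier R. z \<ominus> f (x, y) \<in> C \<longrightarrow> z \<in> U"
      using U xy by (auto simp: openin_iff)
    obtain B where B: "B \<in> \<B>" "\<forall>x'\<in>carrier R. \<forall>y'\<in>carrier R. x' \<ominus> x \<in> B \<longrightarrow> y' \<ominus> y \<in> B \<longrightarrow>
        f (x', y') \<ominus> f (x, y) \<in> C"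
      using assms(2)[OF c C(1)] by auto
    have "x \<ominus> x \<in> B" "y \<ominus> y \<in> B"
      using subgroup[OF B(1)] c by (simp_all add: minus_eq r_neg additive_subgroup.zero_closed)
    moreover have "f (x', y') \<in> U" if "x' \<in> carrier R" "y' \<in> carrier R" "x' \<ominus> x \<in> B" "y' \<ominus> y \<in> B" for x' y'
      using that B C assms(1) by blast
    ultimately show "\<exists>U' V. openin \<tau> U' \<and> openin \<tau> V \<and> x \<in> U' \<and> y \<in> V \<and>
        U' \<times> V \<subseteq> {p \<in> topspace (prod_topology \<tau> \<tau>). f p \<in> U}"
      using c openin_ball[OF B(1)]
      by (intro exI[of _ "{z \<in> carrier R. z \<ominus> x \<in> B}"] exI[of _ "{z \<in> carrier R. z \<ominus> y \<in> B}"]) auto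
  qed
qed

lemma topological_ringI:
  assumes "cring R"
    and mult: "\<And>B x. \<lbrakk>B \<in> \<B>; x \<in> carrier R\<rbrakk> \<Longrightarrow> \<exists>C\<in>\<B>. \<forall>y\<in>C. x \<otimes> y \<in> B"
    and mult': "\<And>B. B \<in> \<B> \<Longrightarrow> \<exists>C\<in>\<B>. \<forall>x\<in>C. \<forall>y\<in>C. x \<otimes> y \<in> B"
  shows "topological_ring R \<tau>"
proof -
  interpret cring R by fact
  have "continuous_map (prod_topology \<tau> \<tau>) \<tau> (\<lambda>(x, y). x \<oplus> y)"
  proof (rule continuous_map_prodI)
    fix x y B assume xy: "x \<in> carrier R" "y \<in> carrier R" and B: "B \<in> \<B>"
    show "\<exists>B'\<in>\<B>. \<forall>x'\<in>carrier R. \<forall>y'\<in>carrier R. x' \<ominus> x \<in> B' \<longrightarrow> y' \<ominus> y \<in> B' \<longrightarrow>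
        (case (x', y') of (x, y) \<Rightarrow> x \<oplus> y) \<ominus> (case (x, y) of (x, y) \<Rightarrow> x \<oplus> y) \<in> B"
    proof (intro bexI[OF _ B] ballI impI)
      fix x' y' assume *: "x' \<in> carrier R" "y' \<in> carrier R" "x' \<ominus> x \<in> B" "y' \<ominus> y \<in> B"
      have "(x' \<oplus> y') \<ominus> (x \<oplus> y) = (x' \<ominus> x) \<oplus> (y' \<ominus> y)"
        using * xy by algebra
      then show "(case (x', y') of (x, y) \<Rightarrow> x \<oplus> y) \<ominus> (case (x, y) of (x, y) \<Rightarrow> x \<oplus> y) \<in> B"
        using * additive_subgroup.a_closed[OF subgroup[OF B]] by simp
    qed
  qed auto
  moreover have "continuous_map \<tau> \<tau> (\<lambda>x. \<ominus> x)"
  proof (rule continuous_mapI)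
    show "subgroup_base R \<B>" by (rule subgroup_base_axioms)
    fix x B assume x: "x \<in> carrier R" and B: "B \<in> \<B>"
    show "\<exists>B'\<in>\<B>. \<forall>y\<in>carrier R. y \<ominus> x \<in> B' \<longrightarrow> (\<ominus> y) \<ominus> (\<ominus> x) \<in> B"
    proof (intro bexI[OF _ B] ballI impI)
      fix y assume *: "y \<in> carrier R" "y \<ominus> x \<in> B"
      have "(\<ominus> y) \<ominus> (\<ominus> x) = \<ominus> (y \<ominus> x)" using * x by algebra
      then show "(\<ominus> y) \<ominus> (\<ominus> x) \<in> B"
        using * additive_subgroup.a_inv_closed[OF subgroup[OF B]] by simp
    qed
  qed auto
  moreover have "continuous_map (prod_topology \<tau> \<tau>) \<tau> (\<lambda>(x, y). x \<otimes> y)"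
  proof (rule continuous_map_prodI)
    fix x y B assume xy: "x \<in> carrier R" "y \<in> carrier R" and B: "B \<in> \<B>"
    obtain B1 where b1: "B1 \<in> \<B>" "\<forall>z\<in>B1. x \<otimes> z \<in> B" using mult[OF B xy(1)] by blast
    obtain B2 where b2: "B2 \<in> \<B>" "\<forall>z\<in>B2. y \<otimes> z \<in> B" using mult[OF B xy(2)] by blast
    obtain B3 where b3: "B3 \<in> \<B>" "\<forall>z\<in>B3. \<forall>z'\<in>B3. z \<otimes> z' \<in> B" using mult'[OF B] by blast
    obtain B12 where b12: "B12 \<in> \<B>" "B12 \<subseteq> B1 \<inter> B2" using directed[OF b1(1) b2(1)] by blast
    obtain B' where B': "B' \<in> \<B>" "B' \<subseteq> B12 \<inter> B3" using directed[OF b12(1) b3(1)] by blast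
    show "\<exists>B'\<in>\<B>. \<forall>x'\<in>carrier R. \<forall>y'\<in>carrier R. x' \<ominus> x \<in> B' \<longrightarrow> y' \<ominus> y \<in> B' \<longrightarrow>
        (case (x', y') of (x, y) \<Rightarrow> x \<otimes> y) \<ominus> (case (x, y) of (x, y) \<Rightarrow> x \<otimes> y) \<in> B"
    proof (intro bexI[OF _ B'(1)] ballI impI)
      fix x' y' assume *: "x' \<in> carrier R" "y' \<in> carrier R" "x' \<ominus> x \<in> B'" "y' \<ominus> y \<in> B'"
      \<comment> \<open>The two terms that are linear in the errors are controlled by absorption at
        the fixed points \<open>x\<close> and \<open>y\<close>, the product of the errors by
        \<open>mult'\<close>.\<close>
      have "(x' \<otimes> y') \<ominus> (x \<otimes> y) = x \<otimes> (y' \<ominus> y) \<oplus> (y \<otimes> (x' \<ominus> x) \<oplus> (x' \<ominus> x) \<otimes> (y' \<ominus> y))"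
        using *(1,2) xy by algebra
      moreover have "x \<otimes> (y' \<ominus> y) \<in> B" "y \<otimes> (x' \<ominus> x) \<in> B" "(x' \<ominus> x) \<otimes> (y' \<ominus> y) \<in> B"
        using b1(2) b2(2) b3(2) b12(2) B'(2) *(3,4) by blast+
      ultimately show "(case (x', y') of (x, y) \<Rightarrow> x \<otimes> y) \<ominus> (case (x, y) of (x, y) \<Rightarrow> x \<otimes> y) \<in> B"
        using additive_subgroup.a_closed[OF subgroup[OF B]] by simp
    qed
  qed auto
  ultimately show ?thesis
    unfolding topological_ring_def using assms(1) by simp
qed

end

lemma ring_iso_minus:
  assumes "h \<in> ring_hom R S" "ring R" "ring S" "x \<in> carrier R" "y \<in> carrier R"
  shows "h (x \<ominus>\<^bsub>R\<^esub> y) = h x \<ominus>\<^bsub>S\<^esub> h y"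
proof -
  interpret h: ring_hom_ring R S h
    using assms by (simp add: ring_hom_ringI2)
  show ?thesis
    using assms(4,5) by (simp add: a_minus_def)
qed

text \<open>By additivity of \<open>h\<close>, continuity and openness only have to be compared at
  zero, on the two bases.\<close>

lemma subgroup_topology_homeomorphic:
  assumes iso: "h \<in> ring_iso R S" and R: "subgroup_base R \<B>" and S: "subgroup_base S \<C>"
    and BC: "\<And>C. C \<in> \<C> \<Longrightarrow> \<exists>B\<in>\<B>. h ` B \<subseteq> C" and CB: "\<And>B. B \<in> \<B> \<Longrightarrow> \<exists>C\<in>\<C>. C \<subseteq> h ` B"
  shows "homeomorphic_map (subgroup_topology R \<B>) (subgroup_topology S \<C>) h"
proof -
  interpret R: subgroup_base R \<B> by fact
  interpret S: subgroup_base S \<C> by fact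
  have hom: "h \<in> ring_hom R S" and bij: "bij_betw h (carrier R) (carrier S)"
    using iso by (auto simp: ring_iso_def)
  interpret h: ring_hom_ring R S h
    using hom R.ring_axioms S.ring_axioms by (simp add: ring_hom_ringI2)
  note minus = ring_iso_minus[OF hom R.ring_axioms S.ring_axioms]
  have "continuous_map (subgroup_topology R \<B>) (subgroup_topology S \<C>) h"
  proof (rule R.continuous_mapI[OF _ S])
    fix x C assume x: "x \<in> carrier R" and C: "C \<in> \<C>"
    obtain B where B: "B \<in> \<B>" "h ` B \<subseteq> C" using BC[OF C] by auto
    then show "\<exists>B\<in>\<B>. \<forall>y\<in>carrier R. y \<ominus>\<^bsub>R\<^esub> x \<in> B \<longrightarrow> h y \<ominus>\<^bsub>S\<^esub> h x \<in> C"
      using minus x by (intro bexI[OF _ B(1)]) force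
  qed auto
  moreover have "open_map (subgroup_topology R \<B>) (subgroup_topology S \<C>) h"
    unfolding open_map_def
  proof (intro allI impI)
    fix U assume U: "openin (subgroup_topology R \<B>) U"
    then have sub: "U \<subseteq> carrier R" by (auto simp: R.openin_iff)
    show "openin (subgroup_topology S \<C>) (h ` U)"
      unfolding S.openin_iff
    proof (intro conjI ballI)
      show "h ` U \<subseteq> carrier S" using sub by auto
      fix w assume "w \<in> h ` U"
      then obtain u where u: "u \<in> U" "w = h u" by auto
      then obtain B where B: "B \<in> \<B>" "\<forall>y\<in>carrier R. y \<ominus>\<^bsub>R\<^esub> u \<in> B \<longrightarrow> y \<in> U"
        using U by (auto simp: R.openin_iff)
      obtain C where C: "C \<in> \<C>" "C \<subseteq> h ` B" using CB[OF B(1)] by auto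
      show "\<exists>C\<in>\<C>. \<forall>y\<in>carrier S. y \<ominus>\<^bsub>S\<^esub> w \<in> C \<longrightarrow> y \<in> h ` U"
      proof (intro bexI[OF _ C(1)] ballI impI)
        fix y assume y: "y \<in> carrier S" "y \<ominus>\<^bsub>S\<^esub> w \<in> C"
        obtain z where z: "z \<in> carrier R" "y = h z" using y bij by (auto simp: bij_betw_def)
        obtain b where b: "b \<in> B" "y \<ominus>\<^bsub>S\<^esub> w = h b" using y C by auto
        have "h (z \<ominus>\<^bsub>R\<^esub> u) = h b" using minus z u sub b by auto
        moreover have "b \<in> carrier R" "z \<ominus>\<^bsub>R\<^esub> u \<in> carrier R"
          using additive_subgroup.a_subset[OF R.subgroup[OF B(1)]] b z u sub by auto
        ultimately have "z \<ominus>\<^bsub>R\<^esub> u = b" using bij by (auto simp: bij_betw_def inj_on_def)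
        then show "y \<in> h ` U" using B b z by auto
      qed
    qed
  qed
  ultimately show ?thesis
    using bij by (intro bijective_open_imp_homeomorphic_map) (auto simp: bij_betw_def)
qed

section \<open>Localization of a commutative ring at one element\<close>

locale cring_localization = cring R for R :: "'r ring" (structure) +
  fixes s :: 'r
  assumes s_closed [simp, intro]: "s \<in> carrier R"
begin

abbreviation "L \<equiv> localization R s"
abbreviation "frct \<equiv> frac_class R s"

lemma mem_frct:
  "(b, m) \<in> frct a n \<longleftrightarrow> b \<in> carrier R \<and>
     (\<exists>k::nat. s [^] k \<otimes> (s [^] n \<otimes> b) = s [^] k \<otimes> (s [^] m \<otimes> a))"
  by (simp add: frac_class_def)

lemma frct_self: "a \<in> carrier R \<Longrightarrow> (a, n) \<in> frct a n"
  by (auto simp: mem_frct)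

lemma frct_trans:
  assumes "a \<in> carrier R" "(b, m) \<in> frct a n" "(c, l) \<in> frct b m"
  shows "(c, l) \<in> frct a n"
proof -
  from assms(2) obtain k :: nat where b: "b \<in> carrier R" and k: "s [^] k \<otimes> (s [^] n \<otimes> b) = s [^] k \<otimes> (s [^] m \<otimes> a)"
    by (auto simp: mem_frct)
  from assms(3) obtain k' :: nat where c: "c \<in> carrier R" and k': "s [^] k' \<otimes> (s [^] m \<otimes> c) = s [^] k' \<otimes> (s [^] l \<otimes> b)"
    by (auto simp: mem_frct)
  \<comment> \<open>The factor \<open>s [^] m\<close> is the denominator of the middle fraction. It
    cannot be cancelled, so it joins the witness exponent.\<close>
  have "s [^] (k + k' + m) \<otimes> (s [^] n \<otimes> c) = (s [^] k \<otimes> s [^] n) \<otimes> (s [^] k' \<otimes> (s [^] m \<otimes> c))"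
    using c by (simp add: nat_pow_mult[symmetric] m_ac)
  also have "\<dots> = (s [^] k' \<otimes> s [^] l) \<otimes> (s [^] k \<otimes> (s [^] n \<otimes> b))"
    unfolding k' using b by (simp add: m_ac)
  also have "\<dots> = s [^] (k + k' + m) \<otimes> (s [^] l \<otimes> a)"
    unfolding k using assms(1) by (simp add: nat_pow_mult[symmetric] m_ac)
  finally show ?thesis using c by (auto simp: mem_frct)
qed

lemma frct_sym: "\<lbrakk>a \<in> carrier R; (b, m) \<in> frct a n\<rbrakk> \<Longrightarrow> (a, n) \<in> frct b m"
  by (auto simp: mem_frct) metis

lemma frct_eq_iff_mem:
  assumes "a \<in> carrier R" "b \<in> carrier R"
  shows "frct a n = frct b m \<longleftrightarrow> (b, m) \<in> frct a n"
proof
  assume "(b, m) \<in> frct a n"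
  note ba = this
  show "frct a n = frct b m"
  proof (intro subset_antisym subrelI)
    fix c l assume "(c, l) \<in> frct a n"
    then show "(c, l) \<in> frct b m"
      by (rule frct_trans[OF assms(2) frct_sym[OF assms(1) ba]])
  next
    fix c l assume "(c, l) \<in> frct b m"
    then show "(c, l) \<in> frct a n" by (rule frct_trans[OF assms(1) ba])
  qed
next
  assume "frct a n = frct b m"
  then show "(b, m) \<in> frct a n" using frct_self[OF assms(2)] by simp
qed

lemma frct_eqI:
  assumes "a \<in> carrier R" "b \<in> carrier R" "s [^] n \<otimes> b = s [^] m \<otimes> a"
  shows "frct a n = frct b m"
  using assms by (auto simp: frct_eq_iff_mem mem_frct)

text \<open>The operations of \<open>localization\<close> are unions over all pairs of
  representatives. When \<open>h\<close> gives the same set for every choice, the union collapses to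
  the value at the chosen pair.\<close>

lemma UN_frct:
  fixes h :: "'r \<Rightarrow> nat \<Rightarrow> 'r \<Rightarrow> nat \<Rightarrow> 'b set"
  assumes "\<And>a' n' b' m'. \<lbrakk>(a', n') \<in> frct a n; (b', m') \<in> frct b m\<rbrakk> \<Longrightarrow> h a' n' b' m' = h a n b m"
    "a \<in> carrier R" "b \<in> carrier R"
  shows "(\<Union>(a', n')\<in>frct a n. \<Union>(b', m')\<in>frct b m. h a' n' b' m') = h a n b m"
proof (intro Set.set_eqI iffI)
  fix z assume "z \<in> (\<Union>(a', n')\<in>frct a n. \<Union>(b', m')\<in>frct b m. h a' n' b' m')"
  then obtain a' n' b' m' where "(a', n') \<in> frct a n" "(b', m') \<in> frct b m" "z \<in> h a' n' b' m'" by blast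
  then show "z \<in> h a n b m" using assms(1) by metis
next
  fix z assume "z \<in> h a n b m"
  then show "z \<in> (\<Union>(a', n')\<in>frct a n. \<Union>(b', m')\<in>frct b m. h a' n' b' m')"
    using frct_self[OF assms(2)] frct_self[OF assms(3)] by blast
qed

lemma mult_frct:
  assumes "a \<in> carrier R" "b \<in> carrier R"
  shows "frct a n \<otimes>\<^bsub>L\<^esub> frct b m = frct (a \<otimes> b) (n + m)"
proof -
  have *: "frct (a' \<otimes> b') (n' + m') = frct (a \<otimes> b) (n + m)"
    if a: "(a', n') \<in> frct a n" and b: "(b', m') \<in> frct b m" for a' n' b' m'
  proof -
  from a obtain k :: nat where a': "a' \<in> carrier R" and k: "s [^] k \<otimes> (s [^] n \<otimes> a') = s [^] k \<otimes> (s [^] n' \<otimes> a)"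
    by (auto simp: mem_frct)
  from b obtain k' :: nat where b': "b' \<in> carrier R" and k': "s [^] k' \<otimes> (s [^] m \<otimes> b') = s [^] k' \<otimes> (s [^] m' \<otimes> b)"
    by (auto simp: mem_frct)
  have ac: "p \<otimes> p' \<otimes> (q \<otimes> q' \<otimes> (u \<otimes> u')) = (p \<otimes> (q \<otimes> u)) \<otimes> (p' \<otimes> (q' \<otimes> u'))"
    if "p \<in> carrier R" "p' \<in> carrier R" "q \<in> carrier R" "q' \<in> carrier R" "u \<in> carrier R" "u' \<in> carrier R"
    for p p' q q' u u'
    using that by algebra
  have "s [^] (k + k') \<otimes> (s [^] (n + m) \<otimes> (a' \<otimes> b')) =
      (s [^] k \<otimes> (s [^] n \<otimes> a')) \<otimes> (s [^] k' \<otimes> (s [^] m \<otimes> b'))"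
    using a' b' by (simp add: nat_pow_mult[symmetric] ac)
  also have "\<dots> = s [^] (k + k') \<otimes> (s [^] (n' + m') \<otimes> (a \<otimes> b))"
    unfolding k k' using assms by (simp add: nat_pow_mult[symmetric] ac)
  finally have "(a' \<otimes> b', n' + m') \<in> frct (a \<otimes> b) (n + m)"
    using a' b' unfolding mem_frct by blast
  then have "frct (a \<otimes> b) (n + m) = frct (a' \<otimes> b') (n' + m')"
    using a' b' assms by (simp add: frct_eq_iff_mem)
  then show ?thesis by (rule sym)
qed
  show ?thesis
    using UN_frct[where a = a and b = b and n = n and m = m and h = "\<lambda>a n b m. frct (a \<otimes> b) (n + m)", OF * assms]
    by (simp add: localization_def)
qed

lemma add_frct:
  assumes "a \<in> carrier R" "b \<in> carrier R"
  shows "frct a n \<oplus>\<^bsub>L\<^esub> frct b m = frct (s [^] m \<otimes> a \<oplus> s [^] n \<otimes> b) (n + m)"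
proof -
  have *: "frct (s [^] m' \<otimes> a' \<oplus> s [^] n' \<otimes> b') (n' + m') = frct (s [^] m \<otimes> a \<oplus> s [^] n \<otimes> b) (n + m)"
    if a: "(a', n') \<in> frct a n" and b: "(b', m') \<in> frct b m" for a' n' b' m'
  proof -
  from a obtain k :: nat where a': "a' \<in> carrier R" and k: "s [^] k \<otimes> (s [^] n \<otimes> a') = s [^] k \<otimes> (s [^] n' \<otimes> a)"
    by (auto simp: mem_frct)
  from b obtain k' :: nat where b': "b' \<in> carrier R" and k': "s [^] k' \<otimes> (s [^] m \<otimes> b') = s [^] k' \<otimes> (s [^] m' \<otimes> b)"
    by (auto simp: mem_frct)
  have ac: "p \<otimes> p' \<otimes> (q \<otimes> q' \<otimes> (r' \<otimes> u \<oplus> r \<otimes> u')) =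
      (p' \<otimes> (q' \<otimes> r')) \<otimes> (p \<otimes> (q \<otimes> u)) \<oplus> (p \<otimes> (q \<otimes> r)) \<otimes> (p' \<otimes> (q' \<otimes> u'))"
    if "p \<in> carrier R" "p' \<in> carrier R" "q \<in> carrier R" "q' \<in> carrier R" "r \<in> carrier R" "r' \<in> carrier R"
      "u \<in> carrier R" "u' \<in> carrier R"
    for p p' q q' r r' u u'
    using that by algebra
  have "s [^] (k + k') \<otimes> (s [^] (n + m) \<otimes> (s [^] m' \<otimes> a' \<oplus> s [^] n' \<otimes> b')) =
      (s [^] k' \<otimes> (s [^] m \<otimes> s [^] m')) \<otimes> (s [^] k \<otimes> (s [^] n \<otimes> a')) \<oplus>
      (s [^] k \<otimes> (s [^] n \<otimes> s [^] n')) \<otimes> (s [^] k' \<otimes> (s [^] m \<otimes> b'))"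
    using a' b' by (simp add: nat_pow_mult[symmetric] ac)
  also have "\<dots> = (s [^] k' \<otimes> (s [^] m' \<otimes> s [^] m)) \<otimes> (s [^] k \<otimes> (s [^] n' \<otimes> a)) \<oplus>
      (s [^] k \<otimes> (s [^] n' \<otimes> s [^] n)) \<otimes> (s [^] k' \<otimes> (s [^] m' \<otimes> b))"
    unfolding k k' by (simp add: m_comm)
  also have "\<dots> = s [^] (k + k') \<otimes> (s [^] (n' + m') \<otimes> (s [^] m \<otimes> a \<oplus> s [^] n \<otimes> b))"
    using assms by (simp add: nat_pow_mult[symmetric] ac)
  finally have "(s [^] m' \<otimes> a' \<oplus> s [^] n' \<otimes> b', n' + m') \<in> frct (s [^] m \<otimes> a \<oplus> s [^] n \<otimes> b) (n + m)"
    using a' b' unfolding mem_frct by blast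
  then have "frct (s [^] m \<otimes> a \<oplus> s [^] n \<otimes> b) (n + m) = frct (s [^] m' \<otimes> a' \<oplus> s [^] n' \<otimes> b') (n' + m')"
    using a' b' assms by (simp add: frct_eq_iff_mem)
  then show ?thesis by (rule sym)
qed
  show ?thesis
    using UN_frct[where a = a and b = b and n = n and m = m and h = "\<lambda>a n b m. frct (s [^] m \<otimes> a \<oplus> s [^] n \<otimes> b) (n + m)", OF * assms]
    by (simp add: localization_def)
qed

lemma carrier_L: "carrier L = {frct a n | a n. a \<in> carrier R}"
  and one_L: "\<one>\<^bsub>L\<^esub> = frct \<one> 0" and zero_L: "\<zero>\<^bsub>L\<^esub> = frct \<zero> 0"
  by (simp_all add: localization_def)

lemma frct_closed [simp]: "a \<in> carrier R \<Longrightarrow> frct a n \<in> carrier L"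
  by (auto simp: carrier_L)

text \<open>Each axiom is an identity of numerators. For additive inverses and distributivity the
  two sides come with different denominators, which \<open>frct_eqI\<close> reconciles.\<close>

lemma cring_L: "cring L"
proof (rule cringI)
  show "abelian_group L"
  proof (rule abelian_groupI)
    fix x y assume "x \<in> carrier L" "y \<in> carrier L"
    then show "x \<oplus>\<^bsub>L\<^esub> y \<in> carrier L" by (auto simp: carrier_L add_frct) blast
  next
    show "\<zero>\<^bsub>L\<^esub> \<in> carrier L" by (simp add: zero_L)
  next
    fix x y z assume "x \<in> carrier L" "y \<in> carrier L" "z \<in> carrier L"
    then obtain a b c and i j k :: nat where "a \<in> carrier R" "b \<in> carrier R" "c \<in> carrier R"
        "x = frct a i" "y = frct b j" "z = frct c k"
      by (auto simp: carrier_L)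
    moreover have ac: "r \<otimes> (q \<otimes> a \<oplus> p \<otimes> b) \<oplus> p \<otimes> q \<otimes> c = q \<otimes> r \<otimes> a \<oplus> p \<otimes> (r \<otimes> b \<oplus> q \<otimes> c)"
      if "p \<in> carrier R" "q \<in> carrier R" "r \<in> carrier R" "a \<in> carrier R" "b \<in> carrier R" "c \<in> carrier R"
      for p q r a b c
      using that by algebra
    ultimately show "x \<oplus>\<^bsub>L\<^esub> y \<oplus>\<^bsub>L\<^esub> z = x \<oplus>\<^bsub>L\<^esub> (y \<oplus>\<^bsub>L\<^esub> z)"
      using ac[of "s [^] i" "s [^] j" "s [^] k" a b c]
      by (simp add: add_frct nat_pow_mult[symmetric] add.assoc)
  next
    fix x y assume "x \<in> carrier L" "y \<in> carrier L"
    then obtain a b i j where "a \<in> carrier R" "b \<in> carrier R" "x = frct a i" "y = frct b j"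
      by (auto simp: carrier_L)
    then show "x \<oplus>\<^bsub>L\<^esub> y = y \<oplus>\<^bsub>L\<^esub> x" by (simp add: add_frct a_comm add.commute)
  next
    fix x assume "x \<in> carrier L"
    then obtain a i where x: "a \<in> carrier R" "x = frct a i" by (auto simp: carrier_L)
    then show "\<zero>\<^bsub>L\<^esub> \<oplus>\<^bsub>L\<^esub> x = x" by (simp add: add_frct zero_L)
    have "frct (\<ominus> a) i \<oplus>\<^bsub>L\<^esub> x = \<zero>\<^bsub>L\<^esub>"
      unfolding zero_L using x by (simp add: add_frct) (intro frct_eqI, auto simp: r_distr[symmetric] l_neg)
    then show "\<exists>y\<in>carrier L. y \<oplus>\<^bsub>L\<^esub> x = \<zero>\<^bsub>L\<^esub>" using x by (intro bexI[of _ "frct (\<ominus> a) i"]) auto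
  qed
  show "comm_monoid L"
  proof (rule comm_monoidI)
    fix x y assume "x \<in> carrier L" "y \<in> carrier L"
    then show "x \<otimes>\<^bsub>L\<^esub> y \<in> carrier L" by (auto simp: carrier_L mult_frct) blast
  next
    show "\<one>\<^bsub>L\<^esub> \<in> carrier L" by (simp add: one_L)
  next
    fix x y z assume "x \<in> carrier L" "y \<in> carrier L" "z \<in> carrier L"
    then show "x \<otimes>\<^bsub>L\<^esub> y \<otimes>\<^bsub>L\<^esub> z = x \<otimes>\<^bsub>L\<^esub> (y \<otimes>\<^bsub>L\<^esub> z)"
      by (auto simp: carrier_L mult_frct m_assoc add.assoc)
  next
    fix x assume "x \<in> carrier L"
    then show "\<one>\<^bsub>L\<^esub> \<otimes>\<^bsub>L\<^esub> x = x" by (auto simp: carrier_L mult_frct one_L)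
  next
    fix x y assume "x \<in> carrier L" "y \<in> carrier L"
    then show "x \<otimes>\<^bsub>L\<^esub> y = y \<otimes>\<^bsub>L\<^esub> x" by (auto simp: carrier_L mult_frct m_comm add.commute)
  qed
  fix x y z assume "x \<in> carrier L" "y \<in> carrier L" "z \<in> carrier L"
  then obtain a b c and i j k :: nat where *: "a \<in> carrier R" "b \<in> carrier R" "c \<in> carrier R"
      "x = frct a i" "y = frct b j" "z = frct c k"
    by (auto simp: carrier_L)
  have distr: "p \<otimes> q \<otimes> r \<otimes> (q \<otimes> r \<otimes> (a \<otimes> c) \<oplus> p \<otimes> r \<otimes> (b \<otimes> c)) =
      p \<otimes> r \<otimes> (q \<otimes> r) \<otimes> ((q \<otimes> a \<oplus> p \<otimes> b) \<otimes> c)"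
    if "p \<in> carrier R" "q \<in> carrier R" "r \<in> carrier R" for p q r
    using that *(1-3) by algebra
  show "(x \<oplus>\<^bsub>L\<^esub> y) \<otimes>\<^bsub>L\<^esub> z = x \<otimes>\<^bsub>L\<^esub> z \<oplus>\<^bsub>L\<^esub> y \<otimes>\<^bsub>L\<^esub> z"
    using * distr[of "s [^] i" "s [^] j" "s [^] k"]
    by (simp add: add_frct mult_frct) (rule frct_eqI, simp_all add: nat_pow_mult[symmetric])
qed

lemma frct_pow:
  assumes "a \<in> carrier R"
  shows "frct a 1 [^]\<^bsub>L\<^esub> (n::nat) = frct (a [^] n) n"
  using assms by (induction n) (auto simp: one_L mult_frct)

end

section \<open>Completion along a surjection onto a complete ring\<close>

text \<open>\<open>R\<close> is to carry the topology pulled back from \<open>S\<close> and need not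
  be Hausdorff. Since \<open>\<phi>\<close> is onto and \<open>S\<close> is separated and complete
  for the countable filtration \<open>N\<close>, the completion of \<open>R\<close> is
  \<open>S\<close> itself; the kernel of \<open>\<phi>\<close> disappears into the null
  sequences.\<close>

locale complete_quotient = R: cring R + S: cring S
  for R :: "'r ring" and S :: "('s, 'm) ring_scheme" +
  fixes \<phi> :: "'r \<Rightarrow> 's" and N :: "nat \<Rightarrow> 's set"
  assumes hom: "\<phi> \<in> ring_hom R S" and surj: "\<phi> ` carrier R = carrier S"
    and N_subgroup: "\<And>n. additive_subgroup (N n) S"
    and N_Suc: "\<And>n. N (Suc n) \<subseteq> N n"
    and N_separated: "\<And>x. (\<And>n. x \<in> N n) \<Longrightarrow> x = \<zero>\<^bsub>S\<^esub>"
    and N_mult: "\<And>n x y. \<lbrakk>x \<in> N n; y \<in> N n\<rbrakk> \<Longrightarrow> x \<otimes>\<^bsub>S\<^esub> y \<in> N n"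
    and N_absorb: "\<And>n x. x \<in> carrier S \<Longrightarrow> \<exists>m. \<forall>y\<in>N m. x \<otimes>\<^bsub>S\<^esub> y \<in> N n"
    and N_complete: "\<And>x :: nat \<Rightarrow> 's. \<lbrakk>\<And>k. x k \<in> carrier S; \<And>n. \<exists>M. \<forall>k\<ge>M. \<forall>l\<ge>M. x k \<ominus>\<^bsub>S\<^esub> x l \<in> N n\<rbrakk>
      \<Longrightarrow> \<exists>y\<in>carrier S. \<forall>n. \<exists>M. \<forall>k\<ge>M. x k \<ominus>\<^bsub>S\<^esub> y \<in> N n"
begin

lemma N_antimono: "m \<le> n \<Longrightarrow> N n \<subseteq> N m"
  using N_Suc by (rule lift_Suc_antimono_le)

lemma N_carrier: "x \<in> N n \<Longrightarrow> x \<in> carrier S"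
  using additive_subgroup.a_subset[OF N_subgroup] by blast

lemmas N_add = additive_subgroup.a_closed[OF N_subgroup]
lemmas N_neg = additive_subgroup.a_inv_closed[OF N_subgroup]
lemmas N_zero = additive_subgroup.zero_closed[OF N_subgroup]
lemmas N_minus = S.additive_subgroup_minus[OF N_subgroup]

sublocale \<phi>: ring_hom_ring R S \<phi>
  using hom R.ring_axioms S.ring_axioms by (simp add: ring_hom_ringI2)

definition pre :: "nat \<Rightarrow> 'r set" where "pre n = {x \<in> carrier R. \<phi> x \<in> N n}"

abbreviation "\<tau> \<equiv> subgroup_topology R (range pre)"
abbreviation "CR \<equiv> cauchy_ring R \<tau>"

lemma pre_subgroup: "additive_subgroup (pre n) R"
proof (unfold_locales, goal_cases)
  case 1 then show ?case by (auto simp: pre_def)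
next
  case (2 x y) then show ?case by (auto simp: pre_def N_add)
next
  case 3 then show ?case by (auto simp: pre_def N_zero)
next
  case (4 x)
  then have "inv\<^bsub>add_monoid R\<^esub> x = \<ominus>\<^bsub>R\<^esub> x" by (simp add: a_inv_def)
  then show ?case using 4 by (auto simp: pre_def N_neg)
qed

lemma pre_antimono: "m \<le> n \<Longrightarrow> pre n \<subseteq> pre m"
  using N_antimono by (auto simp: pre_def)

sublocale pre: subgroup_base R "range pre"
proof (intro subgroup_base.intro subgroup_base_axioms.intro R.ring_axioms)
  fix B C assume "B \<in> range pre" "C \<in> range pre"
  then obtain m n where "B = pre m" "C = pre n" by auto
  then show "\<exists>D\<in>range pre. D \<subseteq> B \<inter> C"
    using pre_antimono[of m "max m n"] pre_antimono[of n "max m n"] by auto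
qed (use pre_subgroup in auto)

definition converges :: "(nat \<Rightarrow> 'r) \<Rightarrow> 's \<Rightarrow> bool" where
  "converges x y \<longleftrightarrow> (\<forall>k. x k \<in> carrier R) \<and> y \<in> carrier S \<and> (\<forall>n. \<exists>M. \<forall>k\<ge>M. \<phi> (x k) \<ominus>\<^bsub>S\<^esub> y \<in> N n)"

lemma open_subgroups_pre:
  "open_subgroups R \<tau> = {V. additive_subgroup V R \<and> (\<exists>n. pre n \<subseteq> V)}"
  by (auto simp: pre.open_subgroups_eq)

lemma pre_open: "pre n \<in> open_subgroups R \<tau>"
  using pre_subgroup by (auto simp: open_subgroups_pre)

text \<open>With two indices this covers the Cauchy condition and, for \<open>f\<close> independent
  of the second index, also the condition defining null sequences.\<close>

lemma eventually_open_subgroups_iff: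
  "(\<forall>V\<in>open_subgroups R \<tau>. \<exists>M. \<forall>k\<ge>M. \<forall>l\<ge>M. f k l \<in> V) \<longleftrightarrow> (\<forall>n. \<exists>M. \<forall>k\<ge>M. \<forall>l\<ge>M. f k l \<in> pre n)"
  (is "?A = ?B")
proof
  show "?A \<Longrightarrow> ?B" using pre_open by blast
  show "?A" if B: ?B
  proof
    fix V assume "V \<in> open_subgroups R \<tau>"
    then obtain n where "pre n \<subseteq> V" by (auto simp: open_subgroups_pre)
    with B show "\<exists>M. \<forall>k\<ge>M. \<forall>l\<ge>M. f k l \<in> V" by (meson subsetD)
  qed
qed

text \<open>Completeness of \<open>S\<close> turns Cauchy sequences into sequences whose images
  converge, so that all later arguments take place at limits in \<open>S\<close>.\<close>

lemma carrier_cauchy: "carrier CR = {x. \<exists>y. converges x y}"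
proof -
  have "(\<forall>k. x k \<in> carrier R) \<and> (\<forall>n. \<exists>M. \<forall>k\<ge>M. \<forall>l\<ge>M. x k \<ominus>\<^bsub>R\<^esub> x l \<in> pre n) \<longleftrightarrow> (\<exists>y. converges x y)" for x
  proof (intro iffI; (elim conjE exE)?)
    assume x: "\<forall>k. x k \<in> carrier R" and c: "\<forall>n. \<exists>M. \<forall>k\<ge>M. \<forall>l\<ge>M. x k \<ominus>\<^bsub>R\<^esub> x l \<in> pre n"
    have "\<exists>y\<in>carrier S. \<forall>n. \<exists>M. \<forall>k\<ge>M. \<phi> (x k) \<ominus>\<^bsub>S\<^esub> y \<in> N n"
    proof (rule N_complete)
      fix n
      from c obtain M where "\<forall>k\<ge>M. \<forall>l\<ge>M. x k \<ominus>\<^bsub>R\<^esub> x l \<in> pre n" by blast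
      then have "\<forall>k\<ge>M. \<forall>l\<ge>M. \<phi> (x k) \<ominus>\<^bsub>S\<^esub> \<phi> (x l) \<in> N n"
        using x by (simp add: pre_def ring_iso_minus[OF hom R.ring_axioms S.ring_axioms])
      then show "\<exists>M. \<forall>k\<ge>M. \<forall>l\<ge>M. \<phi> (x k) \<ominus>\<^bsub>S\<^esub> \<phi> (x l) \<in> N n" by blast
    qed (use x in auto)
    then show "\<exists>y. converges x y" using x by (auto simp: converges_def)
  next
    fix y assume y: "converges x y"
    then have x: "\<forall>k. x k \<in> carrier R" by (simp add: converges_def)
    show "(\<forall>k. x k \<in> carrier R) \<and> (\<forall>n. \<exists>M. \<forall>k\<ge>M. \<forall>l\<ge>M. x k \<ominus>\<^bsub>R\<^esub> x l \<in> pre n)"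
    proof (intro conjI x allI)
      fix n
      obtain M where M: "\<forall>k\<ge>M. \<phi> (x k) \<ominus>\<^bsub>S\<^esub> y \<in> N n" using y unfolding converges_def by blast
      show "\<exists>M. \<forall>k\<ge>M. \<forall>l\<ge>M. x k \<ominus>\<^bsub>R\<^esub> x l \<in> pre n"
      proof (intro exI[of _ M] allI impI)
        fix k l assume kl: "k \<ge> M" "l \<ge> M"
        have c: "\<phi> (x k) \<in> carrier S" "\<phi> (x l) \<in> carrier S" "y \<in> carrier S"
          using x y by (auto simp: converges_def)
        have "\<phi> (x k \<ominus>\<^bsub>R\<^esub> x l) = \<phi> (x k) \<ominus>\<^bsub>S\<^esub> \<phi> (x l)"
          using x by (simp add: ring_iso_minus[OF hom R.ring_axioms S.ring_axioms])
        also have "\<dots> = (\<phi> (x k) \<ominus>\<^bsub>S\<^esub> y) \<ominus>\<^bsub>S\<^esub> (\<phi> (x l) \<ominus>\<^bsub>S\<^esub> y)"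
          using c by algebra
        also have "\<dots> \<in> N n" using M kl by (auto intro: N_minus)
        finally show "x k \<ominus>\<^bsub>R\<^esub> x l \<in> pre n" using x by (auto simp: pre_def)
      qed
    qed
  qed
  then show ?thesis
    by (simp add: cauchy_ring_def eventually_open_subgroups_iff)
qed

lemma converges_unique:
  assumes "converges x y" "converges x z"
  shows "y = z"
proof -
  have yz: "y \<in> carrier S" "z \<in> carrier S" using assms by (auto simp: converges_def)
  have "z \<ominus>\<^bsub>S\<^esub> y = \<zero>\<^bsub>S\<^esub>"
  proof (rule N_separated)
    fix n
    obtain M M' where M: "\<forall>k\<ge>M. \<phi> (x k) \<ominus>\<^bsub>S\<^esub> y \<in> N n" "\<forall>k\<ge>M'. \<phi> (x k) \<ominus>\<^bsub>S\<^esub> z \<in> N n"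
      using assms unfolding converges_def by meson
    have c: "\<phi> (x (max M M')) \<in> carrier S" using assms by (auto simp: converges_def)
    have "z \<ominus>\<^bsub>S\<^esub> y = (\<phi> (x (max M M')) \<ominus>\<^bsub>S\<^esub> y) \<ominus>\<^bsub>S\<^esub> (\<phi> (x (max M M')) \<ominus>\<^bsub>S\<^esub> z)"
      using c yz by algebra
    then show "z \<ominus>\<^bsub>S\<^esub> y \<in> N n" using M by (auto intro: N_minus)
  qed
  then show ?thesis using yz by simp
qed

definition limit :: "(nat \<Rightarrow> 'r) \<Rightarrow> 's" where "limit x = (THE y. converges x y)"

lemma limit_eqI: "converges x y \<Longrightarrow> limit x = y"
  unfolding limit_def using converges_unique by blast

lemma converges_limit: "x \<in> carrier CR \<Longrightarrow> converges x (limit x)"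
  using limit_eqI by (auto simp: carrier_cauchy)

lemma converges_const: "r \<in> carrier R \<Longrightarrow> converges (\<lambda>n. r) (\<phi> r)"
  by (auto simp: converges_def S.minus_eq S.r_neg N_zero)

lemma converges_add:
  assumes "converges x y" "converges x' y'"
  shows "converges (\<lambda>n. x n \<oplus>\<^bsub>R\<^esub> x' n) (y \<oplus>\<^bsub>S\<^esub> y')"
  unfolding converges_def
proof (intro conjI allI)
  fix n
  obtain M M' where M: "\<forall>k\<ge>M. \<phi> (x k) \<ominus>\<^bsub>S\<^esub> y \<in> N n" "\<forall>k\<ge>M'. \<phi> (x' k) \<ominus>\<^bsub>S\<^esub> y' \<in> N n"
    using assms unfolding converges_def by meson
  show "\<exists>M. \<forall>k\<ge>M. \<phi> (x k \<oplus>\<^bsub>R\<^esub> x' k) \<ominus>\<^bsub>S\<^esub> (y \<oplus>\<^bsub>S\<^esub> y') \<in> N n"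
  proof (intro exI[of _ "max M M'"] allI impI)
    fix k assume k: "max M M' \<le> k"
    have c: "\<phi> (x k) \<in> carrier S" "\<phi> (x' k) \<in> carrier S" "y \<in> carrier S" "y' \<in> carrier S"
      "x k \<in> carrier R" "x' k \<in> carrier R"
      using assms by (auto simp: converges_def)
    have "\<phi> (x k \<oplus>\<^bsub>R\<^esub> x' k) \<ominus>\<^bsub>S\<^esub> (y \<oplus>\<^bsub>S\<^esub> y') = (\<phi> (x k) \<oplus>\<^bsub>S\<^esub> \<phi> (x' k)) \<ominus>\<^bsub>S\<^esub> (y \<oplus>\<^bsub>S\<^esub> y')"
      using c by simp
    also have "\<dots> = (\<phi> (x k) \<ominus>\<^bsub>S\<^esub> y) \<oplus>\<^bsub>S\<^esub> (\<phi> (x' k) \<ominus>\<^bsub>S\<^esub> y')"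
      using c(1-4) by algebra
    also have "\<dots> \<in> N n" using M k by (auto intro: N_add)
    finally show "\<phi> (x k \<oplus>\<^bsub>R\<^esub> x' k) \<ominus>\<^bsub>S\<^esub> (y \<oplus>\<^bsub>S\<^esub> y') \<in> N n" .
  qed
qed (use assms in \<open>auto simp: converges_def\<close>)

lemma converges_mult:
  assumes "converges x y" "converges x' y'"
  shows "converges (\<lambda>n. x n \<otimes>\<^bsub>R\<^esub> x' n) (y \<otimes>\<^bsub>S\<^esub> y')"
  unfolding converges_def
proof (intro conjI allI)
  fix n
  have y: "y \<in> carrier S" "y' \<in> carrier S" using assms by (auto simp: converges_def)
  obtain p p' where p: "\<forall>z\<in>N p. y \<otimes>\<^bsub>S\<^esub> z \<in> N n" "\<forall>z\<in>N p'. y' \<otimes>\<^bsub>S\<^esub> z \<in> N n"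
    using N_absorb y by meson
  \<comment> \<open>\<open>p\<close> and \<open>p'\<close> absorb the limits \<open>y\<close> and
    \<open>y'\<close>, which need not lie in any \<open>N\<close>; the bound by \<open>n\<close>
    serves the product of the two errors.\<close>
  define q where "q = max n (max p p')"
  have q: "N q \<subseteq> N n" "N q \<subseteq> N p" "N q \<subseteq> N p'" by (auto simp: q_def intro!: N_antimono)
  obtain M M' where M: "\<forall>k\<ge>M. \<phi> (x k) \<ominus>\<^bsub>S\<^esub> y \<in> N q" "\<forall>k\<ge>M'. \<phi> (x' k) \<ominus>\<^bsub>S\<^esub> y' \<in> N q"
    using assms unfolding converges_def by meson
  show "\<exists>M. \<forall>k\<ge>M. \<phi> (x k \<otimes>\<^bsub>R\<^esub> x' k) \<ominus>\<^bsub>S\<^esub> (y \<otimes>\<^bsub>S\<^esub> y') \<in> N n"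
  proof (intro exI[of _ "max M M'"] allI impI)
    fix k assume k: "max M M' \<le> k"
    have c: "\<phi> (x k) \<in> carrier S" "\<phi> (x' k) \<in> carrier S" "x k \<in> carrier R" "x' k \<in> carrier R"
      using assms by (auto simp: converges_def)
    have d: "\<phi> (x k) \<ominus>\<^bsub>S\<^esub> y \<in> N q" "\<phi> (x' k) \<ominus>\<^bsub>S\<^esub> y' \<in> N q" using M k by auto
    have "\<phi> (x k \<otimes>\<^bsub>R\<^esub> x' k) \<ominus>\<^bsub>S\<^esub> (y \<otimes>\<^bsub>S\<^esub> y') = (\<phi> (x k) \<otimes>\<^bsub>S\<^esub> \<phi> (x' k)) \<ominus>\<^bsub>S\<^esub> (y \<otimes>\<^bsub>S\<^esub> y')"
      using c by simp
    also have "\<dots> = y \<otimes>\<^bsub>S\<^esub> (\<phi> (x' k) \<ominus>\<^bsub>S\<^esub> y') \<oplus>\<^bsub>S\<^esub>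
        (y' \<otimes>\<^bsub>S\<^esub> (\<phi> (x k) \<ominus>\<^bsub>S\<^esub> y) \<oplus>\<^bsub>S\<^esub> (\<phi> (x k) \<ominus>\<^bsub>S\<^esub> y) \<otimes>\<^bsub>S\<^esub> (\<phi> (x' k) \<ominus>\<^bsub>S\<^esub> y'))"
      using c(1,2) y by algebra
    also have "\<dots> \<in> N n"
    proof (intro N_add)
      show "y \<otimes>\<^bsub>S\<^esub> (\<phi> (x' k) \<ominus>\<^bsub>S\<^esub> y') \<in> N n" using p(1) q(2) d(2) by blast
      show "y' \<otimes>\<^bsub>S\<^esub> (\<phi> (x k) \<ominus>\<^bsub>S\<^esub> y) \<in> N n" using p(2) q(3) d(1) by blast
      show "(\<phi> (x k) \<ominus>\<^bsub>S\<^esub> y) \<otimes>\<^bsub>S\<^esub> (\<phi> (x' k) \<ominus>\<^bsub>S\<^esub> y') \<in> N n"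
        using N_mult[OF d] q(1) by blast
    qed
    finally show "\<phi> (x k \<otimes>\<^bsub>R\<^esub> x' k) \<ominus>\<^bsub>S\<^esub> (y \<otimes>\<^bsub>S\<^esub> y') \<in> N n" .
  qed
qed (use assms in \<open>auto simp: converges_def\<close>)

lemma cauchy_simps:
  "x \<otimes>\<^bsub>CR\<^esub> y = (\<lambda>n. x n \<otimes>\<^bsub>R\<^esub> y n)" "x \<oplus>\<^bsub>CR\<^esub> y = (\<lambda>n. x n \<oplus>\<^bsub>R\<^esub> y n)"
  "\<one>\<^bsub>CR\<^esub> = (\<lambda>n. \<one>\<^bsub>R\<^esub>)" "\<zero>\<^bsub>CR\<^esub> = (\<lambda>n. \<zero>\<^bsub>R\<^esub>)"
  by (simp_all add: cauchy_ring_def)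

lemma const_cauchy: "r \<in> carrier R \<Longrightarrow> (\<lambda>n. r) \<in> carrier CR"
  using converges_const by (auto simp: carrier_cauchy)

lemma cauchy_closed: "x \<in> carrier CR \<Longrightarrow> x n \<in> carrier R"
  by (auto simp: carrier_cauchy converges_def)

lemma cring_cauchy: "cring CR"
proof (rule cringI)
  have add: "x \<oplus>\<^bsub>CR\<^esub> y \<in> carrier CR" and mult: "x \<otimes>\<^bsub>CR\<^esub> y \<in> carrier CR"
    if "x \<in> carrier CR" "y \<in> carrier CR" for x y
    using that converges_add converges_mult unfolding carrier_cauchy cauchy_simps by blast+
  note pointwise = cauchy_simps cauchy_closed fun_eq_iff
  show "abelian_group CR"
  proof (rule abelian_groupI)
    fix x assume x: "x \<in> carrier CR"
    \<comment> \<open>Multiplication by the constant sequence \<open>- 1\<close> supplies negatives,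
      so closure under products suffices.\<close>
    have "(\<lambda>n. \<ominus>\<^bsub>R\<^esub> \<one>\<^bsub>R\<^esub>) \<otimes>\<^bsub>CR\<^esub> x \<in> carrier CR" using x by (intro mult const_cauchy) auto
    moreover have "(\<lambda>n. \<ominus>\<^bsub>R\<^esub> \<one>\<^bsub>R\<^esub>) \<otimes>\<^bsub>CR\<^esub> x \<oplus>\<^bsub>CR\<^esub> x = \<zero>\<^bsub>CR\<^esub>"
      using x by (simp add: pointwise R.l_minus R.l_neg)
    ultimately show "\<exists>y\<in>carrier CR. y \<oplus>\<^bsub>CR\<^esub> x = \<zero>\<^bsub>CR\<^esub>" by blast
  qed (use add const_cauchy in \<open>auto simp: pointwise R.a_ac\<close>)
  show "comm_monoid CR"
    by (rule comm_monoidI) (use mult const_cauchy in \<open>auto simp: pointwise R.m_ac\<close>)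
qed (auto simp: cauchy_simps cauchy_closed R.l_distr)

lemma limit_hom: "limit \<in> ring_hom CR S"
proof (rule ring_hom_memI)
  fix x assume "x \<in> carrier CR"
  then show "limit x \<in> carrier S" using converges_limit by (auto simp: converges_def)
next
  fix x y assume "x \<in> carrier CR" "y \<in> carrier CR"
  then have "converges x (limit x)" "converges y (limit y)" by (auto intro: converges_limit)
  then show "limit (x \<otimes>\<^bsub>CR\<^esub> y) = limit x \<otimes>\<^bsub>S\<^esub> limit y" "limit (x \<oplus>\<^bsub>CR\<^esub> y) = limit x \<oplus>\<^bsub>S\<^esub> limit y"
    by (auto simp: cauchy_simps intro!: limit_eqI converges_mult converges_add)
next
  show "limit \<one>\<^bsub>CR\<^esub> = \<one>\<^bsub>S\<^esub>"
    using converges_const[of "\<one>\<^bsub>R\<^esub>"] by (auto simp: cauchy_simps intro!: limit_eqI)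
qed

sublocale limit: ring_hom_ring CR S limit
  using limit_hom cring.axioms(1)[OF cring_cauchy] S.ring_axioms by (simp add: ring_hom_ringI2)

lemma limit_surj: "limit ` carrier CR = carrier S"
proof
  show "limit ` carrier CR \<subseteq> carrier S" by auto
  show "carrier S \<subseteq> limit ` carrier CR"
  proof
    fix y assume "y \<in> carrier S"
    \<comment> \<open>As \<open>\<phi>\<close> is onto, constant sequences already reach every
      limit.\<close>
    then obtain r where "r \<in> carrier R" "y = \<phi> r" using surj by auto
    then show "y \<in> limit ` carrier CR"
      using limit_eqI[OF converges_const] const_cauchy by (intro image_eqI[of _ _ "\<lambda>n. r"]) auto
  qed
qed

text \<open>An open subgroup is also closed: as soon as the error lies in \<open>N n\<close>, a term
  and the limit belong to \<open>N n\<close> together.\<close>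

lemma limit_mem_iff:
  assumes "x \<in> carrier CR"
  shows "limit x \<in> N n \<longleftrightarrow> (\<exists>M. \<forall>k\<ge>M. x k \<in> pre n)"
proof -
  have x: "converges x (limit x)" using assms by (rule converges_limit)
  then obtain M where M: "\<forall>k\<ge>M. \<phi> (x k) \<ominus>\<^bsub>S\<^esub> limit x \<in> N n"
    unfolding converges_def by blast
  have c: "limit x \<in> carrier S" "\<phi> (x k) \<in> carrier S" "x k \<in> carrier R" for k
    using x by (auto simp: converges_def)
  have 1: "\<phi> (x k) = (\<phi> (x k) \<ominus>\<^bsub>S\<^esub> limit x) \<oplus>\<^bsub>S\<^esub> limit x"
    and 2: "limit x = \<phi> (x k) \<ominus>\<^bsub>S\<^esub> (\<phi> (x k) \<ominus>\<^bsub>S\<^esub> limit x)" for k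
    using c(1) c(2)[of k] by algebra+
  show ?thesis
  proof
    assume l: "limit x \<in> N n"
    have "x k \<in> pre n" if "k \<ge> M" for k
      using N_add[OF M[rule_format, OF that] l] 1[of k] c by (simp add: pre_def)
    then show "\<exists>M. \<forall>k\<ge>M. x k \<in> pre n" by blast
  next
    assume "\<exists>M. \<forall>k\<ge>M. x k \<in> pre n"
    then obtain M' where M': "\<forall>k\<ge>M'. x k \<in> pre n" by blast
    show "limit x \<in> N n"
      using N_minus[of "\<phi> (x (max M M'))" n "\<phi> (x (max M M')) \<ominus>\<^bsub>S\<^esub> limit x"] M M' 2[of "max M M'"]
      by (simp add: pre_def)
  qed
qed

text \<open>With this the completion is \<open>CR\<close> modulo the kernel of the surjection
  \<open>limit\<close>, and the first isomorphism theorem identifies it with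
  \<open>S\<close>.\<close>

lemma null_seqs_eq: "null_seqs R \<tau> = a_kernel CR S limit"
proof -
  have *: "(\<forall>V\<in>open_subgroups R \<tau>. \<exists>M. \<forall>k\<ge>M. x k \<in> V) \<longleftrightarrow> limit x = \<zero>\<^bsub>S\<^esub>" if x: "x \<in> carrier CR" for x
  proof -
    have "(\<forall>V\<in>open_subgroups R \<tau>. \<exists>M. \<forall>k\<ge>M. x k \<in> V) \<longleftrightarrow> (\<forall>n. \<exists>M. \<forall>k\<ge>M. x k \<in> pre n)"
    proof -
      have "(\<forall>k\<ge>M. \<forall>l\<ge>M. x k \<in> V) \<longleftrightarrow> (\<forall>k\<ge>M. x k \<in> V)" for M :: nat and V by auto
      then show ?thesis using eventually_open_subgroups_iff[of "\<lambda>k l. x k"] by simp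
    qed
    also have "\<dots> \<longleftrightarrow> (\<forall>n. limit x \<in> N n)" using limit_mem_iff[OF x] by simp
    also have "\<dots> \<longleftrightarrow> limit x = \<zero>\<^bsub>S\<^esub>" using N_separated N_zero by auto
    finally show ?thesis .
  qed
  show ?thesis
    unfolding null_seqs_def a_kernel_def' by (intro Collect_cong conj_cong refl *)
qed

text \<open>\<open>limit\<close> is constant on each coset of its kernel, so the image of such a
  coset is a singleton.\<close>

definition completion_iso :: "(nat \<Rightarrow> 'r) set \<Rightarrow> 's" where
  "completion_iso Z = the_elem (limit ` Z)"

lemma completion_eq: "completion R \<tau> = CR Quot a_kernel CR S limit"
  by (simp only: completion_def null_seqs_eq)

lemma completion_iso: "completion_iso \<in> ring_iso (completion R \<tau>) S"
proof -
  have "completion_iso = (\<lambda>Z. the_elem (limit ` Z))"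
    by (rule ext) (simp only: completion_iso_def)
  then show ?thesis
    using limit.FactRing_iso_set[OF limit_surj] by (simp only: completion_eq)
qed

lemma completion_iso_coset:
  assumes "x \<in> carrier CR"
  shows "completion_iso (null_seqs R \<tau> +>\<^bsub>CR\<^esub> x) = limit x"
  unfolding completion_iso_def null_seqs_eq using assms by (rule limit.the_elem_simp)

lemma mem_coset:
  assumes "x \<in> carrier CR"
  shows "z \<in> null_seqs R \<tau> +>\<^bsub>CR\<^esub> x \<longleftrightarrow> z \<in> carrier CR \<and> limit z = limit x"
  unfolding null_seqs_eq limit.rcos_eq_homeq[OF assms] by simp

lemma completion_iso_map: "r \<in> carrier R \<Longrightarrow> completion_iso (completion_map R \<tau> r) = \<phi> r"
  unfolding completion_map_def using completion_iso_coset[OF const_cauchy] limit_eqI[OF converges_const] by simp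

lemma carrier_completion: "carrier (completion R \<tau>) = {null_seqs R \<tau> +>\<^bsub>CR\<^esub> x | x. x \<in> carrier CR}"
  unfolding completion_def FactRing_def A_RCOSETS_def' partial_object.simps by blast

lemma ring_completion: "cring (completion R \<tau>)"
  using ideal.quotient_is_cring[OF limit.kernel_is_ideal cring_cauchy]
  by (simp only: completion_eq)

lemma completion_map_closed: "r \<in> carrier R \<Longrightarrow> completion_map R \<tau> r \<in> carrier (completion R \<tau>)"
  unfolding completion_map_def carrier_completion using const_cauchy by blast

definition completion_nbhd :: "nat \<Rightarrow> (nat \<Rightarrow> 'r) set set" where
  "completion_nbhd n = {Z \<in> carrier (completion R \<tau>). completion_iso Z \<in> N n}"

text \<open>The base of \<open>completion_topology\<close> ranges over all open subgroups. The sets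
  belonging to the \<open>pre n\<close> are cofinal among them and by \<open>limit_mem_iff\<close>
  are the preimages of the \<open>N n\<close>. The comparison is made on translates, so only the
  sets \<open>completion_nbhd n\<close> have to be recognized as subgroups later.\<close>

lemma completion_topology_eq:
  "completion_topology R \<tau> = subgroup_topology (completion R \<tau>) (range completion_nbhd)"
proof -
  define G where "G V = {Z \<in> carrier (completion R \<tau>). \<exists>x\<in>Z. \<exists>M. \<forall>k\<ge>M. x k \<in> V}" for V
  have G: "G (pre n) = completion_nbhd n" for n
  proof -
    have "(\<exists>x\<in>Z. \<exists>M. \<forall>k\<ge>M. x k \<in> pre n) \<longleftrightarrow> completion_iso Z \<in> N n" if Z: "Z \<in> carrier (completion R \<tau>)" for Z
    proof -
          obtain x where x: "x \<in> carrier CR" "Z = null_seqs R \<tau> +>\<^bsub>CR\<^esub> x" using Z unfolding carrier_completion by blast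
      have mem: "z \<in> Z \<longleftrightarrow> z \<in> carrier CR \<and> limit z = limit x" for z
        unfolding x(2) using x(1) by (rule mem_coset)
      have iso: "completion_iso Z = limit x" unfolding x(2) using x(1) by (rule completion_iso_coset)
      show ?thesis
        unfolding iso
      proof
        assume "\<exists>z\<in>Z. \<exists>M. \<forall>k\<ge>M. z k \<in> pre n"
        then obtain z where z: "z \<in> Z" "\<exists>M. \<forall>k\<ge>M. z k \<in> pre n" by blast
        then have "limit z \<in> N n" using limit_mem_iff[of z n] mem by blast
        then show "limit x \<in> N n" using mem z(1) by simp
      next
        assume "limit x \<in> N n"
        then have "\<exists>M. \<forall>k\<ge>M. x k \<in> pre n" using limit_mem_iff[OF x(1)] by blast
        then show "\<exists>z\<in>Z. \<exists>M. \<forall>k\<ge>M. z k \<in> pre n" using mem x(1) by blast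
      qed
    qed
    then show ?thesis unfolding G_def completion_nbhd_def by (intro Collect_cong conj_cong refl)
  qed
  have mono: "G V \<subseteq> G V'" if "V \<subseteq> V'" for V V'
  proof
    fix Z assume "Z \<in> G V"
    then obtain x M where "Z \<in> carrier (completion R \<tau>)" "x \<in> Z" "\<forall>k\<ge>M. x k \<in> V"
      unfolding G_def by blast
    then show "Z \<in> G V'" unfolding G_def using that by blast
  qed
  have coset_mono: "B +>\<^bsub>completion R \<tau>\<^esub> w \<subseteq> C +>\<^bsub>completion R \<tau>\<^esub> w" if "B \<subseteq> C" for B C w
    using that unfolding a_r_coset_def' by blast
  have "(\<exists>B\<in>G ` open_subgroups R \<tau>. B +>\<^bsub>completion R \<tau>\<^esub> w \<subseteq> W) \<longleftrightarrow>
      (\<exists>B\<in>range completion_nbhd. B +>\<^bsub>completion R \<tau>\<^esub> w \<subseteq> W)" for w W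
  proof
    assume "\<exists>B\<in>G ` open_subgroups R \<tau>. B +>\<^bsub>completion R \<tau>\<^esub> w \<subseteq> W"
    then obtain V n where V: "pre n \<subseteq> V" "G V +>\<^bsub>completion R \<tau>\<^esub> w \<subseteq> W"
      unfolding open_subgroups_pre by blast
    then have "completion_nbhd n +>\<^bsub>completion R \<tau>\<^esub> w \<subseteq> W"
      using coset_mono[OF mono[OF V(1)], of w] unfolding G by (rule_tac order_trans)
    then show "\<exists>B\<in>range completion_nbhd. B +>\<^bsub>completion R \<tau>\<^esub> w \<subseteq> W" by blast
  next
    assume "\<exists>B\<in>range completion_nbhd. B +>\<^bsub>completion R \<tau>\<^esub> w \<subseteq> W"
    then obtain n where "completion_nbhd n +>\<^bsub>completion R \<tau>\<^esub> w \<subseteq> W" by blast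
    then show "\<exists>B\<in>G ` open_subgroups R \<tau>. B +>\<^bsub>completion R \<tau>\<^esub> w \<subseteq> W"
      unfolding G[symmetric] using pre_open by blast
  qed
  then have "subgroup_topology (completion R \<tau>) (G ` open_subgroups R \<tau>) =
      subgroup_topology (completion R \<tau>) (range completion_nbhd)"
    by (simp only: subgroup_topology_def)
  moreover have "{{Z \<in> carrier (completion R \<tau>). \<exists>x\<in>Z. \<exists>N. \<forall>n\<ge>N. x n \<in> V} | V. V \<in> open_subgroups R \<tau>}
      = G ` open_subgroups R \<tau>"
    unfolding G_def by blast
  ultimately show ?thesis by (simp only: completion_topology_def)
qed

lemma subgroup_base_N: "subgroup_base S (range N)"
proof (intro subgroup_base.intro subgroup_base_axioms.intro S.ring_axioms, goal_cases)
  case (3 B C)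
  then obtain m n where "B = N m" "C = N n" by auto
  then show ?case
    using N_antimono[of m "max m n"] N_antimono[of n "max m n"] by auto
qed (use N_subgroup in auto)

lemma subgroup_base_completion: "subgroup_base (completion R \<tau>) (range completion_nbhd)"
proof -
  interpret Q: cring "completion R \<tau>" by (rule ring_completion)
  interpret h: ring_hom_ring "completion R \<tau>" S completion_iso
    using completion_iso Q.ring_axioms S.ring_axioms by (auto simp: ring_iso_def intro: ring_hom_ringI2)
  show ?thesis
  proof (intro subgroup_base.intro subgroup_base_axioms.intro Q.ring_axioms, goal_cases)
    case (1 B)
    then obtain n where B: "B = completion_nbhd n" by auto
    show ?case
      unfolding B
    proof (unfold_locales, goal_cases)
      case 1 then show ?case by (auto simp: completion_nbhd_def)
    next
      case (2 x y) then show ?case by (auto simp: completion_nbhd_def N_add)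
    next
      case 3 then show ?case by (auto simp: completion_nbhd_def N_zero)
    next
      case (4 x)
      then have "inv\<^bsub>add_monoid (completion R \<tau>)\<^esub> x = \<ominus>\<^bsub>completion R \<tau>\<^esub> x" by (simp add: a_inv_def)
      then show ?case using 4 by (auto simp: completion_nbhd_def N_neg)
    qed
  next
    case (3 B C)
    then obtain m n where "B = completion_nbhd m" "C = completion_nbhd n" by auto
    moreover have "completion_nbhd (max m n) \<subseteq> completion_nbhd m \<inter> completion_nbhd n"
      using N_antimono[of m "max m n"] N_antimono[of n "max m n"] by (auto simp: completion_nbhd_def)
    ultimately show ?case by auto
  qed auto
qed

lemma completion_homeomorphic:
  "homeomorphic_map (completion_topology R \<tau>) (subgroup_topology S (range N)) completion_iso"
  unfolding completion_topology_eq
proof (rule subgroup_topology_homeomorphic[OF completion_iso subgroup_base_completion subgroup_base_N])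
  have bij: "completion_iso ` carrier (completion R \<tau>) = carrier S"
    using completion_iso by (auto simp: ring_iso_def bij_betw_def)
  have img: "completion_iso ` completion_nbhd n = N n" for n
    using bij N_carrier by (fastforce simp: completion_nbhd_def image_iff set_eq_iff)
  show "\<exists>B\<in>range completion_nbhd. completion_iso ` B \<subseteq> C" if "C \<in> range N" for C
    using that img by blast
  show "\<exists>C\<in>range N. C \<subseteq> completion_iso ` B" if "B \<in> range completion_nbhd" for B
    using that img by blast
qed

end

section \<open>Discretely valued fields\<close>

text \<open>Integer indices extend \<open>val_ideal\<close> to fractional ideals, as is necessary
  for elements of the field that are not integral.\<close>

definition vball :: "'a ring \<Rightarrow> ('a \<Rightarrow> int) \<Rightarrow> int \<Rightarrow> 'a set" where
  "vball K v n = {x \<in> carrier K. x = \<zero>\<^bsub>K\<^esub> \<or> n \<le> v x}"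

lemma val_ideal_eq_vball: "val_ideal K v n = vball K v (int n)"
  by (simp add: val_ideal_def vball_def)

context complete_dvf
begin

sublocale K: field K by (rule is_field)

lemma inv_nonzero:
  assumes "x \<in> carrier K" "x \<noteq> \<zero>\<^bsub>K\<^esub>"
  shows "inv\<^bsub>K\<^esub> x \<in> carrier K" "inv\<^bsub>K\<^esub> x \<otimes>\<^bsub>K\<^esub> x = \<one>\<^bsub>K\<^esub>" "x \<otimes>\<^bsub>K\<^esub> inv\<^bsub>K\<^esub> x = \<one>\<^bsub>K\<^esub>" "inv\<^bsub>K\<^esub> x \<noteq> \<zero>\<^bsub>K\<^esub>"
proof -
  have u: "x \<in> Units K" using assms by (simp add: K.field_Units)
  show c: "inv\<^bsub>K\<^esub> x \<in> carrier K" and l: "inv\<^bsub>K\<^esub> x \<otimes>\<^bsub>K\<^esub> x = \<one>\<^bsub>K\<^esub>" and "x \<otimes>\<^bsub>K\<^esub> inv\<^bsub>K\<^esub> x = \<one>\<^bsub>K\<^esub>"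
    using u by auto
  show "inv\<^bsub>K\<^esub> x \<noteq> \<zero>\<^bsub>K\<^esub>" using l assms(1) by auto
qed

lemma inv_mult_cancel:
  assumes "x \<in> carrier K" "x \<noteq> \<zero>\<^bsub>K\<^esub>" "y \<in> carrier K"
  shows "inv\<^bsub>K\<^esub> x \<otimes>\<^bsub>K\<^esub> (x \<otimes>\<^bsub>K\<^esub> y) = y" "x \<otimes>\<^bsub>K\<^esub> (inv\<^bsub>K\<^esub> x \<otimes>\<^bsub>K\<^esub> y) = y"
  using inv_nonzero[OF assms(1,2)] assms by (simp_all add: K.m_assoc[symmetric])

lemma minus_self: "x \<in> carrier K \<Longrightarrow> x \<ominus>\<^bsub>K\<^esub> x = \<zero>\<^bsub>K\<^esub>"
  by (simp add: K.minus_eq K.r_neg)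

lemma v_one: "v \<one>\<^bsub>K\<^esub> = 0"
  using val_mult[of "\<one>\<^bsub>K\<^esub>" "\<one>\<^bsub>K\<^esub>"] by simp

text \<open>Since \<open>-1\<close> squares to 1, twice its value is zero, and multiplying by it
  does not change values.\<close>

lemma v_neg: "x \<in> carrier K \<Longrightarrow> v (\<ominus>\<^bsub>K\<^esub> x) = v x"
proof (cases "x = \<zero>\<^bsub>K\<^esub>")
  case False
  assume x: "x \<in> carrier K"
  have nz: "\<ominus>\<^bsub>K\<^esub> \<one>\<^bsub>K\<^esub> \<noteq> \<zero>\<^bsub>K\<^esub>"
    using K.minus_minus[OF K.one_closed] by auto
  have "(\<ominus>\<^bsub>K\<^esub> \<one>\<^bsub>K\<^esub>) \<otimes>\<^bsub>K\<^esub> (\<ominus>\<^bsub>K\<^esub> \<one>\<^bsub>K\<^esub>) = \<one>\<^bsub>K\<^esub>" by (simp add: K.l_minus K.r_minus)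
  then have "v (\<ominus>\<^bsub>K\<^esub> \<one>\<^bsub>K\<^esub>) = 0" using val_mult[OF _ _ nz nz] v_one by simp
  moreover have "\<ominus>\<^bsub>K\<^esub> x = (\<ominus>\<^bsub>K\<^esub> \<one>\<^bsub>K\<^esub>) \<otimes>\<^bsub>K\<^esub> x" using x by (simp add: K.l_minus)
  ultimately show ?thesis using val_mult[OF _ x nz False] by simp
qed simp

lemma v_inv:
  assumes "x \<in> carrier K" "x \<noteq> \<zero>\<^bsub>K\<^esub>"
  shows "v (inv\<^bsub>K\<^esub> x) = - v x"
  using val_mult[of x "inv\<^bsub>K\<^esub> x"] inv_nonzero[OF assms] assms v_one by simp

lemma mult_nonzero:
  "\<lbrakk>x \<in> carrier K; y \<in> carrier K; x \<noteq> \<zero>\<^bsub>K\<^esub>; y \<noteq> \<zero>\<^bsub>K\<^esub>\<rbrakk> \<Longrightarrow> x \<otimes>\<^bsub>K\<^esub> y \<noteq> \<zero>\<^bsub>K\<^esub>"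
  by (simp add: K.integral_iff)

lemma v_pow:
  assumes "x \<in> carrier K" "x \<noteq> \<zero>\<^bsub>K\<^esub>"
  shows "x [^]\<^bsub>K\<^esub> (n::nat) \<noteq> \<zero>\<^bsub>K\<^esub>" "v (x [^]\<^bsub>K\<^esub> n) = int n * v x"
proof -
  have "x [^]\<^bsub>K\<^esub> n \<noteq> \<zero>\<^bsub>K\<^esub> \<and> v (x [^]\<^bsub>K\<^esub> n) = int n * v x"
    using assms by (induction n) (auto simp: v_one mult_nonzero val_mult algebra_simps)
  then show "x [^]\<^bsub>K\<^esub> n \<noteq> \<zero>\<^bsub>K\<^esub>" "v (x [^]\<^bsub>K\<^esub> n) = int n * v x" by auto
qed

abbreviation "B n \<equiv> vball K v n"

lemma B_carrier: "x \<in> B n \<Longrightarrow> x \<in> carrier K"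
  by (simp add: vball_def)

lemma B_zero [simp]: "\<zero>\<^bsub>K\<^esub> \<in> B n"
  by (simp add: vball_def)

lemma B_one [simp]: "\<one>\<^bsub>K\<^esub> \<in> B 0"
  by (simp add: vball_def v_one)

lemma B_antimono: "\<lbrakk>m \<le> n; x \<in> B n\<rbrakk> \<Longrightarrow> x \<in> B m"
  by (auto simp: vball_def)

lemma B_add: "\<lbrakk>x \<in> B n; y \<in> B n\<rbrakk> \<Longrightarrow> x \<oplus>\<^bsub>K\<^esub> y \<in> B n"
  using val_add[of x y] by (fastforce simp: vball_def)

lemma B_neg: "x \<in> B n \<Longrightarrow> \<ominus>\<^bsub>K\<^esub> x \<in> B n"
  by (auto simp: vball_def v_neg)

lemma B_minus: "\<lbrakk>x \<in> B n; y \<in> B n\<rbrakk> \<Longrightarrow> x \<ominus>\<^bsub>K\<^esub> y \<in> B n"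
  by (simp add: K.minus_eq B_add B_neg)

lemma B_mult: "\<lbrakk>x \<in> B m; y \<in> B n\<rbrakk> \<Longrightarrow> x \<otimes>\<^bsub>K\<^esub> y \<in> B (m + n)"
  by (cases "x = \<zero>\<^bsub>K\<^esub> \<or> y = \<zero>\<^bsub>K\<^esub>") (auto simp: vball_def val_mult)

lemma B_mult0: "\<lbrakk>x \<in> B 0; y \<in> B n\<rbrakk> \<Longrightarrow> x \<otimes>\<^bsub>K\<^esub> y \<in> B n"
  using B_mult[of x 0 y n] by simp

lemma B_add_cancel:
  assumes "x \<in> carrier K" "y \<in> carrier K" "y \<ominus>\<^bsub>K\<^esub> x \<in> B n"
  shows "y \<in> B n \<longleftrightarrow> x \<in> B n"
proof -
  have "y = (y \<ominus>\<^bsub>K\<^esub> x) \<oplus>\<^bsub>K\<^esub> x" "x = y \<ominus>\<^bsub>K\<^esub> (y \<ominus>\<^bsub>K\<^esub> x)"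
    using assms(1,2) by (simp_all add: K.minus_eq K.minus_add K.a_assoc[symmetric] K.r_neg K.a_assoc K.l_neg)
  then show ?thesis using B_add[OF assms(3)] B_minus[OF _ assms(3)] by metis
qed

lemma B_close: "\<lbrakk>y \<ominus>\<^bsub>K\<^esub> x \<in> B n; x \<in> B n; y \<in> carrier K\<rbrakk> \<Longrightarrow> y \<in> B n"
  using B_add_cancel B_carrier by blast

lemma B_minus_sym:
  assumes "x \<in> carrier K" "y \<in> carrier K" "y \<ominus>\<^bsub>K\<^esub> x \<in> B n"
  shows "x \<ominus>\<^bsub>K\<^esub> y \<in> B n"
proof -
  have "x \<ominus>\<^bsub>K\<^esub> y = \<ominus>\<^bsub>K\<^esub> (y \<ominus>\<^bsub>K\<^esub> x)"
    using assms(1,2) by (simp add: K.minus_eq K.minus_add K.a_comm)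
  then show ?thesis using B_neg[OF assms(3)] by simp
qed

lemma B_minus_trans:
  assumes "x \<in> carrier K" "y \<in> carrier K" "z \<in> carrier K" "x \<ominus>\<^bsub>K\<^esub> y \<in> B n" "y \<ominus>\<^bsub>K\<^esub> z \<in> B n"
  shows "x \<ominus>\<^bsub>K\<^esub> z \<in> B n"
proof -
  have "x \<ominus>\<^bsub>K\<^esub> z = (x \<ominus>\<^bsub>K\<^esub> y) \<oplus>\<^bsub>K\<^esub> (y \<ominus>\<^bsub>K\<^esub> z)"
    using assms(1-3) by (simp add: K.minus_eq K.a_assoc K.r_neg1)
  then show ?thesis using B_add[OF assms(4,5)] by simp
qed

lemma B_mult_iff:
  assumes "w \<in> carrier K" "w \<noteq> \<zero>\<^bsub>K\<^esub>" "x \<in> carrier K"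
  shows "w \<otimes>\<^bsub>K\<^esub> x \<in> B (v w + n) \<longleftrightarrow> x \<in> B n"
  using assms by (auto simp: vball_def val_mult K.integral_iff)

lemma B_separated: "(\<And>n::nat. x \<in> B (int n)) \<Longrightarrow> x = \<zero>\<^bsub>K\<^esub>"
proof (rule ccontr)
  assume *: "\<And>n::nat. x \<in> B (int n)" and "x \<noteq> \<zero>\<^bsub>K\<^esub>"
  then have "int n \<le> v x" for n by (auto simp: vball_def)
  from this[of "nat (v x) + 1"] show False by (cases "0 \<le> v x") auto
qed

lemma B_bound: "x \<in> carrier K \<Longrightarrow> \<exists>m::nat. x \<in> B (- int m)"
  by (intro exI[of _ "nat (- v x)"]) (auto simp: vball_def)

lemma B_subgroup: "additive_subgroup (B n) K"
proof (unfold_locales, goal_cases)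
  case (4 x)
  then have "inv\<^bsub>add_monoid K\<^esub> x = \<ominus>\<^bsub>K\<^esub> x" by (simp add: a_inv_def)
  then show ?case using 4 by (simp add: B_neg)
qed (auto simp: B_add dest: B_carrier)

lemma carrier_val_ring: "carrier (val_ring K v) = B 0"
  by (simp add: val_ring_def val_ideal_eq_vball)

lemma subring_B0: "subring (B 0) K"
  by (rule K.subringI) (auto simp: B_add B_neg B_mult0 dest: B_carrier)

lemma cring_val_ring: "cring (val_ring K v)"
  using K.subcringI'[OF subring_B0] K.subcring_iff[of "B 0"] B_carrier
  by (auto simp: val_ring_def val_ideal_eq_vball)

lemma ideal_val_ring: "ideal (val_ideal K v n) (val_ring K v)"
proof -
  interpret V: cring "val_ring K v" by (rule cring_val_ring)
  have sub: "val_ideal K v n \<subseteq> carrier (val_ring K v)"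
    unfolding carrier_val_ring val_ideal_eq_vball by (auto intro: B_antimono[of 0 "int n"])
  have mult: "x \<otimes>\<^bsub>val_ring K v\<^esub> a = x \<otimes>\<^bsub>K\<^esub> a" and add: "x \<oplus>\<^bsub>val_ring K v\<^esub> a = x \<oplus>\<^bsub>K\<^esub> a"
    and zero: "\<zero>\<^bsub>val_ring K v\<^esub> = \<zero>\<^bsub>K\<^esub>" for x a
    by (simp_all add: val_ring_def)
  have "subgroup (val_ideal K v n) (add_monoid (val_ring K v))"
  proof (rule V.add.subgroupI)
    show "val_ideal K v n \<subseteq> carrier (val_ring K v)" by (rule sub)
    show "val_ideal K v n \<noteq> {}" using B_zero[of "int n"] unfolding val_ideal_eq_vball by blast
  next
    fix a assume a: "a \<in> val_ideal K v n"
    then have "a \<in> carrier K" using B_carrier by (auto simp: val_ideal_eq_vball)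
    then have "\<ominus>\<^bsub>val_ring K v\<^esub> a = \<ominus>\<^bsub>K\<^esub> a"
      using a sub carrier_val_ring
      by (intro V.minus_equality) (auto simp: add zero K.l_neg B_neg dest: B_carrier)
    then show "\<ominus>\<^bsub>val_ring K v\<^esub> a \<in> val_ideal K v n" using a by (simp add: val_ideal_eq_vball B_neg)
  next
    fix a b assume "a \<in> val_ideal K v n" "b \<in> val_ideal K v n"
    then show "a \<oplus>\<^bsub>val_ring K v\<^esub> b \<in> val_ideal K v n" by (simp add: val_ideal_eq_vball B_add add)
  qed
  moreover have "x \<otimes>\<^bsub>K\<^esub> a \<in> val_ideal K v n" if "a \<in> val_ideal K v n" "x \<in> carrier (val_ring K v)" for a x
    using that by (simp add: val_ideal_eq_vball carrier_val_ring B_mult0)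
  ultimately show ?thesis
    by (intro idealI V.ring_axioms) (auto simp: mult V.m_comm[unfolded mult] subsetD[OF sub])
qed

end

lemma (in ring) a_rcos_eq_iff:
  assumes B: "additive_subgroup B R" and xy: "x \<in> carrier R" "y \<in> carrier R"
  shows "B +> x = B +> y \<longleftrightarrow> x \<ominus> y \<in> B"
proof
  assume "B +> x = B +> y"
  moreover have "x \<in> B +> x"
    using mem_a_rcos[OF B xy(1)] xy(1) additive_subgroup.zero_closed[OF B] by (simp add: minus_eq r_neg)
  ultimately show "x \<ominus> y \<in> B" using mem_a_rcos[OF B xy(2)] by simp
next
  assume d: "x \<ominus> y \<in> B"
  have "z \<ominus> x \<in> B \<longleftrightarrow> z \<ominus> y \<in> B" if z: "z \<in> carrier R" for z
  proof -
    have 1: "z \<ominus> y = (z \<ominus> x) \<oplus> (x \<ominus> y)" using z xy by algebra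
    have 2: "z \<ominus> x = (z \<ominus> y) \<ominus> (x \<ominus> y)" using z xy by algebra
    show ?thesis
    proof
      assume "z \<ominus> x \<in> B"
      then show "z \<ominus> y \<in> B" unfolding 1 by (rule additive_subgroup.a_closed[OF B _ d])
    next
      assume "z \<ominus> y \<in> B"
      then show "z \<ominus> x \<in> B" unfolding 2 by (rule additive_subgroup_minus[OF B _ d])
    qed
  qed
  then show "B +> x = B +> y"
    using mem_a_rcos[OF B xy(1)] mem_a_rcos[OF B xy(2)] by blast
qed

section \<open>Approximation between the fields of a family\<close>

context local_field_family
begin

sublocale dv: complete_dvf "fld F i" "vl F i" for i by (rule cdvf)

abbreviation E where "E i \<equiv> fld F i"
abbreviation B where "B i n \<equiv> vball (fld F i) (vl F i) n"
abbreviation u where "u i \<equiv> unif F i"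
abbreviation e where "e k \<equiv> ramif F k"

lemma u_infinity: "u \<infinity> \<in> carrier (E \<infinity>) \<and> u \<infinity> \<noteq> \<zero>\<^bsub>E \<infinity>\<^esub> \<and> vl F \<infinity> (u \<infinity>) = 1"
proof -
  have hom: "lam \<in> ring_hom (E \<infinity>) ring_of_type_algebra" using laurent by (simp add: ring_iso_def)
  have "lam \<zero>\<^bsub>E \<infinity>\<^esub> = \<zero>\<^bsub>ring_of_type_algebra\<^esub>"
    using ring_hom_zero[OF hom dv.K.ring_axioms ring_from_type_algebra] .
  then have "lam \<zero>\<^bsub>E \<infinity>\<^esub> = 0" by (simp add: ring_of_type_algebra_def)
  then have "u \<infinity> \<noteq> \<zero>\<^bsub>E \<infinity>\<^esub>" using unif_infinity by auto
  then show ?thesis using unif_infinity laurent_val[of "u \<infinity>"] by simp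
qed

lemma u_closed [simp]: "u i \<in> carrier (E i)"
  and u_nonzero: "u i \<noteq> \<zero>\<^bsub>E i\<^esub>" and v_u: "vl F i (u i) = 1"
  using u_infinity unif_val by (cases i; auto)+

abbreviation up where "up i n \<equiv> u i [^]\<^bsub>E i\<^esub> (n::nat)"

lemma up_nonzero: "up i n \<noteq> \<zero>\<^bsub>E i\<^esub>" and v_up: "vl F i (up i n) = int n"
  using dv.v_pow[OF u_closed u_nonzero, of i n] v_u by auto

lemma up_B: "up i n \<in> B i (int n)"
  by (simp add: vball_def v_up)

lemma up_mult_B_iff: "x \<in> carrier (E i) \<Longrightarrow> up i m \<otimes>\<^bsub>E i\<^esub> x \<in> B i (int m + n) \<longleftrightarrow> x \<in> B i n"
  using dv.B_mult_iff[OF _ up_nonzero, of i m x n] v_up by simp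

lemma up_add: "up i (m + n) = up i m \<otimes>\<^bsub>E i\<^esub> up i n"
  by (simp add: dv.K.nat_pow_mult)

lemma coset_ints: "pp F i n +>\<^bsub>ints F i\<^esub> x = B i (int n) +>\<^bsub>E i\<^esub> x"
  by (simp add: pp_def ints_def val_ring_def val_ideal_eq_vball a_r_coset_def')

lemma carrier_ints: "carrier (ints F i) = B i 0"
  by (simp add: ints_def dv.carrier_val_ring)

lemma ideal_pp: "ideal (pp F i n) (ints F i)"
  by (simp add: ints_def pp_def dv.ideal_val_ring)

lemma ints_ops: "x \<oplus>\<^bsub>ints F i\<^esub> y = x \<oplus>\<^bsub>E i\<^esub> y" "x \<otimes>\<^bsub>ints F i\<^esub> y = x \<otimes>\<^bsub>E i\<^esub> y" "\<one>\<^bsub>ints F i\<^esub> = \<one>\<^bsub>E i\<^esub>"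
  by (simp_all add: ints_def val_ring_def)

text \<open>By \<open>coset_ints\<close> this is the coset in the valuation ring, hence an element
  of \<open>Q i n\<close> when \<open>x\<close> is integral; forming it in the field makes field
  arithmetic available.\<close>

definition cs :: "enat \<Rightarrow> nat \<Rightarrow> 'a \<Rightarrow> 'a set" where "cs i n x = B i (int n) +>\<^bsub>E i\<^esub> x"

abbreviation Q where "Q i n \<equiv> ints F i Quot pp F i n"

lemma carrier_Q: "carrier (Q i n) = cs i n ` B i 0"
  by (auto simp: FactRing_def A_RCOSETS_def' carrier_ints coset_ints cs_def)

lemma cs_hom: "cs i n \<in> ring_hom (ints F i) (Q i n)"
proof -
  have "(+>\<^bsub>ints F i\<^esub>) (pp F i n) = cs i n" by (simp add: fun_eq_iff coset_ints cs_def)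
  then show ?thesis using ideal.rcos_ring_hom[OF ideal_pp, of i n] by simp
qed

lemma cs_eq_iff:
  "\<lbrakk>x \<in> carrier (E i); y \<in> carrier (E i)\<rbrakk> \<Longrightarrow> cs i n x = cs i n y \<longleftrightarrow> x \<ominus>\<^bsub>E i\<^esub> y \<in> B i (int n)"
  unfolding cs_def by (rule dv.K.a_rcos_eq_iff[OF dv.B_subgroup])

lemma mem_cs: "x \<in> carrier (E i) \<Longrightarrow> y \<in> cs i n x \<longleftrightarrow> y \<in> carrier (E i) \<and> y \<ominus>\<^bsub>E i\<^esub> x \<in> B i (int n)"
  unfolding cs_def by (rule dv.K.mem_a_rcos[OF dv.B_subgroup])

section \<open>The correspondence of integral elements modulo the power \<open>e k\<close>\<close>

abbreviation f where "f k \<equiv> fst (tr_iso F k)"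

lemma f_iso: "f k \<in> ring_iso (Q (enat k) (e k)) (Q \<infinity> (e k))"
  using tr_iso[of k] by (auto simp: deligne_iso_def Tr_def ints_def pp_def split: prod.splits)

text \<open>The fixed isomorphism read on representatives. It is a relation because each side
  determines the other only modulo the power \<open>e k\<close> of the maximal ideal.\<close>

definition rho :: "nat \<Rightarrow> 'a \<Rightarrow> 'a \<Rightarrow> bool" where
  "rho k y x \<longleftrightarrow> y \<in> B (enat k) 0 \<and> x \<in> B \<infinity> 0 \<and> f k (cs (enat k) (e k) y) = cs \<infinity> (e k) x"

lemma f_cs_hom: "f k \<circ> cs (enat k) (e k) \<in> ring_hom (ints F (enat k)) (Q \<infinity> (e k))"
  using ring_hom_trans[OF cs_hom] f_iso[of k] by (auto simp: ring_iso_def)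

lemma rho_carrier: "rho k y x \<Longrightarrow> y \<in> carrier (E (enat k)) \<and> x \<in> carrier (E \<infinity>)"
  by (auto simp: rho_def dest: dv.B_carrier)

lemma rho_add: "\<lbrakk>rho k y x; rho k y' x'\<rbrakk> \<Longrightarrow> rho k (y \<oplus>\<^bsub>E (enat k)\<^esub> y') (x \<oplus>\<^bsub>E \<infinity>\<^esub> x')"
  using ring_hom_add[OF f_cs_hom, of y k y'] ring_hom_add[OF cs_hom, of x \<infinity> x' "e k"]
  by (auto simp: rho_def dv.B_add carrier_ints ints_ops)

lemma rho_mult: "\<lbrakk>rho k y x; rho k y' x'\<rbrakk> \<Longrightarrow> rho k (y \<otimes>\<^bsub>E (enat k)\<^esub> y') (x \<otimes>\<^bsub>E \<infinity>\<^esub> x')"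
  using ring_hom_mult[OF f_cs_hom, of y k y'] ring_hom_mult[OF cs_hom, of x \<infinity> x' "e k"]
  by (auto simp: rho_def dv.B_mult0 carrier_ints ints_ops)

lemma rho_one: "rho k \<one>\<^bsub>E (enat k)\<^esub> \<one>\<^bsub>E \<infinity>\<^esub>"
  using ring_hom_one[OF f_cs_hom, of k] ring_hom_one[OF cs_hom, of \<infinity> "e k"]
  by (auto simp: rho_def ints_ops)

lemma rho_cong:
  "\<lbrakk>rho k y x; x' \<in> B \<infinity> 0; x' \<ominus>\<^bsub>E \<infinity>\<^esub> x \<in> B \<infinity> (int (e k))\<rbrakk> \<Longrightarrow> rho k y x'"
  using cs_eq_iff[of x' \<infinity> x "e k"] by (auto simp: rho_def dest: dv.B_carrier)

text \<open>This is injectivity of the isomorphism on cosets. Uniqueness of partners on either side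
  is the special case in which the other sides coincide.\<close>

lemma rho_eq_iff:
  assumes "rho k y x" "rho k y' x'"
  shows "y \<ominus>\<^bsub>E (enat k)\<^esub> y' \<in> B (enat k) (int (e k)) \<longleftrightarrow> x \<ominus>\<^bsub>E \<infinity>\<^esub> x' \<in> B \<infinity> (int (e k))"
proof -
  have inj: "inj_on (f k) (carrier (Q (enat k) (e k)))"
    using f_iso[of k] by (auto simp: ring_iso_def bij_betw_def)
  have m: "cs (enat k) (e k) y \<in> carrier (Q (enat k) (e k))" "cs (enat k) (e k) y' \<in> carrier (Q (enat k) (e k))"
    using assms by (auto simp: rho_def carrier_Q)
  have "cs (enat k) (e k) y = cs (enat k) (e k) y' \<longleftrightarrow>
      f k (cs (enat k) (e k) y) = f k (cs (enat k) (e k) y')"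
    by (rule inj_on_eq_iff[OF inj m, symmetric])
  also have "\<dots> \<longleftrightarrow> cs \<infinity> (e k) x = cs \<infinity> (e k) x'" using assms by (simp add: rho_def)
  finally show ?thesis
    using rho_carrier[OF assms(1)] rho_carrier[OF assms(2)] by (simp add: cs_eq_iff)
qed

lemma rho_unique_right:
  assumes "rho k y x" "rho k y x'"
  shows "x \<ominus>\<^bsub>E \<infinity>\<^esub> x' \<in> B \<infinity> (int (e k))"
  using rho_eq_iff[OF assms] rho_carrier[OF assms(1)] by (simp add: dv.minus_self)

lemma rho_unique_left:
  assumes "rho k y x" "rho k y' x"
  shows "y \<ominus>\<^bsub>E (enat k)\<^esub> y' \<in> B (enat k) (int (e k))"
  using rho_eq_iff[OF assms] rho_carrier[OF assms(1)] by (simp add: dv.minus_self)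

lemma rho_total: "y \<in> B (enat k) 0 \<Longrightarrow> \<exists>x. rho k y x"
proof -
  assume y: "y \<in> B (enat k) 0"
  have "f k \<in> ring_hom (Q (enat k) (e k)) (Q \<infinity> (e k))" using f_iso[of k] by (simp add: ring_iso_def)
  then have "f k (cs (enat k) (e k) y) \<in> carrier (Q \<infinity> (e k))"
    by (rule ring_hom_closed) (use y in \<open>simp add: carrier_Q\<close>)
  then obtain x where "x \<in> B \<infinity> 0" "f k (cs (enat k) (e k) y) = cs \<infinity> (e k) x"
    unfolding carrier_Q by blast
  then show ?thesis using y unfolding rho_def by blast
qed

lemma rho_surj: "x \<in> B \<infinity> 0 \<Longrightarrow> \<exists>y. rho k y x"
proof -
  assume x: "x \<in> B \<infinity> 0"
  have "f k ` carrier (Q (enat k) (e k)) = carrier (Q \<infinity> (e k))"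
    using f_iso[of k] by (auto simp: ring_iso_def bij_betw_def)
  then have "cs \<infinity> (e k) x \<in> f k ` carrier (Q (enat k) (e k))" using x by (auto simp: carrier_Q)
  then obtain y where "y \<in> B (enat k) 0" "cs \<infinity> (e k) x = f k (cs (enat k) (e k) y)"
    unfolding carrier_Q by blast
  then show ?thesis using x unfolding rho_def by metis
qed

lemma rho_u: "rho k (u (enat k)) (u \<infinity>)"
proof -
  have "u i \<in> B i 0" for i by (simp add: vball_def v_u)
  then show ?thesis
    using unif_tr[of k] by (simp add: rho_def coset_ints cs_def)
qed

lemma rho_up: "rho k (up (enat k) n) (up \<infinity> n)"
  by (induction n) (auto simp: rho_one intro: rho_mult rho_u)

text \<open>A partner \<open>z\<close> of the difference yields the partner \<open>z + x'\<close> of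
  \<open>y\<close>. Partners of \<open>y\<close> agree modulo the power \<open>e k\<close>, so
  \<open>x - x'\<close> may replace \<open>z\<close>.\<close>

lemma rho_minus:
  assumes "rho k y x" "rho k y' x'"
  shows "rho k (y \<ominus>\<^bsub>E (enat k)\<^esub> y') (x \<ominus>\<^bsub>E \<infinity>\<^esub> x')"
proof -
  note c = rho_carrier[OF assms(1)] rho_carrier[OF assms(2)]
  have B0: "y \<ominus>\<^bsub>E (enat k)\<^esub> y' \<in> B (enat k) 0" "x \<ominus>\<^bsub>E \<infinity>\<^esub> x' \<in> B \<infinity> 0"
    using assms by (auto simp: rho_def dv.B_minus)
  obtain z where z: "rho k (y \<ominus>\<^bsub>E (enat k)\<^esub> y') z" using rho_total[OF B0(1)] by blast
  have "y \<ominus>\<^bsub>E (enat k)\<^esub> y' \<oplus>\<^bsub>E (enat k)\<^esub> y' = y" using c by (simp add: dv.K.minus_eq dv.K.a_assoc dv.K.l_neg)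
  then have 1: "rho k y (z \<oplus>\<^bsub>E \<infinity>\<^esub> x')" using rho_add[OF z assms(2)] by simp
  have "x \<ominus>\<^bsub>E \<infinity>\<^esub> x' \<ominus>\<^bsub>E \<infinity>\<^esub> z = x \<ominus>\<^bsub>E \<infinity>\<^esub> (z \<oplus>\<^bsub>E \<infinity>\<^esub> x')"
    using c rho_carrier[OF z] by (simp add: dv.K.minus_eq dv.K.minus_add dv.K.a_ac)
  moreover have "x \<ominus>\<^bsub>E \<infinity>\<^esub> (z \<oplus>\<^bsub>E \<infinity>\<^esub> x') \<in> B \<infinity> (int (e k))"
    by (rule rho_unique_right[OF assms(1) 1])
  ultimately show ?thesis using rho_cong[OF z B0(2)] by simp
qed

text \<open>The uniformizers correspond, so divisibility by their \<open>m\<close>-th powers is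
  transferred: write one side as that power times an integral element, take a partner of the second
  factor, and use uniqueness of partners modulo the power \<open>e k\<close>, which is finer than
  modulo the power \<open>m\<close>.\<close>

lemma rho_B_aux:
  assumes "int m \<le> int (e k)" "rho k y x"
  shows "y \<in> B (enat k) (int m) \<longleftrightarrow> x \<in> B \<infinity> (int m)"
proof
  note c = rho_carrier[OF assms(2)]
  note cancel = dv.inv_mult_cancel(2)[OF _ up_nonzero, simplified]
  have inv: "inv\<^bsub>E i\<^esub> (up i m) \<in> carrier (E i)" for i by (simp add: dv.inv_nonzero up_nonzero)
  {
    assume y: "y \<in> B (enat k) (int m)"
    define z where "z = inv\<^bsub>E (enat k)\<^esub> (up (enat k) m) \<otimes>\<^bsub>E (enat k)\<^esub> y"
    have z: "up (enat k) m \<otimes>\<^bsub>E (enat k)\<^esub> z = y" "z \<in> carrier (E (enat k))" using cancel c inv by (auto simp: z_def)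
    then have "z \<in> B (enat k) 0" using up_mult_B_iff[of z "enat k" m 0] y by simp
    then obtain z' where z': "rho k z z'" using rho_total by blast
    then have "rho k y (up \<infinity> m \<otimes>\<^bsub>E \<infinity>\<^esub> z')" using rho_mult[OF rho_up[of k m] z'] z by simp
    then have "x \<ominus>\<^bsub>E \<infinity>\<^esub> (up \<infinity> m \<otimes>\<^bsub>E \<infinity>\<^esub> z') \<in> B \<infinity> (int (e k))"
      by (rule rho_unique_right[OF assms(2)])
    then have "x \<ominus>\<^bsub>E \<infinity>\<^esub> (up \<infinity> m \<otimes>\<^bsub>E \<infinity>\<^esub> z') \<in> B \<infinity> (int m)" using assms(1) by (rule dv.B_antimono[rotated])
    moreover have "up \<infinity> m \<otimes>\<^bsub>E \<infinity>\<^esub> z' \<in> B \<infinity> (int m)"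
      using up_mult_B_iff[of z' \<infinity> m 0] z' rho_carrier[OF z'] by (simp add: rho_def)
    ultimately show "x \<in> B \<infinity> (int m)" by (rule dv.B_close) (use c in simp)
  }
  {
    assume x: "x \<in> B \<infinity> (int m)"
    define z where "z = inv\<^bsub>E \<infinity>\<^esub> (up \<infinity> m) \<otimes>\<^bsub>E \<infinity>\<^esub> x"
    have z: "up \<infinity> m \<otimes>\<^bsub>E \<infinity>\<^esub> z = x" "z \<in> carrier (E \<infinity>)" using cancel c inv by (auto simp: z_def)
    then have "z \<in> B \<infinity> 0" using up_mult_B_iff[of z \<infinity> m 0] x by simp
    then obtain z' where z': "rho k z' z" using rho_surj by blast
    then have "rho k (up (enat k) m \<otimes>\<^bsub>E (enat k)\<^esub> z') x" using rho_mult[OF rho_up[of k m] z'] z by simp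
    then have "y \<ominus>\<^bsub>E (enat k)\<^esub> (up (enat k) m \<otimes>\<^bsub>E (enat k)\<^esub> z') \<in> B (enat k) (int (e k))"
      by (rule rho_unique_left[OF assms(2)])
    then have "y \<ominus>\<^bsub>E (enat k)\<^esub> (up (enat k) m \<otimes>\<^bsub>E (enat k)\<^esub> z') \<in> B (enat k) (int m)" using assms(1) by (rule dv.B_antimono[rotated])
    moreover have "up (enat k) m \<otimes>\<^bsub>E (enat k)\<^esub> z' \<in> B (enat k) (int m)"
      using up_mult_B_iff[of z' "enat k" m 0] z' rho_carrier[OF z'] by (simp add: rho_def)
    ultimately show "y \<in> B (enat k) (int m)" by (rule dv.B_close) (use c in simp)
  }
qed

lemma rho_B: "\<lbrakk>n \<le> int (e k); rho k y x\<rbrakk> \<Longrightarrow> y \<in> B (enat k) n \<longleftrightarrow> x \<in> B \<infinity> n"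
proof (cases "0 \<le> n")
  case True
  assume "n \<le> int (e k)" "rho k y x"
  then show ?thesis using rho_B_aux[of "nat n" k y x] True by simp
next
  case False
  assume "n \<le> int (e k)" "rho k y x"
  \<comment> \<open>A ball of negative index contains all integral elements.\<close>
  then show ?thesis using False dv.B_antimono[of n 0] by (auto simp: rho_def)
qed

text \<open>
  \<open>apx n k y x\<close> says that the classes of \<open>y\<close> and \<open>x\<close> modulo the \<open>n\<close>-th powers of the maximal ideals
  correspond under the fixed isomorphism.
\<close>

definition apx :: "nat \<Rightarrow> nat \<Rightarrow> 'a \<Rightarrow> 'a \<Rightarrow> bool" where
  "apx n k y x \<longleftrightarrow> n \<le> e k \<and> x \<in> B \<infinity> 0 \<and> (\<exists>x'. rho k y x' \<and> x' \<ominus>\<^bsub>E \<infinity>\<^esub> x \<in> B \<infinity> (int n))"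

lemma rho_apx: "\<lbrakk>rho k y x; n \<le> e k\<rbrakk> \<Longrightarrow> apx n k y x"
  using rho_carrier[of k y x] by (auto simp: apx_def rho_def dv.K.r_neg dv.K.minus_eq intro!: exI[of _ x])

lemma apx_carrier: "apx n k y x \<Longrightarrow> y \<in> B (enat k) 0 \<and> x \<in> B \<infinity> 0 \<and> y \<in> carrier (E (enat k)) \<and> x \<in> carrier (E \<infinity>)"
  by (auto simp: apx_def rho_def dest: dv.B_carrier)

lemma apx_le: "\<lbrakk>apx n k y x; m \<le> n\<rbrakk> \<Longrightarrow> apx m k y x"
  unfolding apx_def by (meson dv.B_antimono le_trans of_nat_mono)

lemma apx_add:
  assumes "apx n k y x" "apx n k y' x'"
  shows "apx n k (y \<oplus>\<^bsub>E (enat k)\<^esub> y') (x \<oplus>\<^bsub>E \<infinity>\<^esub> x')"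
proof -
  from assms obtain z z' where z: "rho k y z" "z \<ominus>\<^bsub>E \<infinity>\<^esub> x \<in> B \<infinity> (int n)" "rho k y' z'" "z' \<ominus>\<^bsub>E \<infinity>\<^esub> x' \<in> B \<infinity> (int n)"
    by (auto simp: apx_def)
  have c: "x \<in> carrier (E \<infinity>)" "x' \<in> carrier (E \<infinity>)" "z \<in> carrier (E \<infinity>)" "z' \<in> carrier (E \<infinity>)"
    using assms z by (auto dest: apx_carrier rho_carrier)
  have "(z \<oplus>\<^bsub>E \<infinity>\<^esub> z') \<ominus>\<^bsub>E \<infinity>\<^esub> (x \<oplus>\<^bsub>E \<infinity>\<^esub> x') = (z \<ominus>\<^bsub>E \<infinity>\<^esub> x) \<oplus>\<^bsub>E \<infinity>\<^esub> (z' \<ominus>\<^bsub>E \<infinity>\<^esub> x')"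
    using c by (simp add: dv.K.minus_eq dv.K.minus_add dv.K.a_ac)
  then show ?thesis
    using assms rho_add[OF z(1,3)] dv.B_add[OF z(2,4)] unfolding apx_def by (auto simp: dv.B_add)
qed

lemma apx_minus:
  assumes "apx n k y x" "apx n k y' x'"
  shows "apx n k (y \<ominus>\<^bsub>E (enat k)\<^esub> y') (x \<ominus>\<^bsub>E \<infinity>\<^esub> x')"
proof -
  from assms obtain z z' where z: "rho k y z" "z \<ominus>\<^bsub>E \<infinity>\<^esub> x \<in> B \<infinity> (int n)" "rho k y' z'" "z' \<ominus>\<^bsub>E \<infinity>\<^esub> x' \<in> B \<infinity> (int n)"
    by (auto simp: apx_def)
  have c: "x \<in> carrier (E \<infinity>)" "x' \<in> carrier (E \<infinity>)" "z \<in> carrier (E \<infinity>)" "z' \<in> carrier (E \<infinity>)"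
    using assms z by (auto dest: apx_carrier rho_carrier)
  have "(z \<ominus>\<^bsub>E \<infinity>\<^esub> z') \<ominus>\<^bsub>E \<infinity>\<^esub> (x \<ominus>\<^bsub>E \<infinity>\<^esub> x') = (z \<ominus>\<^bsub>E \<infinity>\<^esub> x) \<ominus>\<^bsub>E \<infinity>\<^esub> (z' \<ominus>\<^bsub>E \<infinity>\<^esub> x')"
    using c by (simp add: dv.K.minus_eq dv.K.minus_add dv.K.a_ac)
  then show ?thesis
    using assms rho_minus[OF z(1,3)] dv.B_minus[OF z(2,4)] unfolding apx_def by (auto simp: dv.B_minus)
qed

lemma apx_mult:
  assumes "apx n k y x" "apx n k y' x'"
  shows "apx n k (y \<otimes>\<^bsub>E (enat k)\<^esub> y') (x \<otimes>\<^bsub>E \<infinity>\<^esub> x')"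
proof -
  from assms obtain z z' where z: "rho k y z" "z \<ominus>\<^bsub>E \<infinity>\<^esub> x \<in> B \<infinity> (int n)" "rho k y' z'" "z' \<ominus>\<^bsub>E \<infinity>\<^esub> x' \<in> B \<infinity> (int n)"
    by (auto simp: apx_def)
  have c: "x \<in> carrier (E \<infinity>)" "x' \<in> carrier (E \<infinity>)" "z \<in> carrier (E \<infinity>)" "z' \<in> carrier (E \<infinity>)"
    using assms z by (auto dest: apx_carrier rho_carrier)
  have "(z \<otimes>\<^bsub>E \<infinity>\<^esub> z') \<ominus>\<^bsub>E \<infinity>\<^esub> (x \<otimes>\<^bsub>E \<infinity>\<^esub> x') =
      z \<otimes>\<^bsub>E \<infinity>\<^esub> (z' \<ominus>\<^bsub>E \<infinity>\<^esub> x') \<oplus>\<^bsub>E \<infinity>\<^esub> x' \<otimes>\<^bsub>E \<infinity>\<^esub> (z \<ominus>\<^bsub>E \<infinity>\<^esub> x)"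
    using c by (simp add: dv.K.minus_eq dv.K.r_distr dv.K.r_minus dv.K.a_assoc dv.K.m_comm dv.K.r_neg1 dv.K.r_neg2)
  moreover have "z \<otimes>\<^bsub>E \<infinity>\<^esub> (z' \<ominus>\<^bsub>E \<infinity>\<^esub> x') \<oplus>\<^bsub>E \<infinity>\<^esub> x' \<otimes>\<^bsub>E \<infinity>\<^esub> (z \<ominus>\<^bsub>E \<infinity>\<^esub> x) \<in> B \<infinity> (int n)"
    using assms z by (intro dv.B_add dv.B_mult0) (auto simp: rho_def apx_def)
  ultimately show ?thesis
    using assms rho_mult[OF z(1,3)] unfolding apx_def by (auto simp: dv.B_mult0)
qed

lemma apx_up: "n \<le> e k \<Longrightarrow> apx n k (up (enat k) d) (up \<infinity> d)"
  using rho_apx rho_up by blast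

lemma apx_up_mult: "apx n k y x \<Longrightarrow> apx n k (up (enat k) d \<otimes>\<^bsub>E (enat k)\<^esub> y) (up \<infinity> d \<otimes>\<^bsub>E \<infinity>\<^esub> x)"
  by (rule apx_mult[OF apx_up]) (auto simp: apx_def)

lemma apx_ex: "\<lbrakk>n \<le> e k; x \<in> B \<infinity> 0\<rbrakk> \<Longrightarrow> \<exists>y. apx n k y x"
  using rho_surj rho_apx by blast

text \<open>Obtained as 1 minus 1, since \<open>rho\<close> is known at 1 and \<open>apx\<close>
  respects differences.\<close>

lemma apx_zero: "n \<le> e k \<Longrightarrow> apx n k \<zero>\<^bsub>E (enat k)\<^esub> \<zero>\<^bsub>E \<infinity>\<^esub>"
proof -
  assume "n \<le> e k"
  then have "apx n k (\<one>\<^bsub>E (enat k)\<^esub> \<ominus>\<^bsub>E (enat k)\<^esub> \<one>\<^bsub>E (enat k)\<^esub>) (\<one>\<^bsub>E \<infinity>\<^esub> \<ominus>\<^bsub>E \<infinity>\<^esub> \<one>\<^bsub>E \<infinity>\<^esub>)"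
    by (intro apx_minus rho_apx rho_one)
  then show ?thesis by (simp add: dv.K.minus_eq dv.K.r_neg)
qed

lemma apx_B:
  assumes "apx n k y x" "m \<le> int n"
  shows "y \<in> B (enat k) m \<longleftrightarrow> x \<in> B \<infinity> m"
proof -
  from assms obtain z where z: "rho k y z" "z \<ominus>\<^bsub>E \<infinity>\<^esub> x \<in> B \<infinity> (int n)" "n \<le> e k" by (auto simp: apx_def)
  have "z \<in> B \<infinity> m \<longleftrightarrow> x \<in> B \<infinity> m"
    using dv.B_add_cancel[of x \<infinity> z m] dv.B_antimono[OF assms(2) z(2)] rho_carrier[OF z(1)] apx_carrier[OF assms(1)] by auto
  then show ?thesis using rho_B[OF _ z(1), of m] assms(2) z(3) by simp
qed

text \<open>The change of \<open>y\<close> lies in the \<open>n\<close>-th power, hence by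
  \<open>rho_B\<close> so does a partner \<open>d\<close> of it, and adding \<open>d\<close> leaves
  the class of \<open>x\<close> unchanged.\<close>

lemma apx_close_left:
  assumes "apx n k y x" "y' \<in> carrier (E (enat k))" "y' \<ominus>\<^bsub>E (enat k)\<^esub> y \<in> B (enat k) (int n)"
  shows "apx n k y' x"
proof -
  have n: "n \<le> e k" using assms by (auto simp: apx_def)
  note c = apx_carrier[OF assms(1)]
  have "y' \<ominus>\<^bsub>E (enat k)\<^esub> y \<in> B (enat k) 0" using dv.B_antimono[OF _ assms(3), of 0] by simp
  then obtain d where d: "rho k (y' \<ominus>\<^bsub>E (enat k)\<^esub> y) d" using rho_total by blast
  have d': "d \<in> B \<infinity> (int n)" using rho_B[OF _ d, of "int n"] assms(3) n by simp
  then have dc: "d \<in> carrier (E \<infinity>)" by (rule dv.B_carrier)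
  have "apx n k (y \<oplus>\<^bsub>E (enat k)\<^esub> (y' \<ominus>\<^bsub>E (enat k)\<^esub> y)) (x \<oplus>\<^bsub>E \<infinity>\<^esub> d)"
    by (rule apx_add[OF assms(1) rho_apx[OF d n]])
  moreover have "y \<oplus>\<^bsub>E (enat k)\<^esub> (y' \<ominus>\<^bsub>E (enat k)\<^esub> y) = y'"
    using c assms(2) by (simp add: dv.K.minus_eq dv.K.a_comm dv.K.a_assoc[symmetric] dv.K.r_neg)
  ultimately obtain z where z: "rho k y' z" "z \<ominus>\<^bsub>E \<infinity>\<^esub> (x \<oplus>\<^bsub>E \<infinity>\<^esub> d) \<in> B \<infinity> (int n)" by (auto simp: apx_def)
  have "z \<ominus>\<^bsub>E \<infinity>\<^esub> x = (z \<ominus>\<^bsub>E \<infinity>\<^esub> (x \<oplus>\<^bsub>E \<infinity>\<^esub> d)) \<oplus>\<^bsub>E \<infinity>\<^esub> d"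
    using c dc rho_carrier[OF z(1)] by (simp add: dv.K.minus_eq dv.K.minus_add dv.K.a_assoc dv.K.l_neg)
  then show ?thesis using z d' n c dv.B_add by (auto simp: apx_def)
qed

lemma apx_close_right:
  assumes "apx n k y x" "x' \<in> carrier (E \<infinity>)" "x' \<ominus>\<^bsub>E \<infinity>\<^esub> x \<in> B \<infinity> (int n)"
  shows "apx n k y x'"
proof -
  note c = apx_carrier[OF assms(1)]
  from assms(1) obtain z where z: "rho k y z" "z \<ominus>\<^bsub>E \<infinity>\<^esub> x \<in> B \<infinity> (int n)" by (auto simp: apx_def)
  have "x \<ominus>\<^bsub>E \<infinity>\<^esub> x' \<in> B \<infinity> (int n)" using dv.B_minus_sym assms c by blast
  then have "z \<ominus>\<^bsub>E \<infinity>\<^esub> x' \<in> B \<infinity> (int n)"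
    using dv.B_minus_trans z(2) c assms(2) rho_carrier[OF z(1)] by blast
  moreover have "x' \<in> B \<infinity> 0"
    using dv.B_add_cancel[of x \<infinity> x' 0] dv.B_antimono[OF _ assms(3), of 0] c assms(2) by auto
  ultimately show ?thesis using z(1) assms(1) by (auto simp: apx_def)
qed

lemma apx_unique_left:
  assumes "apx n k y x" "apx n k y' x"
  shows "y \<ominus>\<^bsub>E (enat k)\<^esub> y' \<in> B (enat k) (int n)"
proof -
  have "apx n k (y \<ominus>\<^bsub>E (enat k)\<^esub> y') (x \<ominus>\<^bsub>E \<infinity>\<^esub> x)" by (rule apx_minus[OF assms])
  from apx_B[OF this, of "int n"] show ?thesis using apx_carrier[OF assms(1)] by (simp add: dv.minus_self)
qed

lemma apx_unique_right:
  assumes "apx n k y x" "apx n k y x'"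
  shows "x \<ominus>\<^bsub>E \<infinity>\<^esub> x' \<in> B \<infinity> (int n)"
proof -
  have "apx n k (y \<ominus>\<^bsub>E (enat k)\<^esub> y) (x \<ominus>\<^bsub>E \<infinity>\<^esub> x')" by (rule apx_minus[OF assms])
  from apx_B[OF this, of "int n"] show ?thesis using apx_carrier[OF assms(1)] by (simp add: dv.minus_self)
qed

text \<open>Division by the \<open>d\<close>-th power of the uniformizer costs \<open>d\<close>
  digits of precision. The quotient \<open>y\<close> is compared with an actual lift
  \<open>z\<close> of \<open>x\<close>: both become close after multiplication by the power, so they
  are close with \<open>d\<close> digits less.\<close>

lemma apx_divide:
  assumes "apx (n + d) k (up (enat k) d \<otimes>\<^bsub>E (enat k)\<^esub> y) (up \<infinity> d \<otimes>\<^bsub>E \<infinity>\<^esub> x)" "x \<in> B \<infinity> 0" "y \<in> carrier (E (enat k))"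
  shows "apx n k y x"
proof -
  have "n + d \<le> e k" using assms by (auto simp: apx_def)
  then obtain z where z: "apx (n + d) k z x" using apx_ex[OF _ assms(2)] by blast
  note c = apx_carrier[OF z]
  have "up (enat k) d \<otimes>\<^bsub>E (enat k)\<^esub> y \<ominus>\<^bsub>E (enat k)\<^esub> up (enat k) d \<otimes>\<^bsub>E (enat k)\<^esub> z \<in> B (enat k) (int (n + d))"
    by (rule apx_unique_left[OF assms(1) apx_up_mult[OF z]])
  moreover have "up (enat k) d \<otimes>\<^bsub>E (enat k)\<^esub> y \<ominus>\<^bsub>E (enat k)\<^esub> up (enat k) d \<otimes>\<^bsub>E (enat k)\<^esub> z =
      up (enat k) d \<otimes>\<^bsub>E (enat k)\<^esub> (y \<ominus>\<^bsub>E (enat k)\<^esub> z)"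
    using c assms(3) by (simp add: dv.K.minus_eq dv.K.r_distr dv.K.r_minus)
  ultimately have "y \<ominus>\<^bsub>E (enat k)\<^esub> z \<in> B (enat k) (int n)"
    using up_mult_B_iff[of "y \<ominus>\<^bsub>E (enat k)\<^esub> z" "enat k" d "int n"] c assms(3) by (simp add: add.commute)
  then show ?thesis using apx_close_left[OF apx_le[OF z]] assms(3) by simp
qed

text \<open>The cosets modulo the power \<open>e k\<close> inside one coset modulo the
  \<open>n\<close>-th power are mapped onto those inside the corresponding coset, because
  \<open>rho\<close> preserves membership in the \<open>n\<close>-th powers for \<open>n\<close> up
  to \<open>e k\<close>.\<close>

lemma trunc_iso_rho:
  assumes r: "rho k y x" and n: "n \<le> e k"
  shows "trunc_iso F n (enat k) (cs (enat k) n y) = cs \<infinity> n x"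
proof -
  note c = rho_carrier[OF r]
  have "\<Union> (f k ` {Y \<in> carrier (Q (enat k) (e k)). Y \<subseteq> cs (enat k) n y}) = cs \<infinity> n x"
  proof (intro subset_antisym subsetI)
    fix z assume "z \<in> \<Union> (f k ` {Y \<in> carrier (Q (enat k) (e k)). Y \<subseteq> cs (enat k) n y})"
    then obtain Y where Y: "Y \<in> carrier (Q (enat k) (e k))" "Y \<subseteq> cs (enat k) n y" "z \<in> f k Y" by auto
    then obtain y' where y': "y' \<in> B (enat k) 0" "Y = cs (enat k) (e k) y'" by (auto simp: carrier_Q)
    obtain x' where x': "rho k y' x'" using rho_total[OF y'(1)] by blast
    note c' = rho_carrier[OF x']
    have "y' \<in> Y" using c' y'(2) by (simp add: mem_cs dv.K.minus_eq dv.K.r_neg)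
    then have "y' \<ominus>\<^bsub>E (enat k)\<^esub> y \<in> B (enat k) (int n)" using Y(2) c by (auto simp: mem_cs)
    then have 1: "x' \<ominus>\<^bsub>E \<infinity>\<^esub> x \<in> B \<infinity> (int n)"
      using rho_B[OF _ rho_minus[OF x' r], of "int n"] n by simp
    have "z \<in> cs \<infinity> (e k) x'" using Y(3) y'(2) x' by (simp add: rho_def)
    then have z: "z \<in> carrier (E \<infinity>)" "z \<ominus>\<^bsub>E \<infinity>\<^esub> x' \<in> B \<infinity> (int n)"
      using c' n dv.B_antimono[of "int n" "int (e k)"] by (auto simp: mem_cs)
    then show "z \<in> cs \<infinity> n x" using dv.B_minus_trans[OF z(1) _ _ z(2) 1] c c' by (simp add: mem_cs)
  next
    fix z assume z: "z \<in> cs \<infinity> n x"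
    then have zc: "z \<in> carrier (E \<infinity>)" "z \<ominus>\<^bsub>E \<infinity>\<^esub> x \<in> B \<infinity> (int n)" using c by (auto simp: mem_cs)
    then have "z \<in> B \<infinity> 0"
      using dv.B_add_cancel[of x \<infinity> z 0] dv.B_antimono[OF _ zc(2), of 0] c r by (auto simp: rho_def)
    then obtain y' where y': "rho k y' z" using rho_surj by blast
    note c' = rho_carrier[OF y']
    have 1: "y' \<ominus>\<^bsub>E (enat k)\<^esub> y \<in> B (enat k) (int n)"
      using rho_B[OF _ rho_minus[OF y' r], of "int n"] n zc by simp
    have "cs (enat k) (e k) y' \<subseteq> cs (enat k) n y"
    proof
      fix w assume "w \<in> cs (enat k) (e k) y'"
      then have w: "w \<in> carrier (E (enat k))" "w \<ominus>\<^bsub>E (enat k)\<^esub> y' \<in> B (enat k) (int n)"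
        using c' n dv.B_antimono[of "int n" "int (e k)"] by (auto simp: mem_cs)
      then show "w \<in> cs (enat k) n y" using dv.B_minus_trans[OF w(1) _ _ w(2) 1] c c' by (simp add: mem_cs)
    qed
    moreover have "cs (enat k) (e k) y' \<in> carrier (Q (enat k) (e k))" using y' by (auto simp: carrier_Q rho_def)
    moreover have "z \<in> f k (cs (enat k) (e k) y')"
      using y' c' by (simp add: rho_def mem_cs dv.K.minus_eq dv.K.r_neg)
    ultimately show "z \<in> \<Union> (f k ` {Y \<in> carrier (Q (enat k) (e k)). Y \<subseteq> cs (enat k) n y})" by blast
  qed
  then show ?thesis by (simp add: trunc_iso_def)
qed

text \<open>The link between the topology, which is defined through \<open>trunc_iso\<close>, and
  arithmetic with \<open>apx\<close>.\<close>

lemma apx_iff_trunc_iso: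
  assumes "y \<in> B (enat k) 0" "x \<in> B \<infinity> 0" "n \<le> e k"
  shows "apx n k y x \<longleftrightarrow> trunc_iso F n (enat k) (cs (enat k) n y) = cs \<infinity> n x"
proof -
  obtain z where z: "rho k y z" using rho_total[OF assms(1)] by blast
  have c: "z \<in> carrier (E \<infinity>)" "x \<in> carrier (E \<infinity>)" using rho_carrier[OF z] assms(2) by (auto dest: dv.B_carrier)
  have "apx n k y x \<longleftrightarrow> z \<ominus>\<^bsub>E \<infinity>\<^esub> x \<in> B \<infinity> (int n)"
    using apx_unique_right[OF rho_apx[OF z assms(3)], of x] z assms by (auto simp: apx_def)
  then show ?thesis using trunc_iso_rho[OF z assms(3)] cs_eq_iff[OF c] by simp
qed

end

section \<open>The total spaces\<close>

text \<open>Finite points are isolated and final segments form a base at \<open>\<infinity>\<close>.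
  All later continuity arguments use the index space in this form.\<close>

lemma open_enat_iff_eventually:
  "open A \<longleftrightarrow> (\<infinity> \<in> A \<longrightarrow> (\<forall>\<^sub>F k in sequentially. enat k \<in> A))"
proof -
  have "(\<exists>n::nat. {enat n <..} \<subseteq> A) \<longleftrightarrow> (\<forall>\<^sub>F k in sequentially. enat k \<in> A)" if inf: "\<infinity> \<in> A"
  proof
    assume "\<exists>n::nat. {enat n <..} \<subseteq> A"
    then obtain n :: nat where n: "{enat n <..} \<subseteq> A" by blast
    show "\<forall>\<^sub>F k in sequentially. enat k \<in> A"
      by (rule eventually_sequentiallyI[of "Suc n"]) (use n in \<open>auto simp: subset_iff\<close>)
  next
    assume "\<forall>\<^sub>F k in sequentially. enat k \<in> A"
    then obtain n where n: "\<forall>k\<ge>n. enat k \<in> A" by (auto simp: eventually_sequentially)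
    have "x \<in> A" if "enat n < x" for x
      using n inf that by (cases x) auto
    then show "\<exists>n::nat. {enat n <..} \<subseteq> A" by (intro exI[of _ n]) auto
  qed
  then show ?thesis by (simp add: open_enat_iff)
qed

context local_field_family
begin

lemma eventually_e: "\<forall>\<^sub>F k in sequentially. n \<le> e k"
  using ramif_to_infinity by (simp add: filterlim_at_top)

text \<open>The open sets of \<open>int_space\<close> by neighbourhoods. A point over
  \<open>\<infinity>\<close> must come with a ball in its own fibre and with all elements of nearby
  fibres that correspond to its class; one \<open>n\<close> serves for both.\<close>

definition iopen :: "(enat \<times> 'a) set \<Rightarrow> bool" where
  "iopen W \<longleftrightarrow> (\<forall>i x. (i, x) \<in> W \<longrightarrow> x \<in> B i 0) \<and>
     (\<forall>k x. (enat k, x) \<in> W \<longrightarrow>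
        (\<exists>n::nat. \<forall>y\<in>carrier (E (enat k)). y \<ominus>\<^bsub>E (enat k)\<^esub> x \<in> B (enat k) (int n) \<longrightarrow> (enat k, y) \<in> W)) \<and>
     (\<forall>x. (\<infinity>, x) \<in> W \<longrightarrow>
        (\<exists>n::nat. (\<forall>y\<in>carrier (E \<infinity>). y \<ominus>\<^bsub>E \<infinity>\<^esub> x \<in> B \<infinity> (int n) \<longrightarrow> (\<infinity>, y) \<in> W) \<and>
           (\<forall>\<^sub>F k in sequentially. \<forall>y. apx n k y x \<longrightarrow> (enat k, y) \<in> W)))"

lemma iopenI:
  assumes "\<And>i x. (i, x) \<in> W \<Longrightarrow> x \<in> B i 0"
    "\<And>k x. (enat k, x) \<in> W \<Longrightarrow>
        \<exists>n::nat. \<forall>y\<in>carrier (E (enat k)). y \<ominus>\<^bsub>E (enat k)\<^esub> x \<in> B (enat k) (int n) \<longrightarrow> (enat k, y) \<in> W"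
    "\<And>x. (\<infinity>, x) \<in> W \<Longrightarrow>
        \<exists>n::nat. (\<forall>y\<in>carrier (E \<infinity>). y \<ominus>\<^bsub>E \<infinity>\<^esub> x \<in> B \<infinity> (int n) \<longrightarrow> (\<infinity>, y) \<in> W) \<and>
           (\<forall>\<^sub>F k in sequentially. \<forall>y. apx n k y x \<longrightarrow> (enat k, y) \<in> W)"
  shows "iopen W"
  using assms unfolding iopen_def by blast

lemma iopen_integral: "\<lbrakk>iopen W; (i, x) \<in> W\<rbrakk> \<Longrightarrow> x \<in> B i 0"
  unfolding iopen_def by blast

lemma iopen_finite:
  "\<lbrakk>iopen W; (enat k, x) \<in> W\<rbrakk> \<Longrightarrow>
   \<exists>n::nat. \<forall>y\<in>carrier (E (enat k)). y \<ominus>\<^bsub>E (enat k)\<^esub> x \<in> B (enat k) (int n) \<longrightarrow> (enat k, y) \<in> W"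
  unfolding iopen_def by blast

lemma iopen_infinity:
  "\<lbrakk>iopen W; (\<infinity>, x) \<in> W\<rbrakk> \<Longrightarrow>
   \<exists>n::nat. (\<forall>y\<in>carrier (E \<infinity>). y \<ominus>\<^bsub>E \<infinity>\<^esub> x \<in> B \<infinity> (int n) \<longrightarrow> (\<infinity>, y) \<in> W) \<and>
     (\<forall>\<^sub>F k in sequentially. \<forall>y. apx n k y x \<longrightarrow> (enat k, y) \<in> W)"
  unfolding iopen_def by blast

lemma iopen_Int:
  assumes S: "iopen S" and T: "iopen T"
  shows "iopen (S \<inter> T)"
proof (rule iopenI)
  fix i x assume "(i, x) \<in> S \<inter> T"
  then show "x \<in> B i 0" using iopen_integral[OF S] by blast
next
  fix k x assume "(enat k, x) \<in> S \<inter> T"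
  then have "(enat k, x) \<in> S" "(enat k, x) \<in> T" by auto
  then obtain m n :: nat
    where mn: "\<forall>y\<in>carrier (E (enat k)). y \<ominus>\<^bsub>E (enat k)\<^esub> x \<in> B (enat k) (int m) \<longrightarrow> (enat k, y) \<in> S"
      "\<forall>y\<in>carrier (E (enat k)). y \<ominus>\<^bsub>E (enat k)\<^esub> x \<in> B (enat k) (int n) \<longrightarrow> (enat k, y) \<in> T"
    using iopen_finite[OF S, of k x] iopen_finite[OF T, of k x] by auto
  have "y \<in> B (enat k) (int m)" "y \<in> B (enat k) (int n)" if "y \<in> B (enat k) (int (max m n))" for y
    using dv.B_antimono[OF _ that] by auto
  then show "\<exists>n::nat. \<forall>y\<in>carrier (E (enat k)). y \<ominus>\<^bsub>E (enat k)\<^esub> x \<in> B (enat k) (int n) \<longrightarrow> (enat k, y) \<in> S \<inter> T"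
    using mn by (intro exI[of _ "max m n"]) blast
next
  fix x assume "(\<infinity>, x) \<in> S \<inter> T"
  then have "(\<infinity>, x) \<in> S" "(\<infinity>, x) \<in> T" by auto
  then obtain m n :: nat
    where mn: "\<forall>y\<in>carrier (E \<infinity>). y \<ominus>\<^bsub>E \<infinity>\<^esub> x \<in> B \<infinity> (int m) \<longrightarrow> (\<infinity>, y) \<in> S"
        "\<forall>\<^sub>F k in sequentially. \<forall>y. apx m k y x \<longrightarrow> (enat k, y) \<in> S"
      "\<forall>y\<in>carrier (E \<infinity>). y \<ominus>\<^bsub>E \<infinity>\<^esub> x \<in> B \<infinity> (int n) \<longrightarrow> (\<infinity>, y) \<in> T"
        "\<forall>\<^sub>F k in sequentially. \<forall>y. apx n k y x \<longrightarrow> (enat k, y) \<in> T"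
    using iopen_infinity[OF S, of x] iopen_infinity[OF T, of x] by auto
  have "y \<in> B \<infinity> (int m)" "y \<in> B \<infinity> (int n)" if "y \<in> B \<infinity> (int (max m n))" for y
    using dv.B_antimono[OF _ that] by auto
  moreover have "\<forall>\<^sub>F k in sequentially. \<forall>y. apx (max m n) k y x \<longrightarrow> (enat k, y) \<in> S \<inter> T"
    using mn(2,4)
  proof eventually_elim
    case (elim k)
    then show ?case using apx_le[of "max m n" k _ x m] apx_le[of "max m n" k _ x n] by auto
  qed
  ultimately show "\<exists>n::nat. (\<forall>y\<in>carrier (E \<infinity>). y \<ominus>\<^bsub>E \<infinity>\<^esub> x \<in> B \<infinity> (int n) \<longrightarrow> (\<infinity>, y) \<in> S \<inter> T) \<and>
      (\<forall>\<^sub>F k in sequentially. \<forall>y. apx n k y x \<longrightarrow> (enat k, y) \<in> S \<inter> T)"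
    using mn(1,3) by (intro exI[of _ "max m n"]) blast
qed

lemma iopen_Union:
  assumes "\<And>S. S \<in> K \<Longrightarrow> iopen S"
  shows "iopen (\<Union>K)"
proof (rule iopenI)
  fix i x assume "(i, x) \<in> \<Union>K"
  then show "x \<in> B i 0" using iopen_integral[OF assms] by blast
next
  fix k x assume "(enat k, x) \<in> \<Union>K"
  then obtain S where S: "S \<in> K" "(enat k, x) \<in> S" by blast
  then show "\<exists>n::nat. \<forall>y\<in>carrier (E (enat k)). y \<ominus>\<^bsub>E (enat k)\<^esub> x \<in> B (enat k) (int n) \<longrightarrow> (enat k, y) \<in> \<Union>K"
    using iopen_finite[OF assms S(2)] by blast
next
  fix x assume "(\<infinity>, x) \<in> \<Union>K"
  then obtain S where S: "S \<in> K" "(\<infinity>, x) \<in> S" by blast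
  then obtain n :: nat where n: "\<forall>y\<in>carrier (E \<infinity>). y \<ominus>\<^bsub>E \<infinity>\<^esub> x \<in> B \<infinity> (int n) \<longrightarrow> (\<infinity>, y) \<in> S"
     "\<forall>\<^sub>F k in sequentially. \<forall>y. apx n k y x \<longrightarrow> (enat k, y) \<in> S"
    using iopen_infinity[OF assms S(2)] by blast
  have "\<forall>\<^sub>F k in sequentially. \<forall>y. apx n k y x \<longrightarrow> (enat k, y) \<in> \<Union>K"
    using n(2) by (rule eventually_mono) (use S(1) in blast)
  then show "\<exists>n::nat. (\<forall>y\<in>carrier (E \<infinity>). y \<ominus>\<^bsub>E \<infinity>\<^esub> x \<in> B \<infinity> (int n) \<longrightarrow> (\<infinity>, y) \<in> \<Union>K) \<and>
      (\<forall>\<^sub>F k in sequentially. \<forall>y. apx n k y x \<longrightarrow> (enat k, y) \<in> \<Union>K)"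
    using n(1) S(1) by blast
qed

lemma openin_trunc_space: "openin (trunc_space F n) V \<longleftrightarrow> trunc_open F n V"
  unfolding trunc_space_def by (simp add: topology_inverse'[OF istopology_trunc_open])

lemma mem_trunc_nbhd: "\<infinity> \<in> trunc_nbhd F n" "enat k \<in> trunc_nbhd F n \<longleftrightarrow> n \<le> e k"
  by (auto simp: trunc_nbhd_def)

lemma trunc_iso_infinity: "trunc_iso F n \<infinity> Z = Z"
  by (simp add: trunc_iso_def)

text \<open>Over \<open>\<infinity>\<close> the trivialization is the identity, so an open set
  contains the preimage of a neighbourhood of \<open>\<infinity>\<close> times one class;
  \<open>apx_iff_trunc_iso\<close> says which elements have their class in this preimage.\<close>

lemma trunc_open_infinity:
  assumes V: "trunc_open F n V" and x: "x \<in> B \<infinity> 0" "(\<infinity>, cs \<infinity> n x) \<in> V"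
  shows "\<forall>\<^sub>F k in sequentially. \<forall>y. apx n k y x \<longrightarrow> (enat k, cs (enat k) n y) \<in> V"
proof -
  let ?N = "trunc_nbhd F n"
  from V obtain S where S: "openin (prod_topology (top_of_set ?N) (discrete_topology (carrier (Q \<infinity> n)))) S"
      and eq: "{w \<in> V. fst w \<in> ?N} = trunc_triv F n -` S \<inter> {w \<in> trunc_total F n. fst w \<in> ?N}"
    unfolding trunc_open_def openin_pullback_topology by blast
  have "(\<infinity>, cs \<infinity> n x) \<in> {w \<in> V. fst w \<in> ?N}" using x mem_trunc_nbhd by simp
  then have "trunc_triv F n (\<infinity>, cs \<infinity> n x) \<in> S" unfolding eq by blast
  then have "(\<infinity>, cs \<infinity> n x) \<in> S" by (simp add: trunc_triv_def trunc_iso_infinity)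
  then obtain U Z where U: "openin (top_of_set ?N) U" "\<infinity> \<in> U" "cs \<infinity> n x \<in> Z" "U \<times> Z \<subseteq> S"
    using S unfolding openin_prod_topology_alt by blast
  obtain T where T: "open T" "U = ?N \<inter> T" using U(1) by (auto simp: openin_open)
  have "\<forall>\<^sub>F k in sequentially. enat k \<in> T" using T U(2) by (auto simp: open_enat_iff_eventually)
  then show ?thesis
    using eventually_e[of n]
  proof eventually_elim
    case (elim k)
    show ?case
    proof (intro allI impI)
      fix y assume y: "apx n k y x"
      have "trunc_iso F n (enat k) (cs (enat k) n y) = cs \<infinity> n x"
        using apx_iff_trunc_iso[of y k x n] apx_carrier[OF y] elim y by simp
      moreover have "enat k \<in> U" using T elim by (simp add: mem_trunc_nbhd)
      ultimately have "(enat k, cs (enat k) n y) \<in> trunc_triv F n -` S"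
        using U by (auto simp: trunc_triv_def)
      moreover have "(enat k, cs (enat k) n y) \<in> {w \<in> trunc_total F n. fst w \<in> ?N}"
        using apx_carrier[OF y] elim by (auto simp: trunc_total_def carrier_Q mem_trunc_nbhd)
      ultimately show "(enat k, cs (enat k) n y) \<in> V" using eq by blast
    qed
  qed
qed

text \<open>Such a set is the preimage under the trivialization of an open set times a single point
  of the discrete fibre.\<close>

lemma trunc_openI:
  assumes "open T" "Z \<in> carrier (Q \<infinity> n)"
  shows "trunc_open F n {w \<in> trunc_total F n. fst w \<in> trunc_nbhd F n \<inter> T \<and> trunc_iso F n (fst w) (snd w) = Z}"
    (is "trunc_open F n ?V")
  unfolding trunc_open_def openin_pullback_topology
proof (intro conjI exI)
  let ?N = "trunc_nbhd F n"
  show "?V \<subseteq> trunc_total F n" by blast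
  have "openin (top_of_set ?N) (?N \<inter> T)" using assms(1) by (auto simp: openin_open)
  then show "openin (prod_topology (top_of_set ?N) (discrete_topology (carrier (Q \<infinity> n)))) ((?N \<inter> T) \<times> {Z})"
    using assms(2) by (simp add: openin_prod_Times_iff)
  show "{w \<in> ?V. fst w \<in> ?N} = trunc_triv F n -` ((?N \<inter> T) \<times> {Z}) \<inter> {w \<in> trunc_total F n. fst w \<in> ?N}"
    by (auto simp: trunc_triv_def)
qed

lemma trunc_open_outside:
  assumes "V \<subseteq> trunc_total F n" "\<And>w. w \<in> V \<Longrightarrow> fst w \<notin> trunc_nbhd F n"
  shows "trunc_open F n V"
proof -
  have "{w \<in> V. fst w \<in> trunc_nbhd F n} = {}" using assms(2) by blast
  then show ?thesis using assms(1) unfolding trunc_open_def by (metis openin_empty)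
qed

text \<open>If \<open>k\<close> lies outside the trivializing neighbourhood, every set over it is
  open. Inside, the point is the preimage of the isolated index times one class, since the class at
  \<open>\<infinity>\<close> determines the class at \<open>k\<close>.\<close>

lemma trunc_open_point:
  assumes x: "x \<in> B (enat k) 0"
  shows "trunc_open F n {(enat k, cs (enat k) n x)}"
proof (cases "n \<le> e k")
  case False
  show ?thesis
  proof (rule trunc_open_outside)
    show "{(enat k, cs (enat k) n x)} \<subseteq> trunc_total F n" using x by (auto simp: trunc_total_def carrier_Q)
    show "fst w \<notin> trunc_nbhd F n" if "w \<in> {(enat k, cs (enat k) n x)}" for w
      using that False mem_trunc_nbhd(2) by auto
  qed
next
  case True
  obtain z where z: "rho k x z" using rho_total[OF x] by blast
  have xz: "apx n k x z" using rho_apx[OF z True] .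
  have Zc: "cs \<infinity> n z \<in> carrier (Q \<infinity> n)" using z by (auto simp: carrier_Q rho_def)
  have t: "trunc_iso F n (enat k) (cs (enat k) n y) = cs \<infinity> n z \<longleftrightarrow> cs (enat k) n y = cs (enat k) n x"
    if y: "y \<in> B (enat k) 0" for y
  proof
    assume "trunc_iso F n (enat k) (cs (enat k) n y) = cs \<infinity> n z"
    moreover have "z \<in> B \<infinity> 0" using z unfolding rho_def by blast
    ultimately have "apx n k y z" using apx_iff_trunc_iso[OF y _ True] by blast
    from apx_unique_left[OF this xz] show "cs (enat k) n y = cs (enat k) n x"
      using cs_eq_iff[OF dv.B_carrier[OF y] dv.B_carrier[OF x]] by blast
  next
    assume "cs (enat k) n y = cs (enat k) n x"
    then show "trunc_iso F n (enat k) (cs (enat k) n y) = cs \<infinity> n z"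
      using trunc_iso_rho[OF z True] by simp
  qed
  have "{(enat k, cs (enat k) n x)} = {w \<in> trunc_total F n. fst w \<in> trunc_nbhd F n \<inter> {enat k} \<and>
      trunc_iso F n (fst w) (snd w) = cs \<infinity> n z}" (is "_ = ?V")
  proof (intro subset_antisym subsetI)
    fix w assume "w \<in> {(enat k, cs (enat k) n x)}"
    then show "w \<in> ?V" using x t[OF x] True by (auto simp: trunc_total_def carrier_Q mem_trunc_nbhd)
  next
    fix w assume w: "w \<in> ?V"
    then obtain Y where Y: "w = (enat k, Y)" "Y \<in> carrier (Q (enat k) n)"
      "trunc_iso F n (enat k) Y = cs \<infinity> n z" by (auto simp: trunc_total_def)
    then obtain y where y: "y \<in> B (enat k) 0" "Y = cs (enat k) n y" unfolding carrier_Q by blast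
    then show "w \<in> {(enat k, cs (enat k) n x)}" using Y t[OF y(1)] by simp
  qed
  then show ?thesis using trunc_openI[OF open_enat Zc, of k] by simp
qed

definition isub :: "nat \<Rightarrow> (enat \<times> 'a set) set \<Rightarrow> (enat \<times> 'a) set" where
  "isub n V = {(i, x). x \<in> B i 0 \<and> (i, cs i n x) \<in> V}"

lemma int_space_eq:
  "int_space F = topology_generated_by {isub n V | n V. 1 \<le> n \<and> trunc_open F n V}"
proof -
  have "{(i, x). x \<in> carrier (ints F i) \<and> (i, pp F i n +>\<^bsub>ints F i\<^esub> x) \<in> V} = isub n V" for n V
    unfolding isub_def carrier_ints coset_ints cs_def by (rule refl)
  then show ?thesis
    unfolding int_space_def openin_trunc_space by (simp only:)
qed

text \<open>Reduction modulo the \<open>n\<close>-th power is constant on balls of index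
  \<open>n\<close>, so the level \<open>n\<close> is itself the required index.\<close>

lemma iopen_isub:
  assumes V: "trunc_open F n V"
  shows "iopen (isub n V)"
proof (rule iopenI)
  have near: "y \<in> B i 0 \<and> cs i n y = cs i n x"
    if "x \<in> B i 0" "y \<in> carrier (E i)" "y \<ominus>\<^bsub>E i\<^esub> x \<in> B i (int n)" for i x y
  proof
    show "y \<in> B i 0" using dv.B_close[OF dv.B_antimono[OF _ that(3), of 0] that(1,2)] by simp
    show "cs i n y = cs i n x" using cs_eq_iff[OF that(2) dv.B_carrier[OF that(1)]] that(3) by blast
  qed
  {
    fix i x assume "(i, x) \<in> isub n V"
    then show "x \<in> B i 0" by (simp add: isub_def)
  }
  {
    fix k x assume "(enat k, x) \<in> isub n V"
    then show "\<exists>n'::nat. \<forall>y\<in>carrier (E (enat k)). y \<ominus>\<^bsub>E (enat k)\<^esub> x \<in> B (enat k) (int n') \<longrightarrow> (enat k, y) \<in> isub n V"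
      using near[of x "enat k"] by (intro exI[of _ n]) (simp add: isub_def)
  }
  {
    fix x assume x: "(\<infinity>, x) \<in> isub n V"
    have "\<forall>\<^sub>F k in sequentially. \<forall>y. apx n k y x \<longrightarrow> (enat k, cs (enat k) n y) \<in> V"
      using trunc_open_infinity[OF V] x by (simp add: isub_def)
    then have "\<forall>\<^sub>F k in sequentially. \<forall>y. apx n k y x \<longrightarrow> (enat k, y) \<in> isub n V"
      by (rule eventually_mono) (auto simp: isub_def dest: apx_carrier)
    then show "\<exists>n'::nat. (\<forall>y\<in>carrier (E \<infinity>). y \<ominus>\<^bsub>E \<infinity>\<^esub> x \<in> B \<infinity> (int n') \<longrightarrow> (\<infinity>, y) \<in> isub n V) \<and>
        (\<forall>\<^sub>F k in sequentially. \<forall>y. apx n' k y x \<longrightarrow> (enat k, y) \<in> isub n V)"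
      using near[of x \<infinity>] x by (intro exI[of _ n]) (simp add: isub_def)
  }
qed

lemma openin_int_space: "openin (int_space F) W \<longleftrightarrow> iopen W"
proof
  assume "openin (int_space F) W"
  then have "generate_topology_on {isub n V | n V. 1 \<le> n \<and> trunc_open F n V} W"
    unfolding int_space_eq by (rule openin_topology_generated_by)
  then show "iopen W"
  proof (induction rule: generate_topology_on.induct)
    case Empty
    show ?case by (simp add: iopen_def)
  next
    case (Int a b)
    then show ?case by (simp add: iopen_Int)
  next
    case (UN K)
    show ?case by (rule iopen_Union) (rule UN)
  next
    case (Basis s)
    then show ?case using iopen_isub by blast
  qed
next
  assume W: "iopen W"
  have "\<exists>G. openin (int_space F) G \<and> p \<in> G \<and> G \<subseteq> W" if p: "p \<in> W" for p
  proof -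
    obtain i x where ix: "p = (i, x)" by (cases p)
    have x: "x \<in> B i 0" using iopen_integral[OF W] p ix by blast
    have open_isub: "openin (int_space F) (isub n V)" if "1 \<le> n" "trunc_open F n V" for n V
      unfolding int_space_eq using that by (intro topology_generated_by_Basis) blast
    show ?thesis
    proof (cases i)
      case (enat k)
      then obtain n0 :: nat where n0: "\<forall>y\<in>carrier (E i). y \<ominus>\<^bsub>E i\<^esub> x \<in> B i (int n0) \<longrightarrow> (i, y) \<in> W"
        using iopen_finite[OF W, of k x] p ix by blast
      \<comment> \<open>The generating sets of \<open>int_space\<close> have level at least
        1.\<close>
      define n where "n = max 1 n0"
      let ?G = "isub n {(i, cs i n x)}"
      have "openin (int_space F) ?G"
        unfolding enat by (rule open_isub) (use x enat in \<open>simp_all add: n_def trunc_open_point\<close>)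
      moreover have "p \<in> ?G" using x ix by (simp add: isub_def)
      moreover have "?G \<subseteq> W"
      proof
        fix q assume "q \<in> ?G"
        then obtain y where y: "q = (i, y)" "y \<in> B i 0" "cs i n y = cs i n x" by (auto simp: isub_def)
        then have "y \<ominus>\<^bsub>E i\<^esub> x \<in> B i (int n)" using x cs_eq_iff dv.B_carrier by blast
        then have "y \<ominus>\<^bsub>E i\<^esub> x \<in> B i (int n0)" by (rule dv.B_antimono[rotated]) (simp add: n_def)
        then show "q \<in> W" using n0 y dv.B_carrier by blast
      qed
      ultimately show ?thesis by blast
    next
      case infinity
      then obtain n0 :: nat where n0: "\<forall>y\<in>carrier (E \<infinity>). y \<ominus>\<^bsub>E \<infinity>\<^esub> x \<in> B \<infinity> (int n0) \<longrightarrow> (\<infinity>, y) \<in> W"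
          "\<forall>\<^sub>F k in sequentially. \<forall>y. apx n0 k y x \<longrightarrow> (enat k, y) \<in> W"
        using iopen_infinity[OF W, of x] p ix by blast
      define n where "n = max 1 n0"
      \<comment> \<open>\<open>T\<close> collects the indices at which the eventual condition
        already holds; it is open because all large indices satisfy it.\<close>
      define T where "T = {\<infinity>} \<union> enat ` {k. \<forall>y. apx n0 k y x \<longrightarrow> (enat k, y) \<in> W}"
      have T: "open T"
        unfolding open_enat_iff_eventually using n0(2) by (auto simp: T_def elim!: eventually_mono)
      define V where "V = {w \<in> trunc_total F n. fst w \<in> trunc_nbhd F n \<inter> T \<and> trunc_iso F n (fst w) (snd w) = cs \<infinity> n x}"
      have xc: "cs \<infinity> n x \<in> carrier (Q \<infinity> n)" using x infinity by (auto simp: carrier_Q)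
      have "openin (int_space F) (isub n V)"
        by (rule open_isub) (simp add: n_def, unfold V_def, rule trunc_openI[OF T xc])
      moreover have "p \<in> isub n V"
        using x ix infinity xc by (auto simp: isub_def V_def trunc_total_def mem_trunc_nbhd T_def trunc_iso_infinity)
      moreover have "isub n V \<subseteq> W"
      proof
        fix q assume "q \<in> isub n V"
        then obtain j y where q: "q = (j, y)" "y \<in> B j 0" "j \<in> trunc_nbhd F n" "j \<in> T"
            "trunc_iso F n j (cs j n y) = cs \<infinity> n x"
          by (auto simp: isub_def V_def)
        show "q \<in> W"
        proof (cases j)
          case (enat k)
          then have "apx n k y x"
            using apx_iff_trunc_iso[of y k x n] q x infinity by (simp add: mem_trunc_nbhd)
          then have "apx n0 k y x" by (rule apx_le) (simp add: n_def)
          then show ?thesis using q enat by (auto simp: T_def)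
        next
          case j: infinity
          then have "y \<ominus>\<^bsub>E \<infinity>\<^esub> x \<in> B \<infinity> (int n)"
            using q x infinity cs_eq_iff[of y \<infinity> x n] by (simp add: trunc_iso_infinity dv.B_carrier)
          then have "y \<ominus>\<^bsub>E \<infinity>\<^esub> x \<in> B \<infinity> (int n0)" by (rule dv.B_antimono[rotated]) (simp add: n_def)
          then show ?thesis using n0(1) q j dv.B_carrier by blast
        qed
      qed
      ultimately show ?thesis by blast
    qed
  qed
  then show "openin (int_space F) W" by (subst openin_subopen) blast
qed

section \<open>The direct limit along multiplication by the uniformizers\<close>

lemma openin_fld_space:
  "openin (fld_space F) W \<longleftrightarrow> (\<forall>i x. (i, x) \<in> W \<longrightarrow> x \<in> carrier (E i)) \<and>
     (\<forall>m::nat. iopen {(i, x). x \<in> B i 0 \<and> (i, inv\<^bsub>E i\<^esub> (up i m) \<otimes>\<^bsub>E i\<^esub> x) \<in> W})"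
proof -
  have "W \<subseteq> (SIGMA i:UNIV. carrier (fld F i)) \<longleftrightarrow> (\<forall>i x. (i, x) \<in> W \<longrightarrow> x \<in> carrier (E i))" by auto
  then show ?thesis
    unfolding fld_space_def topology_inverse'[OF istopology_fld_open] fld_open_def openin_int_space carrier_ints
    by simp
qed

lemma up_cancel:
  assumes "x \<in> carrier (E i)"
  shows "inv\<^bsub>E i\<^esub> (up i m) \<otimes>\<^bsub>E i\<^esub> (up i m \<otimes>\<^bsub>E i\<^esub> x) = x" "up i m \<otimes>\<^bsub>E i\<^esub> (inv\<^bsub>E i\<^esub> (up i m) \<otimes>\<^bsub>E i\<^esub> x) = x"
    "inv\<^bsub>E i\<^esub> (up i m) \<in> carrier (E i)"
  using dv.inv_mult_cancel[OF _ up_nonzero assms] dv.inv_nonzero[OF _ up_nonzero] by auto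

lemma up_minus:
  "\<lbrakk>x \<in> carrier (E i); y \<in> carrier (E i)\<rbrakk> \<Longrightarrow>
    up i m \<otimes>\<^bsub>E i\<^esub> x \<ominus>\<^bsub>E i\<^esub> up i m \<otimes>\<^bsub>E i\<^esub> y = up i m \<otimes>\<^bsub>E i\<^esub> (x \<ominus>\<^bsub>E i\<^esub> y)"
  by (simp add: dv.K.minus_eq dv.K.r_distr dv.K.r_minus)

lemma up_bound: "x \<in> carrier (E i) \<Longrightarrow> \<exists>m. up i m \<otimes>\<^bsub>E i\<^esub> x \<in> B i 0"
proof -
  assume x: "x \<in> carrier (E i)"
  then obtain m where "x \<in> B i (- int m)" using dv.B_bound by blast
  then show ?thesis using up_mult_B_iff[OF x, of m "- int m"] by auto
qed

lemma up_diff_B: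
  assumes "x \<in> carrier (E i)" "y \<in> carrier (E i)" "y \<ominus>\<^bsub>E i\<^esub> x \<in> B i (int n)"
  shows "up i m \<otimes>\<^bsub>E i\<^esub> y \<ominus>\<^bsub>E i\<^esub> up i m \<otimes>\<^bsub>E i\<^esub> x \<in> B i (int n)"
proof -
  have "up i m \<otimes>\<^bsub>E i\<^esub> (y \<ominus>\<^bsub>E i\<^esub> x) \<in> B i (int m + int n)"
    using up_mult_B_iff[of "y \<ominus>\<^bsub>E i\<^esub> x"] assms by simp
  then have "up i m \<otimes>\<^bsub>E i\<^esub> (y \<ominus>\<^bsub>E i\<^esub> x) \<in> B i (int n)" by (rule dv.B_antimono[rotated]) simp
  then show ?thesis using up_minus assms by simp
qed

text \<open>Clear the denominator of \<open>x\<close> with an \<open>m\<close>-th power and work in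
  the \<open>m\<close>-th copy of \<open>int_space\<close>; multiplication by the power only makes
  differences smaller.\<close>

lemma fld_open_finite:
  assumes W: "openin (fld_space F) W" and x: "(enat k, x) \<in> W"
  shows "\<exists>n::nat. \<forall>y\<in>carrier (E (enat k)). y \<ominus>\<^bsub>E (enat k)\<^esub> x \<in> B (enat k) (int n) \<longrightarrow> (enat k, y) \<in> W"
proof -
  let ?i = "enat k"
  have xc: "x \<in> carrier (E ?i)" using W x unfolding openin_fld_space by blast
  obtain m where m: "up ?i m \<otimes>\<^bsub>E ?i\<^esub> x \<in> B ?i 0" using up_bound[OF xc] by blast
  let ?W = "{(i, x). x \<in> B i 0 \<and> (i, inv\<^bsub>E i\<^esub> (up i m) \<otimes>\<^bsub>E i\<^esub> x) \<in> W}"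
  have iW: "iopen ?W" using W unfolding openin_fld_space by blast
  have "(?i, up ?i m \<otimes>\<^bsub>E ?i\<^esub> x) \<in> ?W" using m x xc by (simp add: up_cancel)
  from iopen_finite[OF iW this] obtain n :: nat where
    n: "\<forall>y\<in>carrier (E ?i). y \<ominus>\<^bsub>E ?i\<^esub> up ?i m \<otimes>\<^bsub>E ?i\<^esub> x \<in> B ?i (int n) \<longrightarrow> (?i, y) \<in> ?W" by blast
  have "(?i, y) \<in> W" if y: "y \<in> carrier (E ?i)" "y \<ominus>\<^bsub>E ?i\<^esub> x \<in> B ?i (int n)" for y
  proof -
    have "(?i, up ?i m \<otimes>\<^bsub>E ?i\<^esub> y) \<in> ?W" using n up_diff_B[OF xc y] y by simp
    then show ?thesis using y by (simp add: up_cancel)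
  qed
  then show ?thesis by blast
qed

lemma fld_open_infinity:
  assumes W: "openin (fld_space F) W" and x: "(\<infinity>, x) \<in> W" and m: "up \<infinity> m \<otimes>\<^bsub>E \<infinity>\<^esub> x \<in> B \<infinity> 0"
  shows "\<exists>n::nat. (\<forall>y\<in>carrier (E \<infinity>). y \<ominus>\<^bsub>E \<infinity>\<^esub> x \<in> B \<infinity> (int n) \<longrightarrow> (\<infinity>, y) \<in> W) \<and>
    (\<forall>\<^sub>F k in sequentially. \<forall>y\<in>carrier (E (enat k)).
       apx n k (up (enat k) m \<otimes>\<^bsub>E (enat k)\<^esub> y) (up \<infinity> m \<otimes>\<^bsub>E \<infinity>\<^esub> x) \<longrightarrow> (enat k, y) \<in> W)"
proof -
  have xc: "x \<in> carrier (E \<infinity>)" using W x unfolding openin_fld_space by blast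
  let ?W = "{(i, x). x \<in> B i 0 \<and> (i, inv\<^bsub>E i\<^esub> (up i m) \<otimes>\<^bsub>E i\<^esub> x) \<in> W}"
  have iW: "iopen ?W" using W unfolding openin_fld_space by blast
  have "(\<infinity>, up \<infinity> m \<otimes>\<^bsub>E \<infinity>\<^esub> x) \<in> ?W" using m x xc by (simp add: up_cancel)
  from iopen_infinity[OF iW this] obtain n :: nat where
    n: "\<forall>y\<in>carrier (E \<infinity>). y \<ominus>\<^bsub>E \<infinity>\<^esub> up \<infinity> m \<otimes>\<^bsub>E \<infinity>\<^esub> x \<in> B \<infinity> (int n) \<longrightarrow> (\<infinity>, y) \<in> ?W"
      "\<forall>\<^sub>F k in sequentially. \<forall>y. apx n k y (up \<infinity> m \<otimes>\<^bsub>E \<infinity>\<^esub> x) \<longrightarrow> (enat k, y) \<in> ?W" by blast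
  have "(\<infinity>, y) \<in> W" if y: "y \<in> carrier (E \<infinity>)" "y \<ominus>\<^bsub>E \<infinity>\<^esub> x \<in> B \<infinity> (int n)" for y
  proof -
    have "(\<infinity>, up \<infinity> m \<otimes>\<^bsub>E \<infinity>\<^esub> y) \<in> ?W" using n(1) up_diff_B[OF xc y] y by simp
    then show ?thesis using y by (simp add: up_cancel)
  qed
  moreover have "\<forall>\<^sub>F k in sequentially. \<forall>y\<in>carrier (E (enat k)).
       apx n k (up (enat k) m \<otimes>\<^bsub>E (enat k)\<^esub> y) (up \<infinity> m \<otimes>\<^bsub>E \<infinity>\<^esub> x) \<longrightarrow> (enat k, y) \<in> W"
    using n(2)
  proof eventually_elim
    case (elim k)
    show ?case
    proof (intro ballI impI)
      fix y assume y: "y \<in> carrier (E (enat k))" "apx n k (up (enat k) m \<otimes>\<^bsub>E (enat k)\<^esub> y) (up \<infinity> m \<otimes>\<^bsub>E \<infinity>\<^esub> x)"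
      then have "(enat k, up (enat k) m \<otimes>\<^bsub>E (enat k)\<^esub> y) \<in> ?W" using elim by blast
      then show "(enat k, y) \<in> W" using y(1) by (simp add: up_cancel)
    qed
  qed
  ultimately show ?thesis by blast
qed

lemma openin_fld_spaceI:
  assumes c: "\<And>i x. (i, x) \<in> W \<Longrightarrow> x \<in> carrier (E i)"
    and fin: "\<And>k x. (enat k, x) \<in> W \<Longrightarrow>
        \<exists>n::nat. \<forall>y\<in>carrier (E (enat k)). y \<ominus>\<^bsub>E (enat k)\<^esub> x \<in> B (enat k) (int n) \<longrightarrow> (enat k, y) \<in> W"
    and inf: "\<And>x m. \<lbrakk>(\<infinity>, x) \<in> W; up \<infinity> m \<otimes>\<^bsub>E \<infinity>\<^esub> x \<in> B \<infinity> 0\<rbrakk> \<Longrightarrow>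
        \<exists>n::nat. (\<forall>y\<in>carrier (E \<infinity>). y \<ominus>\<^bsub>E \<infinity>\<^esub> x \<in> B \<infinity> (int n) \<longrightarrow> (\<infinity>, y) \<in> W) \<and>
    (\<forall>\<^sub>F k in sequentially. \<forall>y\<in>carrier (E (enat k)).
       apx n k (up (enat k) m \<otimes>\<^bsub>E (enat k)\<^esub> y) (up \<infinity> m \<otimes>\<^bsub>E \<infinity>\<^esub> x) \<longrightarrow> (enat k, y) \<in> W)"
  shows "openin (fld_space F) W"
  unfolding openin_fld_space
proof (intro conjI allI impI)
  fix i x assume "(i, x) \<in> W" then show "x \<in> carrier (E i)" by (rule c)
next
  fix m :: nat
  let ?W = "{(i, x). x \<in> B i 0 \<and> (i, inv\<^bsub>E i\<^esub> (up i m) \<otimes>\<^bsub>E i\<^esub> x) \<in> W}"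
  have near: "z' \<in> B i 0 \<and> inv\<^bsub>E i\<^esub> (up i m) \<otimes>\<^bsub>E i\<^esub> z' \<ominus>\<^bsub>E i\<^esub> inv\<^bsub>E i\<^esub> (up i m) \<otimes>\<^bsub>E i\<^esub> z \<in> B i (int n)"
    if "z \<in> B i 0" "z' \<in> carrier (E i)" "z' \<ominus>\<^bsub>E i\<^esub> z \<in> B i (int (m + n))" for i z z' n
  proof
    have zc: "z \<in> carrier (E i)" using that(1) by (rule dv.B_carrier)
    show "z' \<in> B i 0" using dv.B_close[OF dv.B_antimono[OF _ that(3), of 0] that(1,2)] by simp
    let ?x = "inv\<^bsub>E i\<^esub> (up i m) \<otimes>\<^bsub>E i\<^esub> z" and ?x' = "inv\<^bsub>E i\<^esub> (up i m) \<otimes>\<^bsub>E i\<^esub> z'"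
    have xc: "?x \<in> carrier (E i)" "?x' \<in> carrier (E i)" using zc that up_cancel(3)[OF zc, of m] by auto
    have "up i m \<otimes>\<^bsub>E i\<^esub> (?x' \<ominus>\<^bsub>E i\<^esub> ?x) = z' \<ominus>\<^bsub>E i\<^esub> z"
      using up_minus[OF xc(2,1), of m] zc that by (simp add: up_cancel)
    then show "?x' \<ominus>\<^bsub>E i\<^esub> ?x \<in> B i (int n)"
      using up_mult_B_iff[of "?x' \<ominus>\<^bsub>E i\<^esub> ?x" i m "int n"] that xc by simp
  qed
  show "iopen ?W"
  proof (rule iopenI)
    fix i x assume "(i, x) \<in> ?W" then show "x \<in> B i 0" by simp
  next
    fix k z assume z: "(enat k, z) \<in> ?W"
    then obtain n :: nat where n: "\<forall>y\<in>carrier (E (enat k)).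
        y \<ominus>\<^bsub>E (enat k)\<^esub> inv\<^bsub>E (enat k)\<^esub> (up (enat k) m) \<otimes>\<^bsub>E (enat k)\<^esub> z \<in> B (enat k) (int n) \<longrightarrow> (enat k, y) \<in> W"
      using fin by blast
    show "\<exists>n::nat. \<forall>y\<in>carrier (E (enat k)). y \<ominus>\<^bsub>E (enat k)\<^esub> z \<in> B (enat k) (int n) \<longrightarrow> (enat k, y) \<in> ?W"
    \<comment> \<open>Returning from the \<open>m\<close>-th copy divides by the \<open>m\<close>-th
      power of the uniformizer and lowers the index of a ball by \<open>m\<close>.\<close>
    proof (intro exI[of _ "m + n"] ballI impI)
      fix y assume y: "y \<in> carrier (E (enat k))" "y \<ominus>\<^bsub>E (enat k)\<^esub> z \<in> B (enat k) (int (m + n))"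
      have "z \<in> B (enat k) 0" using z by simp
      from near[OF this y] show "(enat k, y) \<in> ?W" using n y(1) up_cancel(3)[OF y(1), of m] by simp
    qed
  next
    fix z assume z: "(\<infinity>, z) \<in> ?W"
    let ?x = "inv\<^bsub>E \<infinity>\<^esub> (up \<infinity> m) \<otimes>\<^bsub>E \<infinity>\<^esub> z"
    have z0: "z \<in> B \<infinity> 0" and zc: "z \<in> carrier (E \<infinity>)" using z dv.B_carrier by auto
    have zx: "up \<infinity> m \<otimes>\<^bsub>E \<infinity>\<^esub> ?x = z" using zc by (rule up_cancel)
    obtain n :: nat where n: "\<forall>y\<in>carrier (E \<infinity>). y \<ominus>\<^bsub>E \<infinity>\<^esub> ?x \<in> B \<infinity> (int n) \<longrightarrow> (\<infinity>, y) \<in> W"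
      "\<forall>\<^sub>F k in sequentially. \<forall>y\<in>carrier (E (enat k)).
         apx n k (up (enat k) m \<otimes>\<^bsub>E (enat k)\<^esub> y) z \<longrightarrow> (enat k, y) \<in> W"
      using inf[of ?x m] z unfolding zx by blast
    show "\<exists>n::nat. (\<forall>y\<in>carrier (E \<infinity>). y \<ominus>\<^bsub>E \<infinity>\<^esub> z \<in> B \<infinity> (int n) \<longrightarrow> (\<infinity>, y) \<in> ?W) \<and>
        (\<forall>\<^sub>F k in sequentially. \<forall>y. apx n k y z \<longrightarrow> (enat k, y) \<in> ?W)"
    proof (intro exI[of _ "m + n"] conjI ballI impI)
      fix y assume y: "y \<in> carrier (E \<infinity>)" "y \<ominus>\<^bsub>E \<infinity>\<^esub> z \<in> B \<infinity> (int (m + n))"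
      from near[OF z0 y] show "(\<infinity>, y) \<in> ?W" using n(1) y(1) up_cancel(3)[OF y(1), of m] by simp
    next
      show "\<forall>\<^sub>F k in sequentially. \<forall>y. apx (m + n) k y z \<longrightarrow> (enat k, y) \<in> ?W"
        using n(2)
      proof eventually_elim
        case (elim k)
        show ?case
        proof (intro allI impI)
          fix y assume y: "apx (m + n) k y z"
          then have yc: "y \<in> carrier (E (enat k))" "y \<in> B (enat k) 0" using apx_carrier by auto
          have "apx n k y z" using apx_le[OF y] by simp
          then show "(enat k, y) \<in> ?W" using elim yc up_cancel[OF yc(1), of m] by simp
        qed
      qed
    qed
  qed
qed

lemma topspace_fld_space: "topspace (fld_space F) = (SIGMA i:UNIV. carrier (E i))"
proof -
  have "openin (fld_space F) (SIGMA i:UNIV. carrier (E i))"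
  proof (rule openin_fld_spaceI)
    fix x m assume "(\<infinity>, x) \<in> (SIGMA i:UNIV. carrier (E i))"
    show "\<exists>n::nat. (\<forall>y\<in>carrier (E \<infinity>). y \<ominus>\<^bsub>E \<infinity>\<^esub> x \<in> B \<infinity> (int n) \<longrightarrow> (\<infinity>, y) \<in> (SIGMA i:UNIV. carrier (E i))) \<and>
    (\<forall>\<^sub>F k in sequentially. \<forall>y\<in>carrier (E (enat k)).
       apx n k (up (enat k) m \<otimes>\<^bsub>E (enat k)\<^esub> y) (up \<infinity> m \<otimes>\<^bsub>E \<infinity>\<^esub> x) \<longrightarrow> (enat k, y) \<in> (SIGMA i:UNIV. carrier (E i)))"
      by (intro exI conjI ballI impI always_eventually allI) auto
  qed auto
  moreover have "topspace (fld_space F) \<subseteq> (SIGMA i:UNIV. carrier (E i))"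
    using openin_topspace[of "fld_space F"] unfolding openin_fld_space by auto
  ultimately show ?thesis using openin_subset by blast
qed

section \<open>Continuous sections\<close>

text \<open>Convergence at \<open>\<infinity>\<close> after multiplication by the
  \<open>m\<close>-th power. Integrality is demanded at \<open>\<infinity>\<close>, where it forces
  integrality at all large indices; the finitely many other values are free.\<close>

definition conv :: "nat \<Rightarrow> (enat \<Rightarrow> 'a) \<Rightarrow> bool" where
  "conv m s \<longleftrightarrow> up \<infinity> m \<otimes>\<^bsub>E \<infinity>\<^esub> s \<infinity> \<in> B \<infinity> 0 \<and>
     (\<forall>n. \<forall>\<^sub>F k in sequentially. apx n k (up (enat k) m \<otimes>\<^bsub>E (enat k)\<^esub> s (enat k)) (up \<infinity> m \<otimes>\<^bsub>E \<infinity>\<^esub> s \<infinity>))"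

abbreviation A where "A \<equiv> section_ring F"

lemma A_closed: "s \<in> carrier A \<Longrightarrow> s i \<in> carrier (E i)"
  by (simp add: section_ring_def)

text \<open>These are the test neighbourhoods of a point over \<open>\<infinity>\<close> from which
  \<open>continuous_section_iff\<close> reads off convergence.\<close>

lemma openin_apx:
  assumes x: "x \<in> carrier (E \<infinity>)" "up \<infinity> m \<otimes>\<^bsub>E \<infinity>\<^esub> x \<in> B \<infinity> 0"
  shows "openin (fld_space F)
    ({(enat k, y) | k y. y \<in> carrier (E (enat k)) \<and> apx n k (up (enat k) m \<otimes>\<^bsub>E (enat k)\<^esub> y) (up \<infinity> m \<otimes>\<^bsub>E \<infinity>\<^esub> x)} \<union>
     {(\<infinity>, y) | y. y \<in> carrier (E \<infinity>) \<and> up \<infinity> m \<otimes>\<^bsub>E \<infinity>\<^esub> y \<ominus>\<^bsub>E \<infinity>\<^esub> up \<infinity> m \<otimes>\<^bsub>E \<infinity>\<^esub> x \<in> B \<infinity> (int n)})"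
    (is "openin _ ?W")
proof (rule openin_fld_spaceI)
  have Wfin: "(enat k, y) \<in> ?W \<longleftrightarrow> y \<in> carrier (E (enat k)) \<and> apx n k (up (enat k) m \<otimes>\<^bsub>E (enat k)\<^esub> y) (up \<infinity> m \<otimes>\<^bsub>E \<infinity>\<^esub> x)"
    and Winf: "(\<infinity>, y) \<in> ?W \<longleftrightarrow> y \<in> carrier (E \<infinity>) \<and> up \<infinity> m \<otimes>\<^bsub>E \<infinity>\<^esub> y \<ominus>\<^bsub>E \<infinity>\<^esub> up \<infinity> m \<otimes>\<^bsub>E \<infinity>\<^esub> x \<in> B \<infinity> (int n)" for k y
    by auto
  {
    fix i y assume "(i, y) \<in> ?W" then show "y \<in> carrier (E i)" by auto
  }
  {
    fix k y assume "(enat k, y) \<in> ?W"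
    then have y: "y \<in> carrier (E (enat k))" "apx n k (up (enat k) m \<otimes>\<^bsub>E (enat k)\<^esub> y) (up \<infinity> m \<otimes>\<^bsub>E \<infinity>\<^esub> x)"
      unfolding Wfin by auto
    show "\<exists>n'::nat. \<forall>z\<in>carrier (E (enat k)). z \<ominus>\<^bsub>E (enat k)\<^esub> y \<in> B (enat k) (int n') \<longrightarrow> (enat k, z) \<in> ?W"
      unfolding Wfin
    proof (intro exI[of _ n] ballI impI conjI)
      fix z assume z: "z \<in> carrier (E (enat k))" "z \<ominus>\<^bsub>E (enat k)\<^esub> y \<in> B (enat k) (int n)"
      show "apx n k (up (enat k) m \<otimes>\<^bsub>E (enat k)\<^esub> z) (up \<infinity> m \<otimes>\<^bsub>E \<infinity>\<^esub> x)"
        using apx_close_left[OF y(2)] up_diff_B[OF y(1) z] z by simp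
    qed
  }
  {
    fix y m' assume "(\<infinity>, y) \<in> ?W"
    then have y: "y \<in> carrier (E \<infinity>)" "up \<infinity> m \<otimes>\<^bsub>E \<infinity>\<^esub> y \<ominus>\<^bsub>E \<infinity>\<^esub> up \<infinity> m \<otimes>\<^bsub>E \<infinity>\<^esub> x \<in> B \<infinity> (int n)"
      unfolding Winf by auto
    have y0: "up \<infinity> m \<otimes>\<^bsub>E \<infinity>\<^esub> y \<in> B \<infinity> 0"
      using dv.B_close[OF dv.B_antimono[OF _ y(2), of 0] x(2)] y(1) by simp
    have "up \<infinity> m \<otimes>\<^bsub>E \<infinity>\<^esub> x \<ominus>\<^bsub>E \<infinity>\<^esub> up \<infinity> m \<otimes>\<^bsub>E \<infinity>\<^esub> y \<in> B \<infinity> (int n)"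
      using dv.B_minus_sym[OF _ _ y(2)] x(1) y(1) by simp
    then have right: "apx n k z (up \<infinity> m \<otimes>\<^bsub>E \<infinity>\<^esub> x)" if "apx n k z (up \<infinity> m \<otimes>\<^bsub>E \<infinity>\<^esub> y)" for k z
      using apx_close_right[OF that] x by simp
    show "\<exists>n'::nat. (\<forall>z\<in>carrier (E \<infinity>). z \<ominus>\<^bsub>E \<infinity>\<^esub> y \<in> B \<infinity> (int n') \<longrightarrow> (\<infinity>, z) \<in> ?W) \<and>
      (\<forall>\<^sub>F k in sequentially. \<forall>z\<in>carrier (E (enat k)).
         apx n' k (up (enat k) m' \<otimes>\<^bsub>E (enat k)\<^esub> z) (up \<infinity> m' \<otimes>\<^bsub>E \<infinity>\<^esub> y) \<longrightarrow> (enat k, z) \<in> ?W)"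
      unfolding Wfin Winf
    \<comment> \<open>Openness is tested at an arbitrary admissible \<open>m'\<close>. Returning
      from \<open>m'\<close> to \<open>m\<close> divides by the \<open>m'\<close>-th power and loses
      \<open>m'\<close> digits.\<close>
    proof (intro exI[of _ "n + m'"] conjI ballI impI always_eventually allI)
      fix z assume z: "z \<in> carrier (E \<infinity>)" "z \<ominus>\<^bsub>E \<infinity>\<^esub> y \<in> B \<infinity> (int (n + m'))"
      then have "z \<ominus>\<^bsub>E \<infinity>\<^esub> y \<in> B \<infinity> (int n)" using dv.B_antimono[OF _ z(2), of "int n"] by simp
      from up_diff_B[OF y(1) z(1) this, of m]
      show "up \<infinity> m \<otimes>\<^bsub>E \<infinity>\<^esub> z \<ominus>\<^bsub>E \<infinity>\<^esub> up \<infinity> m \<otimes>\<^bsub>E \<infinity>\<^esub> x \<in> B \<infinity> (int n)"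
        using dv.B_minus_trans[OF _ _ _ _ y(2)] x(1) y(1) z(1) by simp
    next
      fix k z assume z: "z \<in> carrier (E (enat k))"
        "apx (n + m') k (up (enat k) m' \<otimes>\<^bsub>E (enat k)\<^esub> z) (up \<infinity> m' \<otimes>\<^bsub>E \<infinity>\<^esub> y)"
      have comm: "up i m \<otimes>\<^bsub>E i\<^esub> (up i m' \<otimes>\<^bsub>E i\<^esub> w) = up i m' \<otimes>\<^bsub>E i\<^esub> (up i m \<otimes>\<^bsub>E i\<^esub> w)" if "w \<in> carrier (E i)" for i w
        using that by (simp add: dv.K.m_lcomm)
      from apx_up_mult[OF z(2), of m]
      have "apx (n + m') k (up (enat k) m' \<otimes>\<^bsub>E (enat k)\<^esub> (up (enat k) m \<otimes>\<^bsub>E (enat k)\<^esub> z))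
          (up \<infinity> m' \<otimes>\<^bsub>E \<infinity>\<^esub> (up \<infinity> m \<otimes>\<^bsub>E \<infinity>\<^esub> y))"
        using comm[OF z(1)] comm[OF y(1)] by simp
      then have "apx n k (up (enat k) m \<otimes>\<^bsub>E (enat k)\<^esub> z) (up \<infinity> m \<otimes>\<^bsub>E \<infinity>\<^esub> y)"
        by (rule apx_divide) (use y0 z in simp_all)
      then show "apx n k (up (enat k) m \<otimes>\<^bsub>E (enat k)\<^esub> z) (up \<infinity> m \<otimes>\<^bsub>E \<infinity>\<^esub> x)" by (rule right)
    qed auto
  }
qed

text \<open>Continuity at finite indices is automatic. At \<open>\<infinity>\<close> the sets of
  \<open>openin_apx\<close> force convergence, and \<open>fld_open_infinity\<close> gives the
  converse with the same \<open>m\<close>.\<close>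

lemma continuous_section_iff:
  assumes s: "\<And>i. s i \<in> carrier (E i)" and m: "up \<infinity> m \<otimes>\<^bsub>E \<infinity>\<^esub> s \<infinity> \<in> B \<infinity> 0"
  shows "continuous_map euclidean (fld_space F) (\<lambda>i. (i, s i)) \<longleftrightarrow> conv m s"
proof
  assume cont: "continuous_map euclidean (fld_space F) (\<lambda>i. (i, s i))"
  show "conv m s"
    unfolding conv_def
  proof (intro conjI m allI)
    fix n
    define W where "W = {(enat k, y) | k y. y \<in> carrier (E (enat k)) \<and>
        apx n k (up (enat k) m \<otimes>\<^bsub>E (enat k)\<^esub> y) (up \<infinity> m \<otimes>\<^bsub>E \<infinity>\<^esub> s \<infinity>)} \<union>
      {(\<infinity>, y) | y. y \<in> carrier (E \<infinity>) \<and>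
        up \<infinity> m \<otimes>\<^bsub>E \<infinity>\<^esub> y \<ominus>\<^bsub>E \<infinity>\<^esub> up \<infinity> m \<otimes>\<^bsub>E \<infinity>\<^esub> s \<infinity> \<in> B \<infinity> (int n)}"
    have "openin (fld_space F) W" unfolding W_def by (rule openin_apx[OF s m])
    then have "open {i. (i, s i) \<in> W}" using cont unfolding continuous_map_def by simp
    moreover have "\<infinity> \<in> {i. (i, s i) \<in> W}" using s[of \<infinity>] by (simp add: W_def dv.minus_self)
    ultimately have "\<forall>\<^sub>F k in sequentially. enat k \<in> {i. (i, s i) \<in> W}"
      unfolding open_enat_iff_eventually by blast
    then show "\<forall>\<^sub>F k in sequentially. apx n k (up (enat k) m \<otimes>\<^bsub>E (enat k)\<^esub> s (enat k)) (up \<infinity> m \<otimes>\<^bsub>E \<infinity>\<^esub> s \<infinity>)"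
      by (rule eventually_mono) (simp add: W_def)
  qed
next
  assume conv: "conv m s"
  show "continuous_map euclidean (fld_space F) (\<lambda>i. (i, s i))"
    unfolding continuous_map_def
  proof (intro conjI allI impI)
    show "(\<lambda>i. (i, s i)) \<in> topspace euclidean \<rightarrow> topspace (fld_space F)" using s by (simp add: topspace_fld_space)
    fix U assume U: "openin (fld_space F) U"
    have "\<forall>\<^sub>F k in sequentially. (enat k, s (enat k)) \<in> U" if inU: "(\<infinity>, s \<infinity>) \<in> U"
    proof -
      obtain n where n: "\<forall>\<^sub>F k in sequentially. \<forall>y\<in>carrier (E (enat k)).
          apx n k (up (enat k) m \<otimes>\<^bsub>E (enat k)\<^esub> y) (up \<infinity> m \<otimes>\<^bsub>E \<infinity>\<^esub> s \<infinity>) \<longrightarrow> (enat k, y) \<in> U"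
        using fld_open_infinity[OF U inU m] by blast
      have "\<forall>\<^sub>F k in sequentially. apx n k (up (enat k) m \<otimes>\<^bsub>E (enat k)\<^esub> s (enat k)) (up \<infinity> m \<otimes>\<^bsub>E \<infinity>\<^esub> s \<infinity>)"
        using conv unfolding conv_def by blast
      with n show ?thesis by eventually_elim (use s in blast)
    qed
    then show "openin euclidean {i \<in> topspace euclidean. (i, s i) \<in> U}"
      by (simp add: open_enat_iff_eventually)
  qed
qed

lemma section_iff: "s \<in> carrier A \<longleftrightarrow> (\<forall>i. s i \<in> carrier (E i)) \<and> (\<exists>m. conv m s)"
proof
  assume s: "s \<in> carrier A"
  then have c: "\<And>i. s i \<in> carrier (E i)" by (rule A_closed)
  obtain m where "up \<infinity> m \<otimes>\<^bsub>E \<infinity>\<^esub> s \<infinity> \<in> B \<infinity> 0" using up_bound[OF c] by blast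
  then show "(\<forall>i. s i \<in> carrier (E i)) \<and> (\<exists>m. conv m s)"
    using continuous_section_iff[OF c] s c by (auto simp: section_ring_def)
next
  assume s: "(\<forall>i. s i \<in> carrier (E i)) \<and> (\<exists>m. conv m s)"
  then obtain m where m: "conv m s" by blast
  then have "up \<infinity> m \<otimes>\<^bsub>E \<infinity>\<^esub> s \<infinity> \<in> B \<infinity> 0" unfolding conv_def by blast
  then show "s \<in> carrier A"
    using continuous_section_iff[of s m] s m by (auto simp: section_ring_def)
qed

lemma section_conv:
  assumes "s \<in> carrier A" "up \<infinity> m \<otimes>\<^bsub>E \<infinity>\<^esub> s \<infinity> \<in> B \<infinity> 0"
  shows "conv m s"
  using continuous_section_iff[of s m] assms by (auto simp: section_ring_def)

end

text \<open>The sum over the finitely many exceptional indices dominates each of their bounds. This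
  is how compactness of the index space enters uniform estimates.\<close>

lemma eventually_sequentially_enat_bound:
  assumes "\<And>k. P k (b k)" "\<And>k m n. \<lbrakk>P k m; m \<le> n\<rbrakk> \<Longrightarrow> P k n" "\<forall>\<^sub>F k in sequentially. P k n0"
  shows "\<exists>n\<ge>n0. \<forall>k::nat. P k (n::nat)"
proof -
  obtain K where K: "\<forall>k\<ge>K. P k n0" using assms(3) by (auto simp: eventually_sequentially)
  define n where "n = n0 + (\<Sum>k<K. b k)"
  have "P k n" for k
  proof (cases "k < K")
    case True
    then have "b k \<le> n" using member_le_sum[of k "{..<K}" b] by (simp add: n_def)
    then show ?thesis using assms(1,2) by blast
  next
    case False
    then show ?thesis using K assms(2)[of k n0 n] by (simp add: n_def)
  qed
  then show ?thesis by (intro exI[of _ n]) (simp add: n_def)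
qed

text \<open>A member of the cover that contains \<open>\<infinity>\<close> leaves out only finitely
  many points.\<close>

lemma compact_UNIV_enat: "compact (UNIV :: enat set)"
  unfolding compact_eq_Heine_Borel
proof (intro allI impI)
  fix \<C> :: "enat set set" assume C: "Ball \<C> open \<and> UNIV \<subseteq> \<Union>\<C>"
  then obtain U where U: "U \<in> \<C>" "\<infinity> \<in> U" by blast
  then obtain K where K: "\<forall>k\<ge>K. enat k \<in> U"
    using C by (auto simp: open_enat_iff_eventually eventually_sequentially)
  have "\<forall>k. \<exists>V. V \<in> \<C> \<and> enat k \<in> V" using C by blast
  from choice[OF this] obtain V where V: "\<forall>k. V k \<in> \<C> \<and> enat k \<in> V k" by blast
  have "x \<in> \<Union> (insert U (V ` {..<K}))" for x
  proof (cases x)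
    case (enat k)
    then show ?thesis using K V by (cases "k < K") auto
  qed (use U in auto)
  then show "\<exists>\<C>'\<subseteq>\<C>. finite \<C>' \<and> UNIV \<subseteq> \<Union>\<C>'"
    using U V by (intro exI[of _ "insert U (V ` {..<K})"]) auto
qed

section \<open>The ring of continuous sections\<close>

text \<open>Elements are families extended by zero outside \<open>U\<close>, so the unit is the
  indicator of \<open>U\<close>. The ring of all sections and the rings of sections over open sets
  are then of one kind.\<close>

definition pointwise_ring :: "'a local_fields \<Rightarrow> (enat \<Rightarrow> 'a) set \<Rightarrow> enat set \<Rightarrow> (enat \<Rightarrow> 'a) ring" where
  "pointwise_ring F Z U = \<lparr>carrier = Z, monoid.mult = (\<lambda>s t i. s i \<otimes>\<^bsub>fld F i\<^esub> t i),
     monoid.one = (\<lambda>i. if i \<in> U then \<one>\<^bsub>fld F i\<^esub> else \<zero>\<^bsub>fld F i\<^esub>),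
     ring.zero = (\<lambda>i. \<zero>\<^bsub>fld F i\<^esub>), ring.add = (\<lambda>s t i. s i \<oplus>\<^bsub>fld F i\<^esub> t i)\<rparr>"

context local_field_family
begin

abbreviation pw where "pw \<equiv> pointwise_ring F"

lemma pw_simps [simp]:
  "carrier (pw Z U) = Z" "s \<otimes>\<^bsub>pw Z U\<^esub> t = (\<lambda>i. s i \<otimes>\<^bsub>E i\<^esub> t i)" "s \<oplus>\<^bsub>pw Z U\<^esub> t = (\<lambda>i. s i \<oplus>\<^bsub>E i\<^esub> t i)"
  "\<one>\<^bsub>pw Z U\<^esub> = (\<lambda>i. if i \<in> U then \<one>\<^bsub>E i\<^esub> else \<zero>\<^bsub>E i\<^esub>)" "\<zero>\<^bsub>pw Z U\<^esub> = (\<lambda>i. \<zero>\<^bsub>E i\<^esub>)"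
  by (simp_all add: pointwise_ring_def)

lemma cring_pw:
  assumes c: "\<And>s i. s \<in> Z \<Longrightarrow> s i \<in> carrier (E i)" and supp: "\<And>s i. \<lbrakk>s \<in> Z; i \<notin> U\<rbrakk> \<Longrightarrow> s i = \<zero>\<^bsub>E i\<^esub>"
    and add: "\<And>s t. \<lbrakk>s \<in> Z; t \<in> Z\<rbrakk> \<Longrightarrow> (\<lambda>i. s i \<oplus>\<^bsub>E i\<^esub> t i) \<in> Z"
    and mult: "\<And>s t. \<lbrakk>s \<in> Z; t \<in> Z\<rbrakk> \<Longrightarrow> (\<lambda>i. s i \<otimes>\<^bsub>E i\<^esub> t i) \<in> Z"
    and neg: "\<And>s. s \<in> Z \<Longrightarrow> (\<lambda>i. \<ominus>\<^bsub>E i\<^esub> s i) \<in> Z"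
    and zero: "(\<lambda>i. \<zero>\<^bsub>E i\<^esub>) \<in> Z" and one: "(\<lambda>i. if i \<in> U then \<one>\<^bsub>E i\<^esub> else \<zero>\<^bsub>E i\<^esub>) \<in> Z"
  shows "cring (pw Z U)"
proof (rule cringI)
  show "abelian_group (pw Z U)"
  proof (rule abelian_groupI)
    fix x assume x: "x \<in> carrier (pw Z U)"
    then have "(\<lambda>i. \<ominus>\<^bsub>E i\<^esub> x i) \<in> carrier (pw Z U)" "(\<lambda>i. \<ominus>\<^bsub>E i\<^esub> x i) \<oplus>\<^bsub>pw Z U\<^esub> x = \<zero>\<^bsub>pw Z U\<^esub>"
      using neg c by (simp_all add: dv.K.l_neg)
    then show "\<exists>y\<in>carrier (pw Z U). y \<oplus>\<^bsub>pw Z U\<^esub> x = \<zero>\<^bsub>pw Z U\<^esub>" by blast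
  qed (use add zero c in \<open>simp_all add: dv.K.a_ac\<close>)
  show "comm_monoid (pw Z U)"
  proof (rule comm_monoidI)
    fix x assume x: "x \<in> carrier (pw Z U)"
    have "(\<one>\<^bsub>pw Z U\<^esub> \<otimes>\<^bsub>pw Z U\<^esub> x) i = x i" for i
      using x c[of x i] supp[of x i] by (cases "i \<in> U") simp_all
    then show "\<one>\<^bsub>pw Z U\<^esub> \<otimes>\<^bsub>pw Z U\<^esub> x = x" by (rule ext)
  qed (use mult one c in \<open>simp_all add: dv.K.m_ac\<close>)
qed (use c in \<open>simp add: dv.K.l_distr\<close>)

lemma pw_minus:
  assumes "cring (pw Z U)" "s \<in> Z" "t \<in> Z" "\<And>s i. s \<in> Z \<Longrightarrow> s i \<in> carrier (E i)" "(\<lambda>i. \<ominus>\<^bsub>E i\<^esub> t i) \<in> Z"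
  shows "s \<ominus>\<^bsub>pw Z U\<^esub> t = (\<lambda>i. s i \<ominus>\<^bsub>E i\<^esub> t i)"
proof -
  interpret cring "pw Z U" by fact
  have "\<ominus>\<^bsub>pw Z U\<^esub> t = (\<lambda>i. \<ominus>\<^bsub>E i\<^esub> t i)"
    by (rule minus_equality) (use assms in \<open>simp_all add: dv.K.l_neg\<close>)
  then show ?thesis by (simp add: a_minus_def)
qed

lemma A_eq_pw: "A = pw (carrier A) UNIV"
  by (simp add: pointwise_ring_def section_ring_def)

text \<open>The uniformizers correspond to full precision, so multiplying by more of them keeps the
  relation. Two sections can therefore share one exponent.\<close>

lemma conv_mono:
  assumes "conv m s" "m \<le> m'" "\<And>i. s i \<in> carrier (E i)"
  shows "conv m' s"
proof -
  define d where "d = m' - m"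
  have split: "up i m' \<otimes>\<^bsub>E i\<^esub> s i = up i d \<otimes>\<^bsub>E i\<^esub> (up i m \<otimes>\<^bsub>E i\<^esub> s i)" for i
    using assms(2,3) up_add[of i d m] by (simp add: d_def dv.K.m_assoc)
  have "up i d \<in> B i 0" for i using up_B dv.B_antimono[of 0 "int d"] by simp
  then show ?thesis
    using assms(1) unfolding conv_def split
    by (auto intro: dv.B_mult0 eventually_mono[OF _ apx_up_mult])
qed

lemma conv_common:
  assumes "s \<in> carrier A" "t \<in> carrier A"
  obtains m where "conv m s" "conv m t"
proof -
  obtain m m' where "conv m s" "conv m' t" using assms section_iff by blast
  then have "conv (max m m') s" "conv (max m m') t"
    using conv_mono A_closed assms by (meson max.cobounded1 max.cobounded2)+
  then show ?thesis using that by blast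
qed

lemma A_add: "\<lbrakk>s \<in> carrier A; t \<in> carrier A\<rbrakk> \<Longrightarrow> (\<lambda>i. s i \<oplus>\<^bsub>E i\<^esub> t i) \<in> carrier A"
proof -
  assume st: "s \<in> carrier A" "t \<in> carrier A"
  then obtain m where m: "conv m s" "conv m t" by (rule conv_common)
  have split: "up i m \<otimes>\<^bsub>E i\<^esub> (s i \<oplus>\<^bsub>E i\<^esub> t i) = up i m \<otimes>\<^bsub>E i\<^esub> s i \<oplus>\<^bsub>E i\<^esub> up i m \<otimes>\<^bsub>E i\<^esub> t i" for i
    using st A_closed by (simp add: dv.K.r_distr)
  have "conv m (\<lambda>i. s i \<oplus>\<^bsub>E i\<^esub> t i)"
    unfolding conv_def split
  proof (intro conjI allI)
    show "up \<infinity> m \<otimes>\<^bsub>E \<infinity>\<^esub> s \<infinity> \<oplus>\<^bsub>E \<infinity>\<^esub> up \<infinity> m \<otimes>\<^bsub>E \<infinity>\<^esub> t \<infinity> \<in> B \<infinity> 0"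
      using m unfolding conv_def by (simp add: dv.B_add)
    fix n
    have "\<forall>\<^sub>F k in sequentially. apx n k (up (enat k) m \<otimes>\<^bsub>E (enat k)\<^esub> s (enat k)) (up \<infinity> m \<otimes>\<^bsub>E \<infinity>\<^esub> s \<infinity>)"
      "\<forall>\<^sub>F k in sequentially. apx n k (up (enat k) m \<otimes>\<^bsub>E (enat k)\<^esub> t (enat k)) (up \<infinity> m \<otimes>\<^bsub>E \<infinity>\<^esub> t \<infinity>)"
      using m unfolding conv_def by blast+
    then show "\<forall>\<^sub>F k in sequentially. apx n k (up (enat k) m \<otimes>\<^bsub>E (enat k)\<^esub> s (enat k) \<oplus>\<^bsub>E (enat k)\<^esub> up (enat k) m \<otimes>\<^bsub>E (enat k)\<^esub> t (enat k))
        (up \<infinity> m \<otimes>\<^bsub>E \<infinity>\<^esub> s \<infinity> \<oplus>\<^bsub>E \<infinity>\<^esub> up \<infinity> m \<otimes>\<^bsub>E \<infinity>\<^esub> t \<infinity>)"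
      by eventually_elim (rule apx_add)
  qed
  then show ?thesis using st A_closed by (auto simp: section_iff)
qed

lemma A_mult: "\<lbrakk>s \<in> carrier A; t \<in> carrier A\<rbrakk> \<Longrightarrow> (\<lambda>i. s i \<otimes>\<^bsub>E i\<^esub> t i) \<in> carrier A"
proof -
  assume st: "s \<in> carrier A" "t \<in> carrier A"
  then obtain m where m: "conv m s" "conv m t" by (rule conv_common)
  \<comment> \<open>Both factors need the exponent \<open>m\<close> to become integral, so the
    product needs twice as much.\<close>
  have split: "up i (m + m) \<otimes>\<^bsub>E i\<^esub> (s i \<otimes>\<^bsub>E i\<^esub> t i) = (up i m \<otimes>\<^bsub>E i\<^esub> s i) \<otimes>\<^bsub>E i\<^esub> (up i m \<otimes>\<^bsub>E i\<^esub> t i)" for i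
    using st A_closed by (simp add: up_add dv.K.m_ac)
  have "conv (m + m) (\<lambda>i. s i \<otimes>\<^bsub>E i\<^esub> t i)"
    unfolding conv_def split
  proof (intro conjI allI)
    show "(up \<infinity> m \<otimes>\<^bsub>E \<infinity>\<^esub> s \<infinity>) \<otimes>\<^bsub>E \<infinity>\<^esub> (up \<infinity> m \<otimes>\<^bsub>E \<infinity>\<^esub> t \<infinity>) \<in> B \<infinity> 0"
      using m unfolding conv_def by (simp add: dv.B_mult0)
    fix n
    have "\<forall>\<^sub>F k in sequentially. apx n k (up (enat k) m \<otimes>\<^bsub>E (enat k)\<^esub> s (enat k)) (up \<infinity> m \<otimes>\<^bsub>E \<infinity>\<^esub> s \<infinity>)"
      "\<forall>\<^sub>F k in sequentially. apx n k (up (enat k) m \<otimes>\<^bsub>E (enat k)\<^esub> t (enat k)) (up \<infinity> m \<otimes>\<^bsub>E \<infinity>\<^esub> t \<infinity>)"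
      using m unfolding conv_def by blast+
    then show "\<forall>\<^sub>F k in sequentially. apx n k ((up (enat k) m \<otimes>\<^bsub>E (enat k)\<^esub> s (enat k)) \<otimes>\<^bsub>E (enat k)\<^esub> (up (enat k) m \<otimes>\<^bsub>E (enat k)\<^esub> t (enat k)))
        ((up \<infinity> m \<otimes>\<^bsub>E \<infinity>\<^esub> s \<infinity>) \<otimes>\<^bsub>E \<infinity>\<^esub> (up \<infinity> m \<otimes>\<^bsub>E \<infinity>\<^esub> t \<infinity>))"
      by eventually_elim (rule apx_mult)
  qed
  then show ?thesis using st A_closed by (auto simp: section_iff)
qed

lemma conv0I:
  assumes "\<And>i. s i \<in> carrier (E i)" "\<And>n. \<forall>\<^sub>F k in sequentially. apx n k (s (enat k)) (s \<infinity>)"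
  shows "s \<in> carrier A"
proof -
  have up0: "up i 0 \<otimes>\<^bsub>E i\<^esub> s i = s i" for i using assms(1) by simp
  \<comment> \<open>\<open>apx\<close> includes integrality of the element at
    \<open>\<infinity>\<close>, so a single index at which it holds is enough.\<close>
  obtain k where "apx 0 k (s (enat k)) (s \<infinity>)"
    using eventually_happens'[OF sequentially_bot assms(2)[of 0]] by blast
  then have "conv 0 s" unfolding conv_def up0 using assms(2) apx_carrier by blast
  then show ?thesis using assms(1) section_iff by blast
qed

lemma A_zero: "(\<lambda>i. \<zero>\<^bsub>E i\<^esub>) \<in> carrier A"
  by (rule conv0I) (auto intro: eventually_mono[OF eventually_e apx_zero])

lemma A_one: "(\<lambda>i. \<one>\<^bsub>E i\<^esub>) \<in> carrier A"
  by (rule conv0I) (auto intro: eventually_mono[OF eventually_e rho_apx[OF rho_one]])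

lemma A_u: "u \<in> carrier A"
  by (rule conv0I) (auto intro: eventually_mono[OF eventually_e rho_apx[OF rho_u]])

text \<open>With this, closure under negation follows from closure under products.\<close>

lemma A_minus_one: "(\<lambda>i. \<ominus>\<^bsub>E i\<^esub> \<one>\<^bsub>E i\<^esub>) \<in> carrier A"
proof (rule conv0I)
  fix n
  show "\<forall>\<^sub>F k in sequentially. apx n k (\<ominus>\<^bsub>E (enat k)\<^esub> \<one>\<^bsub>E (enat k)\<^esub>) (\<ominus>\<^bsub>E \<infinity>\<^esub> \<one>\<^bsub>E \<infinity>\<^esub>)"
    using eventually_e[of n]
  proof eventually_elim
    case (elim k)
    then have "apx n k (\<zero>\<^bsub>E (enat k)\<^esub> \<ominus>\<^bsub>E (enat k)\<^esub> \<one>\<^bsub>E (enat k)\<^esub>) (\<zero>\<^bsub>E \<infinity>\<^esub> \<ominus>\<^bsub>E \<infinity>\<^esub> \<one>\<^bsub>E \<infinity>\<^esub>)"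
      by (intro apx_minus apx_zero rho_apx rho_one)
    then show ?case by (simp add: dv.K.minus_eq)
  qed
qed simp

lemma A_neg: "s \<in> carrier A \<Longrightarrow> (\<lambda>i. \<ominus>\<^bsub>E i\<^esub> s i) \<in> carrier A"
  using A_mult[OF A_minus_one, of s] A_closed[of s] by (simp add: dv.K.l_minus)

lemma cring_A: "cring A"
  by (subst A_eq_pw, rule cring_pw) (auto simp: A_closed A_add A_mult A_neg A_zero A_one)

sublocale A: cring A by (rule cring_A)

lemma A_simps:
  "s \<otimes>\<^bsub>A\<^esub> t = (\<lambda>i. s i \<otimes>\<^bsub>E i\<^esub> t i)" "s \<oplus>\<^bsub>A\<^esub> t = (\<lambda>i. s i \<oplus>\<^bsub>E i\<^esub> t i)"
  "\<one>\<^bsub>A\<^esub> = (\<lambda>i. \<one>\<^bsub>E i\<^esub>)" "\<zero>\<^bsub>A\<^esub> = (\<lambda>i. \<zero>\<^bsub>E i\<^esub>)"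
  by (simp_all add: section_ring_def)

lemma A_minus: "\<lbrakk>s \<in> carrier A; t \<in> carrier A\<rbrakk> \<Longrightarrow> s \<ominus>\<^bsub>A\<^esub> t = (\<lambda>i. s i \<ominus>\<^bsub>E i\<^esub> t i)"
  using pw_minus[of "carrier A" UNIV s t] cring_A A_closed A_neg A_eq_pw by metis

lemma A_pow: "s \<in> carrier A \<Longrightarrow> s [^]\<^bsub>A\<^esub> (n::nat) = (\<lambda>i. s i [^]\<^bsub>E i\<^esub> n)"
  by (induction n) (simp_all add: A_simps)

lemma A_up: "(\<lambda>i. up i n) \<in> carrier A"
  using A.nat_pow_closed[OF A_u, of n] A_pow[OF A_u, of n] by simp

text \<open>\<open>conv\<close> involves only the value at \<open>\<infinity>\<close> and the values
  at all large indices, so the remaining values can be altered at will.\<close>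

lemma A_glue:
  assumes a: "a \<in> carrier A" and g: "\<And>i. g i \<in> carrier (E i)" "g \<infinity> = a \<infinity>"
    "\<forall>\<^sub>F k in sequentially. g (enat k) = a (enat k)"
  shows "g \<in> carrier A"
proof -
  obtain m where m: "conv m a" using a section_iff by blast
  have "conv m g"
    unfolding conv_def
  proof (intro conjI allI)
    show "up \<infinity> m \<otimes>\<^bsub>E \<infinity>\<^esub> g \<infinity> \<in> B \<infinity> 0" using m g(2) unfolding conv_def by simp
    fix n
    have "\<forall>\<^sub>F k in sequentially. apx n k (up (enat k) m \<otimes>\<^bsub>E (enat k)\<^esub> a (enat k)) (up \<infinity> m \<otimes>\<^bsub>E \<infinity>\<^esub> a \<infinity>)"
      using m unfolding conv_def by blast
    with g(3) show "\<forall>\<^sub>F k in sequentially. apx n k (up (enat k) m \<otimes>\<^bsub>E (enat k)\<^esub> g (enat k)) (up \<infinity> m \<otimes>\<^bsub>E \<infinity>\<^esub> g \<infinity>)"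
      by eventually_elim (simp add: g(2))
  qed
  then show ?thesis using g(1) section_iff by blast
qed

definition cut :: "enat set \<Rightarrow> (enat \<Rightarrow> 'a) \<Rightarrow> enat \<Rightarrow> 'a" where
  "cut C a = (\<lambda>i. if i \<in> C then a i else \<zero>\<^bsub>E i\<^esub>)"

abbreviation clopen :: "enat set \<Rightarrow> bool" where "clopen C \<equiv> open C \<and> open (- C)"

lemma clopen_iff: "clopen C \<longleftrightarrow>
    (if \<infinity> \<in> C then \<forall>\<^sub>F k in sequentially. enat k \<in> C else \<forall>\<^sub>F k in sequentially. enat k \<notin> C)"
  by (simp add: open_enat_iff_eventually)

text \<open>\<open>g\<close> itself need not be a section. If \<open>C\<close> contains
  \<open>\<infinity>\<close> it only has to agree with a section \<open>a\<close> there and at all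
  large indices; if not, \<open>C\<close> is finite and there is nothing to compare.\<close>

lemma A_cut_local:
  assumes C: "clopen C" and g: "\<And>i. i \<in> C \<Longrightarrow> g i \<in> carrier (E i)"
    and a: "\<infinity> \<in> C \<Longrightarrow> a \<in> carrier A \<and> a \<infinity> = g \<infinity> \<and> (\<forall>\<^sub>F k in sequentially. g (enat k) = a (enat k))"
  shows "cut C g \<in> carrier A"
proof (cases "\<infinity> \<in> C")
  case True
  have cut_closed: "cut C g i \<in> carrier (E i)" for i using g by (simp add: cut_def)
  have aA: "a \<in> carrier A" and inf: "cut C g \<infinity> = a \<infinity>" and ev: "\<forall>\<^sub>F k in sequentially. g (enat k) = a (enat k)"
    using a[OF True] True by (simp_all add: cut_def)
  have "\<forall>\<^sub>F k in sequentially. enat k \<in> C" using C True by (simp add: clopen_iff)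
  with ev have "\<forall>\<^sub>F k in sequentially. cut C g (enat k) = a (enat k)"
    by eventually_elim (simp add: cut_def)
  then show ?thesis by (rule A_glue[OF aA cut_closed inf])
next
  case False
  have cut_closed: "cut C g i \<in> carrier (E i)" for i using g by (simp add: cut_def)
  have "\<forall>\<^sub>F k in sequentially. enat k \<notin> C" using C False by (simp add: clopen_iff)
  then have "\<forall>\<^sub>F k in sequentially. cut C g (enat k) = \<zero>\<^bsub>E (enat k)\<^esub>"
    by eventually_elim (simp add: cut_def)
  moreover have "cut C g \<infinity> = \<zero>\<^bsub>E \<infinity>\<^esub>" using False by (simp add: cut_def)
  ultimately show ?thesis using A_glue[OF A_zero cut_closed] by blast
qed

lemma A_cut: "\<lbrakk>clopen C; a \<in> carrier A\<rbrakk> \<Longrightarrow> cut C a \<in> carrier A"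
  by (rule A_cut_local[of C a a]) (auto simp: A_closed)

lemma clopen_point: "clopen {enat k}"
  by (simp add: clopen_iff eventually_sequentially)

text \<open>The precision \<open>m + n\<close> is the one for the elements scaled by the
  \<open>m\<close>-th power. If the sum is negative, \<open>nat\<close> turns it into 0, which still
  satisfies the bound in \<open>apx_B\<close>.\<close>

lemma A_B:
  assumes "a \<in> carrier A"
  shows "\<forall>\<^sub>F k in sequentially. a (enat k) \<in> B (enat k) n \<longleftrightarrow> a \<infinity> \<in> B \<infinity> n"
proof -
  obtain m where m: "conv m a" using assms section_iff by blast
  then have "\<forall>\<^sub>F k in sequentially. apx (nat (int m + n)) k (up (enat k) m \<otimes>\<^bsub>E (enat k)\<^esub> a (enat k)) (up \<infinity> m \<otimes>\<^bsub>E \<infinity>\<^esub> a \<infinity>)"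
    unfolding conv_def by blast
  then show ?thesis
  proof eventually_elim
    case (elim k)
    from apx_B[OF elim, of "int m + n"] show ?case
      using up_mult_B_iff[OF A_closed[OF assms], of _ m n] by simp
  qed
qed

text \<open>Let \<open>v\<close> be the value at \<open>\<infinity>\<close>. The balls of index
  \<open>v\<close> and \<open>v + 1\<close> pin a value down, and by \<open>A_B\<close> membership
  in each is eventually the same as at \<open>\<infinity>\<close>.\<close>

lemma A_v:
  assumes a: "a \<in> carrier A" "a \<infinity> \<noteq> \<zero>\<^bsub>E \<infinity>\<^esub>"
  shows "\<forall>\<^sub>F k in sequentially. a (enat k) \<noteq> \<zero>\<^bsub>E (enat k)\<^esub> \<and> vl F (enat k) (a (enat k)) = vl F \<infinity> (a \<infinity>)"
  using A_B[OF a(1), of "vl F \<infinity> (a \<infinity>)"] A_B[OF a(1), of "vl F \<infinity> (a \<infinity>) + 1"]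
proof eventually_elim
  case (elim k)
  then show ?case using a A_closed[OF a(1)] by (auto simp: vball_def)
qed

text \<open>Put \<open>Z = u^m a\<close> and \<open>Y = u^c / a\<close>, whose product is
  \<open>u^(m + c)\<close>. If \<open>y\<close> lifts \<open>Y \<infinity>\<close>, then
  \<open>Z y\<close> and \<open>Z Y\<close> agree to precision \<open>n + c\<close>; dividing by
  \<open>Z\<close>, whose value is eventually \<open>c\<close> by \<open>A_v\<close>, leaves
  precision \<open>n\<close>.\<close>

lemma A_inverse:
  assumes a: "a \<in> carrier A" "\<And>i. a i \<noteq> \<zero>\<^bsub>E i\<^esub>"
  shows "(\<lambda>i. inv\<^bsub>E i\<^esub> (a i)) \<in> carrier A"
proof -
  have ac: "a i \<in> carrier (E i)" for i using a(1) by (rule A_closed)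
  have ic: "inv\<^bsub>E i\<^esub> (a i) \<in> carrier (E i)" for i using dv.inv_nonzero[OF ac a(2)] by simp
  obtain m where m: "conv m a" using a section_iff by blast
  have "up \<infinity> m \<otimes>\<^bsub>E \<infinity>\<^esub> a \<infinity> \<in> B \<infinity> 0" using m unfolding conv_def by blast
  moreover have "up \<infinity> m \<otimes>\<^bsub>E \<infinity>\<^esub> a \<infinity> \<noteq> \<zero>\<^bsub>E \<infinity>\<^esub>"
    by (rule dv.mult_nonzero) (use ac a(2) up_nonzero in auto)
  moreover have vX: "vl F \<infinity> (up \<infinity> m \<otimes>\<^bsub>E \<infinity>\<^esub> a \<infinity>) = int m + vl F \<infinity> (a \<infinity>)"
    using dv.val_mult[OF _ ac up_nonzero a(2)] by (simp add: v_up)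
  ultimately have "0 \<le> int m + vl F \<infinity> (a \<infinity>)" by (auto simp: vball_def)
  \<comment> \<open>With this exponent the value of \<open>Y\<close> at \<open>\<infinity>\<close>
    is \<open>m\<close>, so \<open>Y\<close> is integral there.\<close>
  then obtain c where c: "int m + vl F \<infinity> (a \<infinity>) = int c" by (metis nonneg_int_cases)
  define Z where "Z i = up i m \<otimes>\<^bsub>E i\<^esub> a i" for i
  define Y where "Y i = up i c \<otimes>\<^bsub>E i\<^esub> inv\<^bsub>E i\<^esub> (a i)" for i
  have Xc: "Z i \<in> carrier (E i)" and Yc: "Y i \<in> carrier (E i)" for i using ac ic by (auto simp: Z_def Y_def)
  have XY: "Z i \<otimes>\<^bsub>E i\<^esub> Y i = up i (m + c)" for i
  proof -
    have "Z i \<otimes>\<^bsub>E i\<^esub> Y i = (up i m \<otimes>\<^bsub>E i\<^esub> up i c) \<otimes>\<^bsub>E i\<^esub> (a i \<otimes>\<^bsub>E i\<^esub> inv\<^bsub>E i\<^esub> (a i))"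
      using ac[of i] ic[of i] by (simp add: Z_def Y_def dv.K.m_ac)
    then show ?thesis using dv.inv_nonzero[OF ac a(2), of i] by (simp add: up_add)
  qed
  have "vl F \<infinity> (Y \<infinity>) = int m"
    unfolding Y_def using dv.val_mult[OF _ ic up_nonzero dv.inv_nonzero(4)[OF ac a(2)], of \<infinity> c] c
    by (simp add: v_up dv.v_inv[OF ac a(2)])
  then have Y0: "Y \<infinity> \<in> B \<infinity> 0" using Yc by (simp add: vball_def)
  have "conv c (\<lambda>i. inv\<^bsub>E i\<^esub> (a i))"
    unfolding conv_def Y_def[symmetric]
  proof (intro conjI allI Y0)
    fix n
    have "\<forall>\<^sub>F k in sequentially. apx (n + c) k (Z (enat k)) (Z \<infinity>)"
      using m unfolding conv_def Z_def by blast
    then show "\<forall>\<^sub>F k in sequentially. apx n k (Y (enat k)) (Y \<infinity>)"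
      using A_v[OF a(1) a(2)]
    proof eventually_elim
      case (elim k)
      have ek: "n + c \<le> e k" using elim(1) by (simp add: apx_def)
      obtain y where y: "apx (n + c) k y (Y \<infinity>)" using apx_ex[OF ek Y0] by blast
      have yc: "y \<in> carrier (E (enat k))" using apx_carrier[OF y] by simp
      have 1: "apx (n + c) k (Z (enat k) \<otimes>\<^bsub>E (enat k)\<^esub> y) (up \<infinity> (m + c))"
        using apx_mult[OF elim(1) y] XY by simp
      have "Z (enat k) \<otimes>\<^bsub>E (enat k)\<^esub> Y (enat k) \<ominus>\<^bsub>E (enat k)\<^esub> Z (enat k) \<otimes>\<^bsub>E (enat k)\<^esub> y \<in> B (enat k) (int (n + c))"
        unfolding XY by (rule apx_unique_left[OF apx_up[OF ek] 1])
      moreover have "Z (enat k) \<otimes>\<^bsub>E (enat k)\<^esub> Y (enat k) \<ominus>\<^bsub>E (enat k)\<^esub> Z (enat k) \<otimes>\<^bsub>E (enat k)\<^esub> y =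
          Z (enat k) \<otimes>\<^bsub>E (enat k)\<^esub> (Y (enat k) \<ominus>\<^bsub>E (enat k)\<^esub> y)"
        using Xc[of "enat k"] Yc[of "enat k"] yc by (simp add: dv.K.minus_eq dv.K.r_distr dv.K.r_minus)
      moreover have "Z (enat k) \<noteq> \<zero>\<^bsub>E (enat k)\<^esub>"
        unfolding Z_def by (rule dv.mult_nonzero) (use ac a(2) up_nonzero in auto)
      moreover have "vl F (enat k) (Z (enat k)) = int c"
        unfolding Z_def using dv.val_mult[OF _ ac up_nonzero a(2), of "enat k" m] elim(2) c by (simp add: v_up)
      ultimately have "Y (enat k) \<ominus>\<^bsub>E (enat k)\<^esub> y \<in> B (enat k) (int n)"
        using dv.B_mult_iff[OF Xc, of "enat k" "Y (enat k) \<ominus>\<^bsub>E (enat k)\<^esub> y" "int n"] Yc[of "enat k"] yc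
        by (simp add: add.commute)
      then show ?case using apx_close_left[OF apx_le[OF y]] Yc by simp
    qed
  qed
  then show ?thesis using ic section_iff by blast
qed

lemma A_inverse_on:
  assumes C: "clopen C" and a: "a \<in> carrier A" "\<And>i. i \<in> C \<Longrightarrow> a i \<noteq> \<zero>\<^bsub>E i\<^esub>"
  shows "cut C (\<lambda>i. inv\<^bsub>E i\<^esub> (a i)) \<in> carrier A"
proof -
  \<comment> \<open>Filling up with 1 outside \<open>C\<close> reduces to a section without
    zeros.\<close>
  define b where "b i = (if i \<in> C then a i else \<one>\<^bsub>E i\<^esub>)" for i
  have "b = (\<lambda>i. cut C a i \<oplus>\<^bsub>E i\<^esub> cut (- C) (\<lambda>i. \<one>\<^bsub>E i\<^esub>) i)"
    using A_closed[OF a(1)] by (auto simp: b_def cut_def)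
  then have "b \<in> carrier A" using A_add A_cut[OF C a(1)] A_cut[of "- C", OF _ A_one] C by simp
  moreover have "b i \<noteq> \<zero>\<^bsub>E i\<^esub>" for i using a(2) by (simp add: b_def)
  ultimately have "(\<lambda>i. inv\<^bsub>E i\<^esub> (b i)) \<in> carrier A" by (rule A_inverse)
  then have "cut C (\<lambda>i. inv\<^bsub>E i\<^esub> (b i)) \<in> carrier A" by (rule A_cut[OF C])
  moreover have "cut C (\<lambda>i. inv\<^bsub>E i\<^esub> (b i)) = cut C (\<lambda>i. inv\<^bsub>E i\<^esub> (a i))" by (auto simp: cut_def b_def)
  ultimately show ?thesis by simp
qed

text \<open>The common bound at all indices is the point: it provides integral sections through a
  given integral element of one fibre.\<close>

lemma A_lift:
  assumes "x \<in> B i n"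
  shows "\<exists>a\<in>carrier A. a i = x \<and> (\<forall>j. a j \<in> B j n)"
proof (cases i)
  case (enat k)
  have xc: "x \<in> carrier (E i)" using assms by (rule dv.B_carrier)
  define b where "b = cut {enat k} (\<lambda>j. if j = i then x else \<zero>\<^bsub>E j\<^esub>)"
  have "b \<in> carrier A" unfolding b_def by (rule A_cut_local[OF clopen_point]) (use xc enat in auto)
  moreover have "b i = x" "b j \<in> B j n" for j using assms enat by (simp_all add: b_def cut_def)
  ultimately show ?thesis by blast
next
  case infinity
  then have x: "x \<in> B \<infinity> n" "x \<in> carrier (E \<infinity>)" using assms dv.B_carrier by auto
  obtain m where m: "up \<infinity> m \<otimes>\<^bsub>E \<infinity>\<^esub> x \<in> B \<infinity> 0" using up_bound[OF x(2)] by blast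
  have "\<forall>k. \<exists>y. apx (e k) k y (up \<infinity> m \<otimes>\<^bsub>E \<infinity>\<^esub> x)" using apx_ex m by blast
  \<comment> \<open>Lifts are taken at the full precision \<open>e k\<close>, so that one choice
    serves every \<open>n'\<close>.\<close>
  then obtain y where y: "\<And>k. apx (e k) k (y k) (up \<infinity> m \<otimes>\<^bsub>E \<infinity>\<^esub> x)" by metis
  have yc: "y k \<in> carrier (E (enat k))" for k using apx_carrier[OF y] by blast
  define a where "a j = (case j of enat k \<Rightarrow> inv\<^bsub>E j\<^esub> (up j m) \<otimes>\<^bsub>E j\<^esub> y k | \<infinity> \<Rightarrow> x)" for j
  have ac: "a j \<in> carrier (E j)" for j
    using x(2) yc up_cancel(3)[OF yc] by (cases j) (auto simp: a_def)
  have "conv m a"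
    unfolding conv_def
  proof (intro conjI allI)
    show "up \<infinity> m \<otimes>\<^bsub>E \<infinity>\<^esub> a \<infinity> \<in> B \<infinity> 0" using m by (simp add: a_def)
    fix n'
    show "\<forall>\<^sub>F k in sequentially. apx n' k (up (enat k) m \<otimes>\<^bsub>E (enat k)\<^esub> a (enat k)) (up \<infinity> m \<otimes>\<^bsub>E \<infinity>\<^esub> a \<infinity>)"
      using eventually_e[of n']
    proof eventually_elim
      case (elim k)
      have "up (enat k) m \<otimes>\<^bsub>E (enat k)\<^esub> a (enat k) = y k" using up_cancel(2)[OF yc, of k m] by (simp add: a_def)
      then show ?case using apx_le[OF y elim] by (simp add: a_def)
    qed
  qed
  then have aA: "a \<in> carrier A" using ac section_iff by blast
  \<comment> \<open>Values that violate the bound are replaced by zero; by \<open>A_B\<close> only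
    finitely many indices are affected.\<close>
  define g where "g j = (if a j \<in> B j n then a j else \<zero>\<^bsub>E j\<^esub>)" for j
  have "\<forall>\<^sub>F k in sequentially. g (enat k) = a (enat k)"
    using A_B[OF aA, of n] by eventually_elim (use x in \<open>simp add: g_def a_def\<close>)
  moreover have "g j \<in> carrier (E j)" for j using ac by (simp add: g_def)
  moreover have "g \<infinity> = a \<infinity>" using x by (simp add: g_def a_def)
  ultimately have "g \<in> carrier A" using A_glue[OF aA, of g] by blast
  moreover have "g i = x" "g j \<in> B j n" for j using x infinity by (simp_all add: g_def a_def)
  ultimately show ?thesis by blast
qed

lemma A_surj: "x \<in> carrier (E i) \<Longrightarrow> \<exists>a\<in>carrier A. a i = x"
  using dv.B_bound[of x i] A_lift by blast

text \<open>By \<open>A_B\<close> a bound at \<open>\<infinity>\<close> holds at all large indices,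
  and the finitely many others are absorbed by a larger bound.\<close>

lemma A_bounded:
  assumes "a \<in> carrier A"
  shows "\<exists>N::nat. \<forall>i. a i \<in> B i (- int N)"
proof -
  have "\<forall>k. \<exists>b::nat. a (enat k) \<in> B (enat k) (- int b)" using A_closed[OF assms] dv.B_bound by blast
  then obtain b :: "nat \<Rightarrow> nat" where b: "\<And>k. a (enat k) \<in> B (enat k) (- int (b k))" by metis
  obtain n0 :: nat where n0: "a \<infinity> \<in> B \<infinity> (- int n0)" using A_closed[OF assms] dv.B_bound by blast
  have "\<exists>n\<ge>n0. \<forall>k. a (enat k) \<in> B (enat k) (- int n)"
  proof (rule eventually_sequentially_enat_bound[of "\<lambda>k n. a (enat k) \<in> B (enat k) (- int n)" b])
    show "a (enat k) \<in> B (enat k) (- int (b k))" for k by (rule b)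
    show "a (enat k) \<in> B (enat k) (- int n)" if "a (enat k) \<in> B (enat k) (- int m)" "m \<le> n" for k m n
      using dv.B_antimono[OF _ that(1)] that(2) by simp
    show "\<forall>\<^sub>F k in sequentially. a (enat k) \<in> B (enat k) (- int n0)"
      using A_B[OF assms, of "- int n0"] n0 by simp
  qed
  then obtain n where n: "n \<ge> n0" "\<forall>k. a (enat k) \<in> B (enat k) (- int n)" by blast
  have "a i \<in> B i (- int n)" for i
    using n dv.B_antimono[OF _ n0, of "- int n"] by (cases i) auto
  then show ?thesis by blast
qed

text \<open>Limits exist in each fibre, and the uniform Cauchy condition makes the convergence
  uniform. Once \<open>x M\<close> is uniformly close to \<open>y\<close>, the exponent
  \<open>m\<close> that works for \<open>y\<close> at \<open>\<infinity>\<close> also works for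
  \<open>x M\<close>, and \<open>apx\<close> passes from \<open>x M\<close> to \<open>y\<close> on
  both sides.\<close>

lemma A_complete:
  fixes x :: "nat \<Rightarrow> enat \<Rightarrow> 'a"
  assumes x: "\<And>k. x k \<in> carrier A"
    and cauchy: "\<And>n::nat. \<exists>M. \<forall>k\<ge>M. \<forall>l\<ge>M. \<forall>i. x k i \<ominus>\<^bsub>E i\<^esub> x l i \<in> B i (int n)"
  shows "\<exists>y\<in>carrier A. \<forall>n::nat. \<exists>M. \<forall>k\<ge>M. \<forall>i. x k i \<ominus>\<^bsub>E i\<^esub> y i \<in> B i (int n)"
proof -
  have xc: "x k i \<in> carrier (E i)" for k i using x A_closed by blast
  have "\<exists>y\<in>carrier (E i). \<forall>n::nat. \<exists>M. \<forall>k\<ge>M. x k i \<ominus>\<^bsub>E i\<^esub> y \<in> B i (int n)" for i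
    using dv.val_complete[of "\<lambda>k. x k i" i] xc cauchy unfolding val_ideal_eq_vball by blast
  then obtain y where y: "\<And>i. y i \<in> carrier (E i)"
      "\<And>i n. \<exists>M. \<forall>k\<ge>M. x k i \<ominus>\<^bsub>E i\<^esub> y i \<in> B i (int n)" by metis
  have lim: "\<exists>M. \<forall>k\<ge>M. \<forall>i. x k i \<ominus>\<^bsub>E i\<^esub> y i \<in> B i (int n)" for n :: nat
  proof -
    obtain M where M: "\<forall>k\<ge>M. \<forall>l\<ge>M. \<forall>i. x k i \<ominus>\<^bsub>E i\<^esub> x l i \<in> B i (int n)" using cauchy by blast
    have "x k i \<ominus>\<^bsub>E i\<^esub> y i \<in> B i (int n)" if k: "k \<ge> M" for k i
    proof -
      obtain M' where M': "\<forall>k\<ge>M'. x k i \<ominus>\<^bsub>E i\<^esub> y i \<in> B i (int n)" using y(2) by blast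
      have "x k i \<ominus>\<^bsub>E i\<^esub> x (max M M') i \<in> B i (int n)" "x (max M M') i \<ominus>\<^bsub>E i\<^esub> y i \<in> B i (int n)"
        using M M' k by auto
      then show ?thesis using dv.B_minus_trans[OF xc xc y(1)] by blast
    qed
    then show ?thesis by blast
  qed
  obtain M0 where M0: "\<forall>k\<ge>M0. \<forall>i. x k i \<ominus>\<^bsub>E i\<^esub> y i \<in> B i (int 0)" using lim by blast
  obtain m where m: "up \<infinity> m \<otimes>\<^bsub>E \<infinity>\<^esub> y \<infinity> \<in> B \<infinity> 0" using up_bound[OF y(1)] by blast
  have "conv m y"
    unfolding conv_def
  proof (intro conjI allI m)
    fix n
    obtain M where M: "\<forall>k\<ge>M. \<forall>i. x k i \<ominus>\<^bsub>E i\<^esub> y i \<in> B i (int n)" using lim by blast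
    have close: "up i m \<otimes>\<^bsub>E i\<^esub> x M i \<ominus>\<^bsub>E i\<^esub> up i m \<otimes>\<^bsub>E i\<^esub> y i \<in> B i (int n)" for i
      by (rule up_diff_B[OF y(1) xc]) (use M in blast)
    then have close': "up i m \<otimes>\<^bsub>E i\<^esub> y i \<ominus>\<^bsub>E i\<^esub> up i m \<otimes>\<^bsub>E i\<^esub> x M i \<in> B i (int n)" for i
      using dv.B_minus_sym[OF _ _ close, of i] y(1) xc by simp
    have "up \<infinity> m \<otimes>\<^bsub>E \<infinity>\<^esub> x M \<infinity> \<in> B \<infinity> 0"
      using dv.B_close[OF dv.B_antimono[OF _ close, of 0] m] xc by simp
    then have "conv m (x M)" by (rule section_conv[OF x])
    then have "\<forall>\<^sub>F k in sequentially. apx n k (up (enat k) m \<otimes>\<^bsub>E (enat k)\<^esub> x M (enat k)) (up \<infinity> m \<otimes>\<^bsub>E \<infinity>\<^esub> x M \<infinity>)"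
      unfolding conv_def by blast
    then show "\<forall>\<^sub>F k in sequentially. apx n k (up (enat k) m \<otimes>\<^bsub>E (enat k)\<^esub> y (enat k)) (up \<infinity> m \<otimes>\<^bsub>E \<infinity>\<^esub> y \<infinity>)"
    proof eventually_elim
      case (elim k)
      have "apx n k (up (enat k) m \<otimes>\<^bsub>E (enat k)\<^esub> y (enat k)) (up \<infinity> m \<otimes>\<^bsub>E \<infinity>\<^esub> x M \<infinity>)"
        by (rule apx_close_left[OF elim _ close']) (use y(1) in simp)
      then show ?case by (rule apx_close_right[OF _ _ close']) (use y(1) in simp)
    qed
  qed
  then have "y \<in> carrier A" using y(1) section_iff by blast
  then show ?thesis using lim by blast
qed

section \<open>The topology on the ring of sections\<close>

text \<open>Equivalently, the multiples of the \<open>n\<close>-th power of the section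
  \<open>u\<close> by integral sections.\<close>

definition AN :: "nat \<Rightarrow> (enat \<Rightarrow> 'a) set" where
  "AN n = {a \<in> carrier A. \<forall>i. a i \<in> B i (int n)}"

lemma AN_subgroup: "additive_subgroup (AN n) A"
proof (unfold_locales, goal_cases)
  case (4 x)
  then have x: "x \<in> carrier A" by (simp add: AN_def)
  have "inv\<^bsub>add_monoid A\<^esub> x = \<ominus>\<^bsub>A\<^esub> x" by (simp add: a_inv_def)
  also have "\<dots> = \<zero>\<^bsub>A\<^esub> \<ominus>\<^bsub>A\<^esub> x" using x by (simp add: A.minus_eq)
  also have "\<dots> = (\<lambda>i. \<zero>\<^bsub>E i\<^esub> \<ominus>\<^bsub>E i\<^esub> x i)" using A_minus[OF A.zero_closed x] by (simp add: A_simps)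
  finally show ?case
    using 4 A.minus_closed[OF A.zero_closed x] A_minus[OF A.zero_closed x]
    by (simp add: AN_def A_simps dv.B_minus)
qed (auto simp: AN_def A_simps dv.B_add A_add A_zero)

lemma AN_antimono: "m \<le> n \<Longrightarrow> AN n \<subseteq> AN m"
  using dv.B_antimono[of "int m" "int n"] by (auto simp: AN_def)

sublocale AT: subgroup_base A "range AN"
proof (intro subgroup_base.intro subgroup_base_axioms.intro A.ring_axioms)
  fix S T assume "S \<in> range AN" "T \<in> range AN"
  then obtain m n where "S = AN m" "T = AN n" by blast
  then show "\<exists>D\<in>range AN. D \<subseteq> S \<inter> T"
    using AN_antimono[of m "max m n"] AN_antimono[of n "max m n"] by (intro bexI[of _ "AN (max m n)"]) auto
qed (use AN_subgroup in auto)

definition sopen :: "(enat \<Rightarrow> 'a) set \<Rightarrow> bool" where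
  "sopen W \<longleftrightarrow> W \<subseteq> carrier A \<and>
     (\<forall>s\<in>W. \<exists>n::nat. \<forall>t\<in>carrier A. (\<forall>i. t i \<ominus>\<^bsub>E i\<^esub> s i \<in> B i (int n)) \<longrightarrow> t \<in> W)"

lemma minus_AN_iff: "\<lbrakk>s \<in> carrier A; t \<in> carrier A\<rbrakk> \<Longrightarrow> t \<ominus>\<^bsub>A\<^esub> s \<in> AN n \<longleftrightarrow> (\<forall>i. t i \<ominus>\<^bsub>E i\<^esub> s i \<in> B i (int n))"
  using A.minus_closed[of t s] A_minus[of t s] by (simp add: AN_def)

lemma openin_AT: "openin AT.\<tau> W \<longleftrightarrow> sopen W"
proof -
  have "W \<subseteq> carrier A \<Longrightarrow> s \<in> W \<Longrightarrow> (\<exists>D\<in>range AN. \<forall>y\<in>carrier A. y \<ominus>\<^bsub>A\<^esub> s \<in> D \<longrightarrow> y \<in> W) \<longleftrightarrow>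
      (\<exists>n::nat. \<forall>t\<in>carrier A. (\<forall>i. t i \<ominus>\<^bsub>E i\<^esub> s i \<in> B i (int n)) \<longrightarrow> t \<in> W)" for s
    using minus_AN_iff[of s] by (simp add: subset_iff)
  then show ?thesis unfolding AT.openin_iff sopen_def by (intro conj_cong ball_cong refl)
qed

text \<open>Openness of \<open>W\<close> gives an index for each point of \<open>C\<close>
  separately. If \<open>\<infinity>\<close> lies in \<open>C\<close>, the one found there also works
  at all large indices; otherwise \<open>C\<close> misses a neighbourhood of
  \<open>\<infinity>\<close>. Either way finitely many indices remain and a common bound
  exists.\<close>

lemma sopen_basic:
  assumes C: "compact C" and W: "openin (fld_space F) W"
  shows "sopen {s \<in> carrier A. \<forall>i\<in>C. (i, s i) \<in> W}"
  unfolding sopen_def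
proof (intro conjI ballI)
  fix s assume "s \<in> {s \<in> carrier A. \<forall>i\<in>C. (i, s i) \<in> W}"
  then have s: "s \<in> carrier A" "\<And>i. i \<in> C \<Longrightarrow> (i, s i) \<in> W" by auto
  define P where "P i n \<longleftrightarrow> (i \<in> C \<longrightarrow> (\<forall>t\<in>carrier (E i). t \<ominus>\<^bsub>E i\<^esub> s i \<in> B i (int n) \<longrightarrow> (i, t) \<in> W))" for i n
  have mono: "P i n" if "P i m" "m \<le> n" for i m n
    using that dv.B_antimono[of "int m" "int n"] unfolding P_def by (meson of_nat_mono)
  have "\<forall>k. \<exists>n. P (enat k) n" using fld_open_finite[OF W s(2)] unfolding P_def by blast
  then obtain b where b: "\<And>k. P (enat k) (b k)" by metis
  have "\<exists>n0. P \<infinity> n0 \<and> (\<forall>\<^sub>F k in sequentially. P (enat k) n0)"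
  proof (cases "\<infinity> \<in> C")
    case True
    obtain m where m: "up \<infinity> m \<otimes>\<^bsub>E \<infinity>\<^esub> s \<infinity> \<in> B \<infinity> 0" using up_bound[OF A_closed[OF s(1)]] by blast
    obtain n :: nat where n: "\<forall>y\<in>carrier (E \<infinity>). y \<ominus>\<^bsub>E \<infinity>\<^esub> s \<infinity> \<in> B \<infinity> (int n) \<longrightarrow> (\<infinity>, y) \<in> W"
      "\<forall>\<^sub>F k in sequentially. \<forall>y\<in>carrier (E (enat k)).
         apx n k (up (enat k) m \<otimes>\<^bsub>E (enat k)\<^esub> y) (up \<infinity> m \<otimes>\<^bsub>E \<infinity>\<^esub> s \<infinity>) \<longrightarrow> (enat k, y) \<in> W"
      using fld_open_infinity[OF W s(2)[OF True] m] by blast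
    have "\<forall>\<^sub>F k in sequentially. apx n k (up (enat k) m \<otimes>\<^bsub>E (enat k)\<^esub> s (enat k)) (up \<infinity> m \<otimes>\<^bsub>E \<infinity>\<^esub> s \<infinity>)"
      using section_conv[OF s(1) m] unfolding conv_def by blast
    with n(2) have "\<forall>\<^sub>F k in sequentially. P (enat k) n"
    proof eventually_elim
      case (elim k)
      show ?case
        unfolding P_def
      proof (intro impI ballI)
        fix t assume t: "t \<in> carrier (E (enat k))" "t \<ominus>\<^bsub>E (enat k)\<^esub> s (enat k) \<in> B (enat k) (int n)"
        have "apx n k (up (enat k) m \<otimes>\<^bsub>E (enat k)\<^esub> t) (up \<infinity> m \<otimes>\<^bsub>E \<infinity>\<^esub> s \<infinity>)"
          by (rule apx_close_left[OF elim(2) _ up_diff_B[OF A_closed[OF s(1)] t]]) (use t in simp)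
        then show "(enat k, t) \<in> W" using elim(1) t(1) by blast
      qed
    qed
    then show ?thesis using n(1) unfolding P_def by blast
  next
    case False
    have "open (- C)" using compact_imp_closed[OF C] by (simp add: open_closed)
    then have "\<forall>\<^sub>F k in sequentially. enat k \<notin> C" using False by (simp add: open_enat_iff_eventually)
    then have "\<forall>\<^sub>F k in sequentially. P (enat k) 0" by eventually_elim (simp add: P_def)
    then show ?thesis using False unfolding P_def by blast
  qed
  then obtain n0 where n0: "P \<infinity> n0" "\<forall>\<^sub>F k in sequentially. P (enat k) n0" by blast
  have "\<exists>n\<ge>n0. \<forall>k. P (enat k) n"
    by (rule eventually_sequentially_enat_bound[of "\<lambda>k. P (enat k)" b, OF b _ n0(2)]) (rule mono)
  then obtain n where n: "n \<ge> n0" "\<forall>k. P (enat k) n" by blast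
  have P: "P i n" for i using n mono[OF n0(1)] by (cases i) auto
  show "\<exists>n::nat. \<forall>t\<in>carrier A. (\<forall>i. t i \<ominus>\<^bsub>E i\<^esub> s i \<in> B i (int n)) \<longrightarrow> t \<in> {s \<in> carrier A. \<forall>i\<in>C. (i, s i) \<in> W}"
  proof (intro exI[of _ n] ballI impI)
    fix t assume t: "t \<in> carrier A" "\<forall>i. t i \<ominus>\<^bsub>E i\<^esub> s i \<in> B i (int n)"
    then show "t \<in> {s \<in> carrier A. \<forall>i\<in>C. (i, s i) \<in> W}" using P A_closed[OF t(1)] unfolding P_def by blast
  qed
qed auto

text \<open>Over \<open>\<infinity>\<close> the precision is \<open>m' + n\<close> because a
  difference in the \<open>n\<close>-th power moves into the power \<open>m' + n\<close> after
  scaling. The section \<open>s\<close> converges with the same \<open>m'\<close> since it is close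
  to \<open>y\<close> at \<open>\<infinity>\<close>.\<close>

lemma openin_translate:
  assumes s: "s \<in> carrier A"
  shows "openin (fld_space F) {(i, y). y \<in> carrier (E i) \<and> y \<ominus>\<^bsub>E i\<^esub> s i \<in> B i (int n)}" (is "openin _ ?V")
proof (rule openin_fld_spaceI)
  have sc: "s i \<in> carrier (E i)" for i using s by (rule A_closed)
  have near: "(i, z) \<in> ?V" if "(i, y) \<in> ?V" "z \<in> carrier (E i)" "z \<ominus>\<^bsub>E i\<^esub> y \<in> B i (int n)" for i y z
    using that dv.B_minus_trans[OF that(2) _ sc that(3)] by simp
  {
    fix i y assume "(i, y) \<in> ?V" then show "y \<in> carrier (E i)" by simp
  }
  {
    fix k y assume "(enat k, y) \<in> ?V"
    then show "\<exists>n'::nat. \<forall>z\<in>carrier (E (enat k)). z \<ominus>\<^bsub>E (enat k)\<^esub> y \<in> B (enat k) (int n') \<longrightarrow> (enat k, z) \<in> ?V"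
      using near by blast
  }
  {
    fix y m' assume y: "(\<infinity>, y) \<in> ?V" and m': "up \<infinity> m' \<otimes>\<^bsub>E \<infinity>\<^esub> y \<in> B \<infinity> 0"
    then have yc: "y \<in> carrier (E \<infinity>)" "y \<ominus>\<^bsub>E \<infinity>\<^esub> s \<infinity> \<in> B \<infinity> (int n)" by auto
    have "up \<infinity> m' \<otimes>\<^bsub>E \<infinity>\<^esub> y \<ominus>\<^bsub>E \<infinity>\<^esub> up \<infinity> m' \<otimes>\<^bsub>E \<infinity>\<^esub> s \<infinity> \<in> B \<infinity> (int n)"
      by (rule up_diff_B[OF sc yc])
    then have "up \<infinity> m' \<otimes>\<^bsub>E \<infinity>\<^esub> s \<infinity> \<ominus>\<^bsub>E \<infinity>\<^esub> up \<infinity> m' \<otimes>\<^bsub>E \<infinity>\<^esub> y \<in> B \<infinity> (int n)"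
      using dv.B_minus_sym yc(1) sc by simp
    then have "up \<infinity> m' \<otimes>\<^bsub>E \<infinity>\<^esub> s \<infinity> \<in> B \<infinity> 0"
      using dv.B_close[OF dv.B_antimono[of 0 "int n"] m'] sc by simp
    then have conv: "conv m' s" by (rule section_conv[OF s])
    have "\<forall>\<^sub>F k in sequentially. \<forall>z\<in>carrier (E (enat k)).
         apx (m' + n) k (up (enat k) m' \<otimes>\<^bsub>E (enat k)\<^esub> z) (up \<infinity> m' \<otimes>\<^bsub>E \<infinity>\<^esub> y) \<longrightarrow> (enat k, z) \<in> ?V"
      using conv[unfolded conv_def, THEN conjunct2, rule_format, of "m' + n"]
    proof eventually_elim
      case (elim k)
      show ?case
      proof (intro ballI impI)
        fix z assume z: "z \<in> carrier (E (enat k))"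
          "apx (m' + n) k (up (enat k) m' \<otimes>\<^bsub>E (enat k)\<^esub> z) (up \<infinity> m' \<otimes>\<^bsub>E \<infinity>\<^esub> y)"
        have "apx (m' + n) k (up (enat k) m' \<otimes>\<^bsub>E (enat k)\<^esub> (z \<ominus>\<^bsub>E (enat k)\<^esub> s (enat k))) (up \<infinity> m' \<otimes>\<^bsub>E \<infinity>\<^esub> (y \<ominus>\<^bsub>E \<infinity>\<^esub> s \<infinity>))"
          using apx_minus[OF z(2) elim] z(1) yc(1) sc by (simp add: up_minus)
        from apx_B[OF this, of "int m' + int n"]
        have "z \<ominus>\<^bsub>E (enat k)\<^esub> s (enat k) \<in> B (enat k) (int n)"
          using up_mult_B_iff[of "z \<ominus>\<^bsub>E (enat k)\<^esub> s (enat k)"] up_mult_B_iff[of "y \<ominus>\<^bsub>E \<infinity>\<^esub> s \<infinity>"] z(1) yc sc by simp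
        then show "(enat k, z) \<in> ?V" using z(1) by simp
      qed
    qed
    moreover have "\<forall>z\<in>carrier (E \<infinity>). z \<ominus>\<^bsub>E \<infinity>\<^esub> y \<in> B \<infinity> (int (m' + n)) \<longrightarrow> (\<infinity>, z) \<in> ?V"
    proof (intro ballI impI)
      fix z assume z: "z \<in> carrier (E \<infinity>)" "z \<ominus>\<^bsub>E \<infinity>\<^esub> y \<in> B \<infinity> (int (m' + n))"
      show "(\<infinity>, z) \<in> ?V" by (rule near[OF y z(1) dv.B_antimono[OF _ z(2)]]) simp
    qed
    ultimately show "\<exists>n'::nat. (\<forall>z\<in>carrier (E \<infinity>). z \<ominus>\<^bsub>E \<infinity>\<^esub> y \<in> B \<infinity> (int n') \<longrightarrow> (\<infinity>, z) \<in> ?V) \<and>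
      (\<forall>\<^sub>F k in sequentially. \<forall>z\<in>carrier (E (enat k)).
         apx n' k (up (enat k) m' \<otimes>\<^bsub>E (enat k)\<^esub> z) (up \<infinity> m' \<otimes>\<^bsub>E \<infinity>\<^esub> y) \<longrightarrow> (enat k, z) \<in> ?V)"
      by blast
  }
qed

abbreviation ST where "ST \<equiv> section_topology F"

text \<open>The whole index space is compact, so the compact-open topology is that of uniform
  convergence with respect to the valuations.\<close>

lemma section_topology_eq: "ST = AT.\<tau>"
  unfolding topology_eq
proof (intro allI iffI)
  fix W assume "openin ST W"
  then have "generate_topology_on {{s \<in> carrier A. \<forall>i\<in>C. (i, s i) \<in> W} | C W. compact C \<and> openin (fld_space F) W} W"
    unfolding section_topology_def by (rule openin_topology_generated_by)
  then show "openin AT.\<tau> W"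
  proof (induction rule: generate_topology_on.induct)
    case (UN K)
    show ?case by (rule openin_Union) (rule UN)
  next
    case (Basis s)
    then show ?case unfolding openin_AT using sopen_basic by blast
  qed auto
next
  fix W assume W: "openin AT.\<tau> W"
  have "\<exists>G. openin ST G \<and> s \<in> G \<and> G \<subseteq> W" if sW: "s \<in> W" for s
  proof -
    from W sW obtain n :: nat where sA: "s \<in> carrier A"
      and n: "\<forall>t\<in>carrier A. (\<forall>i. t i \<ominus>\<^bsub>E i\<^esub> s i \<in> B i (int n)) \<longrightarrow> t \<in> W"
      unfolding openin_AT sopen_def by blast
    define V where "V = {(i, y). y \<in> carrier (E i) \<and> y \<ominus>\<^bsub>E i\<^esub> s i \<in> B i (int n)}"
    have "openin (fld_space F) V" unfolding V_def by (rule openin_translate[OF sA])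
    then have "openin ST {t \<in> carrier A. \<forall>i\<in>UNIV. (i, t i) \<in> V}"
      unfolding section_topology_def using compact_UNIV_enat by (intro topology_generated_by_Basis) blast
    moreover have "s \<in> {t \<in> carrier A. \<forall>i\<in>UNIV. (i, t i) \<in> V}"
      using sA A_closed[OF sA] by (simp add: V_def dv.minus_self)
    moreover have "{t \<in> carrier A. \<forall>i\<in>UNIV. (i, t i) \<in> V} \<subseteq> W" using n by (auto simp: V_def)
    ultimately show ?thesis by blast
  qed
  then show "openin ST W" by (subst openin_subopen) blast
qed

lemma AN_mult: "\<lbrakk>a \<in> AN m; b \<in> AN n\<rbrakk> \<Longrightarrow> a \<otimes>\<^bsub>A\<^esub> b \<in> AN (m + n)"
  using dv.B_mult by (auto simp: AN_def A_simps A_mult)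

text \<open>Every neighbourhood of zero contains a power of \<open>u\<close>, so boundedness of all
  powers of \<open>a\<close> gives one lower bound for all their values.\<close>

lemma power_bounded_eq: "power_bounded A ST = AN 0"
proof (intro subset_antisym subsetI)
  fix a assume a: "a \<in> AN 0"
  then have aA: "a \<in> carrier A" by (simp add: AN_def)
  have pow: "a [^]\<^bsub>A\<^esub> (n::nat) \<in> AN 0" for n
  proof (induction n)
    case (Suc n)
    then show ?case using AN_mult[OF _ a, of "a [^]\<^bsub>A\<^esub> n" 0] by simp
  qed (simp add: AN_def A_simps A_one)
  have "bounded_subset A ST (range (\<lambda>n::nat. a [^]\<^bsub>A\<^esub> n))"
    unfolding bounded_subset_def
  proof (intro conjI allI impI)
    show "range (\<lambda>n::nat. a [^]\<^bsub>A\<^esub> n) \<subseteq> carrier A" using aA by auto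
    fix U assume U: "openin ST U \<and> \<zero>\<^bsub>A\<^esub> \<in> U"
    then obtain D where "D \<in> range AN" "\<forall>y\<in>carrier A. y \<ominus>\<^bsub>A\<^esub> \<zero>\<^bsub>A\<^esub> \<in> D \<longrightarrow> y \<in> U"
      unfolding section_topology_eq AT.openin_iff by blast
    then obtain n where n: "\<forall>y\<in>carrier A. y \<ominus>\<^bsub>A\<^esub> \<zero>\<^bsub>A\<^esub> \<in> AN n \<longrightarrow> y \<in> U" by blast
    have sub: "AN n \<subseteq> U"
    proof
      fix y assume y: "y \<in> AN n"
      then have "y \<in> carrier A" by (simp add: AN_def)
      then show "y \<in> U" using n y by (simp add: A.minus_eq)
    qed
    have "openin ST (AN n)" unfolding section_topology_eq using AT.openin_subgroup_iff[OF AN_subgroup] by blast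
    moreover have "\<zero>\<^bsub>A\<^esub> \<in> AN n" using AN_subgroup by (rule additive_subgroup.zero_closed)
    moreover have "x \<otimes>\<^bsub>A\<^esub> s \<in> U" if "x \<in> AN n" "s \<in> range (\<lambda>n::nat. a [^]\<^bsub>A\<^esub> n)" for x s
      using AN_mult[OF that(1), of s 0] pow that(2) sub by auto
    ultimately show "\<exists>V. openin ST V \<and> \<zero>\<^bsub>A\<^esub> \<in> V \<and> (\<forall>x\<in>V. \<forall>s\<in>range (\<lambda>n::nat. a [^]\<^bsub>A\<^esub> n). x \<otimes>\<^bsub>A\<^esub> s \<in> U)" by blast
  qed
  then show "a \<in> power_bounded A ST" using aA by (simp add: power_bounded_def)
next
  fix a assume "a \<in> power_bounded A ST"
  then have a: "a \<in> carrier A" and bd: "bounded_subset A ST (range (\<lambda>n::nat. a [^]\<^bsub>A\<^esub> n))"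
    by (auto simp: power_bounded_def)
  have "openin ST (AN 0)" unfolding section_topology_eq using AT.openin_subgroup_iff[OF AN_subgroup] by blast
  moreover have "\<zero>\<^bsub>A\<^esub> \<in> AN 0" using AN_subgroup by (rule additive_subgroup.zero_closed)
  ultimately obtain V where V: "openin ST V" "\<zero>\<^bsub>A\<^esub> \<in> V" "\<forall>x\<in>V. \<forall>s\<in>range (\<lambda>n::nat. a [^]\<^bsub>A\<^esub> n). x \<otimes>\<^bsub>A\<^esub> s \<in> AN 0"
    using bd unfolding bounded_subset_def by blast
  then obtain n where n: "\<forall>y\<in>carrier A. y \<ominus>\<^bsub>A\<^esub> \<zero>\<^bsub>A\<^esub> \<in> AN n \<longrightarrow> y \<in> V"
    unfolding section_topology_eq AT.openin_iff by blast
  have "(\<lambda>i. up i n) \<in> AN n" using A_up up_B by (simp add: AN_def)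
  then have "(\<lambda>i. up i n) \<in> V" using n A_up by (simp add: A.minus_eq)
  then have *: "(\<lambda>i. up i n) \<otimes>\<^bsub>A\<^esub> (a [^]\<^bsub>A\<^esub> j) \<in> AN 0" for j :: nat using V(3) by blast
  have "a i \<in> B i 0" for i
  proof (rule ccontr)
    assume not: "a i \<notin> B i 0"
    have ac: "a i \<in> carrier (E i)" using a by (rule A_closed)
    then have nz: "a i \<noteq> \<zero>\<^bsub>E i\<^esub>" and neg: "vl F i (a i) \<le> -1" using not by (auto simp: vball_def)
    \<comment> \<open>If \<open>a i\<close> has value at most -1, its power with exponent
      \<open>Suc n\<close> outweighs \<open>up i n\<close>: the product has value at most
      -1.\<close>
    have "up i n \<otimes>\<^bsub>E i\<^esub> (a i [^]\<^bsub>E i\<^esub> Suc n) \<in> B i 0"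
      using *[of "Suc n"] A_pow[OF a, of "Suc n"] unfolding AN_def A_simps by simp
    moreover have "up i n \<otimes>\<^bsub>E i\<^esub> (a i [^]\<^bsub>E i\<^esub> Suc n) \<noteq> \<zero>\<^bsub>E i\<^esub>"
      by (rule dv.mult_nonzero[OF _ _ up_nonzero dv.v_pow(1)[OF ac nz]]) (use ac in simp_all)
    moreover have "vl F i (up i n \<otimes>\<^bsub>E i\<^esub> (a i [^]\<^bsub>E i\<^esub> Suc n)) = int n + int (Suc n) * vl F i (a i)"
      using dv.val_mult[of "up i n" i "a i [^]\<^bsub>E i\<^esub> Suc n"] ac up_nonzero dv.v_pow[OF ac nz, of "Suc n"] v_up by simp
    ultimately have "0 \<le> int n + int (Suc n) * vl F i (a i)" by (auto simp: vball_def)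
    moreover have "int (Suc n) * vl F i (a i) \<le> int (Suc n) * (-1)" using neg by (intro mult_left_mono) auto
    ultimately show False by simp
  qed
  then show "a \<in> AN 0" using a by (simp add: AN_def)
qed

end

section \<open>Closed prime ideals\<close>

context local_field_family
begin

lemma cut_apply: "cut C a i = (if i \<in> C then a i else \<zero>\<^bsub>E i\<^esub>)"
  by (simp add: cut_def)

abbreviation chi :: "enat set \<Rightarrow> enat \<Rightarrow> 'a" where "chi C \<equiv> cut C (\<lambda>i. \<one>\<^bsub>E i\<^esub>)"

lemma chi_closed: "clopen C \<Longrightarrow> chi C \<in> carrier A"
  by (rule A_cut[OF _ A_one])

lemma mult_chi: "a \<in> carrier A \<Longrightarrow> a \<otimes>\<^bsub>A\<^esub> chi C = cut C a"
  using A_closed[of a] by (auto simp: A_simps cut_apply fun_eq_iff)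

definition evker :: "enat \<Rightarrow> (enat \<Rightarrow> 'a) set" where
  "evker i = {a \<in> carrier A. a i = \<zero>\<^bsub>E i\<^esub>}"

lemma evker_eq: "a_kernel A (E i) (ev i) = evker i"
  by (simp add: a_kernel_def' ev_def evker_def)

text \<open>Evaluation at \<open>i\<close> maps onto the field \<open>E i\<close>, so its kernel is
  a maximal ideal.\<close>

lemma evker_maximal:
  assumes P: "ideal P A" "\<one>\<^bsub>A\<^esub> \<notin> P" and sub: "evker i \<subseteq> P"
  shows "P = evker i"
proof (rule subset_antisym[OF _ sub], rule subsetI)
  interpret P: ideal P A by fact
  fix s assume s: "s \<in> P"
  then have sA: "s \<in> carrier A" using P.Icarr by blast
  show "s \<in> evker i"
  proof (rule ccontr)
    assume "s \<notin> evker i"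
    then have nz: "s i \<noteq> \<zero>\<^bsub>E i\<^esub>" using sA by (simp add: evker_def)
    note inv = dv.inv_nonzero[OF A_closed[OF sA] nz]
    obtain t where t: "t \<in> carrier A" "t i = inv\<^bsub>E i\<^esub> (s i)" using A_surj[OF inv(1)] by blast
    have "(\<one>\<^bsub>A\<^esub> \<ominus>\<^bsub>A\<^esub> s \<otimes>\<^bsub>A\<^esub> t) i = \<zero>\<^bsub>E i\<^esub>"
      unfolding A_minus[OF A.one_closed A.m_closed[OF sA t(1)]] using t inv(3) by (simp add: A_simps dv.minus_self)
    then have "\<one>\<^bsub>A\<^esub> \<ominus>\<^bsub>A\<^esub> s \<otimes>\<^bsub>A\<^esub> t \<in> P" using sA t sub by (auto simp: evker_def)
    moreover have "s \<otimes>\<^bsub>A\<^esub> t \<in> P" using P.I_r_closed[OF s t(1)] .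
    ultimately have "(\<one>\<^bsub>A\<^esub> \<ominus>\<^bsub>A\<^esub> s \<otimes>\<^bsub>A\<^esub> t) \<oplus>\<^bsub>A\<^esub> s \<otimes>\<^bsub>A\<^esub> t \<in> P" by (rule P.a_closed)
    moreover have "(\<one>\<^bsub>A\<^esub> \<ominus>\<^bsub>A\<^esub> s \<otimes>\<^bsub>A\<^esub> t) \<oplus>\<^bsub>A\<^esub> s \<otimes>\<^bsub>A\<^esub> t = \<one>\<^bsub>A\<^esub>"
      using sA t by (simp add: A.minus_eq A.a_assoc A.l_neg)
    ultimately show False using P(2) by simp
  qed
qed

lemma closed_prime:
  assumes P: "primeideal P A" and closed: "closedin ST P"
  shows "\<exists>i. P = evker i"
proof -
  interpret P: primeideal P A by fact
  have one: "\<one>\<^bsub>A\<^esub> \<notin> P" using P.one_imp_carrier P.I_notcarr by blast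
  show ?thesis
  proof (cases "\<exists>k. chi (- {enat k}) \<in> P")
    case True
    then obtain k where k: "chi (- {enat k}) \<in> P" by blast
    have "a \<in> P" if "a \<in> evker (enat k)" for a
    proof -
      have a: "a \<in> carrier A" "a (enat k) = \<zero>\<^bsub>E (enat k)\<^esub>" using that by (auto simp: evker_def)
      have "a = a \<otimes>\<^bsub>A\<^esub> chi (- {enat k})"
        unfolding mult_chi[OF a(1)] by (rule ext) (simp add: cut_apply a(2))
      then show ?thesis using P.I_l_closed[OF k a(1)] by simp
    qed
    then show ?thesis using evker_maximal[OF P.ideal_axioms one] by blast
  next
    case False
    have chi: "chi {enat k} \<in> P" for k
    proof -
      have c: "clopen {enat k}" "clopen (- {enat k})" using clopen_point[of k] by simp_all
      have "chi {enat k} \<otimes>\<^bsub>A\<^esub> chi (- {enat k}) = \<zero>\<^bsub>A\<^esub>"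
        unfolding mult_chi[OF chi_closed[OF c(1)]] by (rule ext) (simp add: A_simps cut_apply)
      then have "chi {enat k} \<otimes>\<^bsub>A\<^esub> chi (- {enat k}) \<in> P" using P.zero_closed by simp
      then show ?thesis using P.I_prime[OF chi_closed[OF c(1)] chi_closed[OF c(2)]] False by blast
    qed
    \<comment> \<open>Such a cut is a finite sum of multiples of the idempotents at single
      indices.\<close>
    have fin: "cut (enat ` {..<K}) a \<in> P" if a: "a \<in> carrier A" for a K
    proof (induction K)
      case 0
      have "cut (enat ` {..<0}) a = \<zero>\<^bsub>A\<^esub>" by (rule ext) (simp add: cut_apply A_simps)
      then show ?case using P.zero_closed by simp
    next
      case (Suc K)
      have "cut (enat ` {..<Suc K}) a = cut (enat ` {..<K}) a \<oplus>\<^bsub>A\<^esub> a \<otimes>\<^bsub>A\<^esub> chi {enat K}"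
        unfolding mult_chi[OF a] using A_closed[OF a]
        by (intro ext) (auto simp: cut_apply A_simps lessThan_Suc)
      then show ?case using P.a_closed[OF Suc P.I_l_closed[OF chi a]] by simp
    qed
    have "a \<in> P" if "a \<in> evker \<infinity>" for a
    proof (rule ccontr)
      assume aP: "a \<notin> P"
      have a: "a \<in> carrier A" "a \<infinity> = \<zero>\<^bsub>E \<infinity>\<^esub>" using that by (auto simp: evker_def)
      have "sopen (carrier A - P)"
        using closed unfolding closedin_def section_topology_eq openin_AT by simp
      then obtain n :: nat where n: "\<forall>t\<in>carrier A. (\<forall>i. t i \<ominus>\<^bsub>E i\<^esub> a i \<in> B i (int n)) \<longrightarrow> t \<notin> P"
        unfolding sopen_def using a aP by blast
      have "\<forall>\<^sub>F k in sequentially. a (enat k) \<in> B (enat k) (int n)"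
        using A_B[OF a(1), of "int n"] a(2) by simp
      \<comment> \<open>From \<open>K\<close> on, \<open>a\<close> is so small that cutting it off
        there stays inside the neighbourhood of \<open>a\<close> that avoids
        \<open>P\<close>.\<close>
      then obtain K where K: "\<forall>k\<ge>K. a (enat k) \<in> B (enat k) (int n)" by (auto simp: eventually_sequentially)
      define t where "t = cut (enat ` {..<K}) a"
      have tP: "t \<in> P" unfolding t_def by (rule fin[OF a(1)])
      have "t i \<ominus>\<^bsub>E i\<^esub> a i \<in> B i (int n)" for i
      proof (cases "i \<in> enat ` {..<K}")
        case True
        then show ?thesis using A_closed[OF a(1)] by (simp add: t_def cut_apply dv.minus_self)
      next
        case False
        have "a i \<in> B i (int n)"
        proof (cases i)
          case (enat k)
          then have "K \<le> k" using False by (simp add: image_iff)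
          then show ?thesis using K enat by simp
        qed (simp add: a(2))
        then have "\<zero>\<^bsub>E i\<^esub> \<ominus>\<^bsub>E i\<^esub> a i \<in> B i (int n)" by (rule dv.B_minus[OF dv.B_zero])
        then show ?thesis using False by (simp add: t_def cut_apply)
      qed
      then show False using n tP P.Icarr by blast
    qed
    then show ?thesis using evker_maximal[OF P.ideal_axioms one] by blast
  qed
qed

section \<open>The points of the adic spectrum\<close>

lemma clopen_nbhd:
  assumes "open U" "i \<in> U"
  shows "\<exists>C. clopen C \<and> i \<in> C \<and> C \<subseteq> U"
proof (cases i)
  case (enat k)
  then show ?thesis using assms clopen_point[of k] by blast
next
  case infinity
  then obtain K where K: "\<forall>k\<ge>K. enat k \<in> U"
    using assms by (auto simp: open_enat_iff_eventually eventually_sequentially)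
  have "clopen (insert \<infinity> (enat ` {K..}))"
    unfolding clopen_iff by (auto simp: eventually_sequentially)
  then show ?thesis using K infinity assms(2) by (intro exI[of _ "insert \<infinity> (enat ` {K..})"]) auto
qed

abbreviation Ap where "Ap \<equiv> power_bounded A ST"

lemma mem_spa_point:
  "(a, b) \<in> spa_point F i \<longleftrightarrow> a \<in> carrier A \<and> b \<in> carrier A \<and>
     (a i = \<zero>\<^bsub>E i\<^esub> \<or> (b i \<noteq> \<zero>\<^bsub>E i\<^esub> \<and> vl F i (b i) \<le> vl F i (a i)))"
  by (auto simp: spa_point_def val_class_def ev_val_def ev_def)

text \<open>
  The definition of \<^const>\<open>Spa\<close> fixes the type of the elements of the value groups, so the integers
  are encoded as elements of that type.
\<close>

definition tag :: "int \<Rightarrow> ((enat \<Rightarrow> 'a) \<times> (enat \<Rightarrow> 'a)) set" where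
  "tag n = {(chi {enat (int_encode n)}, chi {})}"

lemma inj_tag: "inj tag"
proof (rule injI)
  fix m n assume "tag m = tag n"
  then have "chi {enat (int_encode m)} = chi {enat (int_encode n)}" by (simp add: tag_def)
  from fun_cong[OF this, of "enat (int_encode m)"] have "int_encode m = int_encode n"
    by (simp add: cut_apply split: if_splits)
  then show "m = n" using int_encode_eq by blast
qed

definition untag where "untag = the_inv tag"

lemma untag_tag [simp]: "untag (tag n) = n"
  unfolding untag_def by (rule the_inv_f_f[OF inj_tag])

definition TG :: "((enat \<Rightarrow> 'a) \<times> (enat \<Rightarrow> 'a)) set monoid" where
  "TG = \<lparr>carrier = range tag, monoid.mult = (\<lambda>x y. tag (untag x + untag y)), one = tag 0\<rparr>"

definition TL where "TL x y \<longleftrightarrow> untag x \<le> untag y"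

definition TV :: "enat \<Rightarrow> (enat \<Rightarrow> 'a) \<Rightarrow> ((enat \<Rightarrow> 'a) \<times> (enat \<Rightarrow> 'a)) set option" where
  "TV i a = (if a i = \<zero>\<^bsub>E i\<^esub> then None else Some (tag (- vl F i (a i))))"

lemma ordered_group_TG: "ordered_group TG TL"
proof -
  have "comm_group TG"
  proof (rule comm_groupI)
    fix x assume "x \<in> carrier TG"
    then obtain n where "x = tag n" by (auto simp: TG_def)
    then show "\<exists>y\<in>carrier TG. y \<otimes>\<^bsub>TG\<^esub> x = \<one>\<^bsub>TG\<^esub>"
      by (intro bexI[of _ "tag (- n)"]) (auto simp: TG_def)
  qed (auto simp: TG_def algebra_simps)
  then show ?thesis by (auto simp: ordered_group_def TL_def TG_def)
qed

lemma is_valuation_TV: "is_valuation A TG TL (TV i)"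
  unfolding is_valuation_def
proof (intro conjI ballI)
  show "ordered_group TG TL" by (rule ordered_group_TG)
  show "TV i \<zero>\<^bsub>A\<^esub> = None" "TV i \<one>\<^bsub>A\<^esub> = Some \<one>\<^bsub>TG\<^esub>" by (simp_all add: TV_def A_simps TG_def dv.v_one)
  show "TV i a \<in> insert None (Some ` carrier TG)" for a by (simp add: TV_def TG_def)
next
  fix a b assume "a \<in> carrier A" "b \<in> carrier A"
  then have c: "a i \<in> carrier (E i)" "b i \<in> carrier (E i)" by (auto intro: A_closed)
  show "TV i (a \<otimes>\<^bsub>A\<^esub> b) = mult0 TG (TV i a) (TV i b)"
  proof (cases "a i = \<zero>\<^bsub>E i\<^esub> \<or> b i = \<zero>\<^bsub>E i\<^esub>")
    case True
    then show ?thesis using c by (auto simp: TV_def A_simps)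
  next
    case False
    then have nz: "a i \<noteq> \<zero>\<^bsub>E i\<^esub>" "b i \<noteq> \<zero>\<^bsub>E i\<^esub>" by auto
    have "- vl F i (a i \<otimes>\<^bsub>E i\<^esub> b i) = - vl F i (a i) + - vl F i (b i)"
      using dv.val_mult[OF c nz] by simp
    moreover have "a i \<otimes>\<^bsub>E i\<^esub> b i \<noteq> \<zero>\<^bsub>E i\<^esub>" by (rule dv.mult_nonzero[OF c nz])
    ultimately have "TV i (a \<otimes>\<^bsub>A\<^esub> b) = Some (tag (- vl F i (a i) + - vl F i (b i)))"
      by (simp only: TV_def A_simps if_False)
    moreover have "mult0 TG (TV i a) (TV i b) = Some (tag (- vl F i (a i) + - vl F i (b i)))"
      using nz by (simp only: TV_def TG_def if_False mult0.simps monoid.simps untag_tag)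
    ultimately show ?thesis by (simp only:)
  qed
  show "le0 TL (TV i (a \<oplus>\<^bsub>A\<^esub> b)) (TV i a) \<or> le0 TL (TV i (a \<oplus>\<^bsub>A\<^esub> b)) (TV i b)"
  proof (cases "a i = \<zero>\<^bsub>E i\<^esub> \<or> b i = \<zero>\<^bsub>E i\<^esub> \<or> a i \<oplus>\<^bsub>E i\<^esub> b i = \<zero>\<^bsub>E i\<^esub>")
    case True
    then show ?thesis using c by (auto simp: TV_def A_simps TL_def)
  next
    case False
    then show ?thesis using dv.val_add[OF c] by (auto simp: TV_def A_simps TL_def min_def split: if_splits)
  qed
qed

lemma openin_B: "openin ST {a \<in> carrier A. a i \<in> B i n}"
  unfolding section_topology_eq openin_AT sopen_def
proof (intro conjI ballI)
  fix s assume s: "s \<in> {a \<in> carrier A. a i \<in> B i n}"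
  show "\<exists>n'::nat. \<forall>t\<in>carrier A. (\<forall>j. t j \<ominus>\<^bsub>E j\<^esub> s j \<in> B j (int n')) \<longrightarrow> t \<in> {a \<in> carrier A. a i \<in> B i n}"
  \<comment> \<open>The uniform topology is described by natural indices; \<open>nat n\<close> is
    the least one that is at least \<open>n\<close>.\<close>
  proof (intro exI[of _ "nat n"] ballI impI)
    fix t assume t: "t \<in> carrier A" "\<forall>j. t j \<ominus>\<^bsub>E j\<^esub> s j \<in> B j (int (nat n))"
    have "t i \<ominus>\<^bsub>E i\<^esub> s i \<in> B i n" using dv.B_antimono[OF _ t(2)[rule_format, of i], of n] by simp
    from dv.B_close[OF this] have "t i \<in> B i n" using s A_closed[OF t(1)] by simp
    then show "t \<in> {a \<in> carrier A. a i \<in> B i n}" using t by simp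
  qed
qed auto

lemma spa_point_in_Spa: "spa_point F i \<in> Spa A ST Ap"
proof -
  have "continuous_valuation A ST TG TL (TV i)"
    unfolding continuous_valuation_def
  proof (intro conjI is_valuation_TV ballI)
    interpret TG: comm_group TG using ordered_group_TG by (simp add: ordered_group_def)
    fix \<gamma> assume "\<gamma> \<in> generate TG {g. \<exists>a\<in>carrier A. TV i a = Some g}"
    moreover have "{g. \<exists>a\<in>carrier A. TV i a = Some g} \<subseteq> carrier TG" by (auto simp: TV_def TG_def split: if_splits)
    ultimately have "\<gamma> \<in> carrier TG" using TG.generate_in_carrier by blast
    then obtain n where n: "\<gamma> = tag n" by (auto simp: TG_def)
    \<comment> \<open>In additive terms, strictly below \<open>tag n\<close> means value above
      \<open>-n\<close>, that is at least \<open>1 - n\<close>.\<close>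
    have "{a \<in> carrier A. le0 TL (TV i a) (Some \<gamma>) \<and> TV i a \<noteq> Some \<gamma>} = {a \<in> carrier A. a i \<in> B i (1 - n)}"
      using A_closed by (auto simp: n TV_def TL_def vball_def inj_eq[OF inj_tag] split: if_splits)
    then show "openin ST {a \<in> carrier A. le0 TL (TV i a) (Some \<gamma>) \<and> TV i a \<noteq> Some \<gamma>}"
      using openin_B by simp
  qed
  moreover have "le0 TL (TV i a) (Some \<one>\<^bsub>TG\<^esub>)" if "a \<in> Ap" for a
    using that by (auto simp: power_bounded_eq AN_def TV_def TG_def TL_def vball_def)
  moreover have "le0 TL (TV i a) (TV i b) \<longleftrightarrow> le0 (\<le>) (ev_val F i a) (ev_val F i b)" for a b
    by (simp add: ev_val_def ev_def TV_def TL_def)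
  then have "spa_point F i = val_class A TL (TV i)" by (simp add: spa_point_def val_class_def)
  ultimately show ?thesis unfolding Spa_def by blast
qed

lemma Spa_point_exists:
  assumes "x \<in> Spa A ST Ap"
  shows "\<exists>i. x = spa_point F i"
proof -
  from assms obtain G :: "((enat \<Rightarrow> 'a) \<times> (enat \<Rightarrow> 'a)) set monoid" and leq w
    where x: "x = val_class A leq w" and cv: "continuous_valuation A ST G leq w"
      and Apw: "\<forall>a\<in>Ap. le0 leq (w a) (Some \<one>\<^bsub>G\<^esub>)"
    unfolding Spa_def by blast
  have iv: "is_valuation A G leq w" using cv unfolding continuous_valuation_def by blast
  have og: "ordered_group G leq" using iv unfolding is_valuation_def by blast
  interpret G: comm_group G using og unfolding ordered_group_def by blast
  have w_range: "w a = None \<or> (\<exists>g\<in>carrier G. w a = Some g)" if "a \<in> carrier A" for a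
    using iv that unfolding is_valuation_def by blast
  have w0: "w \<zero>\<^bsub>A\<^esub> = None" and w1: "w \<one>\<^bsub>A\<^esub> = Some \<one>\<^bsub>G\<^esub>" using iv unfolding is_valuation_def by blast+
  have wm: "w (a \<otimes>\<^bsub>A\<^esub> b) = mult0 G (w a) (w b)" if "a \<in> carrier A" "b \<in> carrier A" for a b
    using iv that unfolding is_valuation_def by blast
  have wa: "le0 leq (w (a \<oplus>\<^bsub>A\<^esub> b)) (w a) \<or> le0 leq (w (a \<oplus>\<^bsub>A\<^esub> b)) (w b)" if "a \<in> carrier A" "b \<in> carrier A" for a b
    using iv that unfolding is_valuation_def by blast
  have leq_antisym: "g = h" if "leq g h" "leq h g" "g \<in> carrier G" "h \<in> carrier G" for g h
    using og that unfolding ordered_group_def by blast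
  have leq_trans: "leq g k" if "leq g h" "leq h k" "g \<in> carrier G" "h \<in> carrier G" "k \<in> carrier G" for g h k
    using og that unfolding ordered_group_def by blast
  have leq_mult: "leq (g \<otimes>\<^bsub>G\<^esub> k) (h \<otimes>\<^bsub>G\<^esub> k)" if "leq g h" "g \<in> carrier G" "h \<in> carrier G" "k \<in> carrier G" for g h k
    using og that unfolding ordered_group_def by blast
  have le0_None: "le0 leq y None \<longleftrightarrow> y = None" for y by (cases y) auto
  have open_lt: "openin ST {a \<in> carrier A. le0 leq (w a) (Some g) \<and> w a \<noteq> Some g}"
    if "b \<in> carrier A" "w b = Some g" for b g
    using cv that generate.incl[of g "{g. \<exists>a\<in>carrier A. w a = Some g}" G] unfolding continuous_valuation_def by blast
  have lt_nbhd: "\<exists>n. \<forall>a\<in>AN n. le0 leq (w a) (Some g) \<and> w a \<noteq> Some g" if bg: "b \<in> carrier A" "w b = Some g" for b g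
  proof -
    have "\<zero>\<^bsub>A\<^esub> \<in> {a \<in> carrier A. le0 leq (w a) (Some g) \<and> w a \<noteq> Some g}" using w0 by simp
    then obtain n where n: "\<forall>y\<in>carrier A. y \<ominus>\<^bsub>A\<^esub> \<zero>\<^bsub>A\<^esub> \<in> AN n \<longrightarrow> y \<in> {a \<in> carrier A. le0 leq (w a) (Some g) \<and> w a \<noteq> Some g}"
      using open_lt[OF bg] unfolding section_topology_eq AT.openin_iff by blast
    have "a \<in> carrier A \<and> a \<ominus>\<^bsub>A\<^esub> \<zero>\<^bsub>A\<^esub> \<in> AN n" if "a \<in> AN n" for a
      using that by (simp add: AN_def A.minus_eq)
    then show ?thesis using n by blast
  qed
  define P where "P = {a \<in> carrier A. w a = None}"
  have P_neg: "\<ominus>\<^bsub>A\<^esub> a \<in> P" if "a \<in> P" for a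
  proof -
    have a: "a \<in> carrier A" "w a = None" using that by (auto simp: P_def)
    have "\<ominus>\<^bsub>A\<^esub> a = (\<ominus>\<^bsub>A\<^esub> \<one>\<^bsub>A\<^esub>) \<otimes>\<^bsub>A\<^esub> a" using a by (simp add: A.l_minus)
    then show ?thesis using wm[of "\<ominus>\<^bsub>A\<^esub> \<one>\<^bsub>A\<^esub>" a] a by (cases "w (\<ominus>\<^bsub>A\<^esub> \<one>\<^bsub>A\<^esub>)") (simp_all add: P_def)
  qed
  have P_mult: "a \<otimes>\<^bsub>A\<^esub> b \<in> P \<longleftrightarrow> a \<in> P \<or> b \<in> P" if "a \<in> carrier A" "b \<in> carrier A" for a b
    using wm[OF that] that by (cases "w a"; cases "w b") (simp_all add: P_def)
  have P_add: "a \<oplus>\<^bsub>A\<^esub> b \<in> P" if "a \<in> P" "b \<in> P" for a b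
    using wa[of a b] that by (auto simp: P_def le0_None)
  have P_ideal: "ideal P A"
  proof (rule idealI[OF A.ring_axioms])
    show "subgroup P (add_monoid A)"
    proof (rule A.add.subgroupI)
      show "P \<subseteq> carrier A" by (auto simp: P_def)
      show "P \<noteq> {}" using w0 by (auto simp: P_def)
      show "\<ominus>\<^bsub>A\<^esub> a \<in> P" if "a \<in> P" for a using that by (rule P_neg)
      show "a \<oplus>\<^bsub>A\<^esub> b \<in> P" if "a \<in> P" "b \<in> P" for a b using that by (rule P_add)
    qed
    fix a y assume "a \<in> P" "y \<in> carrier A"
    then show "y \<otimes>\<^bsub>A\<^esub> a \<in> P" "a \<otimes>\<^bsub>A\<^esub> y \<in> P" using P_mult[of y a] P_mult[of a y] by (simp_all add: P_def)
  qed
  have oneP: "\<one>\<^bsub>A\<^esub> \<notin> P" using w1 by (simp add: P_def)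
  have P_prime: "primeideal P A"
    using P_ideal
  proof (rule primeidealI[OF _ cring_A])
    show "carrier A \<noteq> P" using oneP A.one_closed by blast
    show "a \<in> P \<or> b \<in> P" if "a \<in> carrier A" "b \<in> carrier A" "a \<otimes>\<^bsub>A\<^esub> b \<in> P" for a b
      using P_mult that by blast
  qed
  have P_closed: "closedin ST P"
    unfolding closedin_def
  proof
    show "P \<subseteq> topspace ST" by (auto simp: section_topology_eq P_def)
    show "openin ST (topspace ST - P)"
      unfolding section_topology_eq AT.topspace AT.openin_iff
    proof (intro conjI ballI)
      fix a assume "a \<in> carrier A - P"
      then have a: "a \<in> carrier A" "w a \<noteq> None" by (auto simp: P_def)
      obtain g where g: "w a = Some g" "g \<in> carrier G" using w_range[OF a(1)] a(2) by auto
      from lt_nbhd[OF a(1) g(1)]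
      obtain n where n: "\<forall>b\<in>AN n. le0 leq (w b) (Some g) \<and> w b \<noteq> Some g" by (rule exE)
      have "t \<notin> P" if t: "t \<in> carrier A" "t \<ominus>\<^bsub>A\<^esub> a \<in> AN n" for t
      proof
        assume "t \<in> P"
        then have tN: "w t = None" by (simp add: P_def)
        \<comment> \<open>If \<open>w t\<close> were zero, the decomposition of \<open>a\<close> as
          \<open>d\<close> plus \<open>t\<close> would bound the value of \<open>a\<close> by that
          of \<open>d\<close>, which is strictly smaller.\<close>
        define d where "d = \<ominus>\<^bsub>A\<^esub> (t \<ominus>\<^bsub>A\<^esub> a)"
        have d: "d \<in> AN n" unfolding d_def by (rule additive_subgroup.a_inv_closed[OF AN_subgroup t(2)])
        then have dA: "d \<in> carrier A" by (simp add: AN_def)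
        have "a = d \<oplus>\<^bsub>A\<^esub> t" using a t by (simp add: d_def A.minus_eq A.minus_add A.a_ac A.r_neg)
        then have "le0 leq (w a) (w d) \<or> le0 leq (w a) (w t)" using wa[OF dA t(1)] by simp
        then have 1: "le0 leq (Some g) (w d)" using tN g by (simp add: le0_None)
        have 2: "le0 leq (w d) (Some g)" "w d \<noteq> Some g" using n d by auto
        show False
        proof (cases "w d")
          case None
          then show False using 1 by simp
        next
          case (Some h)
          then have "h \<in> carrier G" using w_range[OF dA] by auto
          then show False using 1 2 Some leq_antisym[of g h] g by simp
        qed
      qed
      then show "\<exists>D\<in>range AN. \<forall>y\<in>carrier A. y \<ominus>\<^bsub>A\<^esub> a \<in> D \<longrightarrow> y \<in> carrier A - P" by blast
    qed auto
  qed
  obtain i where i: "P = evker i" using closed_prime[OF P_prime P_closed] by blast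
  have wN: "w a = None \<longleftrightarrow> a i = \<zero>\<^bsub>E i\<^esub>" if "a \<in> carrier A" for a
  proof -
    have "a \<in> P \<longleftrightarrow> a \<in> evker i" using i by simp
    then show ?thesis using that by (simp add: P_def evker_def)
  qed
  have le0_trans: "le0 leq (w a) (w c)" if abc: "le0 leq (w a) (w b)" "le0 leq (w b) (w c)" "a \<in> carrier A" "b \<in> carrier A" "c \<in> carrier A" for a b c
  proof (cases "w a")
    case (Some g)
    then obtain h k where hk: "w b = Some h" "w c = Some k" using abc(1,2) by (cases "w b"; cases "w c") auto
    have "g \<in> carrier G" "h \<in> carrier G" "k \<in> carrier G"
      using w_range[OF abc(3)] w_range[OF abc(4)] w_range[OF abc(5)] Some hk by auto
    then show ?thesis using abc(1,2) Some hk leq_trans[of g h k] by simp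
  qed simp
  \<comment> \<open>Here the bound by 1 on the power-bounded elements enters, by
    \<open>power_bounded_eq\<close> for all integral sections.\<close>
  have mult_le: "le0 leq (w (b \<otimes>\<^bsub>A\<^esub> c)) (w b)" if b: "b \<in> carrier A" and c: "c \<in> AN 0" for b c
  proof -
    have cA: "c \<in> carrier A" using c by (simp add: AN_def)
    have c1: "le0 leq (w c) (Some \<one>\<^bsub>G\<^esub>)" using Apw c by (simp add: power_bounded_eq)
    show ?thesis
    proof (cases "w b = None \<or> w c = None")
      case True
      then show ?thesis using wm[OF b cA] by (cases "w b") auto
    next
      case False
      then obtain g h where gh: "w b = Some g" "w c = Some h" by auto
      have "g \<in> carrier G" "h \<in> carrier G" using w_range[OF b] w_range[OF cA] gh by auto
      then show ?thesis using wm[OF b cA] gh c1 leq_mult[of h "\<one>\<^bsub>G\<^esub>" g] by (simp add: G.m_comm)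
    qed
  qed
  have le1: "le0 leq (w a) (w b)"
    if a: "a \<in> carrier A" and b: "b \<in> carrier A" "b i \<noteq> \<zero>\<^bsub>E i\<^esub>" and v: "a i = \<zero>\<^bsub>E i\<^esub> \<or> vl F i (b i) \<le> vl F i (a i)" for a b
  proof -
    note ac = A_closed[OF a, of i] and bc = A_closed[OF b(1), of i]
    note inv = dv.inv_nonzero[OF bc b(2)]
    have "inv\<^bsub>E i\<^esub> (b i) \<otimes>\<^bsub>E i\<^esub> a i \<in> B i 0"
    proof (cases "a i = \<zero>\<^bsub>E i\<^esub>")
      case False
      then show ?thesis
        using v ac inv(1) dv.val_mult[OF inv(1) ac inv(4) False] dv.v_inv[OF bc b(2)] by (simp add: vball_def)
    qed (use inv(1) in simp)
    \<comment> \<open>\<open>c\<close> is an integral section through the quotient of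
      \<open>a i\<close> by \<open>b i\<close>. The remainder \<open>d\<close> then vanishes at
      \<open>i\<close>, so that \<open>w\<close> sends it to zero.\<close>
    then obtain c where c: "c \<in> carrier A" "c i = inv\<^bsub>E i\<^esub> (b i) \<otimes>\<^bsub>E i\<^esub> a i" "\<forall>j. c j \<in> B j 0"
      using A_lift by blast
    then have c0: "c \<in> AN 0" by (simp add: AN_def)
    define d where "d = a \<ominus>\<^bsub>A\<^esub> b \<otimes>\<^bsub>A\<^esub> c"
    have dA: "d \<in> carrier A" using a b c by (simp add: d_def)
    have "b i \<otimes>\<^bsub>E i\<^esub> c i = a i" using dv.inv_mult_cancel(2)[OF bc b(2) ac] c(2) by simp
    then have "d i = \<zero>\<^bsub>E i\<^esub>"
      unfolding d_def A_minus[OF a A.m_closed[OF b(1) c(1)]] using ac by (simp add: A_simps dv.minus_self)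
    then have dN: "w d = None" using wN[OF dA] by simp
    have "a = d \<oplus>\<^bsub>A\<^esub> b \<otimes>\<^bsub>A\<^esub> c" using a b c by (simp add: d_def A.minus_eq A.a_assoc A.l_neg)
    then have "le0 leq (w a) (w d) \<or> le0 leq (w a) (w (b \<otimes>\<^bsub>A\<^esub> c))" using wa[OF dA, of "b \<otimes>\<^bsub>A\<^esub> c"] b c by simp
    then have "le0 leq (w a) (w (b \<otimes>\<^bsub>A\<^esub> c))" using dN by (auto simp: le0_None)
    then show ?thesis using le0_trans[OF _ mult_le[OF b(1) c0] a] b(1) c(1) by simp
  qed
  have u0: "u \<in> AN 0" using A_u by (simp add: AN_def vball_def v_u)
  obtain p where p: "w u = Some p" "p \<in> carrier G" using w_range[OF A_u] wN[OF A_u] u_nonzero by auto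
  have p1: "leq p \<one>\<^bsub>G\<^esub>" using Apw u0 p by (auto simp: power_bounded_eq)
  \<comment> \<open>Continuity excludes the trivial valuation: the powers of \<open>u\<close> tend
    to zero, so their values cannot all be 1.\<close>
  have p_ne: "p \<noteq> \<one>\<^bsub>G\<^esub>"
  proof
    assume "p = \<one>\<^bsub>G\<^esub>"
    then have pow: "w (u [^]\<^bsub>A\<^esub> (n::nat)) = Some \<one>\<^bsub>G\<^esub>" for n
      using p by (induction n) (simp_all add: w1 wm A_u)
    obtain n where n: "\<forall>a\<in>AN n. w a \<noteq> Some \<one>\<^bsub>G\<^esub>" using lt_nbhd[OF A.one_closed w1] by blast
    have "u [^]\<^bsub>A\<^esub> n \<in> AN n" using A_up up_B by (simp add: AN_def A_pow[OF A_u])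
    then show False using n pow by blast
  qed
  have "x = spa_point F i"
  proof -
    have "le0 leq (w a) (w b) \<longleftrightarrow> a i = \<zero>\<^bsub>E i\<^esub> \<or> (b i \<noteq> \<zero>\<^bsub>E i\<^esub> \<and> vl F i (b i) \<le> vl F i (a i))"
      if a: "a \<in> carrier A" and b: "b \<in> carrier A" for a b
    proof (cases "a i = \<zero>\<^bsub>E i\<^esub> \<or> b i = \<zero>\<^bsub>E i\<^esub>")
      case True
      then show ?thesis using wN[OF a] wN[OF b] by (cases "w a") auto
    next
      case False
      \<comment> \<open>If the additive value of \<open>b\<close> is larger, \<open>b\<close> is an
        integral multiple of \<open>a u\<close> at \<open>i\<close>. Then
        \<open>w a \<le> w b\<close> would give \<open>w a \<le> w a p\<close> and hence
        \<open>1 \<le> p\<close>, contrary to \<open>p\<close> being strictly below 1.\<close>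
      have "\<not> le0 leq (w a) (w b)" if lt: "vl F i (a i) < vl F i (b i)"
      proof
        assume le: "le0 leq (w a) (w b)"
        have au: "a \<otimes>\<^bsub>A\<^esub> u \<in> carrier A" using a A_u by simp
        have v: "(a \<otimes>\<^bsub>A\<^esub> u) i \<noteq> \<zero>\<^bsub>E i\<^esub>" "vl F i ((a \<otimes>\<^bsub>A\<^esub> u) i) = vl F i (a i) + 1"
          using dv.mult_nonzero[OF A_closed[OF a] u_closed _ u_nonzero, of i] dv.val_mult[OF A_closed[OF a] u_closed _ u_nonzero, of i] False
          by (simp_all add: A_simps v_u)
        have "le0 leq (w b) (w (a \<otimes>\<^bsub>A\<^esub> u))" by (rule le1[OF b au v(1)]) (use v lt in simp)
        then have 1: "le0 leq (w a) (w (a \<otimes>\<^bsub>A\<^esub> u))" using le0_trans[OF le _ a b au] by blast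
        obtain g where g: "w a = Some g" "g \<in> carrier G" using w_range[OF a] wN[OF a] False by auto
        have "leq g (g \<otimes>\<^bsub>G\<^esub> p)" using 1 wm[OF a A_u] g p by simp
        then have "leq (g \<otimes>\<^bsub>G\<^esub> inv\<^bsub>G\<^esub> g) (g \<otimes>\<^bsub>G\<^esub> p \<otimes>\<^bsub>G\<^esub> inv\<^bsub>G\<^esub> g)"
          using g p by (intro leq_mult) simp_all
        moreover have "g \<otimes>\<^bsub>G\<^esub> p \<otimes>\<^bsub>G\<^esub> inv\<^bsub>G\<^esub> g = p"
          unfolding G.m_comm[OF g(2) p(2)] using g p by (simp add: G.m_assoc)
        ultimately have "leq \<one>\<^bsub>G\<^esub> p" using g by simp
        then show False using leq_antisym[OF p1] p p_ne by simp
      qed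
      then show ?thesis using le1[OF a b] False by (meson not_less)
    qed
    then show ?thesis
      unfolding x set_eq_iff val_class_def by (simp add: split_paired_all mem_spa_point) blast
  qed
  then show ?thesis by blast
qed

lemma Spa_eq: "Spa A ST Ap = range (spa_point F)"
  using spa_point_in_Spa Spa_point_exists by blast

text \<open>For the indicator of a clopen neighbourhood of \<open>i\<close> that avoids
  \<open>j\<close>, the inequality \<open>|1| \<le> |chi C|\<close> holds at \<open>i\<close> and
  fails at \<open>j\<close>.\<close>

lemma inj_spa_point: "inj (spa_point F)"
proof (rule injI, rule ccontr)
  fix i j assume eq: "spa_point F i = spa_point F j" and ne: "i \<noteq> j"
  have "open (- {j})" by (simp add: open_Compl)
  then obtain C where C: "clopen C" "i \<in> C" "C \<subseteq> - {j}" using clopen_nbhd[of "- {j}" i] ne by blast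
  have "(\<lambda>i. \<one>\<^bsub>E i\<^esub>, chi C) \<in> spa_point F i" using C A_one chi_closed by (simp add: mem_spa_point cut_apply)
  moreover have "(\<lambda>i. \<one>\<^bsub>E i\<^esub>, chi C) \<notin> spa_point F j" using C by (auto simp: mem_spa_point cut_apply)
  ultimately show False using eq by simp
qed

section \<open>The topology of the adic spectrum\<close>

definition Dom :: "(enat \<Rightarrow> 'a) \<Rightarrow> (enat \<Rightarrow> 'a) \<Rightarrow> enat set" where
  "Dom t s = {i. s i \<noteq> \<zero>\<^bsub>E i\<^esub> \<and> t i \<in> B i (vl F i (s i))}"

text \<open>By \<open>A_v\<close> the value of \<open>s\<close> is eventually constant, which
  reduces the condition to membership of \<open>t\<close> in a fixed ball.\<close>

lemma open_Dom:
  assumes t: "t \<in> carrier A" and s: "s \<in> carrier A"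
  shows "open (Dom t s)"
  unfolding open_enat_iff_eventually
proof
  assume inf: "\<infinity> \<in> Dom t s"
  have "\<forall>\<^sub>F k in sequentially. s (enat k) \<noteq> \<zero>\<^bsub>E (enat k)\<^esub> \<and> vl F (enat k) (s (enat k)) = vl F \<infinity> (s \<infinity>)"
    using A_v[OF s] inf by (simp add: Dom_def)
  then show "\<forall>\<^sub>F k in sequentially. enat k \<in> Dom t s"
    using A_B[OF t, of "vl F \<infinity> (s \<infinity>)"] by eventually_elim (use inf in \<open>simp add: Dom_def\<close>)
qed

lemma mem_Dom_iff:
  assumes "t \<in> carrier A" "s \<in> carrier A"
  shows "i \<in> Dom t s \<longleftrightarrow> (t, s) \<in> spa_point F i \<and> (s, \<zero>\<^bsub>A\<^esub>) \<notin> spa_point F i"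
  using assms A_closed[OF assms(1), of i] A_zero by (auto simp: Dom_def mem_spa_point vball_def A_simps)

abbreviation SpT where "SpT \<equiv> Spa_topology A ST Ap"

text \<open>By injectivity of \<open>spa_point\<close>, the images of open index sets are closed
  under finite intersections as well as unions, so only the generators have to be compared.\<close>

lemma openin_SpT: "openin SpT W \<longleftrightarrow> (\<exists>U. open U \<and> W = spa_point F ` U)"
proof -
  have basis: "{x \<in> Spa A ST Ap. (f, g) \<in> x \<and> (g, \<zero>\<^bsub>A\<^esub>) \<notin> x} = spa_point F ` Dom f g"
    if "f \<in> carrier A" "g \<in> carrier A" for f g
    using mem_Dom_iff[OF that] unfolding Spa_eq by blast
  have eq: "SpT = topology_generated_by {spa_point F ` Dom f g | f g. f \<in> carrier A \<and> g \<in> carrier A}"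
  proof -
    have "{{x \<in> Spa A ST Ap. (f, g) \<in> x \<and> (g, \<zero>\<^bsub>A\<^esub>) \<notin> x} | f g. f \<in> carrier A \<and> g \<in> carrier A} =
        {spa_point F ` Dom f g | f g. f \<in> carrier A \<and> g \<in> carrier A}"
      using basis by blast
    then show ?thesis unfolding Spa_topology_def by (simp only:)
  qed
  show ?thesis
  proof
    assume "openin SpT W"
    then have "generate_topology_on {spa_point F ` Dom f g | f g. f \<in> carrier A \<and> g \<in> carrier A} W"
      unfolding eq by (rule openin_topology_generated_by)
    then show "\<exists>U. open U \<and> W = spa_point F ` U"
    proof (induction rule: generate_topology_on.induct)
      case Empty
      show ?case by (intro exI[of _ "{}"]) simp
    next
      case (Int a b)
      then obtain U V where "open U" "a = spa_point F ` U" "open V" "b = spa_point F ` V" by blast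
      then show ?case by (intro exI[of _ "U \<inter> V"]) (simp add: open_Int image_Int[OF inj_spa_point])
    next
      case (UN K)
      then have "\<forall>k\<in>K. \<exists>U. open U \<and> k = spa_point F ` U" by blast
      from bchoice[OF this] obtain U where U: "\<forall>k\<in>K. open (U k) \<and> k = spa_point F ` U k" by blast
      have "(\<Union>k\<in>K. k) = (\<Union>k\<in>K. spa_point F ` U k)"
        by (rule SUP_cong[OF refl]) (use U in blast)
      then have "\<Union>K = spa_point F ` (\<Union>k\<in>K. U k)" by (simp add: image_UN)
      moreover have "open (\<Union>k\<in>K. U k)" using U by blast
      ultimately show ?case by blast
    next
      case (Basis s)
      then show ?case using open_Dom by blast
    qed
  next
    assume "\<exists>U. open U \<and> W = spa_point F ` U"
    then obtain U where U: "open U" "W = spa_point F ` U" by blast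
    have "\<exists>G. openin SpT G \<and> x \<in> G \<and> G \<subseteq> W" if xW: "x \<in> W" for x
    proof -
      obtain i where i: "i \<in> U" "x = spa_point F i" using xW U(2) by blast
      obtain C where C: "clopen C" "i \<in> C" "C \<subseteq> U" using clopen_nbhd[OF U(1) i(1)] by blast
      \<comment> \<open>Every clopen set comes from a generator: 1 is bounded by the indicator of
        \<open>C\<close> exactly on \<open>C\<close>.\<close>
      have "Dom (\<lambda>i. \<one>\<^bsub>E i\<^esub>) (chi C) = C" by (auto simp: Dom_def cut_apply dv.v_one)
      then have "openin SpT (spa_point F ` C)"
        unfolding eq using A_one chi_closed[OF C(1)] by (intro topology_generated_by_Basis) blast
      then show ?thesis using C i U(2) by blast
    qed
    then show "openin SpT W" by (subst openin_subopen) blast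
  qed
qed

lemma topspace_SpT: "topspace SpT = range (spa_point F)"
proof -
  have "openin SpT (range (spa_point F))" unfolding openin_SpT by (intro exI[of _ UNIV]) simp
  moreover have "topspace SpT \<subseteq> range (spa_point F)" using openin_topspace[of SpT] unfolding openin_SpT by blast
  ultimately show ?thesis using openin_subset by blast
qed

lemma homeomorphic_spa_point: "homeomorphic_map euclidean SpT (spa_point F)"
proof (rule bijective_open_imp_homeomorphic_map)
  show "continuous_map euclidean SpT (spa_point F)"
    unfolding continuous_map_def
  proof (intro conjI allI impI)
    show "spa_point F \<in> topspace euclidean \<rightarrow> topspace SpT" by (simp add: topspace_SpT)
    fix W assume "openin SpT W"
    then obtain U where "open U" "W = spa_point F ` U" unfolding openin_SpT by blast
    then show "openin euclidean {x \<in> topspace euclidean. spa_point F x \<in> W}"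
      by (simp add: inj_image_mem_iff[OF inj_spa_point])
  qed
  show "open_map euclidean SpT (spa_point F)" unfolding open_map_def openin_SpT by auto
  show "spa_point F ` topspace euclidean = topspace SpT" by (simp add: topspace_SpT)
  show "inj_on (spa_point F) (topspace euclidean)" using inj_spa_point by simp
qed

end

lemma subgroup_topology_cong:
  assumes "subgroup_base R \<B>" "subgroup_base R \<C>"
    "\<And>C. C \<in> \<C> \<Longrightarrow> \<exists>B\<in>\<B>. B \<subseteq> C" "\<And>B. B \<in> \<B> \<Longrightarrow> \<exists>C\<in>\<C>. C \<subseteq> B"
  shows "subgroup_topology R \<B> = subgroup_topology R \<C>"
proof -
  have le: "openin (subgroup_topology R \<C>) W"
    if B: "subgroup_base R \<B>" and C: "subgroup_base R \<C>" and BC: "\<And>B. B \<in> \<B> \<Longrightarrow> \<exists>C\<in>\<C>. C \<subseteq> B"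
      and W: "openin (subgroup_topology R \<B>) W" for \<B> \<C> W
    unfolding subgroup_base.openin_iff[OF C]
  proof (intro conjI ballI)
    show "W \<subseteq> carrier R" using W unfolding subgroup_base.openin_iff[OF B] by blast
    fix w assume "w \<in> W"
    then obtain D where D: "D \<in> \<B>" "\<forall>y\<in>carrier R. y \<ominus>\<^bsub>R\<^esub> w \<in> D \<longrightarrow> y \<in> W"
      using W unfolding subgroup_base.openin_iff[OF B] by blast
    then show "\<exists>D\<in>\<C>. \<forall>y\<in>carrier R. y \<ominus>\<^bsub>R\<^esub> w \<in> D \<longrightarrow> y \<in> W" using BC[OF D(1)] by blast
  qed
  show ?thesis
    unfolding topology_eq using le[OF assms(1,2,4)] le[OF assms(2,1,3)] by blast
qed

lemma (in complete_dvf) pow_cancel: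
  assumes "x \<in> carrier K" "y \<in> carrier K" "s \<in> carrier K" "s \<noteq> \<zero>\<^bsub>K\<^esub>"
    "x \<otimes>\<^bsub>K\<^esub> s [^]\<^bsub>K\<^esub> (n::nat) = y \<otimes>\<^bsub>K\<^esub> s [^]\<^bsub>K\<^esub> n"
  shows "x = y"
  using K.m_rcancel[OF v_pow(1)[OF assms(3,4), of n] _ assms(1,2)] assms(3,5) by simp

context local_field_family
begin

section \<open>Sections over open sets\<close>

text \<open>Continuous sections over an open \<open>U\<close>, extended by zero. Continuity is
  tested on clopen subsets because the extension may be discontinuous, and even unbounded, at a
  limit point outside \<open>U\<close>.\<close>

definition secs :: "enat set \<Rightarrow> (enat \<Rightarrow> 'a) set" where
  "secs U = {g. (\<forall>i. g i \<in> carrier (E i)) \<and> (\<forall>i. i \<notin> U \<longrightarrow> g i = \<zero>\<^bsub>E i\<^esub>) \<and>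
     (\<forall>C. clopen C \<longrightarrow> C \<subseteq> U \<longrightarrow> cut C g \<in> carrier A)}"

abbreviation SR where "SR U \<equiv> pw (secs U) U"

lemma secs_closed: "g \<in> secs U \<Longrightarrow> g i \<in> carrier (E i)"
  and secs_zero: "\<lbrakk>g \<in> secs U; i \<notin> U\<rbrakk> \<Longrightarrow> g i = \<zero>\<^bsub>E i\<^esub>"
  and secs_cut: "\<lbrakk>g \<in> secs U; clopen C; C \<subseteq> U\<rbrakk> \<Longrightarrow> cut C g \<in> carrier A"
  unfolding secs_def by simp_all

lemma secsI:
  assumes "\<And>i. g i \<in> carrier (E i)" "\<And>i. i \<notin> U \<Longrightarrow> g i = \<zero>\<^bsub>E i\<^esub>"
    "\<And>C. \<lbrakk>clopen C; C \<subseteq> U\<rbrakk> \<Longrightarrow> cut C g \<in> carrier A"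
  shows "g \<in> secs U"
  using assms unfolding secs_def by simp

lemma cut_ops:
  "\<lbrakk>\<And>i. s i \<in> carrier (E i); \<And>i. t i \<in> carrier (E i)\<rbrakk> \<Longrightarrow>
    cut C (\<lambda>i. s i \<oplus>\<^bsub>E i\<^esub> t i) = (\<lambda>i. cut C s i \<oplus>\<^bsub>E i\<^esub> cut C t i)"
  "\<lbrakk>\<And>i. s i \<in> carrier (E i); \<And>i. t i \<in> carrier (E i)\<rbrakk> \<Longrightarrow>
    cut C (\<lambda>i. s i \<otimes>\<^bsub>E i\<^esub> t i) = (\<lambda>i. cut C s i \<otimes>\<^bsub>E i\<^esub> cut C t i)"
  "cut C (\<lambda>i. \<ominus>\<^bsub>E i\<^esub> s i) = (\<lambda>i. \<ominus>\<^bsub>E i\<^esub> cut C s i)"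
  by (simp_all add: cut_apply fun_eq_iff)

lemma secs_add: "\<lbrakk>s \<in> secs U; t \<in> secs U\<rbrakk> \<Longrightarrow> (\<lambda>i. s i \<oplus>\<^bsub>E i\<^esub> t i) \<in> secs U"
  by (rule secsI) (simp_all add: secs_closed secs_zero cut_ops A_add secs_cut)

lemma secs_mult: "\<lbrakk>s \<in> secs U; t \<in> secs U\<rbrakk> \<Longrightarrow> (\<lambda>i. s i \<otimes>\<^bsub>E i\<^esub> t i) \<in> secs U"
  by (rule secsI) (simp_all add: secs_closed secs_zero cut_ops A_mult secs_cut)

lemma secs_neg: "s \<in> secs U \<Longrightarrow> (\<lambda>i. \<ominus>\<^bsub>E i\<^esub> s i) \<in> secs U"
  by (rule secsI) (simp_all add: secs_closed secs_zero cut_ops A_neg secs_cut)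

lemma secs_zero_section: "(\<lambda>i. \<zero>\<^bsub>E i\<^esub>) \<in> secs U"
proof (rule secsI)
  fix C
  have "cut C (\<lambda>i. \<zero>\<^bsub>E i\<^esub>) = (\<lambda>i. \<zero>\<^bsub>E i\<^esub>)" by (simp add: cut_apply fun_eq_iff)
  then show "cut C (\<lambda>i. \<zero>\<^bsub>E i\<^esub>) \<in> carrier A" using A_zero by simp
qed simp_all

lemma secs_one_section: "(\<lambda>i. if i \<in> U then \<one>\<^bsub>E i\<^esub> else \<zero>\<^bsub>E i\<^esub>) \<in> secs U"
proof (rule secsI)
  fix C assume C: "clopen C" "C \<subseteq> U"
  then have "cut C (\<lambda>i. if i \<in> U then \<one>\<^bsub>E i\<^esub> else \<zero>\<^bsub>E i\<^esub>) = chi C" by (auto simp: cut_apply fun_eq_iff)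
  then show "cut C (\<lambda>i. if i \<in> U then \<one>\<^bsub>E i\<^esub> else \<zero>\<^bsub>E i\<^esub>) \<in> carrier A" using chi_closed[OF C(1)] by simp
qed simp_all

lemma cring_SR: "cring (SR U)"
  by (rule cring_pw)
     (simp_all add: secs_closed secs_zero secs_add secs_mult secs_neg secs_zero_section secs_one_section)

lemma SR_minus: "\<lbrakk>s \<in> secs U; t \<in> secs U\<rbrakk> \<Longrightarrow> s \<ominus>\<^bsub>SR U\<^esub> t = (\<lambda>i. s i \<ominus>\<^bsub>E i\<^esub> t i)"
  by (rule pw_minus[OF cring_SR]) (simp_all add: secs_closed secs_neg)

lemma SR_neg: "s \<in> secs U \<Longrightarrow> \<ominus>\<^bsub>SR U\<^esub> s = (\<lambda>i. \<ominus>\<^bsub>E i\<^esub> s i)"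
proof -
  assume s: "s \<in> secs U"
  interpret cring "SR U" by (rule cring_SR)
  show ?thesis by (rule minus_equality) (use s in \<open>simp_all add: secs_closed secs_neg dv.K.l_neg\<close>)
qed

text \<open>For clopen \<open>C\<close> the set itself is among the test sets, so the extension by
  zero is a global section.\<close>

lemma secs_clopen:
  assumes "clopen C"
  shows "g \<in> secs C \<longleftrightarrow> g \<in> carrier A \<and> (\<forall>i. i \<notin> C \<longrightarrow> g i = \<zero>\<^bsub>E i\<^esub>)"
proof
  assume g: "g \<in> secs C"
  have "cut C g = g" using secs_zero[OF g] by (auto simp: cut_apply fun_eq_iff)
  then show "g \<in> carrier A \<and> (\<forall>i. i \<notin> C \<longrightarrow> g i = \<zero>\<^bsub>E i\<^esub>)"
    using secs_cut[OF g assms] secs_zero[OF g] by simp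
next
  assume "g \<in> carrier A \<and> (\<forall>i. i \<notin> C \<longrightarrow> g i = \<zero>\<^bsub>E i\<^esub>)"
  then show "g \<in> secs C" by (intro secsI) (simp_all add: A_closed A_cut)
qed

lemma cut_secs: "\<lbrakk>clopen C; a \<in> carrier A\<rbrakk> \<Longrightarrow> cut C a \<in> secs C"
  by (simp add: secs_clopen A_cut) (simp add: cut_apply)

lemma cut_secs_sub: "\<lbrakk>clopen C; C \<subseteq> U; g \<in> secs U\<rbrakk> \<Longrightarrow> cut C g \<in> secs C"
  by (simp add: secs_clopen secs_cut) (simp add: cut_apply)

definition SN :: "enat set \<Rightarrow> enat set \<Rightarrow> nat \<Rightarrow> (enat \<Rightarrow> 'a) set" where
  "SN U C n = {g \<in> secs U. \<forall>i\<in>C. g i \<in> B i (int n)}"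

text \<open>Clopen sets are compact, so this describes uniform convergence on compact open subsets
  of \<open>U\<close>, which for non-compact \<open>U\<close> is weaker than uniform convergence on
  \<open>U\<close>.\<close>

definition SB :: "enat set \<Rightarrow> (enat \<Rightarrow> 'a) set set" where
  "SB U = {SN U C n | C n. clopen C \<and> C \<subseteq> U}"

lemma SN_antimono: "\<lbrakk>C \<subseteq> D; m \<le> n\<rbrakk> \<Longrightarrow> SN U D n \<subseteq> SN U C m"
  using dv.B_antimono[of "int m" "int n"] unfolding SN_def by fastforce

lemma SN_subgroup: "additive_subgroup (SN U C n) (SR U)"
proof (unfold_locales, goal_cases)
  case (4 x)
  then have x: "x \<in> secs U" by (simp add: SN_def)
  have "inv\<^bsub>add_monoid (SR U)\<^esub> x = \<ominus>\<^bsub>SR U\<^esub> x" by (simp add: a_inv_def)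
  then show ?case using 4 SR_neg[OF x] by (simp add: SN_def secs_neg dv.B_neg)
qed (auto simp: SN_def secs_add dv.B_add secs_zero_section)

lemma subgroup_base_SB: "subgroup_base (SR U) (SB U)"
proof (intro subgroup_base.intro subgroup_base_axioms.intro cring.axioms(1)[OF cring_SR])
  show "additive_subgroup S (SR U)" if "S \<in> SB U" for S using that SN_subgroup unfolding SB_def by blast
  have "SN U {} 0 \<in> SB U" unfolding SB_def by auto
  then show "SB U \<noteq> {}" by blast
  fix S T assume "S \<in> SB U" "T \<in> SB U"
  then obtain C m D n where CD: "S = SN U C m" "clopen C" "C \<subseteq> U" "T = SN U D n" "clopen D" "D \<subseteq> U"
    unfolding SB_def by blast
  have "clopen (C \<union> D)" using CD by (simp add: open_Un open_Int)
  then have "SN U (C \<union> D) (max m n) \<in> SB U" using CD unfolding SB_def by blast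
  moreover have "SN U (C \<union> D) (max m n) \<subseteq> S \<inter> T"
    using SN_antimono[of C "C \<union> D" m "max m n" U] SN_antimono[of D "C \<union> D" n "max m n" U] CD by simp
  ultimately show "\<exists>D\<in>SB U. D \<subseteq> S \<inter> T" by blast
qed

abbreviation SRT where "SRT U \<equiv> subgroup_topology (SR U) (SB U)"

lemma openin_SRT:
  "openin (SRT U) W \<longleftrightarrow> W \<subseteq> secs U \<and>
    (\<forall>w\<in>W. \<exists>C n. clopen C \<and> C \<subseteq> U \<and> (\<forall>y\<in>secs U. (\<forall>i\<in>C. y i \<ominus>\<^bsub>E i\<^esub> w i \<in> B i (int n)) \<longrightarrow> y \<in> W))"
proof -
  have eq: "y \<ominus>\<^bsub>SR U\<^esub> w \<in> SN U C n \<longleftrightarrow> (\<forall>i\<in>C. y i \<ominus>\<^bsub>E i\<^esub> w i \<in> B i (int n))"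
    if "y \<in> secs U" "w \<in> secs U" for y w C n
  proof -
    interpret cring "SR U" by (rule cring_SR)
    have "y \<ominus>\<^bsub>SR U\<^esub> w \<in> secs U" using minus_closed[of y w] that by simp
    then show ?thesis using SR_minus[OF that] by (simp add: SN_def)
  qed
  have *: "(\<exists>D\<in>SB U. \<forall>y\<in>secs U. y \<ominus>\<^bsub>SR U\<^esub> w \<in> D \<longrightarrow> y \<in> W) \<longleftrightarrow>
      (\<exists>C n. clopen C \<and> C \<subseteq> U \<and> (\<forall>y\<in>secs U. (\<forall>i\<in>C. y i \<ominus>\<^bsub>E i\<^esub> w i \<in> B i (int n)) \<longrightarrow> y \<in> W))"
    if "w \<in> secs U" for w
  proof -
    have "(\<exists>D\<in>SB U. \<forall>y\<in>secs U. y \<ominus>\<^bsub>SR U\<^esub> w \<in> D \<longrightarrow> y \<in> W) \<longleftrightarrow>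
      (\<exists>C n. clopen C \<and> C \<subseteq> U \<and> (\<forall>y\<in>secs U. y \<ominus>\<^bsub>SR U\<^esub> w \<in> SN U C n \<longrightarrow> y \<in> W))"
      unfolding SB_def by blast
    then show ?thesis using eq[OF _ that] by simp
  qed
  show ?thesis
    unfolding subgroup_base.openin_iff[OF subgroup_base_SB] pw_simps
  proof (intro conj_cong[OF refl] ball_cong[OF refl])
    fix w assume "W \<subseteq> secs U" "w \<in> W"
    then have "w \<in> secs U" by (rule subsetD)
    then show "(\<exists>D\<in>SB U. \<forall>y\<in>secs U. y \<ominus>\<^bsub>SR U\<^esub> w \<in> D \<longrightarrow> y \<in> W) \<longleftrightarrow>
      (\<exists>C n. clopen C \<and> C \<subseteq> U \<and> (\<forall>y\<in>secs U. (\<forall>i\<in>C. y i \<ominus>\<^bsub>E i\<^esub> w i \<in> B i (int n)) \<longrightarrow> y \<in> W))"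
      by (rule *)
  qed
qed

lemma topspace_SRT: "topspace (SRT U) = secs U"
  using subgroup_base.topspace[OF subgroup_base_SB] by simp

lemma topological_ring_SR: "topological_ring (SR U) (SRT U)"
proof (rule subgroup_base.topological_ringI[OF subgroup_base_SB cring_SR])
  fix S x assume "S \<in> SB U" and x: "x \<in> carrier (SR U)"
  then obtain C n where C: "S = SN U C n" "clopen C" "C \<subseteq> U" unfolding SB_def by blast
  have xs: "x \<in> secs U" using x by simp
  \<comment> \<open>A section over \<open>U\<close> is known to be bounded only on clopen subsets,
    so the bound is taken after cutting it to \<open>C\<close>.\<close>
  obtain N :: nat where N: "\<forall>i. cut C x i \<in> B i (- int N)" using A_bounded[OF secs_cut[OF xs C(2,3)]] by blast
  show "\<exists>C\<in>SB U. \<forall>y\<in>C. x \<otimes>\<^bsub>SR U\<^esub> y \<in> S"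
  proof (intro bexI ballI)
    show "SN U C (n + N) \<in> SB U" using C unfolding SB_def by blast
    fix y assume y: "y \<in> SN U C (n + N)"
    have "x i \<otimes>\<^bsub>E i\<^esub> y i \<in> B i (int n)" if "i \<in> C" for i
      using dv.B_mult[of "x i" i "- int N" "y i" "int (n + N)"] N[rule_format, of i] y that by (simp add: SN_def cut_apply)
    then show "x \<otimes>\<^bsub>SR U\<^esub> y \<in> S" using y xs C by (simp add: SN_def secs_mult)
  qed
next
  fix S assume S: "S \<in> SB U"
  then obtain C n where C: "S = SN U C n" unfolding SB_def by blast
  have "x \<otimes>\<^bsub>SR U\<^esub> y \<in> S" if "x \<in> S" "y \<in> S" for x y
  proof -
    have "x i \<otimes>\<^bsub>E i\<^esub> y i \<in> B i (int n)" if "i \<in> C" for i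
      using \<open>x \<in> S\<close> \<open>y \<in> S\<close> that dv.B_antimono[of 0 "int n" "x i" i] by (intro dv.B_mult0) (simp_all add: C SN_def)
    then show ?thesis using that by (simp add: C SN_def secs_mult)
  qed
  then show "\<exists>C\<in>SB U. \<forall>x\<in>C. \<forall>y\<in>C. x \<otimes>\<^bsub>SR U\<^esub> y \<in> S" using S by blast
qed

section \<open>Rational localizations\<close>

text \<open>Compactness reduces a property that holds locally and passes to unions to finitely many
  clopen pieces. The pieces are not cut down, so \<open>V\<close> may exceed
  \<open>C\<close>.\<close>

lemma clopen_cover:
  assumes C: "clopen C" and cover: "\<And>i. i \<in> C \<Longrightarrow> \<exists>V. clopen V \<and> i \<in> V \<and> P V"
    and empty: "P {}" and union: "\<And>V W. \<lbrakk>clopen V; clopen W; P V; P W\<rbrakk> \<Longrightarrow> P (V \<union> W)"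
  shows "\<exists>V. clopen V \<and> C \<subseteq> V \<and> P V"
proof -
  have "closed C" using C by (simp add: closed_def)
  then have comp: "compact C" using compact_Int_closed[OF compact_UNIV_enat, of C] by simp
  have op: "open V" if "V \<in> {V. clopen V \<and> P V}" for V using that by simp
  have sub: "C \<subseteq> \<Union>{V. clopen V \<and> P V}" using cover by blast
  obtain \<D> where D: "\<D> \<subseteq> {V. clopen V \<and> P V}" "finite \<D>" "C \<subseteq> \<Union>\<D>"
    by (rule compactE[OF comp sub op])
  have "clopen (\<Union>\<D>) \<and> P (\<Union>\<D>)"
    using D(2,1)
  proof (induction \<D> rule: finite_induct)
    case empty
    then show ?case using assms(3) by simp
  next
    case (insert V \<D>)
    then have V: "clopen V" "P V" and D: "clopen (\<Union>\<D>)" "P (\<Union>\<D>)" by auto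
    have "clopen (V \<union> \<Union>\<D>)" using V D by (simp add: open_Un open_Int)
    moreover have "P (V \<union> \<Union>\<D>)" by (rule union[OF V(1) D(1) V(2) D(2)])
    ultimately show ?case by simp
  qed
  then show ?thesis using D(3) by blast
qed

definition RC :: "(enat \<Rightarrow> 'a) set \<times> (enat \<Rightarrow> 'a) \<Rightarrow> enat set" where
  "RC D = {i. snd D i \<noteq> \<zero>\<^bsub>E i\<^esub> \<and> (\<forall>t\<in>fst D. t i \<in> B i (vl F i (snd D i)))}"

definition dominated :: "(enat \<Rightarrow> 'a) \<Rightarrow> (enat \<Rightarrow> 'a) \<Rightarrow> enat set" where
  "dominated s t = {i. t i \<noteq> \<zero>\<^bsub>E i\<^esub> \<and> s i \<in> B i (vl F i (t i) + 1)}"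

text \<open>Values are integers and \<open>u\<close> has value 1, so the strict inequality
  \<open>|s| < |t|\<close> is the weak one between \<open>s\<close> and \<open>t u\<close>, and
  \<open>open_Dom\<close> applies.\<close>

lemma open_dominated: "\<lbrakk>s \<in> carrier A; t \<in> carrier A\<rbrakk> \<Longrightarrow> open (dominated s t)"
proof -
  assume st: "s \<in> carrier A" "t \<in> carrier A"
  have "i \<in> dominated s t \<longleftrightarrow> i \<in> Dom s (t \<otimes>\<^bsub>A\<^esub> u)" for i
  proof (cases "t i = \<zero>\<^bsub>E i\<^esub>")
    case True
    then show ?thesis by (simp add: dominated_def Dom_def A_simps)
  next
    case False
    note nz = dv.mult_nonzero[OF A_closed[OF st(2)] u_closed False u_nonzero]
    show ?thesis
      using False nz dv.val_mult[OF A_closed[OF st(2)] u_closed False u_nonzero]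
      by (simp add: dominated_def Dom_def A_simps v_u)
  qed
  then have "dominated s t = Dom s (t \<otimes>\<^bsub>A\<^esub> u)" by (rule Set.set_eqI)
  then show ?thesis using open_Dom[OF st(1) A.m_closed[OF st(2) A_u]] by simp
qed

lemma ideal_evker: "ideal (evker i) A"
proof -
  have "ev i \<in> ring_hom A (E i)" by (rule ring_hom_memI) (simp_all add: ev_def A_simps A_closed)
  then have "ring_hom_ring A (E i) (ev i)" by (rule ring_hom_ringI2[OF A.ring_axioms dv.K.ring_axioms])
  then show ?thesis using ring_hom_ring.kernel_is_ideal[of A "E i" "ev i"] by (simp add: evker_eq)
qed

abbreviation RD where "RD \<equiv> rational_data A ST"

lemma RD_D:
  assumes "D \<in> RD"
  shows "finite (fst D)" "fst D \<subseteq> carrier A" "snd D \<in> carrier A" "openin ST (Idl\<^bsub>A\<^esub> (fst D))"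
  using assms by (auto simp: rational_data_def)

text \<open>An open ideal contains a power of the section \<open>u\<close>, which vanishes nowhere,
  so the generators cannot all vanish at \<open>i\<close>.\<close>

lemma RD_unit:
  assumes "D \<in> RD"
  shows "\<exists>t\<in>fst D. t i \<noteq> \<zero>\<^bsub>E i\<^esub>"
proof (rule ccontr)
  assume neg: "\<not> (\<exists>t\<in>fst D. t i \<noteq> \<zero>\<^bsub>E i\<^esub>)"
  then have "fst D \<subseteq> evker i" using RD_D(2)[OF assms] by (auto simp: evker_def)
  then have sub: "Idl\<^bsub>A\<^esub> (fst D) \<subseteq> evker i" by (rule A.genideal_minimal[OF ideal_evker])
  have "additive_subgroup (Idl\<^bsub>A\<^esub> (fst D)) A"
    by (rule ideal.axioms(1)[OF A.genideal_ideal[OF RD_D(2)[OF assms]]])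
  from AT.openin_subgroup_iff[OF this] obtain n where "AN n \<subseteq> Idl\<^bsub>A\<^esub> (fst D)"
    using RD_D(4)[OF assms] unfolding section_topology_eq by blast
  moreover have "(\<lambda>i. up i n) \<in> AN n" using A_up up_B by (simp add: AN_def)
  ultimately have "(\<lambda>i. up i n) \<in> evker i" using sub by blast
  then show False using up_nonzero by (simp add: evker_def)
qed

text \<open>Where the denominator vanishes, some numerator does not by \<open>RD_unit\<close> and
  dominates it strictly. Elsewhere a failing inequality is a strict one in the other
  direction.\<close>

lemma RC_cover:
  assumes "D \<in> RD"
  shows "- RC D = (\<Union>t\<in>fst D. dominated (snd D) t)"
proof (rule subset_antisym; rule subsetI)
  fix i assume i: "i \<in> - RC D"
  show "i \<in> (\<Union>t\<in>fst D. dominated (snd D) t)"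
  proof (cases "snd D i = \<zero>\<^bsub>E i\<^esub>")
    case True
    then show ?thesis using RD_unit[OF assms, of i] by (auto simp: dominated_def)
  next
    case False
    then obtain t where t: "t \<in> fst D" "t i \<notin> B i (vl F i (snd D i))" using i by (auto simp: RC_def)
    have "t i \<in> carrier (E i)" "snd D i \<in> carrier (E i)" using t RD_D[OF assms] A_closed by blast+
    then have "i \<in> dominated (snd D) t" using t(2) False by (auto simp: dominated_def vball_def)
    then show ?thesis using t by blast
  qed
next
  fix i assume "i \<in> (\<Union>t\<in>fst D. dominated (snd D) t)"
  then show "i \<in> - RC D" by (auto simp: dominated_def RC_def vball_def)
qed

lemma clopen_RC: "D \<in> RD \<Longrightarrow> clopen (RC D)"
proof
  assume D: "D \<in> RD"
  \<comment> \<open>An empty intersection would lose the condition that the denominator is nonzero,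
    which is part of each \<open>Dom\<close>.\<close>
  have "fst D \<noteq> {}" using RD_unit[OF D] by blast
  then have "RC D = (\<Inter>t\<in>fst D. Dom t (snd D))" by (auto simp: RC_def Dom_def)
  moreover have "open (\<Inter>t\<in>fst D. Dom t (snd D))"
    using RD_D[OF D] open_Dom by (intro open_INT) blast+
  ultimately show "open (RC D)" by simp
  have "open (dominated (snd D) t)" if "t \<in> fst D" for t using open_dominated RD_D[OF D] that by blast
  then show "open (- RC D)" unfolding RC_cover[OF D] by blast
qed

lemma rational_subset_eq:
  assumes "D \<in> RD"
  shows "rational_subset A ST Ap D = spa_point F ` RC D"
proof -
  have "spa_point F i \<in> rational_subset A ST Ap D \<longleftrightarrow> i \<in> RC D" for i
  proof -
    have c: "t i \<in> carrier (E i)" "t \<in> carrier A" if "t \<in> fst D" for t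
      using RD_D[OF assms] that A_closed by blast+
    have "(snd D, \<zero>\<^bsub>A\<^esub>) \<notin> spa_point F i \<longleftrightarrow> snd D i \<noteq> \<zero>\<^bsub>E i\<^esub>"
      using RD_D(3)[OF assms] A_zero by (auto simp: mem_spa_point A_simps)
    moreover have "(t, snd D) \<in> spa_point F i \<longleftrightarrow> t i \<in> B i (vl F i (snd D i))"
      if "t \<in> fst D" "snd D i \<noteq> \<zero>\<^bsub>E i\<^esub>" for t
      using c[OF that(1)] that RD_D(3)[OF assms] by (auto simp: mem_spa_point vball_def)
    ultimately show ?thesis
      using spa_point_in_Spa[of i] unfolding rational_subset_def RC_def by blast
  qed
  moreover have "rational_subset A ST Ap D \<subseteq> range (spa_point F)"
    unfolding rational_subset_def Spa_eq by blast
  ultimately show ?thesis by blast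
qed

end

text \<open>
  The kernel of the map \<open>phi\<close> below lies in every open subgroup of the localization: over the complement of \<open>RC D\<close> some \<open>t\<close>
  satisfies \<open>|s| < |t|\<close> locally, so that \<open>s = c t\<close> with \<open>c\<close> topologically nilpotent, and
  \<open>a / s ^ k\<close> is \<open>(t / s) ^ (M + k)\<close> times \<open>c ^ M a / t ^ k\<close> for every \<open>M\<close>.
\<close>

locale rational_localization = local_field_family F lam
  for F :: "'a local_fields" and lam :: "'a \<Rightarrow> 'k::field fls" +
  fixes D :: "(enat \<Rightarrow> 'a) set \<times> (enat \<Rightarrow> 'a)"
  assumes D: "D \<in> rational_data (section_ring F) (section_topology F)"
begin

abbreviation T where "T \<equiv> fst D"
abbreviation s where "s \<equiv> snd D"
abbreviation C where "C \<equiv> RC D"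

sublocale loc: cring_localization A s
  using RD_D(3)[OF D] cring_A by (simp add: cring_localization_def cring_localization_axioms_def)

abbreviation L where "L \<equiv> localization A s"
abbreviation frct where "frct \<equiv> frac_class A s"

lemma cring_L: "cring L" by (rule loc.cring_L)

sublocale L: cring L by (rule cring_L)

lemma clopen_C: "clopen C" by (rule clopen_RC[OF D])

lemma sA: "s \<in> carrier A" by (rule RD_D(3)[OF D])

lemma s_closed: "s i \<in> carrier (E i)" by (rule A_closed[OF sA])

lemma s_nonzero: "i \<in> C \<Longrightarrow> s i \<noteq> \<zero>\<^bsub>E i\<^esub>" by (simp add: RC_def)

text \<open>The fraction \<open>a / s^n\<close> as a section over \<open>C\<close>, extended by
  zero. Clearing denominators for all representatives at once makes independence of the
  representative part of the description.\<close>

definition phi :: "((enat \<Rightarrow> 'a) \<times> nat) set \<Rightarrow> enat \<Rightarrow> 'a" where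
  "phi Z = (THE g. g \<in> secs C \<and> (\<forall>(a, n)\<in>Z. \<forall>i\<in>C. g i \<otimes>\<^bsub>E i\<^esub> s i [^]\<^bsub>E i\<^esub> n = a i))"

lemma phi_frct:
  assumes a: "a \<in> carrier A"
  shows "phi (frct a n) \<in> secs C" "i \<in> C \<Longrightarrow> phi (frct a n) i \<otimes>\<^bsub>E i\<^esub> s i [^]\<^bsub>E i\<^esub> n = a i"
proof -
  \<comment> \<open>\<open>s\<close> has no zero on the clopen set \<open>C\<close>, so by
    \<open>A_inverse_on\<close> its powers can be inverted there inside \<open>A\<close>.\<close>
  define g where "g = a \<otimes>\<^bsub>A\<^esub> cut C (\<lambda>i. inv\<^bsub>E i\<^esub> ((s [^]\<^bsub>A\<^esub> n) i))"
  have sn: "(s [^]\<^bsub>A\<^esub> n) i \<noteq> \<zero>\<^bsub>E i\<^esub>" "s i [^]\<^bsub>E i\<^esub> n \<in> carrier (E i)" "(s [^]\<^bsub>A\<^esub> n) i = s i [^]\<^bsub>E i\<^esub> n" if "i \<in> C" for i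
    using dv.v_pow(1)[OF s_closed s_nonzero[OF that]] s_closed by (simp_all add: A_pow[OF sA])
  have cutA: "cut C (\<lambda>i. inv\<^bsub>E i\<^esub> ((s [^]\<^bsub>A\<^esub> n) i)) \<in> carrier A"
    by (rule A_inverse_on[OF clopen_C A.nat_pow_closed[OF sA]]) (rule sn(1))
  then have gA: "g \<in> carrier A" unfolding g_def using a by simp
  have gs: "g \<in> secs C"
    unfolding secs_clopen[OF clopen_C] using gA A_closed[OF a] by (simp add: g_def A_simps cut_apply)
  have gi: "g i \<otimes>\<^bsub>E i\<^esub> s i [^]\<^bsub>E i\<^esub> n = a i" if i: "i \<in> C" for i
  proof -
    have nz: "s i [^]\<^bsub>E i\<^esub> n \<noteq> \<zero>\<^bsub>E i\<^esub>" using sn[OF i] by simp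
    note inv = dv.inv_nonzero[OF sn(2)[OF i] nz]
    have "g i = a i \<otimes>\<^bsub>E i\<^esub> inv\<^bsub>E i\<^esub> (s i [^]\<^bsub>E i\<^esub> n)" using i sn(3)[OF i] by (simp add: g_def A_simps cut_apply)
    then show ?thesis using inv(1,2) A_closed[OF a, of i] sn(2)[OF i] by (simp add: dv.K.m_assoc)
  qed
  \<comment> \<open>The auxiliary factor \<open>s^k\<close> in \<open>frac_class\<close> can be
    cancelled on \<open>C\<close>, where \<open>s\<close> is nonzero.\<close>
  have g_all: "g i \<otimes>\<^bsub>E i\<^esub> s i [^]\<^bsub>E i\<^esub> m = b i" if b: "(b, m) \<in> frct a n" and i: "i \<in> C" for b m i
  proof -
    obtain k :: nat where bA: "b \<in> carrier A"
      and k: "s [^]\<^bsub>A\<^esub> k \<otimes>\<^bsub>A\<^esub> (s [^]\<^bsub>A\<^esub> n \<otimes>\<^bsub>A\<^esub> b) = s [^]\<^bsub>A\<^esub> k \<otimes>\<^bsub>A\<^esub> (s [^]\<^bsub>A\<^esub> m \<otimes>\<^bsub>A\<^esub> a)"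
      using b unfolding loc.mem_frct by blast
    note sc = s_closed[of i] and nz = s_nonzero[OF i] and ac = A_closed[OF a, of i] and bc = A_closed[OF bA, of i]
      and gc = A_closed[OF gA, of i]
    have sp: "s i [^]\<^bsub>E i\<^esub> j \<in> carrier (E i)" for j :: nat using sc by simp
    have "s i [^]\<^bsub>E i\<^esub> k \<otimes>\<^bsub>E i\<^esub> (s i [^]\<^bsub>E i\<^esub> n \<otimes>\<^bsub>E i\<^esub> b i) = s i [^]\<^bsub>E i\<^esub> k \<otimes>\<^bsub>E i\<^esub> (s i [^]\<^bsub>E i\<^esub> m \<otimes>\<^bsub>E i\<^esub> a i)"
      using fun_cong[OF k, of i] by (simp add: A_simps A_pow[OF sA])
    then have "(s i [^]\<^bsub>E i\<^esub> n \<otimes>\<^bsub>E i\<^esub> b i) \<otimes>\<^bsub>E i\<^esub> s i [^]\<^bsub>E i\<^esub> k = (s i [^]\<^bsub>E i\<^esub> m \<otimes>\<^bsub>E i\<^esub> a i) \<otimes>\<^bsub>E i\<^esub> s i [^]\<^bsub>E i\<^esub> k"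
      using sp[of k] sp[of n] sp[of m] ac bc by (simp add: dv.K.m_comm)
    then have "s i [^]\<^bsub>E i\<^esub> n \<otimes>\<^bsub>E i\<^esub> b i = s i [^]\<^bsub>E i\<^esub> m \<otimes>\<^bsub>E i\<^esub> a i"
      by (rule dv.pow_cancel[rotated 4]) (use sp ac bc sc nz in simp_all)
    then have "b i \<otimes>\<^bsub>E i\<^esub> s i [^]\<^bsub>E i\<^esub> n = (g i \<otimes>\<^bsub>E i\<^esub> s i [^]\<^bsub>E i\<^esub> m) \<otimes>\<^bsub>E i\<^esub> s i [^]\<^bsub>E i\<^esub> n"
      unfolding gi[OF i, symmetric] using sp[of n] sp[of m] bc gc by (simp add: dv.K.m_ac)
    then have "b i = g i \<otimes>\<^bsub>E i\<^esub> s i [^]\<^bsub>E i\<^esub> m"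
      by (rule dv.pow_cancel[rotated 4]) (use sp gc bc sc nz in simp_all)
    then show ?thesis by simp
  qed
  have "phi (frct a n) = g"
    unfolding phi_def
  proof (rule the_equality)
    show "g \<in> secs C \<and> (\<forall>(a, n)\<in>frct a n. \<forall>i\<in>C. g i \<otimes>\<^bsub>E i\<^esub> s i [^]\<^bsub>E i\<^esub> n = a i)"
      using gs g_all by blast
  next
    fix h assume h: "h \<in> secs C \<and> (\<forall>(a, n)\<in>frct a n. \<forall>i\<in>C. h i \<otimes>\<^bsub>E i\<^esub> s i [^]\<^bsub>E i\<^esub> n = a i)"
    then have hi: "h i \<otimes>\<^bsub>E i\<^esub> s i [^]\<^bsub>E i\<^esub> n = a i" if "i \<in> C" for i using loc.frct_self[OF a, of n] that by blast
    show "h = g"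
    proof
      fix i
      show "h i = g i"
      proof (cases "i \<in> C")
        case True
        have "h i \<otimes>\<^bsub>E i\<^esub> s i [^]\<^bsub>E i\<^esub> n = g i \<otimes>\<^bsub>E i\<^esub> s i [^]\<^bsub>E i\<^esub> n" using hi[OF True] gi[OF True] by simp
        then show ?thesis
          by (rule dv.pow_cancel[rotated 4])
             (use secs_closed[OF conjunct1[OF h]] secs_closed[OF gs] True in \<open>simp_all add: s_closed s_nonzero\<close>)
      next
        case False
        then show ?thesis using h gs secs_zero[of h C i] secs_zero[of g C i] by simp
      qed
    qed
  qed
  then show "phi (frct a n) \<in> secs C" "i \<in> C \<Longrightarrow> phi (frct a n) i \<otimes>\<^bsub>E i\<^esub> s i [^]\<^bsub>E i\<^esub> n = a i"
    using gs gi by simp_all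
qed

lemma phi_eqI:
  assumes "a \<in> carrier A" "g \<in> secs C" "\<And>i. i \<in> C \<Longrightarrow> g i \<otimes>\<^bsub>E i\<^esub> s i [^]\<^bsub>E i\<^esub> n = a i"
  shows "phi (frct a n) = g"
proof
  fix i
  show "phi (frct a n) i = g i"
  proof (cases "i \<in> C")
    case True
    have "phi (frct a n) i \<otimes>\<^bsub>E i\<^esub> s i [^]\<^bsub>E i\<^esub> n = g i \<otimes>\<^bsub>E i\<^esub> s i [^]\<^bsub>E i\<^esub> n"
      using phi_frct(2)[OF assms(1) True] assms(3)[OF True] by simp
    then show ?thesis
      by (rule dv.pow_cancel[rotated 4])
         (use secs_closed[OF phi_frct(1)[OF assms(1)]] secs_closed[OF assms(2)] True in \<open>simp_all add: s_closed s_nonzero\<close>)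
  next
    case False
    then show ?thesis using secs_zero[OF phi_frct(1)[OF assms(1)]] secs_zero[OF assms(2)] by simp
  qed
qed

lemma phi_base: "a \<in> carrier A \<Longrightarrow> phi (frct a 0) = cut C a"
  by (rule phi_eqI) (simp_all add: cut_secs clopen_C cut_apply A_closed)

lemma phi_hom: "phi \<in> ring_hom L (SR C)"
proof (rule ring_hom_memI)
  fix x assume "x \<in> carrier L"
  then show "phi x \<in> carrier (SR C)" using phi_frct(1) by (auto simp: loc.carrier_L)
next
  fix x y assume "x \<in> carrier L" "y \<in> carrier L"
  then obtain a b n m where ab: "a \<in> carrier A" "b \<in> carrier A" "x = frct a n" "y = frct b m"
    by (auto simp: loc.carrier_L)
  define g where "g = phi (frct a n)"
  define h where "h = phi (frct b m)"
  have g: "g \<in> secs C" "\<And>i. i \<in> C \<Longrightarrow> g i \<otimes>\<^bsub>E i\<^esub> s i [^]\<^bsub>E i\<^esub> n = a i" using phi_frct[OF ab(1)] by (simp_all add: g_def)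
  have h: "h \<in> secs C" "\<And>i. i \<in> C \<Longrightarrow> h i \<otimes>\<^bsub>E i\<^esub> s i [^]\<^bsub>E i\<^esub> m = b i" using phi_frct[OF ab(2)] by (simp_all add: h_def)
  have cl: "g i \<in> carrier (E i)" "h i \<in> carrier (E i)" "s i [^]\<^bsub>E i\<^esub> n \<in> carrier (E i)" "s i [^]\<^bsub>E i\<^esub> m \<in> carrier (E i)" for i
    using secs_closed[OF g(1)] secs_closed[OF h(1)] s_closed by simp_all
  have pw: "s i [^]\<^bsub>E i\<^esub> (n + m) = s i [^]\<^bsub>E i\<^esub> n \<otimes>\<^bsub>E i\<^esub> s i [^]\<^bsub>E i\<^esub> m" for i
    using s_closed by (simp add: dv.K.nat_pow_mult)
  have "phi (frct (a \<otimes>\<^bsub>A\<^esub> b) (n + m)) = (\<lambda>i. g i \<otimes>\<^bsub>E i\<^esub> h i)"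
  proof (rule phi_eqI)
    fix i assume i: "i \<in> C"
    have "(g i \<otimes>\<^bsub>E i\<^esub> h i) \<otimes>\<^bsub>E i\<^esub> s i [^]\<^bsub>E i\<^esub> (n + m) = (g i \<otimes>\<^bsub>E i\<^esub> s i [^]\<^bsub>E i\<^esub> n) \<otimes>\<^bsub>E i\<^esub> (h i \<otimes>\<^bsub>E i\<^esub> s i [^]\<^bsub>E i\<^esub> m)"
      unfolding pw using cl[of i] by (simp add: dv.K.m_ac)
    then show "(g i \<otimes>\<^bsub>E i\<^esub> h i) \<otimes>\<^bsub>E i\<^esub> s i [^]\<^bsub>E i\<^esub> (n + m) = (a \<otimes>\<^bsub>A\<^esub> b) i"
      unfolding g(2)[OF i] h(2)[OF i] by (simp add: A_simps)
  qed (use ab g h in \<open>simp_all add: secs_mult\<close>)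
  then show "phi (x \<otimes>\<^bsub>L\<^esub> y) = phi x \<otimes>\<^bsub>SR C\<^esub> phi y"
    using ab by (simp add: loc.mult_frct g_def h_def)
  have "phi (frct (s [^]\<^bsub>A\<^esub> m \<otimes>\<^bsub>A\<^esub> a \<oplus>\<^bsub>A\<^esub> s [^]\<^bsub>A\<^esub> n \<otimes>\<^bsub>A\<^esub> b) (n + m)) = (\<lambda>i. g i \<oplus>\<^bsub>E i\<^esub> h i)"
  proof (rule phi_eqI)
    show "s [^]\<^bsub>A\<^esub> m \<otimes>\<^bsub>A\<^esub> a \<oplus>\<^bsub>A\<^esub> s [^]\<^bsub>A\<^esub> n \<otimes>\<^bsub>A\<^esub> b \<in> carrier A" using ab sA by simp
    show "(\<lambda>i. g i \<oplus>\<^bsub>E i\<^esub> h i) \<in> secs C" using g h by (simp add: secs_add)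
    fix i assume i: "i \<in> C"
    have "(g i \<oplus>\<^bsub>E i\<^esub> h i) \<otimes>\<^bsub>E i\<^esub> s i [^]\<^bsub>E i\<^esub> (n + m) =
        s i [^]\<^bsub>E i\<^esub> m \<otimes>\<^bsub>E i\<^esub> (g i \<otimes>\<^bsub>E i\<^esub> s i [^]\<^bsub>E i\<^esub> n) \<oplus>\<^bsub>E i\<^esub> s i [^]\<^bsub>E i\<^esub> n \<otimes>\<^bsub>E i\<^esub> (h i \<otimes>\<^bsub>E i\<^esub> s i [^]\<^bsub>E i\<^esub> m)"
      unfolding pw using cl[of i] by (simp add: dv.K.m_ac dv.K.l_distr dv.K.r_distr)
    then show "(g i \<oplus>\<^bsub>E i\<^esub> h i) \<otimes>\<^bsub>E i\<^esub> s i [^]\<^bsub>E i\<^esub> (n + m) = (s [^]\<^bsub>A\<^esub> m \<otimes>\<^bsub>A\<^esub> a \<oplus>\<^bsub>A\<^esub> s [^]\<^bsub>A\<^esub> n \<otimes>\<^bsub>A\<^esub> b) i"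
      unfolding g(2)[OF i] h(2)[OF i] by (simp add: A_simps A_pow[OF sA])
  qed
  then show "phi (x \<oplus>\<^bsub>L\<^esub> y) = phi x \<oplus>\<^bsub>SR C\<^esub> phi y"
    using ab by (simp add: loc.add_frct g_def h_def)
next
  show "phi \<one>\<^bsub>L\<^esub> = \<one>\<^bsub>SR C\<^esub>"
    unfolding loc.one_L phi_base[OF A.one_closed] by (simp add: A_simps cut_def)
qed

text \<open>Extension by zero from the clopen set \<open>C\<close> stays in \<open>A\<close>, so
  fractions with denominator 1 already suffice.\<close>

lemma phi_surj: "phi ` carrier L = carrier (SR C)"
proof
  show "phi ` carrier L \<subseteq> carrier (SR C)" using ring_hom_closed[OF phi_hom] by blast
  show "carrier (SR C) \<subseteq> phi ` carrier L"
  proof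
    fix g assume "g \<in> carrier (SR C)"
    then have g: "g \<in> carrier A" "\<And>i. i \<notin> C \<Longrightarrow> g i = \<zero>\<^bsub>E i\<^esub>" using secs_clopen[OF clopen_C] by simp_all
    have "cut C g = g" using g(2) by (auto simp: cut_apply fun_eq_iff)
    then have "g = phi (frct g 0)" using phi_base[OF g(1)] by simp
    then show "g \<in> phi ` carrier L" using loc.frct_closed[OF g(1)] by blast
  qed
qed

definition N where "N n = SN C C n"

text \<open>This identifies the completion for the topology \<open>Q.\<tau>\<close> pulled back
  along \<open>phi\<close>; it remains to recognize \<open>localization_topology\<close> as that
  topology.\<close>

sublocale Q: complete_quotient L "SR C" phi N
proof (intro complete_quotient.intro complete_quotient_axioms.intro cring_L cring_SR phi_hom phi_surj)
  show "additive_subgroup (N n) (SR C)" for n unfolding N_def by (rule SN_subgroup)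
  show "N (Suc n) \<subseteq> N n" for n unfolding N_def by (rule SN_antimono) simp_all
next
  fix x assume x: "\<And>n. x \<in> N n"
  have "x i = \<zero>\<^bsub>E i\<^esub>" for i
  proof (cases "i \<in> C")
    case True
    show ?thesis by (rule dv.B_separated) (use x True in \<open>simp add: N_def SN_def\<close>)
  next
    case False
    have "x \<in> secs C" using x[of 0] by (simp add: N_def SN_def)
    then show ?thesis using False by (rule secs_zero)
  qed
  then show "x = \<zero>\<^bsub>SR C\<^esub>" by (simp add: fun_eq_iff)
next
  fix n x y assume x: "x \<in> N n" and y: "y \<in> N n"
  have "x i \<otimes>\<^bsub>E i\<^esub> y i \<in> B i (int n)" if "i \<in> C" for i
    using x y that dv.B_antimono[of 0 "int n" "x i" i] by (intro dv.B_mult0) (simp_all add: N_def SN_def)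
  then show "x \<otimes>\<^bsub>SR C\<^esub> y \<in> N n" using x y by (simp add: N_def SN_def secs_mult)
next
  fix n x assume "x \<in> carrier (SR C)"
  then have x: "x \<in> secs C" "x \<in> carrier A" using secs_clopen[OF clopen_C] by simp_all
  obtain M :: nat where M: "\<forall>i. x i \<in> B i (- int M)" using A_bounded[OF x(2)] by blast
  have "x \<otimes>\<^bsub>SR C\<^esub> y \<in> N n" if y: "y \<in> N (n + M)" for y
  proof -
    have "x i \<otimes>\<^bsub>E i\<^esub> y i \<in> B i (int n)" if "i \<in> C" for i
      using dv.B_mult[of "x i" i "- int M" "y i" "int (n + M)"] M y that by (simp add: N_def SN_def)
    then show ?thesis using x y by (simp add: N_def SN_def secs_mult)
  qed
  then show "\<exists>m. \<forall>y\<in>N m. x \<otimes>\<^bsub>SR C\<^esub> y \<in> N n" by blast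
next
  fix x :: "nat \<Rightarrow> enat \<Rightarrow> 'a"
  assume x: "\<And>k. x k \<in> carrier (SR C)"
    and cauchy: "\<And>n. \<exists>M. \<forall>k\<ge>M. \<forall>l\<ge>M. x k \<ominus>\<^bsub>SR C\<^esub> x l \<in> N n"
  have xs: "x k \<in> secs C" and xA: "x k \<in> carrier A" for k using x[of k] secs_clopen[OF clopen_C] by simp_all
  \<comment> \<open>Off \<open>C\<close> all these sections vanish, so a condition on
    \<open>C\<close> holds at every index and \<open>A_complete\<close> becomes applicable.\<close>
  have N_iff: "y \<ominus>\<^bsub>SR C\<^esub> z \<in> N n \<longleftrightarrow> (\<forall>i. y i \<ominus>\<^bsub>E i\<^esub> z i \<in> B i (int n))" if "y \<in> secs C" "z \<in> secs C" for y z n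
  proof -
    interpret S: cring "SR C" by (rule cring_SR)
    have "y \<ominus>\<^bsub>SR C\<^esub> z \<in> secs C" using S.minus_closed[of y z] that by simp
    moreover have "y i \<ominus>\<^bsub>E i\<^esub> z i \<in> B i (int n)" if "i \<notin> C" for i
      using secs_zero[OF \<open>y \<in> secs C\<close> that] secs_zero[OF \<open>z \<in> secs C\<close> that] by (simp add: dv.minus_self)
    ultimately show ?thesis unfolding SR_minus[OF that] N_def SN_def by blast
  qed
  have "\<exists>y\<in>carrier A. \<forall>n::nat. \<exists>M. \<forall>k\<ge>M. \<forall>i. x k i \<ominus>\<^bsub>E i\<^esub> y i \<in> B i (int n)"
    by (rule A_complete[OF xA]) (use cauchy N_iff[OF xs xs] in simp)
  then obtain y where y: "y \<in> carrier A" "\<And>n::nat. \<exists>M. \<forall>k\<ge>M. \<forall>i. x k i \<ominus>\<^bsub>E i\<^esub> y i \<in> B i (int n)" by blast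
  have "y i = \<zero>\<^bsub>E i\<^esub>" if i: "i \<notin> C" for i
  proof (rule dv.B_separated)
    fix n :: nat
    obtain M where M: "\<forall>k\<ge>M. \<forall>i. x k i \<ominus>\<^bsub>E i\<^esub> y i \<in> B i (int n)" using y(2) by blast
    then have "x M i \<ominus>\<^bsub>E i\<^esub> y i \<in> B i (int n)" by blast
    then have "y i \<ominus>\<^bsub>E i\<^esub> x M i \<in> B i (int n)" by (rule dv.B_minus_sym[OF A_closed[OF y(1)] A_closed[OF xA]])
    from dv.B_close[OF this _ A_closed[OF y(1)]] show "y i \<in> B i (int n)" using secs_zero[OF xs i] by simp
  qed
  then have ys: "y \<in> secs C" using secs_clopen[OF clopen_C] y(1) by blast
  then show "\<exists>y\<in>carrier (SR C). \<forall>n. \<exists>M. \<forall>k\<ge>M. x k \<ominus>\<^bsub>SR C\<^esub> y \<in> N n"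
    using y(2) N_iff[OF xs ys] by (intro bexI[of _ y]) simp_all
qed

lemma mem_pre: "z \<in> Q.pre n \<longleftrightarrow> z \<in> carrier L \<and> (\<forall>i\<in>C. phi z i \<in> B i (int n))"
  using ring_hom_closed[OF phi_hom, of z] by (auto simp: Q.pre_def N_def SN_def)

abbreviation DS where "DS \<equiv> frac_subring A D"

definition G where "G U = generate (add_monoid L) {d \<otimes>\<^bsub>L\<^esub> frct a 0 | d a. d \<in> DS \<and> a \<in> U}"

lemma T_closed: "t \<in> T \<Longrightarrow> t \<in> carrier A"
  using RD_D(2)[OF D] by blast

text \<open>By the definition of \<open>RC\<close> the generators \<open>t / s\<close> are integral
  at every point of \<open>C\<close>, and integrality passes to the subring.\<close>

lemma DS_integral: "d \<in> DS \<Longrightarrow> d \<in> Q.pre 0"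
  unfolding frac_subring_def
proof (induction rule: generate_ring.induct)
  case one
  show ?case unfolding mem_pre using ring_hom_one[OF phi_hom] by (simp add: vball_def dv.v_one)
next
  case (incl h)
  then obtain t where t: "t \<in> T" "h = frct t 1" by blast
  have tA: "t \<in> carrier A" by (rule T_closed[OF t(1)])
  have "phi h i \<in> B i 0" if i: "i \<in> C" for i
  proof -
    have pc: "phi h i \<in> carrier (E i)" using secs_closed[OF phi_frct(1)[OF tA]] t by simp
    have "phi h i \<otimes>\<^bsub>E i\<^esub> s i = t i" using phi_frct(2)[OF tA i, of 1] s_closed[of i] t by simp
    then have "s i \<otimes>\<^bsub>E i\<^esub> phi h i \<in> B i (vl F i (s i) + 0)"
      using i t(1) pc s_closed[of i] by (simp add: dv.K.m_comm RC_def)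
    then show ?thesis using dv.B_mult_iff[OF s_closed s_nonzero[OF i] pc] by blast
  qed
  then show ?case unfolding mem_pre using t tA by simp
next
  case (a_inv h)
  show ?case by (rule additive_subgroup.a_inv_closed[OF Q.pre_subgroup a_inv.IH])
next
  case (eng_add h1 h2)
  then show ?case by (intro additive_subgroup.a_closed[OF Q.pre_subgroup])
next
  case (eng_mult h1 h2)
  then have c: "h1 \<in> carrier L" "h2 \<in> carrier L" by (simp_all add: mem_pre)
  have "phi (h1 \<otimes>\<^bsub>L\<^esub> h2) i \<in> B i 0" if "i \<in> C" for i
    unfolding ring_hom_mult[OF phi_hom c] pw_simps by (rule dv.B_mult0) (use eng_mult that in \<open>simp_all add: mem_pre\<close>)
  then show ?case using c by (simp add: mem_pre)
qed

text \<open>Factors from \<open>DS\<close> are integral on \<open>C\<close>, so they do not lower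
  the values of elements of \<open>AN n\<close>.\<close>

lemma G_subset:
  assumes "U \<subseteq> AN n"
  shows "G U \<subseteq> Q.pre n"
  unfolding G_def
proof (rule L.add.generate_subgroup_incl)
  show "subgroup (Q.pre n) (add_monoid L)" using Q.pre_subgroup by (rule additive_subgroup.a_subgroup)
  show "{d \<otimes>\<^bsub>L\<^esub> frct a 0 | d a. d \<in> DS \<and> a \<in> U} \<subseteq> Q.pre n"
  proof
    fix z assume "z \<in> {d \<otimes>\<^bsub>L\<^esub> frct a 0 | d a. d \<in> DS \<and> a \<in> U}"
    then obtain d a where da: "z = d \<otimes>\<^bsub>L\<^esub> frct a 0" "d \<in> DS" "a \<in> U" by blast
    have d: "d \<in> carrier L" "\<And>i. i \<in> C \<Longrightarrow> phi d i \<in> B i 0" using DS_integral[OF da(2)] by (simp_all add: mem_pre)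
    have a: "a \<in> carrier A" "\<And>i. a i \<in> B i (int n)" using da(3) assms by (auto simp: AN_def)
    have "phi z i \<in> B i (int n)" if "i \<in> C" for i
      unfolding da(1) ring_hom_mult[OF phi_hom d(1) loc.frct_closed[OF a(1)]] pw_simps phi_base[OF a(1)]
      by (rule dv.B_mult0) (use d a that in \<open>simp_all add: cut_apply\<close>)
    then show "z \<in> Q.pre n" using da d a by (simp add: mem_pre)
  qed
qed

context
  fixes U n
  assumes U: "U \<subseteq> carrier A" "AN n \<subseteq> U"
begin

lemma G_add: "\<lbrakk>x \<in> G U; y \<in> G U\<rbrakk> \<Longrightarrow> x \<oplus>\<^bsub>L\<^esub> y \<in> G U"
  unfolding G_def using generate.eng[of x "add_monoid L" _ y] by simp

lemma G_incl: "\<lbrakk>d \<in> DS; a \<in> U\<rbrakk> \<Longrightarrow> d \<otimes>\<^bsub>L\<^esub> frct a 0 \<in> G U"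
  unfolding G_def by (rule generate.incl) blast

lemma frct_add_same:
  assumes "a \<in> carrier A" "b \<in> carrier A"
  shows "frct (a \<oplus>\<^bsub>A\<^esub> b) k = frct a k \<oplus>\<^bsub>L\<^esub> frct b k"
  unfolding loc.add_frct[OF assms]
  by (rule loc.frct_eqI) (use assms sA in \<open>simp_all add: A.r_distr A.nat_pow_mult[symmetric] A.m_assoc\<close>)

lemma frct_dominated:
  assumes V: "clopen V" "V \<subseteq> dominated s t" and t: "t \<in> T" and b: "b \<in> carrier A" "\<And>i. i \<notin> V \<Longrightarrow> b i = \<zero>\<^bsub>E i\<^esub>"
  shows "frct b k \<in> G U"
proof -
  have tA: "t \<in> carrier A" by (rule T_closed[OF t])
  note tc = A_closed[OF tA]
  have t0: "t i \<noteq> \<zero>\<^bsub>E i\<^esub>" if "i \<in> V" for i using V(2) that by (auto simp: dominated_def)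
  have tk0: "(t [^]\<^bsub>A\<^esub> k) i \<noteq> \<zero>\<^bsub>E i\<^esub>" if "i \<in> V" for i
    using dv.v_pow(1)[OF tc t0[OF that]] by (simp add: A_pow[OF tA])
  have tu0: "(t \<otimes>\<^bsub>A\<^esub> u) i \<noteq> \<zero>\<^bsub>E i\<^esub>" if "i \<in> V" for i
    using dv.mult_nonzero[OF tc u_closed t0[OF that] u_nonzero] by (simp add: A_simps)
  define ti where "ti = cut V (\<lambda>i. inv\<^bsub>E i\<^esub> ((t [^]\<^bsub>A\<^esub> k) i))"
  \<comment> \<open>On \<open>V\<close> this is \<open>s / (t u)\<close>, which is integral because
    the value of \<open>s\<close> exceeds that of \<open>t\<close> by at least 1.\<close>
  define c where "c = cut V (\<lambda>i. inv\<^bsub>E i\<^esub> ((t \<otimes>\<^bsub>A\<^esub> u) i)) \<otimes>\<^bsub>A\<^esub> s"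
  have tiA: "ti \<in> carrier A" unfolding ti_def by (rule A_inverse_on[OF V(1) A.nat_pow_closed[OF tA]]) (rule tk0)
  have "cut V (\<lambda>i. inv\<^bsub>E i\<^esub> ((t \<otimes>\<^bsub>A\<^esub> u) i)) \<in> carrier A"
    by (rule A_inverse_on[OF V(1) A.m_closed[OF tA A_u]]) (rule tu0)
  then have cA: "c \<in> carrier A" unfolding c_def using sA by simp
  have tuc: "(t i \<otimes>\<^bsub>E i\<^esub> u i) \<otimes>\<^bsub>E i\<^esub> c i = s i" if i: "i \<in> V" for i
  proof -
    have "c i = inv\<^bsub>E i\<^esub> (t i \<otimes>\<^bsub>E i\<^esub> u i) \<otimes>\<^bsub>E i\<^esub> s i" using i by (simp add: c_def A_simps cut_apply)
    then show ?thesis using dv.inv_mult_cancel(2)[of "t i \<otimes>\<^bsub>E i\<^esub> u i" i "s i"] tu0[OF i] tc[of i] s_closed[of i] by (simp add: A_simps)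
  qed
  have c0: "c i \<in> B i 0" for i
  proof (cases "i \<in> V")
    case True
    have vtu: "vl F i (t i \<otimes>\<^bsub>E i\<^esub> u i) = vl F i (t i) + 1" using dv.val_mult[OF tc u_closed t0[OF True] u_nonzero] by (simp add: v_u)
    have "(t i \<otimes>\<^bsub>E i\<^esub> u i) \<otimes>\<^bsub>E i\<^esub> c i \<in> B i (vl F i (t i \<otimes>\<^bsub>E i\<^esub> u i) + 0)"
      unfolding tuc[OF True] vtu using V(2) True by (auto simp: dominated_def)
    then show ?thesis
      using dv.B_mult_iff[of "t i \<otimes>\<^bsub>E i\<^esub> u i" i "c i" 0] tu0[OF True] tc[of i] A_closed[OF cA] by (simp add: A_simps)
  next
    case False
    then show ?thesis using s_closed[of i] by (simp add: c_def A_simps cut_apply)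
  qed
  define h where "h = b \<otimes>\<^bsub>A\<^esub> ti"
  have hA: "h \<in> carrier A" using b tiA by (simp add: h_def)
  obtain M0 :: nat where M0: "\<forall>i. h i \<in> B i (- int M0)" using A_bounded[OF hA] by blast
  \<comment> \<open>\<open>M0\<close> bounds the poles of \<open>h\<close>, which is
    \<open>b / t^k\<close> on \<open>V\<close>. The exponent \<open>n + M0\<close> therefore brings
    \<open>u^M h\<close> into \<open>AN n\<close>, and the integral factor \<open>c^M\<close> keeps
    \<open>w\<close> there.\<close>
  define M where "M = n + M0"
  define w where "w = c [^]\<^bsub>A\<^esub> M \<otimes>\<^bsub>A\<^esub> (u [^]\<^bsub>A\<^esub> M \<otimes>\<^bsub>A\<^esub> h)"
  have wA: "w \<in> carrier A" using cA A_u hA by (simp add: w_def)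
  have cM: "c [^]\<^bsub>A\<^esub> j \<in> AN 0" for j :: nat
  proof (induction j)
    case 0
    show ?case using A_one by (simp add: AN_def A_simps)
  next
    case (Suc j)
    have "c \<in> AN 0" using cA c0 by (simp add: AN_def)
    from AN_mult[OF Suc this] show ?case by simp
  qed
  have "up i M \<otimes>\<^bsub>E i\<^esub> h i \<in> B i (int n)" for i
    using dv.B_mult[OF up_B, of "h i" i "- int M0" M] M0 by (simp add: M_def)
  then have "u [^]\<^bsub>A\<^esub> M \<otimes>\<^bsub>A\<^esub> h \<in> AN n" using A_u hA by (simp add: AN_def A_simps(1) A_pow[OF A_u] A_mult A_up)
  from AN_mult[OF cM this] have "w \<in> AN n" by (simp add: w_def)
  then have wU: "w \<in> U" using U(2) by blast
  have tjD: "frct t 1 [^]\<^bsub>L\<^esub> j \<in> DS" for j :: nat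
  proof (induction j)
    case 0
    show ?case unfolding frac_subring_def by (simp add: generate_ring.one)
  next
    case (Suc j)
    have "frct t 1 \<in> DS" unfolding frac_subring_def using t by (intro generate_ring.incl) blast
    then show ?case using Suc unfolding frac_subring_def by (simp add: generate_ring.eng_mult)
  qed
  \<comment> \<open>On \<open>V\<close> this follows from \<open>s = t u c\<close> and from
    \<open>ti\<close> being the inverse of \<open>t^k\<close>; off \<open>V\<close> both sides
    vanish with \<open>b\<close>.\<close>
  have "s [^]\<^bsub>A\<^esub> (M + k) \<otimes>\<^bsub>A\<^esub> b = s [^]\<^bsub>A\<^esub> k \<otimes>\<^bsub>A\<^esub> (t [^]\<^bsub>A\<^esub> (M + k) \<otimes>\<^bsub>A\<^esub> w)"
  proof
    fix i
    note cl = tc[of i] s_closed[of i] A_closed[OF cA, of i] A_closed[OF b(1), of i] A_closed[OF tiA, of i] u_closed[of i]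
    show "(s [^]\<^bsub>A\<^esub> (M + k) \<otimes>\<^bsub>A\<^esub> b) i = (s [^]\<^bsub>A\<^esub> k \<otimes>\<^bsub>A\<^esub> (t [^]\<^bsub>A\<^esub> (M + k) \<otimes>\<^bsub>A\<^esub> w)) i"
    proof (cases "i \<in> V")
      case True
      have tti: "t i [^]\<^bsub>E i\<^esub> k \<otimes>\<^bsub>E i\<^esub> ti i = \<one>\<^bsub>E i\<^esub>"
        using dv.inv_nonzero(3)[of "t i [^]\<^bsub>E i\<^esub> k" i] tk0[OF True] True cl(1) by (simp add: ti_def cut_apply A_pow[OF tA])
      have sM: "s i [^]\<^bsub>E i\<^esub> M = t i [^]\<^bsub>E i\<^esub> M \<otimes>\<^bsub>E i\<^esub> u i [^]\<^bsub>E i\<^esub> M \<otimes>\<^bsub>E i\<^esub> c i [^]\<^bsub>E i\<^esub> M"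
        unfolding tuc[OF True, symmetric] using cl by (simp add: dv.K.nat_pow_distrib)
      define p where "p = t i [^]\<^bsub>E i\<^esub> M"
      define q where "q = t i [^]\<^bsub>E i\<^esub> k"
      define r where "r = u i [^]\<^bsub>E i\<^esub> M"
      define c' where "c' = c i [^]\<^bsub>E i\<^esub> M"
      define s' where "s' = s i [^]\<^bsub>E i\<^esub> k"
      have cl': "p \<in> carrier (E i)" "q \<in> carrier (E i)" "r \<in> carrier (E i)" "c' \<in> carrier (E i)" "s' \<in> carrier (E i)"
        using cl by (simp_all add: p_def q_def r_def c'_def s'_def)
      have "(s [^]\<^bsub>A\<^esub> (M + k) \<otimes>\<^bsub>A\<^esub> b) i = ((p \<otimes>\<^bsub>E i\<^esub> r \<otimes>\<^bsub>E i\<^esub> c') \<otimes>\<^bsub>E i\<^esub> s') \<otimes>\<^bsub>E i\<^esub> b i"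
        using cl(2) sM by (simp add: A_simps A_pow[OF sA] dv.K.nat_pow_mult[symmetric] p_def r_def c'_def s'_def)
      also have "\<dots> = s' \<otimes>\<^bsub>E i\<^esub> (p \<otimes>\<^bsub>E i\<^esub> (c' \<otimes>\<^bsub>E i\<^esub> (r \<otimes>\<^bsub>E i\<^esub> b i)))"
        using cl' cl(4) by (simp add: dv.K.m_ac)
      also have "\<dots> = s' \<otimes>\<^bsub>E i\<^esub> (p \<otimes>\<^bsub>E i\<^esub> (c' \<otimes>\<^bsub>E i\<^esub> (r \<otimes>\<^bsub>E i\<^esub> (b i \<otimes>\<^bsub>E i\<^esub> (q \<otimes>\<^bsub>E i\<^esub> ti i)))))"
        unfolding tti[folded q_def] using cl(4) by simp
      also have "\<dots> = s' \<otimes>\<^bsub>E i\<^esub> (p \<otimes>\<^bsub>E i\<^esub> q \<otimes>\<^bsub>E i\<^esub> (c' \<otimes>\<^bsub>E i\<^esub> (r \<otimes>\<^bsub>E i\<^esub> (b i \<otimes>\<^bsub>E i\<^esub> ti i))))"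
        using cl' cl(4,5) by (simp add: dv.K.m_ac)
      also have "\<dots> = (s [^]\<^bsub>A\<^esub> k \<otimes>\<^bsub>A\<^esub> (t [^]\<^bsub>A\<^esub> (M + k) \<otimes>\<^bsub>A\<^esub> w)) i"
        using cl(1) by (simp add: w_def h_def A_simps A_pow[OF sA] A_pow[OF tA] A_pow[OF cA] A_pow[OF A_u]
            dv.K.nat_pow_mult[symmetric] p_def q_def r_def c'_def s'_def)
      finally show ?thesis .
    next
      case False
      then have "b i = \<zero>\<^bsub>E i\<^esub>" by (rule b(2))
      then show ?thesis using cl
        by (simp add: w_def h_def A_simps A_pow[OF sA] A_pow[OF tA] A_pow[OF cA] A_pow[OF A_u])
    qed
  qed
  then have "frct (t [^]\<^bsub>A\<^esub> (M + k) \<otimes>\<^bsub>A\<^esub> w) (M + k) = frct b k"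
    by (intro loc.frct_eqI) (use tA wA b in simp_all)
  moreover have "frct t 1 [^]\<^bsub>L\<^esub> (M + k) \<otimes>\<^bsub>L\<^esub> frct w 0 = frct (t [^]\<^bsub>A\<^esub> (M + k) \<otimes>\<^bsub>A\<^esub> w) (M + k)"
    using loc.mult_frct[OF A.nat_pow_closed[OF tA] wA, of "M + k" "M + k" 0] loc.frct_pow[OF tA, of "M + k"] by simp
  ultimately show ?thesis using G_incl[OF tjD[of "M + k"] wU] by simp
qed

text \<open>\<open>G U\<close> is stable under sums, so a section supported off \<open>C\<close> can
  be split along finitely many clopen sets on each of which one numerator dominates
  \<open>s\<close>.\<close>

lemma frct_kernel:
  assumes b: "b \<in> carrier A" "\<And>i. i \<in> C \<Longrightarrow> b i = \<zero>\<^bsub>E i\<^esub>"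
  shows "frct b k \<in> G U"
proof -
  define P where "P V \<longleftrightarrow> (\<forall>b\<in>carrier A. (\<forall>i. i \<notin> V \<longrightarrow> b i = \<zero>\<^bsub>E i\<^esub>) \<longrightarrow> frct b k \<in> G U)" for V
  have "\<exists>V. clopen V \<and> - C \<subseteq> V \<and> P V"
  proof (rule clopen_cover)
    show "clopen (- C)" using clopen_C by simp
  next
    fix i assume "i \<in> - C"
    then obtain t where t: "t \<in> T" "i \<in> dominated s t" using RC_cover[OF D] by blast
    obtain V where V: "clopen V" "i \<in> V" "V \<subseteq> dominated s t"
      using clopen_nbhd[OF open_dominated[OF sA T_closed[OF t(1)]] t(2)] by blast
    have "P V" unfolding P_def using frct_dominated[OF V(1,3) t(1)] by blast
    then show "\<exists>V. clopen V \<and> i \<in> V \<and> P V" using V by blast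
  next
    show "P {}"
      unfolding P_def
    proof (intro ballI impI)
      fix b assume b: "b \<in> carrier A" "\<forall>i. i \<notin> {} \<longrightarrow> b i = \<zero>\<^bsub>E i\<^esub>"
      then have "b = \<zero>\<^bsub>A\<^esub>" by (simp add: A_simps fun_eq_iff)
      then have "frct b k = \<zero>\<^bsub>L\<^esub>" unfolding loc.zero_L using sA by (intro loc.frct_eqI) simp_all
      then show "frct b k \<in> G U" unfolding G_def using generate.one[of "add_monoid L"] by simp
    qed
  next
    fix V W assume V: "clopen V" "P V" and W: "clopen W" "P W"
    show "P (V \<union> W)"
      unfolding P_def
    proof (intro ballI impI)
      fix b assume b: "b \<in> carrier A" "\<forall>i. i \<notin> V \<union> W \<longrightarrow> b i = \<zero>\<^bsub>E i\<^esub>"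
      have cV: "clopen (- V)" using V by simp
      have "frct (cut V b) k \<in> G U" using V(2) A_cut[OF V(1) b(1)] unfolding P_def by (simp add: cut_apply)
      moreover have "frct (cut (- V) b) k \<in> G U"
        using W(2) A_cut[OF cV b(1)] b(2) unfolding P_def by (simp add: cut_apply)
      moreover have "b = cut V b \<oplus>\<^bsub>A\<^esub> cut (- V) b" using A_closed[OF b(1)] by (auto simp: A_simps cut_apply fun_eq_iff)
      ultimately show "frct b k \<in> G U"
        using frct_add_same[OF A_cut[OF V(1) b(1)] A_cut[OF cV b(1)], of k] G_add by metis
    qed
  qed
  then obtain V where V: "- C \<subseteq> V" "P V" by blast
  then show ?thesis unfolding P_def using b by blast
qed

text \<open>Split \<open>z\<close> into \<open>p = phi z\<close>, read as a section with denominator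
  1 that lies in \<open>U\<close>, and a remainder killed by \<open>phi\<close>, which
  \<open>frct_kernel\<close> covers.\<close>

lemma pre_subset_G: "Q.pre n \<subseteq> G U"
proof
  fix z assume z: "z \<in> Q.pre n"
  then have zL: "z \<in> carrier L" by (simp add: mem_pre)
  define p where "p = phi z"
  have ps: "p \<in> secs C" using ring_hom_closed[OF phi_hom zL] by (simp add: p_def)
  then have p: "p \<in> carrier A" "\<And>i. i \<notin> C \<Longrightarrow> p i = \<zero>\<^bsub>E i\<^esub>" using secs_clopen[OF clopen_C] by simp_all
  have "p i \<in> B i (int n)" for i using z p(2)[of i] by (cases "i \<in> C") (simp_all add: mem_pre p_def)
  then have "p \<in> U" using p(1) U(2) by (auto simp: AN_def)
  moreover have "\<one>\<^bsub>L\<^esub> \<in> DS" unfolding frac_subring_def by (rule generate_ring.one)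
  ultimately have "\<one>\<^bsub>L\<^esub> \<otimes>\<^bsub>L\<^esub> frct p 0 \<in> G U" by (rule G_incl[rotated])
  then have 1: "frct p 0 \<in> G U" using loc.frct_closed[OF p(1)] by simp
  define y where "y = z \<ominus>\<^bsub>L\<^esub> frct p 0"
  have pL: "frct p 0 \<in> carrier L" using p(1) by simp
  have yL: "y \<in> carrier L" using zL pL by (simp add: y_def)
  have cutp: "cut C p = p" using p(2) by (auto simp: cut_apply fun_eq_iff)
  have "phi y = p \<ominus>\<^bsub>SR C\<^esub> p"
    using ring_iso_minus[OF phi_hom L.ring_axioms cring.axioms(1)[OF cring_SR] zL pL] phi_base[OF p(1)] cutp
    by (simp add: y_def p_def)
  then have phiy: "phi y i = \<zero>\<^bsub>E i\<^esub>" for i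
    using secs_closed[OF ps] by (simp add: SR_minus[OF ps ps] dv.minus_self)
  obtain b k where b: "b \<in> carrier A" "y = frct b k" using yL by (auto simp: loc.carrier_L)
  have "b i = \<zero>\<^bsub>E i\<^esub>" if "i \<in> C" for i
    using phi_frct(2)[OF b(1) that, of k] phiy[of i] b(2) s_closed[of i] by simp
  then have "y \<in> G U" unfolding b(2) by (rule frct_kernel[OF b(1)])
  then have "y \<oplus>\<^bsub>L\<^esub> frct p 0 \<in> G U" using 1 by (rule G_add)
  then show "z \<in> G U" using zL pL by (simp add: y_def L.minus_eq L.a_assoc L.l_neg)
qed

end

text \<open>By \<open>G_subset\<close> and \<open>pre_subset_G\<close> the subgroups
  \<open>G U\<close> and \<open>Q.pre n\<close> are cofinal in each other; the comparison is again
  made on translates.\<close>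

lemma localization_topology_eq: "localization_topology A ST D = Q.\<tau>"
proof -
  have coset_mono: "S +>\<^bsub>L\<^esub> w \<subseteq> S' +>\<^bsub>L\<^esub> w" if "S \<subseteq> S'" for S S' w
    using that unfolding a_r_coset_def' by blast
  have sub: "\<exists>n. Q.pre n \<subseteq> G U" if "U \<in> open_subgroups A ST" for U
  proof -
    have "additive_subgroup U A" "\<exists>n. AN n \<subseteq> U" using that unfolding section_topology_eq AT.open_subgroups_eq by blast+
    then show ?thesis using pre_subset_G[of U] additive_subgroup.a_subset[of U A] by blast
  qed
  have AN: "AN n \<in> open_subgroups A ST" for n unfolding section_topology_eq AT.open_subgroups_eq using AN_subgroup by blast
  have "(\<exists>S\<in>{G U | U. U \<in> open_subgroups A ST}. S +>\<^bsub>L\<^esub> w \<subseteq> W) \<longleftrightarrow> (\<exists>S\<in>range Q.pre. S +>\<^bsub>L\<^esub> w \<subseteq> W)" for w W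
  proof
    assume "\<exists>S\<in>{G U | U. U \<in> open_subgroups A ST}. S +>\<^bsub>L\<^esub> w \<subseteq> W"
    then obtain U where U: "U \<in> open_subgroups A ST" "G U +>\<^bsub>L\<^esub> w \<subseteq> W" by blast
    obtain n where "Q.pre n \<subseteq> G U" using sub[OF U(1)] by blast
    from coset_mono[OF this, of w] have "Q.pre n +>\<^bsub>L\<^esub> w \<subseteq> W" using U(2) by (rule order_trans)
    then show "\<exists>S\<in>range Q.pre. S +>\<^bsub>L\<^esub> w \<subseteq> W" by blast
  next
    assume "\<exists>S\<in>range Q.pre. S +>\<^bsub>L\<^esub> w \<subseteq> W"
    then obtain n where n: "Q.pre n +>\<^bsub>L\<^esub> w \<subseteq> W" by blast
    from coset_mono[OF G_subset[OF subset_refl], of n w] have "G (AN n) +>\<^bsub>L\<^esub> w \<subseteq> W" using n by (rule order_trans)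
    then show "\<exists>S\<in>{G U | U. U \<in> open_subgroups A ST}. S +>\<^bsub>L\<^esub> w \<subseteq> W" using AN by blast
  qed
  then have "subgroup_topology L {G U | U. U \<in> open_subgroups A ST} = subgroup_topology L (range Q.pre)"
    by (simp only: subgroup_topology_def)
  then show ?thesis unfolding localization_topology_def G_def by (simp only:)
qed

lemma rat_ring_eq: "rat_ring A ST D = completion L Q.\<tau>"
  and rat_topology_eq: "rat_topology A ST D = completion_topology L Q.\<tau>"
  and rat_map_eq: "rat_map A ST D a = completion_map L Q.\<tau> (frct a 0)"
  unfolding rat_ring_def rat_topology_def rat_map_def localization_topology_eq by (rule refl)+

text \<open>\<open>C\<close> is the largest clopen subset of itself, so closeness on all of
  \<open>C\<close> already gives a base.\<close>

lemma SRT_eq: "SRT C = subgroup_topology (SR C) (range N)"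
proof (rule subgroup_topology_cong[OF subgroup_base_SB Q.subgroup_base_N])
  show "\<exists>S\<in>SB C. S \<subseteq> S'" if S': "S' \<in> range N" for S'
  proof -
    obtain n where "S' = N n" using S' by blast
    then have "S' = SN C C n" by (simp only: N_def)
    then show ?thesis using clopen_C unfolding SB_def by blast
  qed
  show "\<exists>S'\<in>range N. S' \<subseteq> S" if S: "S \<in> SB C" for S
  proof -
    obtain C' n where C': "S = SN C C' n" "C' \<subseteq> C" using S unfolding SB_def by blast
    have "N n \<subseteq> S" unfolding N_def C'(1) by (rule SN_antimono[OF C'(2) le_refl])
    then show ?thesis by blast
  qed
qed

lemma rational_iso:
  "\<exists>\<psi>. \<psi> \<in> ring_iso (rat_ring A ST D) (SR C) \<and> homeomorphic_map (rat_topology A ST D) (SRT C) \<psi> \<and>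
     (\<forall>a\<in>carrier A. \<psi> (rat_map A ST D a) = cut C a)"
proof (intro exI conjI ballI)
  show "Q.completion_iso \<in> ring_iso (rat_ring A ST D) (SR C)" unfolding rat_ring_eq by (rule Q.completion_iso)
  show "homeomorphic_map (rat_topology A ST D) (SRT C) Q.completion_iso"
    unfolding rat_topology_eq SRT_eq by (rule Q.completion_homeomorphic)
  fix a assume a: "a \<in> carrier A"
  show "Q.completion_iso (rat_map A ST D a) = cut C a"
    unfolding rat_map_eq using Q.completion_iso_map[OF loc.frct_closed[OF a]] phi_base[OF a] by simp
qed

lemma cring_rat_ring: "cring (rat_ring A ST D)"
  unfolding rat_ring_eq by (rule Q.ring_completion)

lemma rat_map_closed: "a \<in> carrier A \<Longrightarrow> rat_map A ST D a \<in> carrier (rat_ring A ST D)"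
  unfolding rat_map_eq rat_ring_eq by (rule Q.completion_map_closed[OF loc.frct_closed])

end

text \<open>The operations of \<open>R\<close> are those of \<open>S\<close> conjugated by
  \<open>h\<close> and its continuous inverse.\<close>

lemma topological_ring_transport:
  assumes iso: "h \<in> ring_iso R S" and R: "cring R" and S: "topological_ring S \<sigma>"
    and homeo: "homeomorphic_map \<tau> \<sigma> h" and top: "topspace \<tau> = carrier R"
  shows "topological_ring R \<tau>"
proof -
  interpret R: cring R by fact
  have cS: "cring S" using S by (simp add: topological_ring_def)
  interpret S: cring S by (rule cS)
  have hom: "h \<in> ring_hom R S" using iso by (simp add: ring_iso_def)
  interpret h: ring_hom_ring R S h
    using hom R.ring_axioms S.ring_axioms by (simp add: ring_hom_ringI2)
  obtain g where "homeomorphic_maps \<tau> \<sigma> h g" using homeo homeomorphic_map_maps by blast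
  then have hc: "continuous_map \<tau> \<sigma> h" and gc: "continuous_map \<sigma> \<tau> g" and gh: "\<And>x. x \<in> carrier R \<Longrightarrow> g (h x) = x"
    unfolding homeomorphic_maps_def top by blast+
  have pair: "continuous_map (prod_topology \<tau> \<tau>) (prod_topology \<sigma> \<sigma>) (\<lambda>(x, y). (h x, h y))"
    using hc by (simp add: continuous_map_prod_top)
  have binop: "continuous_map (prod_topology \<tau> \<tau>) \<tau> (\<lambda>(x, y). f x y)"
    if f': "continuous_map (prod_topology \<sigma> \<sigma>) \<sigma> (\<lambda>(x, y). f' x y)"
      and ff': "\<And>x y. \<lbrakk>x \<in> carrier R; y \<in> carrier R\<rbrakk> \<Longrightarrow> h (f x y) = f' (h x) (h y) \<and> f x y \<in> carrier R" for f f'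
  proof -
    have "continuous_map (prod_topology \<tau> \<tau>) \<tau> (g \<circ> ((\<lambda>(x, y). f' x y) \<circ> (\<lambda>(x, y). (h x, h y))))"
      by (rule continuous_map_compose[OF continuous_map_compose[OF pair f'] gc])
    moreover have "(g \<circ> ((\<lambda>(x, y). f' x y) \<circ> (\<lambda>(x, y). (h x, h y)))) p = (\<lambda>(x, y). f x y) p"
      if "p \<in> topspace (prod_topology \<tau> \<tau>)" for p
      using that ff' gh by (auto simp: top) metis
    ultimately show ?thesis by (rule continuous_map_eq)
  qed
  have "continuous_map \<tau> \<tau> (\<lambda>x. \<ominus>\<^bsub>R\<^esub> x)"
  proof -
    have "continuous_map \<sigma> \<sigma> (\<lambda>x. \<ominus>\<^bsub>S\<^esub> x)" using S by (simp add: topological_ring_def)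
    then have "continuous_map \<tau> \<tau> (g \<circ> ((\<lambda>x. \<ominus>\<^bsub>S\<^esub> x) \<circ> h))"
      using continuous_map_compose[OF continuous_map_compose[OF hc] gc] by blast
    moreover have "(g \<circ> ((\<lambda>x. \<ominus>\<^bsub>S\<^esub> x) \<circ> h)) x = \<ominus>\<^bsub>R\<^esub> x" if "x \<in> topspace \<tau>" for x
      using gh[of "\<ominus>\<^bsub>R\<^esub> x"] that by (simp add: top)
    ultimately show ?thesis by (rule continuous_map_eq)
  qed
  moreover have "continuous_map (prod_topology \<tau> \<tau>) \<tau> (\<lambda>(x, y). x \<oplus>\<^bsub>R\<^esub> y)"
    by (rule binop[of "\<lambda>x y. x \<oplus>\<^bsub>S\<^esub> y"]) (use S in \<open>simp_all add: topological_ring_def\<close>)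
  moreover have "continuous_map (prod_topology \<tau> \<tau>) \<tau> (\<lambda>(x, y). x \<otimes>\<^bsub>R\<^esub> y)"
    by (rule binop[of "\<lambda>x y. x \<otimes>\<^bsub>S\<^esub> y"]) (use S in \<open>simp_all add: topological_ring_def\<close>)
  ultimately show ?thesis unfolding topological_ring_def using R top by blast
qed

lemma (in rational_localization) topspace_rat: "topspace (rat_topology A ST D) = carrier (rat_ring A ST D)"
  unfolding rat_topology_eq rat_ring_eq Q.completion_topology_eq
  by (rule subgroup_base.topspace[OF Q.subgroup_base_completion])

section \<open>Rings of rational subsets as rings of sections\<close>

context local_field_family
begin

abbreviation RR where "RR D \<equiv> rat_ring A ST D"
abbreviation RT where "RT D \<equiv> rat_topology A ST D"
abbreviation RM where "RM D \<equiv> rat_map A ST D"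

lemma rational_localizationI: "D \<in> RD \<Longrightarrow> rational_localization F lam D"
  by (intro rational_localization.intro rational_localization_axioms.intro local_field_family_axioms)

lemmas cring_RR = rational_localization.cring_rat_ring[OF rational_localizationI]
lemmas RM_closed = rational_localization.rat_map_closed[OF rational_localizationI]
lemmas topspace_RT = rational_localization.topspace_rat[OF rational_localizationI]

text \<open>Chosen through the three properties in \<open>rational_iso\<close>, so that the rings of
  different \<open>D\<close> can be compared with each other.\<close>

definition psi where
  "psi D = (SOME \<psi>. \<psi> \<in> ring_iso (RR D) (SR (RC D)) \<and> homeomorphic_map (RT D) (SRT (RC D)) \<psi> \<and>
     (\<forall>a\<in>carrier A. \<psi> (RM D a) = cut (RC D) a))"

lemma psi_iso: "D \<in> RD \<Longrightarrow> psi D \<in> ring_iso (RR D) (SR (RC D))"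
  and psi_homeo: "D \<in> RD \<Longrightarrow> homeomorphic_map (RT D) (SRT (RC D)) (psi D)"
  and psi_RM: "\<lbrakk>D \<in> RD; a \<in> carrier A\<rbrakk> \<Longrightarrow> psi D (RM D a) = cut (RC D) a"
  using someI_ex[OF rational_localization.rational_iso[OF rational_localizationI], of D] unfolding psi_def by blast+

lemma psi_hom: "D \<in> RD \<Longrightarrow> psi D \<in> ring_hom (RR D) (SR (RC D))"
  and psi_bij: "D \<in> RD \<Longrightarrow> bij_betw (psi D) (carrier (RR D)) (secs (RC D))"
  using psi_iso[of D] by (simp_all add: ring_iso_def)

lemma psi_closed: "\<lbrakk>D \<in> RD; x \<in> carrier (RR D)\<rbrakk> \<Longrightarrow> psi D x \<in> secs (RC D)"
  using psi_bij[of D] by (auto simp: bij_betw_def)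

lemma psi_A: "\<lbrakk>D \<in> RD; x \<in> carrier (RR D)\<rbrakk> \<Longrightarrow> psi D x \<in> carrier A"
  using psi_closed[of D x] secs_clopen[OF clopen_RC, of D] by simp

lemma psi_inj: "\<lbrakk>D \<in> RD; x \<in> carrier (RR D); y \<in> carrier (RR D); psi D x = psi D y\<rbrakk> \<Longrightarrow> x = y"
  using psi_bij[of D] by (auto simp: bij_betw_def inj_on_def)

lemma psi_ops:
  assumes "D \<in> RD" "x \<in> carrier (RR D)" "y \<in> carrier (RR D)"
  shows "psi D (x \<otimes>\<^bsub>RR D\<^esub> y) = (\<lambda>i. psi D x i \<otimes>\<^bsub>E i\<^esub> psi D y i)"
    "psi D (x \<oplus>\<^bsub>RR D\<^esub> y) = (\<lambda>i. psi D x i \<oplus>\<^bsub>E i\<^esub> psi D y i)"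
  using ring_hom_mult[OF psi_hom[OF assms(1)] assms(2,3)] ring_hom_add[OF psi_hom[OF assms(1)] assms(2,3)] by simp_all

lemma psi_one: "D \<in> RD \<Longrightarrow> psi D \<one>\<^bsub>RR D\<^esub> = (\<lambda>i. if i \<in> RC D then \<one>\<^bsub>E i\<^esub> else \<zero>\<^bsub>E i\<^esub>)"
  using ring_hom_one[OF psi_hom, of D] by simp

lemma psi_zero: "D \<in> RD \<Longrightarrow> psi D \<zero>\<^bsub>RR D\<^esub> = (\<lambda>i. \<zero>\<^bsub>E i\<^esub>)"
  using ring_hom_zero[OF psi_hom cring.axioms(1)[OF cring_RR] cring.axioms(1)[OF cring_SR], of D] by simp

lemma cut_cut: "C \<subseteq> C' \<Longrightarrow> cut C (cut C' a) = cut C a"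
  by (auto simp: cut_def fun_eq_iff)

lemma cut_secs_id: "a \<in> secs U \<Longrightarrow> cut U a = a"
  using secs_zero[of a U] by (auto simp: cut_apply fun_eq_iff)

text \<open>The section \<open>psi D x\<close> belongs to \<open>A\<close> after extension by zero,
  so \<open>A\<close> maps onto the ring of every rational subset.\<close>

lemma RM_psi:
  assumes D: "D \<in> RD" and x: "x \<in> carrier (RR D)"
  shows "RM D (psi D x) = x"
proof (rule psi_inj[OF D RM_closed[OF D psi_A[OF D x]] x])
  show "psi D (RM D (psi D x)) = psi D x"
    unfolding psi_RM[OF D psi_A[OF D x]] by (rule cut_secs_id[OF psi_closed[OF D x]])
qed

text \<open>A clopen subset of the smaller set is one of the larger set, so the same set and index
  describe a neighbourhood in the source.\<close>

lemma continuous_cut: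
  assumes "clopen C" "clopen C'" "C' \<subseteq> C"
  shows "continuous_map (SRT C) (SRT C') (cut C')"
proof (rule subgroup_base.continuous_mapI[OF subgroup_base_SB _ subgroup_base_SB])
  show "cut C' \<in> carrier (SR C) \<rightarrow> carrier (SR C')"
    using cut_secs_sub[OF assms(2,3)] by simp
  fix x S assume x: "x \<in> carrier (SR C)" and S: "S \<in> SB C'"
  then obtain C'' n where C'': "S = SN C' C'' n" "clopen C''" "C'' \<subseteq> C'" unfolding SB_def by blast
  show "\<exists>S'\<in>SB C. \<forall>y\<in>carrier (SR C). y \<ominus>\<^bsub>SR C\<^esub> x \<in> S' \<longrightarrow> cut C' y \<ominus>\<^bsub>SR C'\<^esub> cut C' x \<in> S"
  proof (intro bexI ballI impI)
    show "SN C C'' n \<in> SB C" using C'' assms(3) unfolding SB_def by blast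
    fix y assume y: "y \<in> carrier (SR C)" "y \<ominus>\<^bsub>SR C\<^esub> x \<in> SN C C'' n"
    have s: "x \<in> secs C" "y \<in> secs C" using x y by simp_all
    note cs = cut_secs_sub[OF assms(2,3) s(1)] cut_secs_sub[OF assms(2,3) s(2)]
    interpret S': cring "SR C'" by (rule cring_SR)
    have "cut C' y \<ominus>\<^bsub>SR C'\<^esub> cut C' x \<in> secs C'" using S'.minus_closed[of "cut C' y" "cut C' x"] cs by simp
    moreover have "y i \<ominus>\<^bsub>E i\<^esub> x i \<in> B i (int n)" if "i \<in> C''" for i
      using y(2) that unfolding SR_minus[OF s(2,1)] by (simp add: SN_def)
    then have "cut C' y i \<ominus>\<^bsub>E i\<^esub> cut C' x i \<in> B i (int n)" if "i \<in> C''" for i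
      using that C''(3) by (auto simp: cut_apply)
    ultimately show "cut C' y \<ominus>\<^bsub>SR C'\<^esub> cut C' x \<in> S"
      unfolding C''(1) SN_def SR_minus[OF cs(2,1)] by blast
  qed
qed

text \<open>Under \<open>psi\<close>, restriction is cutting to the smaller clopen set, which is a
  continuous homomorphism. Uniqueness is algebraic: by \<open>RM_psi\<close> every element comes
  from \<open>A\<close>, where the map is prescribed.\<close>

lemma rat_res_eq:
  assumes D: "D \<in> RD" and D': "D' \<in> RD" and sub: "RC D' \<subseteq> RC D" and x: "x \<in> carrier (RR D)"
  shows "rat_res A ST D D' x = RM D' (psi D x)"
proof -
  define \<phi> where "\<phi> = restrict (\<lambda>x. RM D' (psi D x)) (carrier (RR D))"
  define P where "P \<phi> \<longleftrightarrow> \<phi> \<in> extensional (carrier (RR D)) \<and> \<phi> \<in> ring_hom (RR D) (RR D') \<and>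
     continuous_map (RT D) (RT D') \<phi> \<and> (\<forall>a\<in>carrier A. \<phi> (RM D a) = RM D' a)" for \<phi>
  interpret R: cring "RR D" by (rule cring_RR[OF D])
  interpret R': cring "RR D'" by (rule cring_RR[OF D'])
  have phi_closed: "\<phi> y \<in> carrier (RR D')" if "y \<in> carrier (RR D)" for y
    using that RM_closed[OF D' psi_A[OF D that]] by (simp add: \<phi>_def)
  have psi_phi: "psi D' (\<phi> y) = cut (RC D') (psi D y)" if "y \<in> carrier (RR D)" for y
    using that psi_RM[OF D' psi_A[OF D that]] by (simp add: \<phi>_def)
  have hom: "\<phi> \<in> ring_hom (RR D) (RR D')"
  proof (rule ring_hom_memI)
    fix y z assume y: "y \<in> carrier (RR D)" and z: "z \<in> carrier (RR D)"
    note c = phi_closed[OF y] phi_closed[OF z]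
    show "\<phi> (y \<otimes>\<^bsub>RR D\<^esub> z) = \<phi> y \<otimes>\<^bsub>RR D'\<^esub> \<phi> z"
    proof (rule psi_inj[OF D'])
      show "psi D' (\<phi> (y \<otimes>\<^bsub>RR D\<^esub> z)) = psi D' (\<phi> y \<otimes>\<^bsub>RR D'\<^esub> \<phi> z)"
        unfolding psi_phi[OF R.m_closed[OF y z]] psi_ops[OF D y z] psi_ops[OF D' c] psi_phi[OF y] psi_phi[OF z]
        by (rule cut_ops) (simp_all add: A_closed psi_A[OF D] y z)
    qed (use c y z phi_closed in simp_all)
    show "\<phi> (y \<oplus>\<^bsub>RR D\<^esub> z) = \<phi> y \<oplus>\<^bsub>RR D'\<^esub> \<phi> z"
    proof (rule psi_inj[OF D'])
      show "psi D' (\<phi> (y \<oplus>\<^bsub>RR D\<^esub> z)) = psi D' (\<phi> y \<oplus>\<^bsub>RR D'\<^esub> \<phi> z)"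
        unfolding psi_phi[OF R.a_closed[OF y z]] psi_ops[OF D y z] psi_ops[OF D' c] psi_phi[OF y] psi_phi[OF z]
        by (rule cut_ops) (simp_all add: A_closed psi_A[OF D] y z)
    qed (use c y z phi_closed in simp_all)
  next
    show "\<phi> \<one>\<^bsub>RR D\<^esub> = \<one>\<^bsub>RR D'\<^esub>"
    proof (rule psi_inj[OF D'])
      show "psi D' (\<phi> \<one>\<^bsub>RR D\<^esub>) = psi D' \<one>\<^bsub>RR D'\<^esub>"
        unfolding psi_phi[OF R.one_closed] psi_one[OF D] psi_one[OF D'] using sub
        by (auto simp: cut_apply fun_eq_iff)
    qed (use phi_closed in simp_all)
  qed (rule phi_closed)
  obtain g where g: "homeomorphic_maps (RT D') (SRT (RC D')) (psi D') g"
    using psi_homeo[OF D'] homeomorphic_map_maps by blast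
  have cont: "continuous_map (RT D) (RT D') \<phi>"
  proof -
    have "continuous_map (RT D) (RT D') (g \<circ> (cut (RC D') \<circ> psi D))"
    proof (rule continuous_map_compose[OF continuous_map_compose])
      show "continuous_map (RT D) (SRT (RC D)) (psi D)" by (rule homeomorphic_imp_continuous_map[OF psi_homeo[OF D]])
      show "continuous_map (SRT (RC D)) (SRT (RC D')) (cut (RC D'))"
        by (rule continuous_cut[OF clopen_RC[OF D] clopen_RC[OF D'] sub])
      show "continuous_map (SRT (RC D')) (RT D') g" using g by (simp add: homeomorphic_maps_def)
    qed
    moreover have "(g \<circ> (cut (RC D') \<circ> psi D)) y = \<phi> y" if "y \<in> topspace (RT D)" for y
    proof -
      have y: "y \<in> carrier (RR D)" using that topspace_RT[OF D] by simp
      have "g (psi D' (\<phi> y)) = \<phi> y"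
        using g phi_closed[OF y] topspace_RT[OF D'] by (simp add: homeomorphic_maps_def)
      then show ?thesis using psi_phi[OF y] by simp
    qed
    ultimately show ?thesis by (rule continuous_map_eq)
  qed
  have "\<phi> (RM D a) = RM D' a" if a: "a \<in> carrier A" for a
  proof (rule psi_inj[OF D' phi_closed[OF RM_closed[OF D a]] RM_closed[OF D' a]])
    show "psi D' (\<phi> (RM D a)) = psi D' (RM D' a)"
      unfolding psi_phi[OF RM_closed[OF D a]] psi_RM[OF D a] psi_RM[OF D' a] by (rule cut_cut[OF sub])
  qed
  then have P: "P \<phi>" unfolding P_def using hom cont by (simp add: \<phi>_def)
  have "\<phi>' = \<phi>" if "P \<phi>'" for \<phi>'
  proof (rule extensionalityI)
    show "\<phi>' \<in> extensional (carrier (RR D))" "\<phi> \<in> extensional (carrier (RR D))" using that P unfolding P_def by blast+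
    fix y assume y: "y \<in> carrier (RR D)"
    have "\<phi>' (RM D (psi D y)) = RM D' (psi D y)" using that psi_A[OF D y] unfolding P_def by blast
    then show "\<phi>' y = \<phi> y" using RM_psi[OF D y] y by (simp add: \<phi>_def)
  qed
  then have "(THE \<phi>. P \<phi>) = \<phi>" using P by blast
  then have "rat_res A ST D D' = \<phi>" unfolding rat_res_def P_def .
  then show ?thesis using x by (simp add: \<phi>_def)
qed

section \<open>The structure presheaf\<close>

definition UW :: "((enat \<Rightarrow> 'a) \<times> (enat \<Rightarrow> 'a)) set set \<Rightarrow> enat set" where
  "UW W = {i. spa_point F i \<in> W}"

lemma open_UW: "openin SpT W \<Longrightarrow> open (UW W)"
  unfolding openin_SpT UW_def using inj_image_mem_iff[OF inj_spa_point] by auto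

text \<open>The presentation \<open>U(1 / chi C)\<close> of a clopen set:
  \<open>|1| \<le> |chi C|\<close> holds exactly on \<open>C\<close>, and the ideal generated by 1
  is open.\<close>

definition std :: "enat set \<Rightarrow> (enat \<Rightarrow> 'a) set \<times> (enat \<Rightarrow> 'a)" where
  "std C = ({\<one>\<^bsub>A\<^esub>}, chi C)"

lemma std_RD: "clopen C \<Longrightarrow> std C \<in> RD"
proof -
  assume C: "clopen C"
  have "openin ST (carrier A)" using openin_topspace[of ST] unfolding section_topology_eq AT.topspace .
  then show ?thesis using chi_closed[OF C] by (simp add: std_def rational_data_def A.genideal_one)
qed

lemma RC_std: "RC (std C) = C"
  by (auto simp: RC_def std_def cut_apply A_simps dv.v_one)

abbreviation dat where "dat W \<equiv> data_in A ST Ap W"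

lemma mem_dat: "D \<in> dat W \<longleftrightarrow> D \<in> RD \<and> RC D \<subseteq> UW W"
  by (auto simp: data_in_def UW_def rational_subset_eq)

lemma std_dat: "\<lbrakk>clopen C; C \<subseteq> UW W\<rbrakk> \<Longrightarrow> std C \<in> dat W"
  by (simp add: mem_dat std_RD RC_std)

lemma dat_nbhd:
  assumes "openin SpT W" "i \<in> UW W"
  obtains D where "D \<in> dat W" "i \<in> RC D"
proof -
  obtain C where "clopen C" "i \<in> C" "C \<subseteq> UW W" using clopen_nbhd[OF open_UW[OF assms(1)] assms(2)] by blast
  then show ?thesis using that[of "std C"] std_dat RC_std by simp
qed

abbreviation Str where "Str W \<equiv> str_ring A ST Ap W"
abbreviation StT where "StT W \<equiv> str_topology A ST Ap W"

lemma Str_simps: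
  "x \<otimes>\<^bsub>Str W\<^esub> y = (\<lambda>D\<in>dat W. x D \<otimes>\<^bsub>RR D\<^esub> y D)" "x \<oplus>\<^bsub>Str W\<^esub> y = (\<lambda>D\<in>dat W. x D \<oplus>\<^bsub>RR D\<^esub> y D)"
  "\<one>\<^bsub>Str W\<^esub> = (\<lambda>D\<in>dat W. \<one>\<^bsub>RR D\<^esub>)" "\<zero>\<^bsub>Str W\<^esub> = (\<lambda>D\<in>dat W. \<zero>\<^bsub>RR D\<^esub>)"
  by (simp_all add: str_ring_def)

text \<open>By \<open>rat_res_eq\<close> and injectivity of \<open>psi\<close>, compatibility under
  \<open>rat_res\<close> becomes equality of cut sections.\<close>

lemma mem_Str:
  "x \<in> carrier (Str W) \<longleftrightarrow> x \<in> (\<Pi>\<^sub>E D\<in>dat W. carrier (RR D)) \<and>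
    (\<forall>D\<in>dat W. \<forall>D'\<in>dat W. RC D' \<subseteq> RC D \<longrightarrow> psi D' (x D') = cut (RC D') (psi D (x D)))"
proof -
  have "rat_res A ST D D' (x D) = x D' \<longleftrightarrow> psi D' (x D') = cut (RC D') (psi D (x D))"
    if D: "D \<in> RD" "D' \<in> RD" "RC D' \<subseteq> RC D" and x: "x D \<in> carrier (RR D)" "x D' \<in> carrier (RR D')" for D D'
  proof -
    note r = rat_res_eq[OF D x(1)]
    have c: "RM D' (psi D (x D)) \<in> carrier (RR D')" by (rule RM_closed[OF D(2) psi_A[OF D(1) x(1)]])
    have "RM D' (psi D (x D)) = x D' \<longleftrightarrow> psi D' (RM D' (psi D (x D))) = psi D' (x D')"
      using psi_inj[OF D(2) c x(2)] by metis
    then show ?thesis unfolding r psi_RM[OF D(2) psi_A[OF D(1) x(1)]] by (simp only: eq_commute)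
  qed
  moreover have "rational_subset A ST Ap D' \<subseteq> rational_subset A ST Ap D \<longleftrightarrow> RC D' \<subseteq> RC D"
    if "D \<in> RD" "D' \<in> RD" for D D'
    unfolding rational_subset_eq[OF that(1)] rational_subset_eq[OF that(2)] by (rule inj_image_subset_iff[OF inj_spa_point])
  ultimately have *: "(rational_subset A ST Ap D' \<subseteq> rational_subset A ST Ap D \<longrightarrow> rat_res A ST D D' (x D) = x D') \<longleftrightarrow>
      (RC D' \<subseteq> RC D \<longrightarrow> psi D' (x D') = cut (RC D') (psi D (x D)))"
    if "x \<in> (\<Pi>\<^sub>E D\<in>dat W. carrier (RR D))" "D \<in> dat W" "D' \<in> dat W" for D D'
    using that PiE_mem[OF that(1)] mem_dat[of D W] mem_dat[of D' W] by simp
  have "x \<in> carrier (Str W) \<longleftrightarrow> x \<in> (\<Pi>\<^sub>E D\<in>dat W. carrier (RR D)) \<and>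
    (\<forall>D\<in>dat W. \<forall>D'\<in>dat W. rational_subset A ST Ap D' \<subseteq> rational_subset A ST Ap D \<longrightarrow> rat_res A ST D D' (x D) = x D')"
    by (simp add: str_ring_def)
  also have "\<dots> \<longleftrightarrow> x \<in> (\<Pi>\<^sub>E D\<in>dat W. carrier (RR D)) \<and>
    (\<forall>D\<in>dat W. \<forall>D'\<in>dat W. RC D' \<subseteq> RC D \<longrightarrow> psi D' (x D') = cut (RC D') (psi D (x D)))"
    by (intro conj_cong[OF refl] ball_cong[OF refl] *)
  finally show ?thesis .
qed

lemma Str_closed: "\<lbrakk>x \<in> carrier (Str W); D \<in> dat W\<rbrakk> \<Longrightarrow> x D \<in> carrier (RR D)"
  unfolding mem_Str by (auto dest: PiE_mem)

lemma Str_ext: "x \<in> carrier (Str W) \<Longrightarrow> x \<in> extensional (dat W)"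
  unfolding mem_Str PiE_def by blast

lemma Str_compat:
  "\<lbrakk>x \<in> carrier (Str W); D \<in> dat W; D' \<in> dat W; RC D' \<subseteq> RC D\<rbrakk> \<Longrightarrow> psi D' (x D') = cut (RC D') (psi D (x D))"
  unfolding mem_Str by blast

text \<open>An element of the limit is read at \<open>i\<close> through some rational subset
  containing \<open>i\<close>; \<open>val_eq\<close> removes the dependence on the choice.\<close>

definition val where
  "val W x i = (if i \<in> UW W then let D = SOME D. D \<in> dat W \<and> i \<in> RC D in psi D (x D) i else \<zero>\<^bsub>E i\<^esub>)"

lemma val_eq:
  assumes x: "x \<in> carrier (Str W)" and D: "D \<in> dat W" "i \<in> RC D"
  shows "val W x i = psi D (x D) i"
proof -
  define D' where "D' = (SOME D. D \<in> dat W \<and> i \<in> RC D)"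
  have D': "D' \<in> dat W" "i \<in> RC D'" using someI[of "\<lambda>D. D \<in> dat W \<and> i \<in> RC D" D] D unfolding D'_def by blast+
  have RDs: "D \<in> RD" "D' \<in> RD" "RC D \<subseteq> UW W" using D D' mem_dat by blast+
  \<comment> \<open>The two readings are compared on the intersection, which is clopen and hence
    again rational.\<close>
  let ?D = "std (RC D \<inter> RC D')"
  have "clopen (RC D \<inter> RC D')" using clopen_RC[OF RDs(1)] clopen_RC[OF RDs(2)] by (simp add: open_Int open_Un)
  then have dD: "?D \<in> dat W" by (rule std_dat) (use RDs in blast)
  have "psi ?D (x ?D) = cut (RC D \<inter> RC D') (psi D (x D))" using Str_compat[OF x D(1) dD] by (simp add: RC_std)
  moreover have "psi ?D (x ?D) = cut (RC D \<inter> RC D') (psi D' (x D'))" using Str_compat[OF x D'(1) dD] by (simp add: RC_std)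
  ultimately have "cut (RC D \<inter> RC D') (psi D (x D)) i = cut (RC D \<inter> RC D') (psi D' (x D')) i" by simp
  then have "psi D (x D) i = psi D' (x D') i" using D(2) D'(2) by (simp add: cut_apply)
  moreover have "i \<in> UW W" using D RDs by blast
  ultimately show ?thesis by (simp add: val_def D'_def[symmetric] Let_def)
qed

lemma val_outside: "i \<notin> UW W \<Longrightarrow> val W x i = \<zero>\<^bsub>E i\<^esub>"
  by (simp add: val_def)

lemma cut_val:
  assumes "x \<in> carrier (Str W)" "D \<in> dat W"
  shows "cut (RC D) (val W x) = psi D (x D)"
proof -
  have D: "D \<in> RD" using assms(2) mem_dat by blast
  have "psi D (x D) \<in> secs (RC D)" by (rule psi_closed[OF D Str_closed[OF assms]])
  then show ?thesis using val_eq[OF assms] secs_zero[of "psi D (x D)" "RC D"] by (auto simp: cut_apply fun_eq_iff)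
qed

lemma val_secs:
  assumes W: "openin SpT W" and x: "x \<in> carrier (Str W)"
  shows "val W x \<in> secs (UW W)"
proof (rule secsI)
  fix i
  show "val W x i \<in> carrier (E i)"
  proof (cases "i \<in> UW W")
    case True
    obtain D where D: "D \<in> dat W" "i \<in> RC D" using dat_nbhd[OF W True] .
    have "D \<in> RD" using D mem_dat by blast
    then show ?thesis using val_eq[OF x D] A_closed[OF psi_A[OF _ Str_closed[OF x D(1)]]] by simp
  qed (simp add: val_outside)
next
  fix C assume C: "clopen C" "C \<subseteq> UW W"
  have "cut (RC (std C)) (val W x) = psi (std C) (x (std C))" by (rule cut_val[OF x std_dat[OF C]])
  then show "cut C (val W x) \<in> carrier A"
    using psi_A[OF std_RD[OF C(1)] Str_closed[OF x std_dat[OF C]]] by (simp add: RC_std)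
qed (simp add: val_outside)

lemma val_inj:
  assumes x: "x \<in> carrier (Str W)" and y: "y \<in> carrier (Str W)" and eq: "val W x = val W y"
  shows "x = y"
proof (rule extensionalityI[OF Str_ext[OF x] Str_ext[OF y]])
  fix D assume D: "D \<in> dat W"
  then have "D \<in> RD" using mem_dat by blast
  then show "x D = y D"
    by (rule psi_inj[OF _ Str_closed[OF x D] Str_closed[OF y D]])
       (simp add: cut_val[OF x D, symmetric] cut_val[OF y D, symmetric] eq)
qed

lemma val_surj:
  assumes g: "g \<in> secs (UW W)" and W: "openin SpT W"
  shows "\<exists>x\<in>carrier (Str W). val W x = g"
proof -
  \<comment> \<open>The component at \<open>D\<close> is forced to be the image of \<open>g\<close>
    cut to \<open>RC D\<close>; this cut lies in \<open>A\<close> because rational subsets are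
    clopen.\<close>
  define x where "x = (\<lambda>D\<in>dat W. RM D (cut (RC D) g))"
  have D: "D \<in> RD" "RC D \<subseteq> UW W" "cut (RC D) g \<in> carrier A" if "D \<in> dat W" for D
    using that mem_dat secs_cut[OF g] clopen_RC by blast+
  have psi_x: "psi D (x D) = cut (RC D) g" if "D \<in> dat W" for D
    using that psi_RM[OF D(1)[OF that] D(3)[OF that]] by (simp add: x_def cut_cut)
  have x: "x \<in> carrier (Str W)"
    unfolding mem_Str
  proof (intro conjI ballI impI)
    show "x \<in> (\<Pi>\<^sub>E D\<in>dat W. carrier (RR D))" unfolding x_def using D(1,3) RM_closed by (intro restrict_PiE_iff[THEN iffD2] ballI) blast
    fix D D' assume "D \<in> dat W" "D' \<in> dat W" "RC D' \<subseteq> RC D"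
    then show "psi D' (x D') = cut (RC D') (psi D (x D))" by (simp add: psi_x cut_cut)
  qed
  have "val W x i = g i" for i
  proof (cases "i \<in> UW W")
    case True
    obtain D where D: "D \<in> dat W" "i \<in> RC D" using dat_nbhd[OF W True] .
    then show ?thesis using val_eq[OF x D] psi_x[OF D(1)] by (simp add: cut_apply)
  next
    case False
    then show ?thesis using secs_zero[OF g False] by (simp add: val_outside)
  qed
  then have "val W x = g" by (rule ext)
  then show ?thesis using x by blast
qed

lemma Str_op_closed:
  assumes x: "x \<in> carrier (Str W)" and y: "y \<in> carrier (Str W)"
  shows "x \<otimes>\<^bsub>Str W\<^esub> y \<in> carrier (Str W)" "x \<oplus>\<^bsub>Str W\<^esub> y \<in> carrier (Str W)"
proof -
  have c: "D \<in> RD" "x D \<in> carrier (RR D)" "y D \<in> carrier (RR D)" if "D \<in> dat W" for D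
    using that mem_dat Str_closed[OF x] Str_closed[OF y] by blast+
  have m: "x D \<otimes>\<^bsub>RR D\<^esub> y D \<in> carrier (RR D)" "x D \<oplus>\<^bsub>RR D\<^esub> y D \<in> carrier (RR D)" if "D \<in> dat W" for D
  proof -
    interpret cring "RR D" by (rule cring_RR[OF c(1)[OF that]])
    show "x D \<otimes>\<^bsub>RR D\<^esub> y D \<in> carrier (RR D)" "x D \<oplus>\<^bsub>RR D\<^esub> y D \<in> carrier (RR D)" using c[OF that] by simp_all
  qed
  have cl: "psi D (x D) i \<in> carrier (E i)" "psi D (y D) i \<in> carrier (E i)" if "D \<in> dat W" for D i
    using A_closed[OF psi_A[OF c(1) c(2)]] A_closed[OF psi_A[OF c(1) c(3)]] that by blast+
  show "x \<otimes>\<^bsub>Str W\<^esub> y \<in> carrier (Str W)"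
    unfolding mem_Str Str_simps
  proof (intro conjI ballI impI)
    show "(\<lambda>D\<in>dat W. x D \<otimes>\<^bsub>RR D\<^esub> y D) \<in> (\<Pi>\<^sub>E D\<in>dat W. carrier (RR D))" using m by simp
    fix D D' assume DD: "D \<in> dat W" "D' \<in> dat W" "RC D' \<subseteq> RC D"
    show "psi D' ((\<lambda>D\<in>dat W. x D \<otimes>\<^bsub>RR D\<^esub> y D) D') = cut (RC D') (psi D ((\<lambda>D\<in>dat W. x D \<otimes>\<^bsub>RR D\<^esub> y D) D))"
      using DD cut_ops(2)[OF cl[OF DD(1)], of "RC D'"]
      by (simp add: psi_ops[OF c[OF DD(1)]] psi_ops[OF c[OF DD(2)]] Str_compat[OF x DD] Str_compat[OF y DD])
  qed
  show "x \<oplus>\<^bsub>Str W\<^esub> y \<in> carrier (Str W)"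
    unfolding mem_Str Str_simps
  proof (intro conjI ballI impI)
    show "(\<lambda>D\<in>dat W. x D \<oplus>\<^bsub>RR D\<^esub> y D) \<in> (\<Pi>\<^sub>E D\<in>dat W. carrier (RR D))" using m by simp
    fix D D' assume DD: "D \<in> dat W" "D' \<in> dat W" "RC D' \<subseteq> RC D"
    show "psi D' ((\<lambda>D\<in>dat W. x D \<oplus>\<^bsub>RR D\<^esub> y D) D') = cut (RC D') (psi D ((\<lambda>D\<in>dat W. x D \<oplus>\<^bsub>RR D\<^esub> y D) D))"
      using DD cut_ops(1)[OF cl[OF DD(1)], of "RC D'"]
      by (simp add: psi_ops[OF c[OF DD(1)]] psi_ops[OF c[OF DD(2)]] Str_compat[OF x DD] Str_compat[OF y DD])
  qed
qed

lemma Str_const_closed: "\<one>\<^bsub>Str W\<^esub> \<in> carrier (Str W)" "\<zero>\<^bsub>Str W\<^esub> \<in> carrier (Str W)"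
proof -
  have m: "\<one>\<^bsub>RR D\<^esub> \<in> carrier (RR D)" "\<zero>\<^bsub>RR D\<^esub> \<in> carrier (RR D)" if "D \<in> dat W" for D
  proof -
    interpret cring "RR D" using that mem_dat by (intro cring_RR) blast
    show "\<one>\<^bsub>RR D\<^esub> \<in> carrier (RR D)" "\<zero>\<^bsub>RR D\<^esub> \<in> carrier (RR D)" by simp_all
  qed
  show "\<one>\<^bsub>Str W\<^esub> \<in> carrier (Str W)" "\<zero>\<^bsub>Str W\<^esub> \<in> carrier (Str W)"
    unfolding mem_Str Str_simps using m
    by (auto simp: psi_one psi_zero mem_dat cut_apply fun_eq_iff)
qed

text \<open>The operations are componentwise, so at each \<open>i\<close> they can be read through
  one rational subset containing \<open>i\<close>.\<close>

lemma val_iso: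
  assumes W: "openin SpT W"
  shows "val W \<in> ring_iso (Str W) (SR (UW W))"
proof -
  have op: "val W (x \<otimes>\<^bsub>Str W\<^esub> y) i = val W x i \<otimes>\<^bsub>E i\<^esub> val W y i \<and> val W (x \<oplus>\<^bsub>Str W\<^esub> y) i = val W x i \<oplus>\<^bsub>E i\<^esub> val W y i"
    if x: "x \<in> carrier (Str W)" and y: "y \<in> carrier (Str W)" for x y i
  proof (cases "i \<in> UW W")
    case True
    obtain D where D: "D \<in> dat W" "i \<in> RC D" using dat_nbhd[OF W True] .
    have DR: "D \<in> RD" using D mem_dat by blast
    show ?thesis
      using val_eq[OF Str_op_closed(1)[OF x y] D] val_eq[OF Str_op_closed(2)[OF x y] D] D(1)
        psi_ops[OF DR Str_closed[OF x D(1)] Str_closed[OF y D(1)]] val_eq[OF x D] val_eq[OF y D]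
      by (simp add: Str_simps)
  qed (simp add: val_outside)
  have one: "val W \<one>\<^bsub>Str W\<^esub> i = (if i \<in> UW W then \<one>\<^bsub>E i\<^esub> else \<zero>\<^bsub>E i\<^esub>)" for i
  proof (cases "i \<in> UW W")
    case True
    obtain D where D: "D \<in> dat W" "i \<in> RC D" using dat_nbhd[OF W True] .
    have DR: "D \<in> RD" using D mem_dat by blast
    show ?thesis using val_eq[OF Str_const_closed(1) D] True D by (simp add: Str_simps psi_one[OF DR])
  qed (simp add: val_outside)
  have "val W \<in> ring_hom (Str W) (SR (UW W))"
    by (rule ring_hom_memI) (simp_all add: val_secs[OF W] op one fun_eq_iff)
  moreover have "bij_betw (val W) (carrier (Str W)) (secs (UW W))"
    unfolding bij_betw_def inj_on_def using val_inj val_surj[OF _ W] val_secs[OF W] by (auto simp: image_iff) metis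
  ultimately show ?thesis by (simp add: ring_iso_def)
qed

lemma val_zero: "openin SpT W \<Longrightarrow> val W \<zero>\<^bsub>Str W\<^esub> = (\<lambda>i. \<zero>\<^bsub>E i\<^esub>)"
proof
  fix i assume W: "openin SpT W"
  show "val W \<zero>\<^bsub>Str W\<^esub> i = \<zero>\<^bsub>E i\<^esub>"
  proof (cases "i \<in> UW W")
    case True
    obtain D where D: "D \<in> dat W" "i \<in> RC D" using dat_nbhd[OF W True] .
    have DR: "D \<in> RD" using D mem_dat by blast
    show ?thesis using val_eq[OF Str_const_closed(2) D] D by (simp add: Str_simps psi_zero[OF DR])
  qed (simp add: val_outside)
qed

lemma cring_Str:
  assumes W: "openin SpT W"
  shows "cring (Str W)"
proof -
  interpret S: cring "SR (UW W)" by (rule cring_SR)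
  have hom: "val W \<in> ring_hom (Str W) (SR (UW W))" and bij: "bij_betw (val W) (carrier (Str W)) (secs (UW W))"
    using val_iso[OF W] by (simp_all add: ring_iso_def)
  define h where "h = inv_into (carrier (Str W)) (val W)"
  have h: "h g \<in> carrier (Str W)" "val W (h g) = g" if "g \<in> secs (UW W)" for g
    using that bij bij_betw_inv_into[OF bij] unfolding h_def
    by (auto simp: bij_betw_def f_inv_into_f inv_into_into)
  have hv: "h (val W x) = x" if "x \<in> carrier (Str W)" for x
    using val_inj[OF h(1)[OF val_secs[OF W that]] that h(2)[OF val_secs[OF W that]]] .
  have "h \<in> ring_hom (SR (UW W)) (Str W)"
  proof (rule ring_hom_memI)
    fix g g' assume "g \<in> carrier (SR (UW W))" "g' \<in> carrier (SR (UW W))"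
    then have g: "g \<in> secs (UW W)" "g' \<in> secs (UW W)" by simp_all
    note hg = h(1)[OF g(1)] h(1)[OF g(2)]
    have "val W (h g \<otimes>\<^bsub>Str W\<^esub> h g') = g \<otimes>\<^bsub>SR (UW W)\<^esub> g'" "val W (h g \<oplus>\<^bsub>Str W\<^esub> h g') = g \<oplus>\<^bsub>SR (UW W)\<^esub> g'"
      using ring_hom_mult[OF hom hg] ring_hom_add[OF hom hg] h(2) g by simp_all
    then show "h (g \<otimes>\<^bsub>SR (UW W)\<^esub> g') = h g \<otimes>\<^bsub>Str W\<^esub> h g'" "h (g \<oplus>\<^bsub>SR (UW W)\<^esub> g') = h g \<oplus>\<^bsub>Str W\<^esub> h g'"
      using hv[OF Str_op_closed(1)[OF hg]] hv[OF Str_op_closed(2)[OF hg]] by simp_all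
  next
    show "h g \<in> carrier (Str W)" if "g \<in> carrier (SR (UW W))" for g using h that by simp
    show "h \<one>\<^bsub>SR (UW W)\<^esub> = \<one>\<^bsub>Str W\<^esub>" using hv[OF Str_const_closed(1)] ring_hom_one[OF hom] by simp
  qed
  moreover have "bij_betw h (secs (UW W)) (carrier (Str W))" unfolding h_def by (rule bij_betw_inv_into[OF bij])
  ultimately have "h \<in> ring_iso (SR (UW W)) (Str W)" by (simp add: ring_iso_def)
  \<comment> \<open>Transport along \<open>h\<close> yields a ring whose zero is the image of zero;
    that this is the zero of \<open>Str W\<close> is a separate equation.\<close>
  then have "cring (Str W\<lparr>ring.zero := h \<zero>\<^bsub>SR (UW W)\<^esub>\<rparr>)" by (rule S.ring_iso_imp_img_cring)
  moreover have "h \<zero>\<^bsub>SR (UW W)\<^esub> = \<zero>\<^bsub>Str W\<^esub>" using hv[OF Str_const_closed(2)] val_zero[OF W] by simp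
  ultimately show ?thesis by simp
qed

section \<open>The topology on the sections over an open set\<close>

lemma topspace_StT: "topspace (StT W) = carrier (Str W)"
proof -
  have "carrier (Str W) \<subseteq> (\<Pi>\<^sub>E D\<in>dat W. topspace (RT D))"
  proof
    fix x assume x: "x \<in> carrier (Str W)"
    have "(\<Pi>\<^sub>E D\<in>dat W. topspace (RT D)) = (\<Pi>\<^sub>E D\<in>dat W. carrier (RR D))"
      by (rule PiE_cong) (simp add: topspace_RT mem_dat)
    then show "x \<in> (\<Pi>\<^sub>E D\<in>dat W. topspace (RT D))" using x unfolding mem_Str by simp
  qed
  then show ?thesis by (simp add: str_topology_def Int_absorb1)
qed

lemma continuous_component: "D \<in> dat W \<Longrightarrow> continuous_map (StT W) (RT D) (\<lambda>x. x D)"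
  unfolding str_topology_def by (intro continuous_map_from_subtopology continuous_map_product_projection)

text \<open>\<open>RC D\<close> is itself clopen, so one index on all of it describes the
  neighbourhoods.\<close>

lemma openin_RT:
  assumes D: "D \<in> RD"
  shows "openin (RT D) P \<longleftrightarrow> P \<subseteq> carrier (RR D) \<and>
    (\<forall>x\<in>P. \<exists>n::nat. \<forall>y\<in>carrier (RR D). (\<forall>i\<in>RC D. psi D y i \<ominus>\<^bsub>E i\<^esub> psi D x i \<in> B i (int n)) \<longrightarrow> y \<in> P)"
proof (cases "P \<subseteq> carrier (RR D)")
  case False
  then show ?thesis using openin_subset[of "RT D" P] topspace_RT[OF D] by blast
next
  case True
  have img: "psi D y \<in> psi D ` P \<longleftrightarrow> y \<in> P" if "y \<in> carrier (RR D)" for y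
    using psi_inj[OF D that] True by blast
  have bij: "psi D ` carrier (RR D) = secs (RC D)" using psi_bij[OF D] by (simp add: bij_betw_def)
  have "openin (RT D) P \<longleftrightarrow> openin (SRT (RC D)) (psi D ` P)"
    using homeomorphic_map_openness_eq[OF psi_homeo[OF D], of P] True topspace_RT[OF D] by simp
  also have "\<dots> \<longleftrightarrow> (\<forall>x\<in>P. \<exists>C n. clopen C \<and> C \<subseteq> RC D \<and>
      (\<forall>y\<in>carrier (RR D). (\<forall>i\<in>C. psi D y i \<ominus>\<^bsub>E i\<^esub> psi D x i \<in> B i (int n)) \<longrightarrow> y \<in> P))"
  proof -
    have "psi D ` P \<subseteq> secs (RC D)" using True bij by blast
    then show ?thesis unfolding openin_SRT unfolding bij[symmetric] using img by (simp add: ball_simps)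
  qed
  also have "\<dots> \<longleftrightarrow> (\<forall>x\<in>P. \<exists>n::nat. \<forall>y\<in>carrier (RR D). (\<forall>i\<in>RC D. psi D y i \<ominus>\<^bsub>E i\<^esub> psi D x i \<in> B i (int n)) \<longrightarrow> y \<in> P)"
  proof (rule ball_cong[OF refl], rule iffI)
    fix x assume "\<exists>C n. clopen C \<and> C \<subseteq> RC D \<and>
      (\<forall>y\<in>carrier (RR D). (\<forall>i\<in>C. psi D y i \<ominus>\<^bsub>E i\<^esub> psi D x i \<in> B i (int n)) \<longrightarrow> y \<in> P)"
    then obtain C n where "C \<subseteq> RC D" "\<forall>y\<in>carrier (RR D). (\<forall>i\<in>C. psi D y i \<ominus>\<^bsub>E i\<^esub> psi D x i \<in> B i (int n)) \<longrightarrow> y \<in> P" by blast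
    then show "\<exists>n::nat. \<forall>y\<in>carrier (RR D). (\<forall>i\<in>RC D. psi D y i \<ominus>\<^bsub>E i\<^esub> psi D x i \<in> B i (int n)) \<longrightarrow> y \<in> P"
      by (intro exI[of _ n]) (simp add: subset_iff)
  next
    fix x assume "\<exists>n::nat. \<forall>y\<in>carrier (RR D). (\<forall>i\<in>RC D. psi D y i \<ominus>\<^bsub>E i\<^esub> psi D x i \<in> B i (int n)) \<longrightarrow> y \<in> P"
    then show "\<exists>C n. clopen C \<and> C \<subseteq> RC D \<and>
      (\<forall>y\<in>carrier (RR D). (\<forall>i\<in>C. psi D y i \<ominus>\<^bsub>E i\<^esub> psi D x i \<in> B i (int n)) \<longrightarrow> y \<in> P)"
      using clopen_RC[OF D] by (intro exI[of _ "RC D"]) simp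
  qed
  finally show ?thesis using True by simp
qed

text \<open>The projection to the component \<open>std C\<close> is continuous, and closeness on
  \<open>C\<close> is an open condition on this single component.\<close>

lemma open_near:
  assumes W: "openin SpT W" and x: "x \<in> carrier (Str W)" and C: "clopen C" "C \<subseteq> UW W"
  shows "openin (StT W) {y \<in> carrier (Str W). \<forall>i\<in>C. val W y i \<ominus>\<^bsub>E i\<^esub> val W x i \<in> B i (int n)}"
proof -
  let ?D = "std C"
  note dD = std_dat[OF C] and rD = std_RD[OF C(1)]
  define P where "P = {z \<in> carrier (RR ?D). \<forall>i\<in>C. psi ?D z i \<ominus>\<^bsub>E i\<^esub> psi ?D (x ?D) i \<in> B i (int n)}"
  have "openin (RT ?D) P"
    unfolding openin_RT[OF rD] RC_std
  proof (intro conjI ballI)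
    fix z assume z: "z \<in> P"
    then have zc: "z \<in> carrier (RR ?D)" by (simp add: P_def)
    show "\<exists>n'::nat. \<forall>y\<in>carrier (RR ?D). (\<forall>i\<in>C. psi ?D y i \<ominus>\<^bsub>E i\<^esub> psi ?D z i \<in> B i (int n')) \<longrightarrow> y \<in> P"
    proof (intro exI[of _ n] ballI impI)
      fix y assume y: "y \<in> carrier (RR ?D)" "\<forall>i\<in>C. psi ?D y i \<ominus>\<^bsub>E i\<^esub> psi ?D z i \<in> B i (int n)"
      have "psi ?D y i \<ominus>\<^bsub>E i\<^esub> psi ?D (x ?D) i \<in> B i (int n)" if i: "i \<in> C" for i
      proof (rule dv.B_minus_trans[of _ _ "psi ?D z i"])
        show "psi ?D y i \<in> carrier (E i)" "psi ?D z i \<in> carrier (E i)" "psi ?D (x ?D) i \<in> carrier (E i)"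
          using A_closed psi_A[OF rD] y(1) zc Str_closed[OF x dD] by blast+
        show "psi ?D y i \<ominus>\<^bsub>E i\<^esub> psi ?D z i \<in> B i (int n)" using y(2) i by blast
        show "psi ?D z i \<ominus>\<^bsub>E i\<^esub> psi ?D (x ?D) i \<in> B i (int n)" using z i by (simp add: P_def)
      qed
      then show "y \<in> P" using y(1) by (simp add: P_def)
    qed
  qed (auto simp: P_def)
  then have "openin (StT W) {y \<in> topspace (StT W). y ?D \<in> P}"
    by (rule openin_continuous_map_preimage[OF continuous_component[OF dD]])
  moreover have "{y \<in> topspace (StT W). y ?D \<in> P} =
      {y \<in> carrier (Str W). \<forall>i\<in>C. val W y i \<ominus>\<^bsub>E i\<^esub> val W x i \<in> B i (int n)}"
  proof -
    have "y ?D \<in> P \<longleftrightarrow> (\<forall>i\<in>C. val W y i \<ominus>\<^bsub>E i\<^esub> val W x i \<in> B i (int n))" if y: "y \<in> carrier (Str W)" for y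
    proof -
      have "val W y i = psi ?D (y ?D) i" "val W x i = psi ?D (x ?D) i" if "i \<in> C" for i
        using val_eq[OF y dD] val_eq[OF x dD] that by (simp_all add: RC_std)
      then show ?thesis using Str_closed[OF y dD] by (simp add: P_def)
    qed
    then show ?thesis unfolding topspace_StT by blast
  qed
  ultimately show ?thesis by simp
qed

lemma openin_StT:
  assumes W: "openin SpT W"
  shows "openin (StT W) P \<longleftrightarrow> P \<subseteq> carrier (Str W) \<and> (\<forall>x\<in>P. \<exists>C n. clopen C \<and> C \<subseteq> UW W \<and>
    (\<forall>y\<in>carrier (Str W). (\<forall>i\<in>C. val W y i \<ominus>\<^bsub>E i\<^esub> val W x i \<in> B i (int n)) \<longrightarrow> y \<in> P))"
proof (intro iffI conjI ballI)
  assume P: "openin (StT W) P"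
  then show sub: "P \<subseteq> carrier (Str W)" using openin_subset topspace_StT by blast
  fix x assume xP: "x \<in> P"
  then have x: "x \<in> carrier (Str W)" using sub by blast
  obtain O' where O': "openin (product_topology RT (dat W)) O'" "P = O' \<inter> carrier (Str W)"
    using P unfolding str_topology_def openin_subtopology by blast
  have xO: "x \<in> O'" using xP O'(2) by blast
  obtain Z where Z: "finite {D \<in> dat W. Z D \<noteq> topspace (RT D)}" "\<forall>D\<in>dat W. openin (RT D) (Z D)"
      "x \<in> Pi\<^sub>E (dat W) Z" "Pi\<^sub>E (dat W) Z \<subseteq> O'"
    using bspec[OF O'(1)[unfolded openin_product_topology_alt] xO] by (elim exE conjE) (rule that)
  define J where "J = {D \<in> dat W. Z D \<noteq> topspace (RT D)}"
  have JD: "D \<in> RD" "D \<in> dat W" "RC D \<subseteq> UW W" if "D \<in> J" for D using that mem_dat unfolding J_def by blast+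
  have "\<forall>D\<in>J. \<exists>n::nat. \<forall>y\<in>carrier (RR D). (\<forall>i\<in>RC D. psi D y i \<ominus>\<^bsub>E i\<^esub> psi D (x D) i \<in> B i (int n)) \<longrightarrow> y \<in> Z D"
  proof
    fix D assume D: "D \<in> J"
    have "openin (RT D) (Z D)" "x D \<in> Z D" using Z(2,3) JD[OF D] by (auto dest: PiE_mem)
    then show "\<exists>n::nat. \<forall>y\<in>carrier (RR D). (\<forall>i\<in>RC D. psi D y i \<ominus>\<^bsub>E i\<^esub> psi D (x D) i \<in> B i (int n)) \<longrightarrow> y \<in> Z D"
      unfolding openin_RT[OF JD(1)[OF D]] by blast
  qed
  from bchoice[OF this] obtain n where n: "\<forall>D\<in>J. \<forall>y\<in>carrier (RR D).
      (\<forall>i\<in>RC D. psi D y i \<ominus>\<^bsub>E i\<^esub> psi D (x D) i \<in> B i (int (n D))) \<longrightarrow> y \<in> Z D" by blast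
  have fJ: "finite J" using Z(1) by (simp add: J_def)
  \<comment> \<open>Only the finitely many components in \<open>J\<close> are restricted. Their
    rational subsets have a clopen union, and the sum of their indices is a common index.\<close>
  define C where "C = (\<Union>D\<in>J. RC D)"
  have opR: "open (RC D)" "open (- RC D)" if "D \<in> J" for D using clopen_RC[OF JD(1)[OF that]] by blast+
  have "open (\<Inter>D\<in>J. - RC D)" using fJ opR(2) by (intro open_INT) blast+
  moreover have "- C = (\<Inter>D\<in>J. - RC D)" unfolding C_def by blast
  moreover have "open C" unfolding C_def using opR(1) by (intro open_UN) blast
  ultimately have C: "clopen C" by simp
  have CU: "C \<subseteq> UW W" unfolding C_def using JD(3) by blast
  define N where "N = (\<Sum>D\<in>J. n D)"
  have nN: "n D \<le> N" if "D \<in> J" for D unfolding N_def by (rule member_le_sum[OF that _ fJ]) simp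
  have "y \<in> P" if y: "y \<in> carrier (Str W)" "\<forall>i\<in>C. val W y i \<ominus>\<^bsub>E i\<^esub> val W x i \<in> B i (int N)" for y
  proof -
    have "y D \<in> Z D" if D: "D \<in> dat W" for D
    proof (cases "D \<in> J")
      case True
      have "psi D (y D) i \<ominus>\<^bsub>E i\<^esub> psi D (x D) i \<in> B i (int (n D))" if i: "i \<in> RC D" for i
      proof -
        have "i \<in> C" using True i unfolding C_def by blast
        then have "val W y i \<ominus>\<^bsub>E i\<^esub> val W x i \<in> B i (int N)" using y(2) by blast
        then have "psi D (y D) i \<ominus>\<^bsub>E i\<^esub> psi D (x D) i \<in> B i (int N)"
          unfolding val_eq[OF y(1) D i] val_eq[OF x D i] .
        then show ?thesis by (rule dv.B_antimono[rotated]) (simp add: nN[OF True])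
      qed
      then show ?thesis using n True Str_closed[OF y(1) D] by blast
    next
      case False
      then have "Z D = topspace (RT D)" using D by (simp add: J_def)
      moreover have "D \<in> RD" using D mem_dat by blast
      ultimately show ?thesis using Str_closed[OF y(1) D] topspace_RT by blast
    qed
    then have "y \<in> Pi\<^sub>E (dat W) Z" using Str_ext[OF y(1)] by (simp add: PiE_iff)
    then show ?thesis using Z(4) O'(2) y(1) by blast
  qed
  then show "\<exists>C n. clopen C \<and> C \<subseteq> UW W \<and>
    (\<forall>y\<in>carrier (Str W). (\<forall>i\<in>C. val W y i \<ominus>\<^bsub>E i\<^esub> val W x i \<in> B i (int n)) \<longrightarrow> y \<in> P)"
    using C CU by blast
next
  assume P: "P \<subseteq> carrier (Str W) \<and> (\<forall>x\<in>P. \<exists>C n. clopen C \<and> C \<subseteq> UW W \<and>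
    (\<forall>y\<in>carrier (Str W). (\<forall>i\<in>C. val W y i \<ominus>\<^bsub>E i\<^esub> val W x i \<in> B i (int n)) \<longrightarrow> y \<in> P))"
  have "\<exists>S. openin (StT W) S \<and> x \<in> S \<and> S \<subseteq> P" if xP: "x \<in> P" for x
  proof -
    from P xP have x: "x \<in> carrier (Str W)" by blast
    from P xP obtain C n where C: "clopen C" "C \<subseteq> UW W"
      and sub: "\<forall>y\<in>carrier (Str W). (\<forall>i\<in>C. val W y i \<ominus>\<^bsub>E i\<^esub> val W x i \<in> B i (int n)) \<longrightarrow> y \<in> P" by blast
    have "x \<in> {y \<in> carrier (Str W). \<forall>i\<in>C. val W y i \<ominus>\<^bsub>E i\<^esub> val W x i \<in> B i (int n)}"
      using x secs_closed[OF val_secs[OF W x]] by (simp add: dv.minus_self)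
    then show ?thesis using open_near[OF W x C, of n] sub by blast
  qed
  then show "openin (StT W) P" by (subst openin_subopen) blast
qed

text \<open>\<open>openin_StT\<close> and \<open>openin_SRT\<close> describe both topologies by the
  same condition on values.\<close>

lemma val_homeo:
  assumes W: "openin SpT W"
  shows "homeomorphic_map (StT W) (SRT (UW W)) (val W)"
proof -
  have bij: "val W ` carrier (Str W) = secs (UW W)" using val_iso[OF W] by (simp add: ring_iso_def bij_betw_def)
  have eq: "openin (StT W) P \<longleftrightarrow> openin (SRT (UW W)) (val W ` P)" if P: "P \<subseteq> carrier (Str W)" for P
  proof -
    have img: "val W y \<in> val W ` P \<longleftrightarrow> y \<in> P" if "y \<in> carrier (Str W)" for y
      using val_inj[OF that] P by blast
    have "val W ` P \<subseteq> secs (UW W)" using P bij by blast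
    then show ?thesis unfolding openin_SRT openin_StT[OF W] unfolding bij[symmetric] using P img by (simp add: ball_simps)
  qed
  show ?thesis
  proof (rule bijective_open_imp_homeomorphic_map)
    show "val W ` topspace (StT W) = topspace (SRT (UW W))" using bij by (simp add: topspace_StT topspace_SRT)
    show "inj_on (val W) (topspace (StT W))" unfolding topspace_StT inj_on_def using val_inj by blast
    show "open_map (StT W) (SRT (UW W)) (val W)"
      unfolding open_map_def using eq openin_subset[of "StT W"] topspace_StT by blast
    show "continuous_map (StT W) (SRT (UW W)) (val W)"
      unfolding continuous_map_def
    proof (intro conjI allI impI)
      show "val W \<in> topspace (StT W) \<rightarrow> topspace (SRT (UW W))" using bij by (auto simp: topspace_StT topspace_SRT)
      fix O' assume O': "openin (SRT (UW W)) O'"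
      then have "O' \<subseteq> secs (UW W)" using openin_subset topspace_SRT by blast
      then have "val W ` {x \<in> topspace (StT W). val W x \<in> O'} = O'" unfolding topspace_StT bij[symmetric] by blast
      then show "openin (StT W) {x \<in> topspace (StT W). val W x \<in> O'}"
        using eq[of "{x \<in> topspace (StT W). val W x \<in> O'}"] O' by (simp add: topspace_StT)
    qed
  qed
qed

lemma topological_ring_Str: "openin SpT W \<Longrightarrow> topological_ring (Str W) (StT W)"
  by (rule topological_ring_transport[OF val_iso cring_Str topological_ring_SR val_homeo topspace_StT])

section \<open>Restriction, gluing and the sheaf axiom\<close>

abbreviation rs where "rs \<equiv> str_res A ST Ap"

lemma dat_mono: "V \<subseteq> W \<Longrightarrow> dat V \<subseteq> dat W"
  by (auto simp: data_in_def)

lemma rs_closed: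
  assumes "V \<subseteq> W" and x: "x \<in> carrier (Str W)"
  shows "rs W V x \<in> carrier (Str V)"
  unfolding mem_Str
proof (intro conjI ballI impI)
  have m: "D \<in> dat W" if "D \<in> dat V" for D using that dat_mono[OF assms(1)] by blast
  show "rs W V x \<in> (\<Pi>\<^sub>E D\<in>dat V. carrier (RR D))" using Str_closed[OF x m] by (simp add: str_res_def)
  fix D D' assume "D \<in> dat V" "D' \<in> dat V" "RC D' \<subseteq> RC D"
  then show "psi D' (rs W V x D') = cut (RC D') (psi D (rs W V x D))"
    using Str_compat[OF x m m, of D D'] by (simp add: str_res_def)
qed

lemma rs_hom:
  assumes "V \<subseteq> W"
  shows "rs W V \<in> ring_hom (Str W) (Str V)"
proof (rule ring_hom_memI)
  have m: "D \<in> dat W" if "D \<in> dat V" for D using that dat_mono[OF assms(1)] by blast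
  show "rs W V x \<in> carrier (Str V)" if "x \<in> carrier (Str W)" for x by (rule rs_closed[OF assms that])
  show "rs W V (x \<otimes>\<^bsub>Str W\<^esub> y) = rs W V x \<otimes>\<^bsub>Str V\<^esub> rs W V y"
    "rs W V (x \<oplus>\<^bsub>Str W\<^esub> y) = rs W V x \<oplus>\<^bsub>Str V\<^esub> rs W V y"
    "rs W V \<one>\<^bsub>Str W\<^esub> = \<one>\<^bsub>Str V\<^esub>" for x y
    unfolding str_res_def Str_simps by (rule restrict_ext, simp add: m)+
qed

lemma rs_continuous:
  assumes "V \<subseteq> W"
  shows "continuous_map (StT W) (StT V) (rs W V)"
proof -
  have "continuous_map (StT W) (product_topology RT (dat V)) (rs W V)"
    unfolding continuous_map_componentwise
  proof (intro conjI ballI)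
    show "rs W V ` topspace (StT W) \<subseteq> extensional (dat V)" by (auto simp: str_res_def)
    fix D assume D: "D \<in> dat V"
    then have "continuous_map (StT W) (RT D) (\<lambda>x. x D)" using continuous_component dat_mono[OF assms] by blast
    then show "continuous_map (StT W) (RT D) (\<lambda>x. rs W V x D)" using D by (simp add: str_res_def)
  qed
  moreover have "rs W V \<in> topspace (StT W) \<rightarrow> carrier (Str V)" using rs_closed[OF assms] by (auto simp: topspace_StT)
  ultimately show ?thesis by (subst (2) str_topology_def) (auto simp: continuous_map_in_subtopology)
qed

lemma val_rs:
  assumes V: "openin SpT V" and sub: "V \<subseteq> W" and x: "x \<in> carrier (Str W)" and i: "i \<in> UW V"
  shows "val V (rs W V x) i = val W x i"
proof -
  obtain D where D: "D \<in> dat V" "i \<in> RC D" using dat_nbhd[OF V i] .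
  have "D \<in> dat W" using D dat_mono[OF sub] by blast
  from val_eq[OF x this D(2)] show ?thesis
    using val_eq[OF rs_closed[OF sub x] D] D(1) by (simp add: str_res_def)
qed

lemma presheaf: "presheaf_of_topological_rings SpT Str StT rs"
  unfolding presheaf_of_topological_rings_def
proof (intro conjI allI impI ballI; (elim conjE)?)
  show "topological_ring (Str W) (StT W)" if "openin SpT W" for W by (rule topological_ring_Str[OF that])
  show "rs W V \<in> ring_hom (Str W) (Str V)" "continuous_map (StT W) (StT V) (rs W V)" if "V \<subseteq> W" for V W
    by (rule rs_hom[OF that], rule rs_continuous[OF that])
  show "rs W W x = x" if "x \<in> carrier (Str W)" for W x
    unfolding str_res_def by (rule extensional_restrict[OF Str_ext[OF that]])
  show "rs V W (rs U V x) = rs U W x" if "W \<subseteq> V" "V \<subseteq> U" for U V W x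
    using dat_mono[OF that(1)] by (simp add: str_res_def Int_absorb1)
qed

context
  fixes \<U>
  assumes opens: "\<And>V. V \<in> \<U> \<Longrightarrow> openin SpT V"
begin

abbreviation UU where "UU \<equiv> \<Union>\<U>"

lemma openin_UU: "openin SpT UU"
  using opens by blast

lemma UW_UU: "i \<in> UW UU \<longleftrightarrow> (\<exists>V\<in>\<U>. i \<in> UW V)"
  by (auto simp: UW_def)

definition glued where
  "glued = {x \<in> \<Pi>\<^sub>E V\<in>\<U>. carrier (Str V).
     \<forall>V\<in>\<U>. \<forall>V'\<in>\<U>. rs V (V \<inter> V') (x V) = rs V' (V \<inter> V') (x V')}"

definition gl where "gl x = (\<lambda>V\<in>\<U>. rs UU V x)"

lemma gl_val:
  assumes "x \<in> carrier (Str UU)" "V \<in> \<U>" "i \<in> UW V"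
  shows "val V (gl x V) i = val UU x i"
  using val_rs[OF opens[OF assms(2)] Union_upper[OF assms(2)] assms(1,3)] assms(2) by (simp add: gl_def)

lemma gl_glued:
  assumes x: "x \<in> carrier (Str UU)"
  shows "gl x \<in> glued"
proof -
  have "rs V (V \<inter> V') (rs UU V x) = rs UU (V \<inter> V') x" "rs V' (V \<inter> V') (rs UU V' x) = rs UU (V \<inter> V') x" for V V'
    using dat_mono[of "V \<inter> V'" V] dat_mono[of "V \<inter> V'" V'] by (simp_all add: str_res_def Int_absorb1)
  then show ?thesis using rs_closed[OF Union_upper x] by (simp add: glued_def gl_def)
qed

lemma gl_inj:
  assumes x: "x \<in> carrier (Str UU)" and y: "y \<in> carrier (Str UU)" and eq: "gl x = gl y"
  shows "x = y"
proof (rule val_inj[OF x y])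
  show "val UU x = val UU y"
  proof
    fix i
    show "val UU x i = val UU y i"
    proof (cases "i \<in> UW UU")
      case True
      then obtain V where V: "V \<in> \<U>" "i \<in> UW V" unfolding UW_UU by blast
      show ?thesis using gl_val[OF x V] gl_val[OF y V] eq by simp
    qed (simp add: val_outside)
  qed
qed

lemma gl_surj:
  assumes z: "z \<in> glued"
  shows "\<exists>x\<in>carrier (Str UU). gl x = z"
proof -
  have zc: "z V \<in> carrier (Str V)" if "V \<in> \<U>" for V using z that by (auto simp: glued_def dest: PiE_mem)
  have zext: "z \<in> extensional \<U>" using z by (simp add: glued_def PiE_def)
  have compat: "val V (z V) i = val V' (z V') i" if V: "V \<in> \<U>" "V' \<in> \<U>" and i: "i \<in> UW V" "i \<in> UW V'" for V V' i
  proof -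
    have o: "openin SpT (V \<inter> V')" using opens V by (simp add: openin_Int)
    have ii: "i \<in> UW (V \<inter> V')" using i by (simp add: UW_def)
    have "rs V (V \<inter> V') (z V) = rs V' (V \<inter> V') (z V')" using z V by (simp add: glued_def)
    then show ?thesis
      using val_rs[OF o Int_lower1 zc[OF V(1)] ii] val_rs[OF o Int_lower2 zc[OF V(2)] ii] by simp
  qed
  define g where "g i = (if i \<in> UW UU then let V = SOME V. V \<in> \<U> \<and> i \<in> UW V in val V (z V) i else \<zero>\<^bsub>E i\<^esub>)" for i
  have g: "g i = val V (z V) i" if V: "V \<in> \<U>" "i \<in> UW V" for V i
  proof -
    define V' where "V' = (SOME V. V \<in> \<U> \<and> i \<in> UW V)"
    have "V' \<in> \<U> \<and> i \<in> UW V'" unfolding V'_def by (rule someI[of _ V]) (use V in blast)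
    then have "val V' (z V') i = val V (z V) i" using compat V by blast
    moreover have "i \<in> UW UU" using V UW_UU by blast
    ultimately show ?thesis by (simp add: g_def V'_def[symmetric] Let_def)
  qed
  have gc: "g i \<in> carrier (E i)" for i
  proof (cases "i \<in> UW UU")
    case True
    then obtain V where V: "V \<in> \<U>" "i \<in> UW V" unfolding UW_UU by blast
    show ?thesis using g[OF V] secs_closed[OF val_secs[OF opens[OF V(1)] zc[OF V(1)]]] by simp
  qed (simp add: g_def)
  have "g \<in> secs (UW UU)"
  proof (rule secsI[OF gc])
    show "g i = \<zero>\<^bsub>E i\<^esub>" if "i \<notin> UW UU" for i using that by (simp add: g_def)
    fix C assume C: "clopen C" "C \<subseteq> UW UU"
    show "cut C g \<in> carrier A"
    proof (cases "\<infinity> \<in> C")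
      case True
      \<comment> \<open>Continuity is a condition at \<open>\<infinity>\<close> alone, so a single
        member of the cover that contains \<open>\<infinity>\<close> decides it.\<close>
      then obtain V where V: "V \<in> \<U>" "\<infinity> \<in> UW V" using C UW_UU by blast
      obtain C0 where C0: "clopen C0" "\<infinity> \<in> C0" "C0 \<subseteq> UW V" using clopen_nbhd[OF open_UW[OF opens[OF V(1)]] V(2)] by blast
      define a where "a = cut C0 (val V (z V))"
      have a: "a \<in> carrier A" unfolding a_def by (rule secs_cut[OF val_secs[OF opens[OF V(1)] zc[OF V(1)]] C0(1,3)])
      have ga: "g i = a i" if "i \<in> C0" for i using that g[OF V(1), of i] C0(3) by (auto simp: a_def cut_apply)
      have "\<forall>\<^sub>F k in sequentially. enat k \<in> C0" using C0 by (simp add: clopen_iff)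
      then have "\<forall>\<^sub>F k in sequentially. g (enat k) = a (enat k)" by (rule eventually_mono) (rule ga)
      then show ?thesis using ga[OF C0(2)] a by (intro A_cut_local[OF C(1), of g a] conjI gc) simp_all
    next
      case False
      then show ?thesis by (intro A_cut_local[OF C(1), of g g] gc) simp
    qed
  qed
  then obtain x where x: "x \<in> carrier (Str UU)" "val UU x = g" using val_surj[OF _ openin_UU] by blast
  have "gl x V = z V" if V: "V \<in> \<U>" for V
  proof (rule val_inj[OF _ zc[OF V]])
    show "gl x V \<in> carrier (Str V)" using rs_closed[OF Union_upper[OF V] x(1)] V by (simp add: gl_def)
    show "val V (gl x V) = val V (z V)"
    proof
      fix i
      show "val V (gl x V) i = val V (z V) i"
        using gl_val[OF x(1) V, of i] g[OF V, of i] x(2) by (cases "i \<in> UW V") (simp_all add: val_outside)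
    qed
  qed
  moreover have "gl x \<in> extensional \<U>" by (simp add: gl_def)
  ultimately have "gl x = z" using extensionalityI[OF _ zext] by blast
  then show ?thesis using x(1) by blast
qed

text \<open>For openness, closeness on a clopen subset of the union must follow from conditions on
  finitely many members of the cover; compactness of clopen sets provides them.\<close>

lemma gl_homeo: "homeomorphic_map (StT UU) (subtopology (product_topology StT \<U>) glued) gl"
proof (rule bijective_open_imp_homeomorphic_map)
  have top: "topspace (subtopology (product_topology StT \<U>) glued) = glued"
    by (auto simp: topspace_StT glued_def)
  show "gl ` topspace (StT UU) = topspace (subtopology (product_topology StT \<U>) glued)"
    unfolding top topspace_StT using gl_glued gl_surj by blast
  show "inj_on gl (topspace (StT UU))" unfolding inj_on_def topspace_StT using gl_inj by blast
  show "continuous_map (StT UU) (subtopology (product_topology StT \<U>) glued) gl"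
    unfolding continuous_map_in_subtopology continuous_map_componentwise
  proof (intro conjI ballI)
    show "gl ` topspace (StT UU) \<subseteq> extensional \<U>" by (auto simp: gl_def)
    show "gl \<in> topspace (StT UU) \<rightarrow> glued" using gl_glued by (simp add: topspace_StT)
    fix V assume V: "V \<in> \<U>"
    show "continuous_map (StT UU) (StT V) (\<lambda>x. gl x V)"
      using rs_continuous[OF Union_upper[OF V]] V by (simp add: gl_def)
  qed
  show "open_map (StT UU) (subtopology (product_topology StT \<U>) glued) gl"
    unfolding open_map_def
  proof (intro allI impI)
    fix P assume P: "openin (StT UU) P"
    have "\<exists>S. openin (subtopology (product_topology StT \<U>) glued) S \<and> z \<in> S \<and> S \<subseteq> gl ` P" if zP: "z \<in> gl ` P" for z
    proof -
      obtain x where xP: "x \<in> P" "z = gl x" using zP by blast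
      obtain C n where x: "x \<in> carrier (Str UU)" and C: "clopen C" "C \<subseteq> UW UU"
        and CP: "\<forall>y\<in>carrier (Str UU). (\<forall>i\<in>C. val UU y i \<ominus>\<^bsub>E i\<^esub> val UU x i \<in> B i (int n)) \<longrightarrow> y \<in> P"
        using P xP(1) unfolding openin_StT[OF openin_UU] by blast
      \<comment> \<open>\<open>near V'\<close> says that an open condition in the product forces
        closeness on \<open>V'\<close>. It holds for small clopen sets inside one member of the
        cover and passes to unions by intersecting the conditions, as \<open>clopen_cover\<close>
        requires.\<close>
      define near where "near V' \<longleftrightarrow> (\<exists>S. openin (product_topology StT \<U>) S \<and> gl x \<in> S \<and>
        (\<forall>y\<in>carrier (Str UU). gl y \<in> S \<longrightarrow> (\<forall>i\<in>V'. val UU y i \<ominus>\<^bsub>E i\<^esub> val UU x i \<in> B i (int n))))" for V'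
      have glx: "gl y \<in> topspace (product_topology StT \<U>)" if "y \<in> carrier (Str UU)" for y
        using gl_glued[OF that] by (simp add: glued_def topspace_StT)
      have "\<exists>V. clopen V \<and> C \<subseteq> V \<and> near V"
      proof (rule clopen_cover[OF C(1)])
        fix i assume "i \<in> C"
        then obtain V where V: "V \<in> \<U>" "i \<in> UW V" using C(2) UW_UU by blast
        obtain C' where C': "clopen C'" "i \<in> C'" "C' \<subseteq> UW V" using clopen_nbhd[OF open_UW[OF opens[OF V(1)]] V(2)] by blast
        have glV: "gl y V \<in> carrier (Str V)" if "y \<in> carrier (Str UU)" for y
          using rs_closed[OF Union_upper[OF V(1)] that] V(1) by (simp add: gl_def)
        define S where "S = {w \<in> topspace (product_topology StT \<U>). w V \<in>
          {y \<in> carrier (Str V). \<forall>i\<in>C'. val V y i \<ominus>\<^bsub>E i\<^esub> val V (gl x V) i \<in> B i (int n)}}"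
        have "openin (product_topology StT \<U>) S"
          unfolding S_def
          by (rule openin_continuous_map_preimage[OF _ open_near[OF opens[OF V(1)] glV[OF x] C'(1,3)]])
             (rule continuous_map_product_projection[OF V(1)])
        moreover have "gl x \<in> S"
          using glx[OF x] glV[OF x] secs_closed[OF val_secs[OF opens[OF V(1)] glV[OF x]]]
          by (simp add: S_def dv.minus_self)
        moreover have "val UU y j \<ominus>\<^bsub>E j\<^esub> val UU x j \<in> B j (int n)"
          if y: "y \<in> carrier (Str UU)" "gl y \<in> S" and j: "j \<in> C'" for y j
        proof -
          have "val V (gl y V) j \<ominus>\<^bsub>E j\<^esub> val V (gl x V) j \<in> B j (int n)" using y(2) j by (simp add: S_def)
          moreover have "j \<in> UW V" using j C'(3) by blast
          ultimately show ?thesis using gl_val[OF y(1) V(1)] gl_val[OF x V(1)] by simp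
        qed
        ultimately have "near C'" unfolding near_def by blast
        then show "\<exists>V. clopen V \<and> i \<in> V \<and> near V" using C' by blast
      next
        show "near {}" unfolding near_def using glx[OF x] openin_topspace by blast
      next
        fix V V' assume "near V" "near V'"
        then obtain S S' where S: "openin (product_topology StT \<U>) S" "gl x \<in> S"
            "\<forall>y\<in>carrier (Str UU). gl y \<in> S \<longrightarrow> (\<forall>i\<in>V. val UU y i \<ominus>\<^bsub>E i\<^esub> val UU x i \<in> B i (int n))"
          and S': "openin (product_topology StT \<U>) S'" "gl x \<in> S'"
            "\<forall>y\<in>carrier (Str UU). gl y \<in> S' \<longrightarrow> (\<forall>i\<in>V'. val UU y i \<ominus>\<^bsub>E i\<^esub> val UU x i \<in> B i (int n))"
          unfolding near_def by blast
        show "near (V \<union> V')"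
          unfolding near_def
        proof (intro exI[of _ "S \<inter> S'"] conjI ballI impI)
          show "openin (product_topology StT \<U>) (S \<inter> S')" by (rule openin_Int[OF S(1) S'(1)])
          show "gl x \<in> S \<inter> S'" using S(2) S'(2) by blast
          fix y i assume "y \<in> carrier (Str UU)" "gl y \<in> S \<inter> S'" "i \<in> V \<union> V'"
          then show "val UU y i \<ominus>\<^bsub>E i\<^esub> val UU x i \<in> B i (int n)" using S(3) S'(3) by blast
        qed
      qed
      then obtain V S where V: "C \<subseteq> V" and S: "openin (product_topology StT \<U>) S" "gl x \<in> S"
        "\<forall>y\<in>carrier (Str UU). gl y \<in> S \<longrightarrow> (\<forall>i\<in>V. val UU y i \<ominus>\<^bsub>E i\<^esub> val UU x i \<in> B i (int n))"
        unfolding near_def by blast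
      have "S \<inter> glued \<subseteq> gl ` P"
      proof
        fix w assume w: "w \<in> S \<inter> glued"
        then obtain y where y: "y \<in> carrier (Str UU)" "gl y = w" using gl_surj by blast
        then have "\<forall>i\<in>C. val UU y i \<ominus>\<^bsub>E i\<^esub> val UU x i \<in> B i (int n)" using S(3) w V by blast
        then show "w \<in> gl ` P" using CP y by blast
      qed
      moreover have "openin (subtopology (product_topology StT \<U>) glued) (S \<inter> glued)"
        using S(1) by (rule openin_subtopology_Int)
      moreover have "z \<in> S \<inter> glued" using S(2) xP(2) gl_glued[OF x] by simp
      ultimately show ?thesis by blast
    qed
    then show "openin (subtopology (product_topology StT \<U>) glued) (gl ` P)" by (subst openin_subopen) blast
  qed
qed

end

lemma adic_space: "Spa_is_adic_space A ST Ap"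
  unfolding Spa_is_adic_space_def sheaf_of_topological_rings_def
proof (intro conjI presheaf allI impI)
  fix \<U> assume "\<forall>V\<in>\<U>. openin SpT V"
  then have opens: "\<And>V. V \<in> \<U> \<Longrightarrow> openin SpT V" by blast
  have "gl \<U> = (\<lambda>x. \<lambda>V\<in>\<U>. rs (\<Union>\<U>) V x)" by (rule ext) (rule gl_def[of \<U>, OF opens])
  moreover have "glued \<U> = {x \<in> \<Pi>\<^sub>E V\<in>\<U>. carrier (Str V).
                \<forall>V\<in>\<U>. \<forall>V'\<in>\<U>. rs V (V \<inter> V') (x V) = rs V' (V \<inter> V') (x V')}"
    by (rule glued_def[of \<U>, OF opens])
  ultimately show "homeomorphic_map (StT (\<Union>\<U>))
          (subtopology (product_topology StT \<U>)
             {x \<in> \<Pi>\<^sub>E V\<in>\<U>. carrier (Str V).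
                \<forall>V\<in>\<U>. \<forall>V'\<in>\<U>. rs V (V \<inter> V') (x V) = rs V' (V \<inter> V') (x V')})
          (\<lambda>x. \<lambda>V\<in>\<U>. rs (\<Union>\<U>) V x)"
    using gl_homeo[of \<U>, OF opens] by simp
qed

end

theorem proposition2p5:
  fixes F :: "'a local_fields" and lam :: "'a \<Rightarrow> 'k::field fls"
  assumes "local_field_family F lam"
  shows "(\<forall>P. primeideal P (section_ring F) \<and> closedin (section_topology F) P \<longrightarrow>
            (\<exists>i. P = a_kernel (section_ring F) (fld F i) (ev i))) \<and>
         homeomorphic_map euclidean
           (Spa_topology (section_ring F) (section_topology F)
              (power_bounded (section_ring F) (section_topology F)))
           (spa_point F) \<and>
         Spa_is_adic_space (section_ring F) (section_topology F)
           (power_bounded (section_ring F) (section_topology F))"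
proof -
  interpret local_field_family F lam by fact
  show ?thesis
    using closed_prime homeomorphic_spa_point adic_space by (simp add: evker_eq)
qed

end
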